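(* Let $d\ge2$ and let $B$ be Berry's random wave on $\mathbb{R}^d$. Let $X=\{X(\varphi):\varphi\in\mathcal{S}(\mathbb{R}^d)\}$ be an observable of $B$ such that, for all $\varphi\in\mathcal{S}(\mathbb{R}^d)$, $X(\varphi)\in L^2(\mathbb{P})$ and, for some $\alpha\in\mathbb{R}$, $$\mathbb{E}[X(\varphi_R)]=\alpha R^d\int_{\mathbb{R}^d}\varphi(x)\,dx+o(R^{(d+1)/2}),\qquad R\to\infty .$$ Assume moreover that there exist real constants $c_0,c_1,\dots,c_k$ with $\sum_{j=0}^kc_j\ne0$ such that, for every $\varphi\in\mathcal{S}(\mathbb{R}^d)$, $$X(\varphi_R)-\mathbb{E}[X(\varphi_R)]=\sum_{j=0}^kc_j\int_{\mathbb{R}^d}\varphi_R(x)\big(\|\nabla^jB(x)\|^2-1\big)\,dx+T_R,$$ where $\mathrm{Var}(T_R)=o(R^{d+1})$ as $R\to\infty$. Then $X\in\mathbf{UC}\{\mathrm{FGF}_{1/2}(\mathbb{R}^d)\}$, with $$\beta=C(d)^{-1/2}\,K_d\,\Big|\sum_{j=0}^kc_j\Big|,\qquad K_d=\frac{2^{\frac{d-1}2}\Gamma(\frac d2)}{\sqrt\pi},\qquad C(d)=\frac12\pi^{-(d+1)/2}\,\Gamma\Big(\frac{d-1}2\Big).$$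
   Context: Berry's random wave $B=\{B(x):x\in\mathbb{R}^d\}$ is the centered (smooth) Gaussian field with $\mathbb{E}[B(x)B(y)]=\int_{S^{d-1}}e^{i\langle x-y,\theta\rangle}\sigma(d\theta)$, $\sigma$ the uniform probability measure on the unit sphere $S^{d-1}\subset\mathbb{R}^d$. $\nabla^jB(x)$ is the tensor of all ordered $j$-th order partial derivatives and $\|\cdot\|$ its Frobenius norm, so $\|\nabla^jB\|^2=\sum_{\alpha\in\{1,\dots,d\}^j}(\partial_{x_{\alpha_1}}\cdots\partial_{x_{\alpha_j}}B)^2$, $\nabla^0B=B$. $\mathcal{S}(\mathbb{R}^d)$ is the real Schwartz space and a random distribution is a random element of its dual $\mathcal{S}'$ (Borel $\sigma$-field of the weak-$*$ topology). An observable of $B$ is a random distribution measurable with respect to the $\sigma$-field generated by $B$. For $R>0$, $\varphi_R(x)=\varphi(x/R)$. The random variable $T_R$ may depend on $\varphi$. $h\sim\mathrm{FGF}_{1/2}(\mathbb{R}^d)$ denotes the centered Gaussian random distribution with $\mathbb{E}[h(\varphi)h(\psi)]=C(d)\int\int\frac{\varphi(x)\psi(y)}{\|x-y\|^{d-1}}dx\,dy$. A random distribution $X$ with $X(\varphi)\in L^1(\mathbb{P})$ for all $\varphi$ belongs to $\mathbf{UC}\{\mathrm{FGF}_{1/2}(\mathbb{R}^d)\}$ if there are $\alpha\in\mathbb{R}$, $\beta^2>0$ such that, as $R\to\infty$, for every $\varphi\in\mathcal{S}(\mathbb{R}^d)$: (i) $\mathbb{E}[X(\varphi_R)]=\alpha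 R^d\int\varphi\,dx+o(R^{(d+1)/2})$; (ii) $\dfrac{X(\varphi_R)-\alpha R^d\int\varphi\,dx}{\beta R^{(d+1)/2}}$ converges in law to $h(\varphi)$, with $h\sim\mathrm{FGF}_{1/2}(\mathbb{R}^d)$. *)

theory Defs
  imports "HOL-Probability.Probability" "HOL-Library.Landau_Symbols"
begin

section \<open>Partial derivatives and Schwartz functions\<close>

definition partial_deriv :: "'a::euclidean_space \<Rightarrow> ('a \<Rightarrow> real) \<Rightarrow> 'a \<Rightarrow> real" where
  "partial_deriv b f x = deriv (\<lambda>t. f (x + t *\<^sub>R b)) 0"

definition partials :: "'a::euclidean_space list \<Rightarrow> ('a \<Rightarrow> real) \<Rightarrow> 'a \<Rightarrow> real" where
  "partials bs f = foldr partial_deriv bs f"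

text \<open>Differentiability of every iterated partial derivative (the function itself being the case of
  the empty list) guarantees that the next partial derivatives exist and that all are continuous.\<close>

definition smooth_fun :: "('a::euclidean_space \<Rightarrow> real) \<Rightarrow> bool" where
  "smooth_fun f \<longleftrightarrow> (\<forall>bs \<in> lists Basis. \<forall>x. partials bs f differentiable (at x))"

definition grad_norm :: "nat \<Rightarrow> ('a::euclidean_space \<Rightarrow> real) \<Rightarrow> 'a \<Rightarrow> real" where
  "grad_norm j f x = sqrt (\<Sum>bs \<in> {bs. set bs \<subseteq> Basis \<and> length bs = j}. (partials bs f x)\<^sup>2)"

definition schwartz_space :: "('a::euclidean_space \<Rightarrow> real) set" where
  "schwartz_space = {f. smooth_fun f \<and>
     (\<forall>k. \<forall>bs \<in> lists Basis. bdd_above (range (\<lambda>x. (1 + norm x) ^ k * \<bar>partials bs f x\<bar>)))}"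

definition schwartz_seminorm :: "nat \<Rightarrow> 'a::euclidean_space list \<Rightarrow> ('a \<Rightarrow> real) \<Rightarrow> real" where
  "schwartz_seminorm k bs f = (SUP x. (1 + norm x) ^ k * \<bar>partials bs f x\<bar>)"

definition schwartz_topology :: "('a::euclidean_space \<Rightarrow> real) topology" where
  "schwartz_topology = topology_generated_by
     {{\<psi> \<in> schwartz_space. schwartz_seminorm k bs (\<lambda>x. \<psi> x - \<phi> x) < \<epsilon>} | \<phi> k bs \<epsilon>.
        \<phi> \<in> schwartz_space \<and> bs \<in> lists Basis \<and> \<epsilon> > 0}"

definition dilate :: "real \<Rightarrow> ('a::real_vector \<Rightarrow> real) \<Rightarrow> 'a \<Rightarrow> real" where
  "dilate R \<phi> = (\<lambda>x. \<phi> (x /\<^sub>R R))"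


section \<open>Tempered distributions and random distributions\<close>

text \<open>Functionals on the Schwartz space are represented by total functions which are
  \<open>undefined\<close> outside of it, so that equality is equality on the Schwartz space.\<close>

definition tempered_distributions :: "(('a::euclidean_space \<Rightarrow> real) \<Rightarrow> real) set" where
  "tempered_distributions = {u \<in> extensional schwartz_space.
     (\<forall>\<phi> \<in> schwartz_space. \<forall>\<psi> \<in> schwartz_space. \<forall>a b.
        u (\<lambda>x. a * \<phi> x + b * \<psi> x) = a * u \<phi> + b * u \<psi>) \<and>
     continuous_map schwartz_topology euclideanreal u}"

definition weak_star_topology :: "(('a::euclidean_space \<Rightarrow> real) \<Rightarrow> real) topology" where
  "weak_star_topology = subtopology (powertop_real schwartz_space) tempered_distributions"

definition tempered_borel :: "(('a::euclidean_space \<Rightarrow> real) \<Rightarrow> real) measure" where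
  "tempered_borel = sigma tempered_distributions {U. openin weak_star_topology U}"

definition random_distribution ::
    "'w measure \<Rightarrow> ('w \<Rightarrow> ('a::euclidean_space \<Rightarrow> real) \<Rightarrow> real) \<Rightarrow> bool" where
  "random_distribution M X \<longleftrightarrow> X \<in> measurable M tempered_borel"

definition field_algebra :: "'w measure \<Rightarrow> ('w \<Rightarrow> 'a \<Rightarrow> real) \<Rightarrow> 'w measure" where
  "field_algebra M B = vimage_algebra (space M) B (\<Pi>\<^sub>M x\<in>UNIV. borel)"

definition observable ::
    "'w measure \<Rightarrow> ('w \<Rightarrow> 'a::euclidean_space \<Rightarrow> real) \<Rightarrow> ('w \<Rightarrow> ('a \<Rightarrow> real) \<Rightarrow> real) \<Rightarrow> bool" where
  "observable M B X \<longleftrightarrow> random_distribution M X \<and> X \<in> measurable (field_algebra M B) tempered_borel"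

definition square_integrable :: "'w measure \<Rightarrow> ('w \<Rightarrow> real) \<Rightarrow> bool" where
  "square_integrable M Y \<longleftrightarrow> Y \<in> borel_measurable M \<and> integrable M (\<lambda>\<omega>. (Y \<omega>)\<^sup>2)"


section \<open>Gaussian processes\<close>

text \<open>The case \<open>s = 0\<close> is the Dirac mass, regarded as a degenerate Gaussian law.\<close>

definition gaussian_law :: "real \<Rightarrow> real \<Rightarrow> real measure" where
  "gaussian_law m s = (if s = 0 then return borel m else density lborel (normal_density m s))"

definition gaussian_variable :: "'w measure \<Rightarrow> ('w \<Rightarrow> real) \<Rightarrow> bool" where
  "gaussian_variable M Y \<longleftrightarrow>
     Y \<in> borel_measurable M \<and> (\<exists>m s. s \<ge> 0 \<and> distr M borel Y = gaussian_law m s)"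

definition centered_gaussian_process :: "'w measure \<Rightarrow> 't set \<Rightarrow> ('t \<Rightarrow> 'w \<Rightarrow> real) \<Rightarrow> bool" where
  "centered_gaussian_process M I Y \<longleftrightarrow>
     (\<forall>F a. finite F \<and> F \<subseteq> I \<longrightarrow> gaussian_variable M (\<lambda>\<omega>. \<Sum>t\<in>F. a t * Y t \<omega>)) \<and>
     (\<forall>t\<in>I. integral\<^sup>L M (Y t) = 0)"


section \<open>Berry's random wave\<close>

text \<open>The uniform law on the unit sphere, as the image of the uniform law on the unit ball under
  the radial projection \<open>x \<mapsto> x / \<parallel>x\<parallel>\<close>.\<close>

definition sphere_uniform :: "'a::euclidean_space measure" where
  "sphere_uniform = distr (uniform_measure lborel (cball 0 1)) borel sgn"

lemma prob_space_sphere_uniform: "prob_space (sphere_uniform :: 'a::euclidean_space measure)"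
proof -
  have "emeasure lborel (cball 0 1 :: 'a set) \<noteq> 0"
    using emeasure_mono[OF ball_subset_cball[of "0::'a" 1], of lborel] content_ball_pos[of 1 "0::'a"]
    by (auto simp: emeasure_lborel_ball_finite measure_def)
  moreover have "emeasure lborel (cball 0 1 :: 'a set) \<noteq> \<infinity>"
    using emeasure_lborel_cball_finite[of "0::'a" 1] by auto
  ultimately have "prob_space (uniform_measure lborel (cball 0 1 :: 'a set))"
    by (rule prob_space_uniform_measure)
  then show ?thesis
    unfolding sphere_uniform_def by (rule prob_space.prob_space_distr) (simp add: sgn_div_norm)
qed

lemma AE_sphere_uniform: "AE \<theta> in sphere_uniform. norm (\<theta> :: 'a::euclidean_space) = 1"
proof -
  have "AE x in uniform_measure lborel (cball 0 1). norm (sgn (x :: 'a)) = 1"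
    by (rule AE_uniform_measureI) (auto simp: norm_sgn intro: AE_mp[OF AE_lborel_singleton[of 0]])
  then show ?thesis
    unfolding sphere_uniform_def by (subst AE_distr_iff) (auto simp: sgn_div_norm)
qed

definition berry_random_wave :: "'w measure \<Rightarrow> ('w \<Rightarrow> 'a::euclidean_space \<Rightarrow> real) \<Rightarrow> bool" where
  "berry_random_wave M B \<longleftrightarrow> prob_space M \<and>
     centered_gaussian_process M UNIV (\<lambda>x \<omega>. B \<omega> x) \<and>
     (\<forall>x y. complex_of_real (\<integral>\<omega>. B \<omega> x * B \<omega> y \<partial>M) =
        (\<integral>\<theta>. exp (\<i> * complex_of_real ((x - y) \<bullet> \<theta>)) \<partial>sphere_uniform)) \<and>
     (AE \<omega> in M. smooth_fun (B \<omega>))"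


section \<open>The fractional Gaussian field and its universality class\<close>

definition C_const :: "nat \<Rightarrow> real" where
  "C_const d = 1 / 2 * pi powr (- (real d + 1) / 2) * Gamma ((real d - 1) / 2)"

definition K_const :: "nat \<Rightarrow> real" where
  "K_const d = 2 powr ((real d - 1) / 2) * Gamma (real d / 2) / sqrt pi"

definition fgf_half ::
    "'v measure \<Rightarrow> ('v \<Rightarrow> ('a::euclidean_space \<Rightarrow> real) \<Rightarrow> real) \<Rightarrow> bool" where
  "fgf_half N h \<longleftrightarrow> prob_space N \<and> random_distribution N h \<and>
     centered_gaussian_process N schwartz_space (\<lambda>\<phi> v. h v \<phi>) \<and>
     (\<forall>\<phi> \<in> schwartz_space. \<forall>\<psi> \<in> schwartz_space.
        (\<integral>v. h v \<phi> * h v \<psi> \<partial>N) =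
        C_const DIM('a) *
          (\<integral>x. (\<integral>y. \<phi> x * \<psi> y / norm (x - y) ^ (DIM('a) - 1) \<partial>lborel) \<partial>lborel))"

definition converges_in_law ::
    "'w measure \<Rightarrow> (real \<Rightarrow> 'w \<Rightarrow> real) \<Rightarrow> 'v measure \<Rightarrow> ('v \<Rightarrow> real) \<Rightarrow> bool" where
  "converges_in_law M Y N Z \<longleftrightarrow>
     (\<forall>r. filterlim r at_top sequentially \<longrightarrow>
        weak_conv_m (\<lambda>n. distr M borel (Y (r n))) (distr N borel Z))"

text \<open>\<open>h\<close> is a realisation on \<open>N\<close> of the fractional Gaussian field; only the laws of the
  variables \<open>h(\<phi>)\<close>, which do not depend on the realisation, enter.\<close>

definition UC_fgf_half_with ::
    "'w measure \<Rightarrow> ('w \<Rightarrow> ('a::euclidean_space \<Rightarrow> real) \<Rightarrow> real) \<Rightarrow>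
     'v measure \<Rightarrow> ('v \<Rightarrow> ('a \<Rightarrow> real) \<Rightarrow> real) \<Rightarrow> real \<Rightarrow> real \<Rightarrow> bool" where
  "UC_fgf_half_with M X N h \<alpha> \<beta> \<longleftrightarrow>
     random_distribution M X \<and> (\<forall>\<phi> \<in> schwartz_space. integrable M (\<lambda>\<omega>. X \<omega> \<phi>)) \<and>
     fgf_half N h \<and> \<beta>\<^sup>2 > 0 \<and>
     (\<forall>\<phi> \<in> schwartz_space.
        (\<lambda>R. (\<integral>\<omega>. X \<omega> (dilate R \<phi>) \<partial>M) - \<alpha> * R ^ DIM('a) * (\<integral>x. \<phi> x \<partial>lborel))
          \<in> o[at_top](\<lambda>R. R powr ((real DIM('a) + 1) / 2)) \<and>
        converges_in_law M
          (\<lambda>R \<omega>. (X \<omega> (dilate R \<phi>) - \<alpha> * R ^ DIM('a) * (\<integral>x. \<phi> x \<partial>lborel))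
                   / (\<beta> * R powr ((real DIM('a) + 1) / 2)))
          N (\<lambda>v. h v \<phi>))"

definition UC_fgf_half ::
    "'w measure \<Rightarrow> ('w \<Rightarrow> ('a::euclidean_space \<Rightarrow> real) \<Rightarrow> real) \<Rightarrow>
     'v measure \<Rightarrow> ('v \<Rightarrow> ('a \<Rightarrow> real) \<Rightarrow> real) \<Rightarrow> bool" where
  "UC_fgf_half M X N h \<longleftrightarrow> (\<exists>\<alpha> \<beta>. UC_fgf_half_with M X N h \<alpha> \<beta>)"

end

theory Submission
  imports Defs
begin

text \<open>
  Berry's wave is a random superposition of the plane waves \<open>x \<mapsto> exp (\<i> (x \<bullet> \<theta>))\<close> with \<open>\<theta>\<close> on the unit
  sphere. A derivative of order \<open>j\<close> along basis vectors \<open>b1, ..., bj\<close> multiplies the amplitude at \<open>\<theta>\<close>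
  by the product of the \<open>\<i> (\<theta> \<bullet> b)\<close>, and summing over all words of length \<open>j\<close> the amplitude at \<open>\<theta>\<close>
  times the conjugate amplitude at \<open>\<eta>\<close> produces \<open>(\<theta> \<bullet> \<eta>) ^ j\<close>. With \<open>p t = (\<Sum>j\<le>k. c j * t ^ j)\<close> the centred
  quadratic functional in the hypothesis is therefore governed by the single kernel
  \<open>p (\<theta> \<bullet> \<eta>) * fourier \<phi> (\<theta> - \<eta>)\<close> on pairs of points of the sphere (\<open>wave_kernel\<close>), and its variance is
  twice the squared norm of this kernel.

  Replacing \<open>\<phi>\<close> by its dilation forces \<open>\<theta> - \<eta>\<close> to be of size \<open>1 / R\<close>. There \<open>\<theta> \<bullet> \<eta>\<close> is close to \<open>1\<close>, so only
  \<open>p 1\<close>, the sum of the coefficients, survives: all the energies of the gradients of \<open>B\<close> fluctuate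
  alike. The sphere has dimension \<open>d - 1\<close>, so the variance is of order \<open>R ^ (2 * d) / R ^ (d - 1)\<close>, and
  the limiting constant is an integral of the spherical means of \<open>\<bar>fourier \<phi>\<bar>\<^sup>2\<close> against \<open>r ^ (d - 2)\<close>, a multiple
  of the Riesz energy of \<open>\<phi>\<close> with exponent \<open>d - 1\<close> and so of the variance of the fractional field. This is
  \<open>dilated_variance_limit\<close>; it rests on \<open>sphere_concentration_limit\<close>, \<open>spectral_energy_zonal\<close> and
  \<open>spherical_energy_eq_riesz_energy\<close>.

  The limit is Gaussian by a second-order Poincare argument. For a Gaussian vector \<open>g\<close> with an
  independent copy \<open>g'\<close>, the vector \<open>g + sqrt e * g'\<close> has the law of \<open>sqrt (1 + e) * g\<close>. Differentiating the
  characteristic function of a centred quadratic form at \<open>e = 0\<close> shows that it satisfies the equation of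
  a Gaussian characteristic function up to the fluctuations of a second quadratic form, whose variance is
  a fourth trace (\<open>quad_charfun_near_gaussian\<close>). Finite samples of the derivatives of \<open>B\<close> approximate the
  functional, traces of covariance matrices become traces of the kernel above, and Schur's test bounds the
  fourth trace by the squared norm times the square of the largest row integral
  (\<open>energy_charfun_near_gaussian\<close>). Row integrals of the dilated kernel are of order \<open>R\<close>, whereas
  the normalisation is \<open>R powr ((d + 1) / 2)\<close>, so the error tends to zero. The remainder and the error in
  the mean are negligible in mean absolute value, and Levy's continuity theorem concludes.
\<close>

text \<open>The Henstock-Kurzweil integral has lemmas of the same names; here they are those of the Lebesgue integral.\<close>

lemmas integral_cong = Bochner_Integration.integral_cong
  and integral_sum = Bochner_Integration.integral_sum
  and integrable_bound = Bochner_Integration.integrable_bound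
  and integrable_sum = Bochner_Integration.integrable_sum
  and integral_diff = Bochner_Integration.integral_diff
  and integral_add = Bochner_Integration.integral_add
  and integral_cnj = Bochner_Integration.integral_cnj
  and integrable_diff = Bochner_Integration.integrable_diff
  and integrable_add = Bochner_Integration.integrable_add

section \<open>Uniqueness of laws from characteristic functions\<close>

text \<open>Normalising the weights by their common mean turns them into densities of probability measures, to which
  Levy's uniqueness theorem applies. The weight makes it possible to treat the coordinates of a
  random vector one after the other.\<close>

lemma weighted_law_unique:
  fixes X :: "'w \<Rightarrow> real" and X' :: "'v \<Rightarrow> real" and V :: "'w \<Rightarrow> real" and V' :: "'v \<Rightarrow> real"
    and f :: "real \<Rightarrow> complex"
  assumes P: "prob_space P" and P': "prob_space P'"
    and X[measurable]: "X \<in> borel_measurable P" and X'[measurable]: "X' \<in> borel_measurable P'"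
    and V[measurable]: "V \<in> borel_measurable P" and V'[measurable]: "V' \<in> borel_measurable P'"
    and Vb: "\<And>w. 1 \<le> V w \<and> V w \<le> K" and Vb': "\<And>w. 1 \<le> V' w \<and> V' w \<le> K"
    and eq: "\<And>v. (\<integral>w. V w *\<^sub>R iexp (v * X w) \<partial>P) = (\<integral>w. V' w *\<^sub>R iexp (v * X' w) \<partial>P')"
    and f[measurable]: "f \<in> borel_measurable borel"
  shows "(\<integral>w. V w *\<^sub>R f (X w) \<partial>P) = (\<integral>w. V' w *\<^sub>R f (X' w) \<partial>P')"
proof -
  interpret P: prob_space P by fact
  interpret P': prob_space P' by fact
  have iV: "integrable P V" by (rule P.integrable_const_bound[of _ K]) (use Vb in \<open>auto simp: abs_le_iff intro!: AE_I2\<close>, smt (verit) Vb)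
  have iV': "integrable P' V'" by (rule P'.integrable_const_bound[of _ K]) (use Vb' in \<open>auto simp: abs_le_iff intro!: AE_I2\<close>, smt (verit) Vb')
  define m where "m = (\<integral>w. V w \<partial>P)"
  have m: "m = (\<integral>w. V' w \<partial>P')"
  proof -
    have "complex_of_real m = (\<integral>w. V w *\<^sub>R iexp (0 * X w) \<partial>P)"
      unfolding m_def by (simp add: scaleR_conv_of_real)
    also have "\<dots> = (\<integral>w. V' w *\<^sub>R iexp (0 * X' w) \<partial>P')" by (rule eq)
    also have "\<dots> = complex_of_real (\<integral>w. V' w \<partial>P')" by (simp add: scaleR_conv_of_real)
    finally show ?thesis using of_real_eq_iff by blast
  qed
  have "1 \<le> m" unfolding m_def using iV Vb by (intro P.integral_ge_const) auto
  define D where "D = distr (density P (\<lambda>w. ennreal (V w / m))) borel X"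
  define D' where "D' = distr (density P' (\<lambda>w. ennreal (V' w / m))) borel X'"
  have nn: "AE w in P. 0 \<le> V w / m" "AE w in P'. 0 \<le> V' w / m"
    using Vb Vb' \<open>1 \<le> m\<close> by (auto intro!: AE_I2 divide_nonneg_nonneg) (smt (verit) Vb Vb')+
  have dens: "prob_space (density P (\<lambda>w. ennreal (V w / m)))"
  proof (rule prob_spaceI)
    have "emeasure (density P (\<lambda>w. ennreal (V w / m))) (space P) = (\<integral>\<^sup>+w. ennreal (V w / m) \<partial>P)"
      by (subst emeasure_density) (auto intro!: nn_integral_cong simp: indicator_def)
    also have "\<dots> = ennreal (\<integral>w. V w / m \<partial>P)"
      by (rule nn_integral_eq_integral) (use iV nn in auto)
    also have "\<dots> = 1" using \<open>1 \<le> m\<close> by (simp add: m_def[symmetric])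
    finally show "emeasure (density P (\<lambda>w. ennreal (V w / m))) (space (density P (\<lambda>w. ennreal (V w / m)))) = 1"
      by simp
  qed
  have dens': "prob_space (density P' (\<lambda>w. ennreal (V' w / m)))"
  proof (rule prob_spaceI)
    have "emeasure (density P' (\<lambda>w. ennreal (V' w / m))) (space P') = (\<integral>\<^sup>+w. ennreal (V' w / m) \<partial>P')"
      by (subst emeasure_density) (auto intro!: nn_integral_cong simp: indicator_def)
    also have "\<dots> = ennreal (\<integral>w. V' w / m \<partial>P')"
      by (rule nn_integral_eq_integral) (use iV' nn in auto)
    also have "\<dots> = 1" using \<open>1 \<le> m\<close> by (simp add: m[symmetric])
    finally show "emeasure (density P' (\<lambda>w. ennreal (V' w / m))) (space (density P' (\<lambda>w. ennreal (V' w / m)))) = 1"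
      by simp
  qed
  have intD: "(\<integral>x. h x \<partial>D) = (1 / m) *\<^sub>R (\<integral>w. V w *\<^sub>R h (X w) \<partial>P)"
    if [measurable]: "h \<in> borel_measurable borel" for h :: "real \<Rightarrow> complex"
  proof -
    have "(\<integral>x. h x \<partial>D) = (\<integral>w. (V w / m) *\<^sub>R h (X w) \<partial>P)"
      unfolding D_def by (subst integral_distr, simp, simp, subst integral_density) (use nn in auto)
    also have "\<dots> = (\<integral>w. (1 / m) *\<^sub>R (V w *\<^sub>R h (X w)) \<partial>P)" by simp
    finally show ?thesis by (simp only: integral_scaleR_right)
  qed
  have intD': "(\<integral>x. h x \<partial>D') = (1 / m) *\<^sub>R (\<integral>w. V' w *\<^sub>R h (X' w) \<partial>P')"
    if [measurable]: "h \<in> borel_measurable borel" for h :: "real \<Rightarrow> complex"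
  proof -
    have "(\<integral>x. h x \<partial>D') = (\<integral>w. (V' w / m) *\<^sub>R h (X' w) \<partial>P')"
      unfolding D'_def by (subst integral_distr, simp, simp, subst integral_density) (use nn in auto)
    also have "\<dots> = (\<integral>w. (1 / m) *\<^sub>R (V' w *\<^sub>R h (X' w)) \<partial>P')" by simp
    finally show ?thesis by (simp only: integral_scaleR_right)
  qed
  have "real_distribution D" "real_distribution D'"
    unfolding D_def D'_def using dens dens'
    by (auto intro!: prob_space.real_distribution_distr)
  moreover have "char D = char D'"
  proof
    fix v show "char D v = char D' v"
      unfolding char_def by (subst intD, simp, subst intD', simp) (simp only: eq)
  qed
  ultimately have "D = D'" by (rule Levy_uniqueness)
  then have "(1 / m) *\<^sub>R (\<integral>w. V w *\<^sub>R f (X w) \<partial>P) = (1 / m) *\<^sub>R (\<integral>w. V' w *\<^sub>R f (X' w) \<partial>P')"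
    using intD[OF f] intD'[OF f] by argo
  then show ?thesis using \<open>1 \<le> m\<close> unfolding scaleR_cancel_left by simp
qed

lemma complex_weighted_law_unique:
  fixes X :: "'w \<Rightarrow> real" and X' :: "'v \<Rightarrow> real" and W :: "'w \<Rightarrow> complex" and W' :: "'v \<Rightarrow> complex"
    and f :: "real \<Rightarrow> complex"
  assumes P: "prob_space P" and P': "prob_space P'"
    and X[measurable]: "X \<in> borel_measurable P" and X'[measurable]: "X' \<in> borel_measurable P'"
    and W[measurable]: "W \<in> borel_measurable P" and W'[measurable]: "W' \<in> borel_measurable P'"
    and Wb: "\<And>w. norm (W w) \<le> 1" and Wb': "\<And>w. norm (W' w) \<le> 1"
    and eq: "\<And>v. (\<integral>w. W w * iexp (v * X w) \<partial>P) = (\<integral>w. W' w * iexp (v * X' w) \<partial>P')"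
    and eq1: "\<And>v. (\<integral>w. iexp (v * X w) \<partial>P) = (\<integral>w. iexp (v * X' w) \<partial>P')"
    and f[measurable]: "f \<in> borel_measurable borel" and fb: "\<And>x. norm (f x) \<le> 1"
  shows "(\<integral>w. W w * f (X w) \<partial>P) = (\<integral>w. W' w * f (X' w) \<partial>P')"
proof -
  interpret P: prob_space P by fact
  interpret P': prob_space P' by fact
  have bint: "integrable P (\<lambda>w. a w * h (X w))"
    if "\<And>w. norm (a w) \<le> 1" "\<And>x. norm (h x) \<le> 1" "a \<in> borel_measurable P" "h \<in> borel_measurable borel"
    for a and h :: "real \<Rightarrow> complex"
    by (rule P.integrable_const_bound[of _ 1]) (use that in \<open>auto simp: norm_mult intro!: mult_le_one\<close>)
  have bint': "integrable P' (\<lambda>w. a w * h (X' w))"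
    if "\<And>w. norm (a w) \<le> 1" "\<And>x. norm (h x) \<le> 1" "a \<in> borel_measurable P'" "h \<in> borel_measurable borel"
    for a and h :: "real \<Rightarrow> complex"
    by (rule P'.integrable_const_bound[of _ 1]) (use that in \<open>auto simp: norm_mult intro!: mult_le_one\<close>)
  \<comment> \<open>A real bounded weight becomes positive after adding the constant 2, whose contribution is
    known separately.\<close>
  have real_case: "(\<integral>w. of_real (U w) * f (X w) \<partial>P) = (\<integral>w. of_real (U' w) * f (X' w) \<partial>P')"
    if [measurable]: "U \<in> borel_measurable P" "U' \<in> borel_measurable P'"
      and Ub: "\<And>w. \<bar>U w\<bar> \<le> 1" "\<And>w. \<bar>U' w\<bar> \<le> 1"
      and Ueq: "\<And>v. (\<integral>w. of_real (U w) * iexp (v * X w) \<partial>P) = (\<integral>w. of_real (U' w) * iexp (v * X' w) \<partial>P')"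
    for U :: "'w \<Rightarrow> real" and U' :: "'v \<Rightarrow> real"
  proof -
    have split: "(\<integral>w. (2 + U w) *\<^sub>R h (X w) \<partial>P) = 2 * (\<integral>w. h (X w) \<partial>P) + (\<integral>w. of_real (U w) * h (X w) \<partial>P)"
      if "\<And>x. norm (h x) \<le> 1" "h \<in> borel_measurable borel" for h :: "real \<Rightarrow> complex"
    proof -
      have "(\<integral>w. (2 + U w) *\<^sub>R h (X w) \<partial>P) = (\<integral>w. 2 * (1 * h (X w)) + of_real (U w) * h (X w) \<partial>P)"
        by (intro integral_cong) (auto simp: scaleR_conv_of_real algebra_simps)
      also have "\<dots> = (\<integral>w. 2 * (1 * h (X w)) \<partial>P) + (\<integral>w. of_real (U w) * h (X w) \<partial>P)"
        by (intro integral_add integrable_mult_right bint) (use that Ub in auto)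
      finally show ?thesis by simp
    qed
    have split': "(\<integral>w. (2 + U' w) *\<^sub>R h (X' w) \<partial>P') = 2 * (\<integral>w. h (X' w) \<partial>P') + (\<integral>w. of_real (U' w) * h (X' w) \<partial>P')"
      if "\<And>x. norm (h x) \<le> 1" "h \<in> borel_measurable borel" for h :: "real \<Rightarrow> complex"
    proof -
      have "(\<integral>w. (2 + U' w) *\<^sub>R h (X' w) \<partial>P') = (\<integral>w. 2 * (1 * h (X' w)) + of_real (U' w) * h (X' w) \<partial>P')"
        by (intro integral_cong) (auto simp: scaleR_conv_of_real algebra_simps)
      also have "\<dots> = (\<integral>w. 2 * (1 * h (X' w)) \<partial>P') + (\<integral>w. of_real (U' w) * h (X' w) \<partial>P')"
        by (intro integral_add integrable_mult_right bint') (use that Ub in auto)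
      finally show ?thesis by simp
    qed
    have e1: "(\<integral>w. f (X w) \<partial>P) = (\<integral>w. f (X' w) \<partial>P')"
    proof -
      have "(\<integral>w. 1 *\<^sub>R f (X w) \<partial>P) = (\<integral>w. 1 *\<^sub>R f (X' w) \<partial>P')"
      proof (rule weighted_law_unique[OF P P' X X' _ _ _ _ _ f, of _ _ 1])
        show "(\<integral>w. 1 *\<^sub>R iexp (v * X w) \<partial>P) = (\<integral>w. 1 *\<^sub>R iexp (v * X' w) \<partial>P')" for v
          unfolding scaleR_one by (rule eq1)
      qed auto
      then show ?thesis unfolding scaleR_one .
    qed
    have "(\<integral>w. (2 + U w) *\<^sub>R f (X w) \<partial>P) = (\<integral>w. (2 + U' w) *\<^sub>R f (X' w) \<partial>P')"
    proof (rule weighted_law_unique[OF P P' X X' _ _ _ _ _ f, of _ _ 3])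
      show "1 \<le> 2 + U w \<and> 2 + U w \<le> 3" for w using Ub(1)[of w] by auto
      show "1 \<le> 2 + U' w \<and> 2 + U' w \<le> 3" for w using Ub(2)[of w] by auto
      show "(\<integral>w. (2 + U w) *\<^sub>R iexp (v * X w) \<partial>P) = (\<integral>w. (2 + U' w) *\<^sub>R iexp (v * X' w) \<partial>P')" for v
        by (subst split, simp, simp, subst split', simp, simp) (simp only: Ueq eq1)
    qed auto
    then show ?thesis
      using e1 by (simp add: split[OF fb f] split'[OF fb f])
  qed
  have cnj_eq: "(\<integral>w. cnj (W w) * iexp (v * X w) \<partial>P) = (\<integral>w. cnj (W' w) * iexp (v * X' w) \<partial>P')" for v
  proof -
    have "(\<integral>w. cnj (W w) * iexp (v * X w) \<partial>P) = (\<integral>w. cnj (W w * iexp (- v * X w)) \<partial>P)"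
      by (intro integral_cong) (auto simp: exp_cnj)
    also have "\<dots> = cnj (\<integral>w. W' w * iexp (- v * X' w) \<partial>P')" by (subst integral_cnj) (simp only: eq)
    also have "\<dots> = (\<integral>w. cnj (W' w * iexp (- v * X' w)) \<partial>P')" by (rule integral_cnj[symmetric])
    also have "\<dots> = (\<integral>w. cnj (W' w) * iexp (v * X' w) \<partial>P')"
      by (intro integral_cong) (auto simp: exp_cnj)
    finally show ?thesis .
  qed
  have [measurable]: "(\<lambda>w. cnj (W w)) \<in> borel_measurable P" "(\<lambda>w. cnj (W' w)) \<in> borel_measurable P'"
    by (rule measurable_compose[OF _ borel_measurable_continuous_onI], simp,
        intro continuous_intros)+
  have ReW: "of_real (Re z) = (z + cnj z) / 2" and ImW: "of_real (Im z) = (z - cnj z) / (2 * \<i>)" for z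
    by (auto simp: complex_eq_iff)
  have 1: "(\<integral>w. of_real (Re (W w)) * f (X w) \<partial>P) = (\<integral>w. of_real (Re (W' w)) * f (X' w) \<partial>P')"
  proof (rule real_case)
    show "\<bar>Re (W w)\<bar> \<le> 1" for w using abs_Re_le_cmod[of "W w"] Wb[of w] by linarith
    show "\<bar>Re (W' w)\<bar> \<le> 1" for w using abs_Re_le_cmod[of "W' w"] Wb'[of w] by linarith
    fix v
    have "(\<integral>w. of_real (Re (W w)) * iexp (v * X w) \<partial>P) =
       ((\<integral>w. W w * iexp (v * X w) \<partial>P) + (\<integral>w. cnj (W w) * iexp (v * X w) \<partial>P)) / 2"
      unfolding ReW times_divide_eq_left integral_divide_zero distrib_right
      by (subst integral_add) (auto intro!: bint simp: Wb)
    also have "\<dots> = ((\<integral>w. W' w * iexp (v * X' w) \<partial>P') + (\<integral>w. cnj (W' w) * iexp (v * X' w) \<partial>P')) / 2"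
      by (simp only: eq cnj_eq)
    also have "\<dots> = (\<integral>w. of_real (Re (W' w)) * iexp (v * X' w) \<partial>P')"
      unfolding ReW times_divide_eq_left integral_divide_zero distrib_right
      by (subst integral_add) (auto intro!: bint' simp: Wb')
    finally show "(\<integral>w. of_real (Re (W w)) * iexp (v * X w) \<partial>P) = (\<integral>w. of_real (Re (W' w)) * iexp (v * X' w) \<partial>P')" .
  qed auto
  have 2: "(\<integral>w. of_real (Im (W w)) * f (X w) \<partial>P) = (\<integral>w. of_real (Im (W' w)) * f (X' w) \<partial>P')"
  proof (rule real_case)
    show "\<bar>Im (W w)\<bar> \<le> 1" for w using abs_Im_le_cmod[of "W w"] Wb[of w] by linarith
    show "\<bar>Im (W' w)\<bar> \<le> 1" for w using abs_Im_le_cmod[of "W' w"] Wb'[of w] by linarith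
    fix v
    have "(\<integral>w. of_real (Im (W w)) * iexp (v * X w) \<partial>P) =
       ((\<integral>w. W w * iexp (v * X w) \<partial>P) - (\<integral>w. cnj (W w) * iexp (v * X w) \<partial>P)) / (2 * \<i>)"
      unfolding ImW times_divide_eq_left integral_divide_zero left_diff_distrib
      by (subst integral_diff) (auto intro!: bint simp: Wb)
    also have "\<dots> = ((\<integral>w. W' w * iexp (v * X' w) \<partial>P') - (\<integral>w. cnj (W' w) * iexp (v * X' w) \<partial>P')) / (2 * \<i>)"
      by (simp only: eq cnj_eq)
    also have "\<dots> = (\<integral>w. of_real (Im (W' w)) * iexp (v * X' w) \<partial>P')"
      unfolding ImW times_divide_eq_left integral_divide_zero left_diff_distrib
      by (subst integral_diff) (auto intro!: bint' simp: Wb')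
    finally show "(\<integral>w. of_real (Im (W w)) * iexp (v * X w) \<partial>P) = (\<integral>w. of_real (Im (W' w)) * iexp (v * X' w) \<partial>P')" .
  qed auto
  have bRe: "norm (complex_of_real (Re (W w))) \<le> 1" "norm (complex_of_real (Im (W w))) \<le> 1" for w
    using Wb[of w] abs_Re_le_cmod[of "W w"] abs_Im_le_cmod[of "W w"] unfolding norm_of_real by linarith+
  have bRe': "norm (complex_of_real (Re (W' w))) \<le> 1" "norm (complex_of_real (Im (W' w))) \<le> 1" for w
    using Wb'[of w] abs_Re_le_cmod[of "W' w"] abs_Im_le_cmod[of "W' w"] unfolding norm_of_real by linarith+
  have "(\<integral>w. W w * f (X w) \<partial>P) = (\<integral>w. of_real (Re (W w)) * f (X w) + \<i> * (of_real (Im (W w)) * f (X w)) \<partial>P)"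
    by (intro integral_cong refl) (metis (no_types, lifting) complex_eq distrib_right mult.assoc)
  also have "\<dots> = (\<integral>w. of_real (Re (W w)) * f (X w) \<partial>P) + \<i> * (\<integral>w. of_real (Im (W w)) * f (X w) \<partial>P)"
    by (subst integral_add)
       (auto intro!: bint integrable_mult_right fb bRe simp del: norm_of_real)
  also have "\<dots> = (\<integral>w. of_real (Re (W' w)) * f (X' w) \<partial>P') + \<i> * (\<integral>w. of_real (Im (W' w)) * f (X' w) \<partial>P')"
    by (simp only: 1 2)
  also have "\<dots> = (\<integral>w. of_real (Re (W' w)) * f (X' w) + \<i> * (of_real (Im (W' w)) * f (X' w)) \<partial>P')"
    by (subst integral_add)
       (auto intro!: bint' integrable_mult_right fb bRe' simp del: norm_of_real)
  also have "\<dots> = (\<integral>w. W' w * f (X' w) \<partial>P')"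
    by (intro integral_cong refl) (metis (no_types, lifting) complex_eq distrib_right mult.assoc)
  finally show ?thesis .
qed

text \<open>A substitute for the Cramer-Wold theorem. The factors \<open>exp (\<i> v m X m)\<close> are exchanged for \<open>f m (X m)\<close> one
  coordinate at a time, all other factors serving as the complex weight. Product functions suffice for
  later use because the exponential of a diagonal quadratic form is a product.\<close>

lemma charfun_eq_imp_prod_expectation_eq:
  fixes X :: "'i \<Rightarrow> 'w \<Rightarrow> real" and X' :: "'i \<Rightarrow> 'v \<Rightarrow> real" and f :: "'i \<Rightarrow> real \<Rightarrow> complex"
  assumes I: "finite I" and P: "prob_space P" and P': "prob_space P'"
    and X: "\<And>m. m \<in> I \<Longrightarrow> X m \<in> borel_measurable P" and X': "\<And>m. m \<in> I \<Longrightarrow> X' m \<in> borel_measurable P'"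
    and eq: "\<And>v. (\<integral>w. iexp (\<Sum>m\<in>I. v m * X m w) \<partial>P) = (\<integral>w. iexp (\<Sum>m\<in>I. v m * X' m w) \<partial>P')"
    and f[measurable]: "\<And>m. f m \<in> borel_measurable borel" and fb: "\<And>m x. norm (f m x) \<le> 1"
  shows "(\<integral>w. (\<Prod>m\<in>I. f m (X m w)) \<partial>P) = (\<integral>w. (\<Prod>m\<in>I. f m (X' m w)) \<partial>P')"
proof -
  have "G \<subseteq> I \<Longrightarrow> (\<integral>w. (\<Prod>m\<in>G. f m (X m w)) * iexp (\<Sum>m\<in>I-G. v m * X m w) \<partial>P) =
     (\<integral>w. (\<Prod>m\<in>G. f m (X' m w)) * iexp (\<Sum>m\<in>I-G. v m * X' m w) \<partial>P')" if "finite G" for G v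
    using that
  proof (induction G arbitrary: v rule: finite_induct)
    case empty
    show ?case using eq by simp
  next
    case (insert k G)
    then have k: "k \<in> I" "k \<notin> G" "G \<subseteq> I" by auto
    have IG: "I - G = insert k (I - insert k G)" "k \<notin> I - insert k G" "finite (I - insert k G)" using k I by auto
    let ?W = "\<lambda>w. (\<Prod>m\<in>G. f m (X m w)) * iexp (\<Sum>m\<in>I - insert k G. v m * X m w)"
    let ?W' = "\<lambda>w. (\<Prod>m\<in>G. f m (X' m w)) * iexp (\<Sum>m\<in>I - insert k G. v m * X' m w)"
    have [measurable]: "X m \<in> borel_measurable P" "X' m \<in> borel_measurable P'" if "m \<in> I" for m
      using that X X' by auto
    have Gm: "m \<in> I" if "m \<in> G" for m using that k by auto
    have mW: "?W \<in> borel_measurable P" "?W' \<in> borel_measurable P'"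
      by (intro borel_measurable_times borel_measurable_prod borel_measurable_exp; use Gm in measurable)+
    have bW: "norm (\<Prod>m\<in>G. f m (x m)) \<le> 1" for x
      unfolding prod_norm[symmetric] by (intro prod_le_1) (auto simp: fb)
    have "(\<integral>w. ?W w * f k (X k w) \<partial>P) = (\<integral>w. ?W' w * f k (X' k w) \<partial>P')"
    proof (rule complex_weighted_law_unique[OF P P' X[OF k(1)] X'[OF k(1)] mW _ _ _ _ f fb])
      show "norm (?W w) \<le> 1" for w using bW[of "\<lambda>m. X m w"] by (simp add: norm_mult)
      show "norm (?W' w) \<le> 1" for w using bW[of "\<lambda>m. X' m w"] by (simp add: norm_mult)
      show "(\<integral>w. iexp (a * X k w) \<partial>P) = (\<integral>w. iexp (a * X' k w) \<partial>P')" for a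
        using eq[of "\<lambda>m. if m = k then a else 0"] I k by (simp add: if_distrib[of "\<lambda>x. x * _"] cong: if_cong)
      fix a
      have s: "(\<Sum>m\<in>I-G. (v(k := a)) m * x m) = a * x k + (\<Sum>m\<in>I - insert k G. v m * x m)" for x
        unfolding IG(1) by (subst sum.insert[OF IG(3,2)]) (auto intro!: sum.cong)
      have "(\<integral>w. (\<Prod>m\<in>G. f m (X m w)) * iexp (\<Sum>m\<in>I-G. (v(k := a)) m * X m w) \<partial>P) =
         (\<integral>w. (\<Prod>m\<in>G. f m (X' m w)) * iexp (\<Sum>m\<in>I-G. (v(k := a)) m * X' m w) \<partial>P')"
        by (rule insert.IH) (use k in auto)
      then show "(\<integral>w. ?W w * iexp (a * X k w) \<partial>P) = (\<integral>w. ?W' w * iexp (a * X' k w) \<partial>P')"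
        unfolding s by (simp add: exp_add ring_distribs mult_ac)
    qed
    then show ?case using insert.hyps by (simp add: mult_ac)
  qed
  from this[OF I subset_refl] show ?thesis by simp
qed

section \<open>Gaussian families and Wick's formula\<close>

lemma charfun_gaussian_imp_distr:
  assumes M: "prob_space M" and Y[measurable]: "Y \<in> borel_measurable M"
    and ch: "\<And>t. (\<integral>w. iexp (t * Y w) \<partial>M) = of_real (exp (- t\<^sup>2 * q / 2))" and q: "0 \<le> q"
  shows "distr M borel Y = distr std_normal_distribution borel (\<lambda>x. sqrt q * x)"
proof (rule Levy_uniqueness)
  interpret prob_space M by fact
  interpret N: real_distribution std_normal_distribution by (rule real_dist_normal_dist)
  show "real_distribution (distr M borel Y)" by (rule real_distribution_distr) simp
  show "real_distribution (distr std_normal_distribution borel (\<lambda>x. sqrt q * x))"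
    by (rule N.real_distribution_distr) simp
  show "char (distr M borel Y) = char (distr std_normal_distribution borel (\<lambda>x. sqrt q * x))"
  proof
    fix t
    have "char (distr std_normal_distribution borel (\<lambda>x. sqrt q * x)) t = char std_normal_distribution (t * sqrt q)"
      unfolding char_def by (subst integral_distr) (auto simp: mult_ac)
    also have "\<dots> = of_real (exp (- t\<^sup>2 * q / 2))"
      using q by (simp add: char_std_normal_distribution power_mult_distrib)
    also have "\<dots> = char (distr M borel Y) t"
      unfolding char_def by (subst integral_distr, simp, simp) (rule ch[symmetric])
    finally show "char (distr M borel Y) t = char (distr std_normal_distribution borel (\<lambda>x. sqrt q * x)) t" ..
  qed
qed

lemma charfun_gaussian_moments:
  assumes M: "prob_space M" and Y[measurable]: "Y \<in> borel_measurable M"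
    and ch: "\<And>t. (\<integral>w. iexp (t * Y w) \<partial>M) = of_real (exp (- t\<^sup>2 * q / 2))" and q: "0 \<le> q"
  shows "integrable M (\<lambda>w. Y w ^ k)"
    and "(\<integral>w. Y w \<partial>M) = 0" and "(\<integral>w. (Y w)\<^sup>2 \<partial>M) = q" and "(\<integral>w. Y w ^ 4 \<partial>M) = 3 * q\<^sup>2"
proof -
  have d: "distr M borel Y = distr std_normal_distribution borel (\<lambda>x. sqrt q * x)"
    by (rule charfun_gaussian_imp_distr[OF assms])
  have "integrable std_normal_distribution (\<lambda>x. (sqrt q * x) ^ k)"
    by (simp add: power_mult_distrib integrable_std_normal_distribution_moment)
  then have "integrable (distr std_normal_distribution borel (\<lambda>x. sqrt q * x)) (\<lambda>x. x ^ k)"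
    by (subst integrable_distr_eq) auto
  then show "integrable M (\<lambda>w. Y w ^ k)" unfolding d[symmetric] by (subst (asm) integrable_distr_eq) auto
  have mom: "(\<integral>w. Y w ^ j \<partial>M) = sqrt q ^ j * (\<integral>x. x ^ j \<partial>std_normal_distribution)" for j
  proof -
    have "(\<integral>w. Y w ^ j \<partial>M) = (\<integral>x. x ^ j \<partial>distr M borel Y)" by (subst integral_distr) auto
    also have "\<dots> = (\<integral>x. (sqrt q * x) ^ j \<partial>std_normal_distribution)" unfolding d by (subst integral_distr) auto
    finally show ?thesis by (simp add: power_mult_distrib)
  qed
  show "(\<integral>w. Y w \<partial>M) = 0" using mom[of 1] integral_std_normal_distribution_moment_odd[of 1] by simp
  show "(\<integral>w. (Y w)\<^sup>2 \<partial>M) = q" using mom[of 2] std_normal_distribution_even_moments(1)[of 1] q by simp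
  have "sqrt q ^ 4 = q\<^sup>2" using q by (metis mult_2 numeral_Bit0 power_add power_mult real_sqrt_pow2 power2_eq_square)
  then show "(\<integral>w. Y w ^ 4 \<partial>M) = 3 * q\<^sup>2" using mom[of 4] std_normal_distribution_even_moments(1)[of 2]
    by (simp add: fact_numeral)
qed

lemma pair_integral_mult:
  fixes f :: "'v \<Rightarrow> 'c::{real_normed_field,banach,second_countable_topology}"
  assumes "prob_space M" "prob_space N" and f: "integrable M f" and g: "integrable N g"
  shows "integrable (M \<Otimes>\<^sub>M N) (\<lambda>z. f (fst z) * g (snd z))"
    and "(\<integral>z. f (fst z) * g (snd z) \<partial>(M \<Otimes>\<^sub>M N)) = (\<integral>x. f x \<partial>M) * (\<integral>y. g y \<partial>N)"
proof -
  interpret M: prob_space M by fact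
  interpret N: prob_space N by fact
  interpret pair_sigma_finite M N ..
  have [measurable]: "f \<in> borel_measurable M" "g \<in> borel_measurable N" using f g by auto
  show i: "integrable (M \<Otimes>\<^sub>M N) (\<lambda>z. f (fst z) * g (snd z))"
  proof (rule Fubini_integrable)
    show "integrable M (\<lambda>x. \<integral>y. norm (f (fst (x, y)) * g (snd (x, y))) \<partial>N)"
      using f by (simp add: norm_mult)
    show "AE x in M. integrable N (\<lambda>y. f (fst (x, y)) * g (snd (x, y)))" using g by simp
  qed measurable
  have "(\<integral>z. f (fst z) * g (snd z) \<partial>(M \<Otimes>\<^sub>M N)) = (\<integral>x. (\<integral>y. f x * g y \<partial>N) \<partial>M)"
    using integral_fst'[OF i] by simp
  then show "(\<integral>z. f (fst z) * g (snd z) \<partial>(M \<Otimes>\<^sub>M N)) = (\<integral>x. f x \<partial>M) * (\<integral>y. g y \<partial>N)" by simp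
qed

text \<open>The joint law is prescribed through the characteristic function, so that degenerate covariances need no
  separate treatment.\<close>

locale gaussian_family = prob_space M for M :: "'w measure" +
  fixes I :: "'i set" and g :: "'i \<Rightarrow> 'w \<Rightarrow> real" and S :: "'i \<Rightarrow> 'i \<Rightarrow> real"
  assumes finite_I: "finite I"
    and g_meas: "\<And>m. m \<in> I \<Longrightarrow> g m \<in> borel_measurable M"
    and S_sym: "\<And>m n. S m n = S n m"
    and charfun: "\<And>v. (\<integral>w. iexp (\<Sum>m\<in>I. v m * g m w) \<partial>M) =
        of_real (exp (- (\<Sum>m\<in>I. \<Sum>n\<in>I. v m * v n * S m n) / 2))"
begin

definition lin :: "('i \<Rightarrow> real) \<Rightarrow> 'w \<Rightarrow> real" where "lin v w = (\<Sum>m\<in>I. v m * g m w)"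
definition cov :: "('i \<Rightarrow> real) \<Rightarrow> ('i \<Rightarrow> real) \<Rightarrow> real" where
  "cov u v = (\<Sum>m\<in>I. \<Sum>n\<in>I. u m * v n * S m n)"

lemma lin_meas[measurable]: "lin v \<in> borel_measurable M"
  unfolding lin_def[abs_def] using g_meas by (intro borel_measurable_sum borel_measurable_times) auto

lemma cov_sym: "cov u v = cov v u"
  unfolding cov_def by (subst sum.swap) (auto intro!: sum.cong simp: S_sym)

lemma cov_lin: "cov (\<lambda>k. a * u k + b * v k) z = a * cov u z + b * cov v z"
  unfolding cov_def by (simp add: sum.distrib sum_distrib_left algebra_simps)

lemma lin_lin: "lin (\<lambda>k. a * u k + b * v k) w = a * lin u w + b * lin v w"
  unfolding lin_def by (simp add: sum.distrib sum_distrib_left algebra_simps)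


lemma lin_charfun: "(\<integral>w. iexp (t * lin v w) \<partial>M) = of_real (exp (- t\<^sup>2 * cov v v / 2))"
proof -
  have "(\<Sum>m\<in>I. (t * v m) * g m w) = t * lin v w" for w
    by (simp add: lin_def sum_distrib_left mult_ac)
  moreover have "(\<Sum>m\<in>I. \<Sum>n\<in>I. (t * v m) * (t * v n) * S m n) = t\<^sup>2 * cov v v"
    by (simp add: cov_def sum_distrib_left power2_eq_square mult_ac)
  ultimately show ?thesis using charfun[of "\<lambda>m. t * v m"] by simp
qed

lemma cov_nonneg: "0 \<le> cov v v"
proof -
  have "norm (\<integral>w. iexp (1 * lin v w) \<partial>M) \<le> (\<integral>w. norm (iexp (1 * lin v w)) \<partial>M)" by (rule integral_norm_bound)
  then have "exp (- cov v v / 2) \<le> 1" unfolding lin_charfun by (simp add: prob_space)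
  then show ?thesis by simp
qed

lemma lin_moments:
  "integrable M (\<lambda>w. lin v w ^ k)" "(\<integral>w. lin v w \<partial>M) = 0"
  "(\<integral>w. (lin v w)\<^sup>2 \<partial>M) = cov v v" "(\<integral>w. lin v w ^ 4 \<partial>M) = 3 * (cov v v)\<^sup>2"
  using charfun_gaussian_moments[OF prob_space_axioms lin_meas lin_charfun cov_nonneg] by blast+

lemma lin_prod_square:
  "integrable M (\<lambda>w. lin u w * lin v w)" "(\<integral>w. lin u w * lin v w \<partial>M) = cov u v"
proof -
  have eq: "lin u w * lin v w = (1/4) * (lin (\<lambda>k. 1 * u k + 1 * v k) w)\<^sup>2 - (1/4) * (lin (\<lambda>k. 1 * u k + (-1) * v k) w)\<^sup>2" for w
    unfolding lin_lin by (simp add: power2_eq_square field_simps)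
  show "integrable M (\<lambda>w. lin u w * lin v w)" unfolding eq by (intro integrable_diff integrable_mult_right lin_moments)
  have r: "cov z (\<lambda>k. 1 * u k + s * v k) = 1 * cov z u + s * cov z v" for s z
    by (metis cov_sym cov_lin)
  have c: "cov (\<lambda>k. 1 * u k + s * v k) (\<lambda>k. 1 * u k + s * v k) = cov u u + 2 * s * cov u v + s\<^sup>2 * cov v v" for s
    unfolding cov_lin r by (simp add: cov_sym[of v u] power2_eq_square algebra_simps)
  have i: "integrable M (\<lambda>w. (1/4) * (lin (\<lambda>k. 1 * u k + s * v k) w)\<^sup>2)"
    and m: "(\<integral>w. (1/4) * (lin (\<lambda>k. 1 * u k + s * v k) w)\<^sup>2 \<partial>M) =
      (1/4) * cov (\<lambda>k. 1 * u k + s * v k) (\<lambda>k. 1 * u k + s * v k)" for s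
    by (intro integrable_mult_right lin_moments) (simp only: integral_mult_right_zero lin_moments(3))
  show "(\<integral>w. lin u w * lin v w \<partial>M) = cov u v"
    unfolding eq integral_diff[OF i i] m c by (simp add: field_simps)
qed

text \<open>Wick's formula follows from the fourth moment of a single Gaussian variable by polarization.\<close>

lemma lin_prod_four:
  "integrable M (\<lambda>w. lin a w * lin b w * lin c w * lin d w)"
  "(\<integral>w. lin a w * lin b w * lin c w * lin d w \<partial>M) = cov a b * cov c d + cov a c * cov b d + cov a d * cov b c"
proof -
  define L where "L = (\<lambda>\<epsilon>1 \<epsilon>2 \<epsilon>3. lin (\<lambda>k. 1 * (\<epsilon>1 * a k + \<epsilon>2 * b k) + 1 * (\<epsilon>3 * c k + 1 * d k)))"
  have L: "L e1 e2 e3 w = e1 * lin a w + e2 * lin b w + e3 * lin c w + lin d w" for e1 e2 e3 w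
    unfolding L_def lin_lin by simp
  define C where "C = (\<lambda>e1 e2 e3. cov (\<lambda>k. 1 * (e1 * a k + e2 * b k) + 1 * (e3 * c k + 1 * d k)) (\<lambda>k. 1 * (e1 * a k + e2 * b k) + 1 * (e3 * c k + 1 * d k)))"
  have r: "cov z (\<lambda>k. s * u k + t * v k) = s * cov z u + t * cov z v" for s t u v z
    by (metis cov_sym cov_lin)
  have C: "C e1 e2 e3 = e1\<^sup>2 * cov a a + e2\<^sup>2 * cov b b + e3\<^sup>2 * cov c c + cov d d + 2 * (e1 * e2 * cov a b + e1 * e3 * cov a c + e1 * cov a d
      + e2 * e3 * cov b c + e2 * cov b d + e3 * cov c d)" for e1 e2 e3
    unfolding C_def cov_lin r
    by (simp add: cov_sym[of b a] cov_sym[of c a] cov_sym[of d a] cov_sym[of c b] cov_sym[of d b] cov_sym[of d c] power2_eq_square algebra_simps)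
  have iL: "integrable M (\<lambda>w. L e1 e2 e3 w ^ 4)" and mL: "(\<integral>w. L e1 e2 e3 w ^ 4 \<partial>M) = 3 * (C e1 e2 e3)\<^sup>2" for e1 e2 e3
    unfolding L_def C_def by (rule lin_moments)+
  \<comment> \<open>Polarization: averaging the fourth power of the signed sums against the product of the signs
    isolates the mixed product.\<close>
  have eq: "lin a w * lin b w * lin c w * lin d w =
     (1/192) * (L 1 1 1 w ^ 4 - L 1 1 (-1) w ^ 4 - L 1 (-1) 1 w ^ 4 - L (-1) 1 1 w ^ 4
       + L 1 (-1) (-1) w ^ 4 + L (-1) 1 (-1) w ^ 4 + L (-1) (-1) 1 w ^ 4 - L (-1) (-1) (-1) w ^ 4)" for w
    unfolding L by (simp add: power4_eq_xxxx algebra_simps)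
  show "integrable M (\<lambda>w. lin a w * lin b w * lin c w * lin d w)" unfolding eq
    by (intro integrable_mult_right integrable_diff integrable_add iL)
  have "(\<integral>w. lin a w * lin b w * lin c w * lin d w \<partial>M) = (1/192) * (3 * (C 1 1 1)\<^sup>2 - 3 * (C 1 1 (-1))\<^sup>2 - 3 * (C 1 (-1) 1)\<^sup>2 - 3 * (C (-1) 1 1)\<^sup>2
       + 3 * (C 1 (-1) (-1))\<^sup>2 + 3 * (C (-1) 1 (-1))\<^sup>2 + 3 * (C (-1) (-1) 1)\<^sup>2 - 3 * (C (-1) (-1) (-1))\<^sup>2)"
    unfolding eq by (simp add: iL mL)
  also have "\<dots> = cov a b * cov c d + cov a c * cov b d + cov a d * cov b c"
    unfolding C by (simp add: power2_eq_square algebra_simps)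
  finally show "(\<integral>w. lin a w * lin b w * lin c w * lin d w \<partial>M) = cov a b * cov c d + cov a c * cov b d + cov a d * cov b c" .
qed

lemma lin_unit: "m \<in> I \<Longrightarrow> lin (\<lambda>k. if k = m then 1 else 0) w = g m w"
  unfolding lin_def using finite_I by (simp add: if_distrib[of "\<lambda>x. x * _"] cong: if_cong)

lemma cov_unit: "m \<in> I \<Longrightarrow> n \<in> I \<Longrightarrow> cov (\<lambda>k. if k = m then 1 else 0) (\<lambda>k. if k = n then 1 else 0) = S m n"
  unfolding cov_def using finite_I
  by (simp add: if_distrib[of "\<lambda>x. x * _"] if_distrib[of "\<lambda>x. _ * x"] cong: if_cong)

lemma prod_two:
  assumes "m \<in> I" "n \<in> I"
  shows "integrable M (\<lambda>w. g m w * g n w)" "(\<integral>w. g m w * g n w \<partial>M) = S m n"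
  using lin_prod_square[of "\<lambda>k. if k = m then 1 else 0" "\<lambda>k. if k = n then 1 else 0"] assms
  by (simp_all add: lin_unit cov_unit)

lemma prod_one: "m \<in> I \<Longrightarrow> integrable M (g m)" "m \<in> I \<Longrightarrow> (\<integral>w. g m w \<partial>M) = 0"
  using lin_moments(1)[of "\<lambda>k. if k = m then 1 else 0" 1] lin_moments(2)[of "\<lambda>k. if k = m then 1 else 0"]
  by (simp_all add: lin_unit)

lemma prod_four:
  assumes "m \<in> I" "n \<in> I" "p \<in> I" "q \<in> I"
  shows "integrable M (\<lambda>w. g m w * g n w * g p w * g q w)"
    "(\<integral>w. g m w * g n w * g p w * g q w \<partial>M) = S m n * S p q + S m p * S n q + S m q * S n p"
  using lin_prod_four[of "\<lambda>k. if k = m then 1 else 0" "\<lambda>k. if k = n then 1 else 0"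
      "\<lambda>k. if k = p then 1 else 0" "\<lambda>k. if k = q then 1 else 0"] assms
  by (simp_all add: lin_unit cov_unit)

lemma quadratic_form:
  fixes A :: "'i \<Rightarrow> 'i \<Rightarrow> real"
  defines "Y \<equiv> \<lambda>w. \<Sum>m\<in>I. \<Sum>n\<in>I. A m n * (g m w * g n w)"
  shows "integrable M Y" "(\<integral>w. Y w \<partial>M) = (\<Sum>m\<in>I. \<Sum>n\<in>I. A m n * S m n)"
    "integrable M (\<lambda>w. (Y w)\<^sup>2)"
    "(\<integral>w. (Y w)\<^sup>2 \<partial>M) = (\<Sum>m\<in>I. \<Sum>n\<in>I. \<Sum>p\<in>I. \<Sum>q\<in>I. A m n * A p q * (S m n * S p q + S m p * S n q + S m q * S n p))"
proof -
  show "integrable M Y" unfolding Y_def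
    by (intro integrable_sum integrable_mult_right prod_two)
  show "(\<integral>w. Y w \<partial>M) = (\<Sum>m\<in>I. \<Sum>n\<in>I. A m n * S m n)" unfolding Y_def
    by (subst integral_sum, intro integrable_sum integrable_mult_right prod_two, assumption, assumption,
        intro sum.cong refl, subst integral_sum, intro integrable_mult_right prod_two, assumption, assumption)
      (simp add: prod_two)
  have sq: "(Y w)\<^sup>2 = (\<Sum>m\<in>I. \<Sum>n\<in>I. \<Sum>p\<in>I. \<Sum>q\<in>I. A m n * A p q * (g m w * g n w * g p w * g q w))" for w
    unfolding Y_def by (simp only: power2_eq_square sum_distrib_right, simp only: sum_distrib_left)
      (intro sum.cong refl, simp add: mult_ac)
  show "integrable M (\<lambda>w. (Y w)\<^sup>2)" unfolding sq
    by (intro integrable_sum integrable_mult_right prod_four)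
  show "(\<integral>w. (Y w)\<^sup>2 \<partial>M) = (\<Sum>m\<in>I. \<Sum>n\<in>I. \<Sum>p\<in>I. \<Sum>q\<in>I. A m n * A p q * (S m n * S p q + S m p * S n q + S m q * S n p))"
    unfolding sq
    by (simp add: integral_sum integrable_sum prod_four)
qed

end

section \<open>Quadratic forms in a Gaussian family\<close>

lemma norm_iexp_minus_1: "norm (iexp x - 1) \<le> \<bar>x\<bar>"
  using iexp_approx1[of x 0] by simp

lemma norm_iexp_minus_2: "norm (iexp x - 1 - \<i> * of_real x) \<le> x\<^sup>2 / 2"
  using iexp_approx1[of x 1] by (simp add: power2_eq_square diff_diff_eq numeral_2_eq_2)

text \<open>This bound transfers every approximation in mean, by discretisation or by discarding a remainder, to
  characteristic functions.\<close>

lemma charfun_lipschitz: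
  assumes M: "prob_space M" and U: "integrable M U" and V: "integrable M V"
  shows "norm ((\<integral>\<omega>. iexp (t * U \<omega>) \<partial>M) - (\<integral>\<omega>. iexp (t * V \<omega>) \<partial>M)) \<le> \<bar>t\<bar> * (\<integral>\<omega>. \<bar>U \<omega> - V \<omega>\<bar> \<partial>M)"
proof -
  interpret prob_space M by (rule M)
  have [measurable]: "U \<in> borel_measurable M" "V \<in> borel_measurable M" using U V by auto
  have ii: "integrable M (\<lambda>\<omega>. iexp (t * U \<omega>))" "integrable M (\<lambda>\<omega>. iexp (t * V \<omega>))"
    by (rule integrable_const_bound[of _ 1]; simp)+
  have "norm ((\<integral>\<omega>. iexp (t * U \<omega>) \<partial>M) - (\<integral>\<omega>. iexp (t * V \<omega>) \<partial>M)) = norm (\<integral>\<omega>. iexp (t * U \<omega>) - iexp (t * V \<omega>) \<partial>M)"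
    using ii by simp
  also have "\<dots> \<le> (\<integral>\<omega>. norm (iexp (t * U \<omega>) - iexp (t * V \<omega>)) \<partial>M)" by (rule integral_norm_bound)
  also have "\<dots> \<le> (\<integral>\<omega>. \<bar>t\<bar> * \<bar>U \<omega> - V \<omega>\<bar> \<partial>M)"
  proof (rule Bochner_Integration.integral_mono)
    show "integrable M (\<lambda>\<omega>. norm (iexp (t * U \<omega>) - iexp (t * V \<omega>)))" using ii by simp
    show "integrable M (\<lambda>\<omega>. \<bar>t\<bar> * \<bar>U \<omega> - V \<omega>\<bar>)" using U V by simp
    fix \<omega>
    have "iexp (t * U \<omega>) - iexp (t * V \<omega>) = iexp (t * V \<omega>) * (iexp (t * (U \<omega> - V \<omega>)) - 1)"
      by (simp add: right_diff_distrib exp_diff)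
    then have "norm (iexp (t * U \<omega>) - iexp (t * V \<omega>)) = norm (iexp (t * (U \<omega> - V \<omega>)) - 1)"
      by (simp add: norm_mult)
    also have "\<dots> \<le> \<bar>t * (U \<omega> - V \<omega>)\<bar>" by (rule norm_iexp_minus_1)
    finally show "norm (iexp (t * U \<omega>) - iexp (t * V \<omega>)) \<le> \<bar>t\<bar> * \<bar>U \<omega> - V \<omega>\<bar>" by (simp add: abs_mult)
  qed
  finally show ?thesis by simp
qed

lemma has_vector_derivative_iff_quotient:
  fixes f :: "real \<Rightarrow> 'a::real_normed_vector"
  shows "(f has_vector_derivative d) (at t) \<longleftrightarrow> ((\<lambda>h. (f (t + h) - f t) /\<^sub>R h) \<longlongrightarrow> d) (at 0)"
proof -
  have ev: "\<forall>\<^sub>F h in at 0. norm (f (t + h) - f t - h *\<^sub>R d) / norm h = norm ((f (t + h) - f t) /\<^sub>R h - d)"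
  proof (rule eventually_at_filter[THEN iffD2], rule always_eventually, intro allI impI)
    fix h :: real assume "h \<noteq> 0"
    then have "f (t + h) - f t - h *\<^sub>R d = h *\<^sub>R ((f (t + h) - f t) /\<^sub>R h - d)" by (simp add: scaleR_diff_right)
    then show "norm (f (t + h) - f t - h *\<^sub>R d) / norm h = norm ((f (t + h) - f t) /\<^sub>R h - d)"
      using \<open>h \<noteq> 0\<close> by simp
  qed
  have "(f has_vector_derivative d) (at t) \<longleftrightarrow> ((\<lambda>h. norm (f (t + h) - f t - h *\<^sub>R d) / norm h) \<longlongrightarrow> 0) (at 0)"
    by (simp add: has_vector_derivative_def has_derivative_at bounded_linear_scaleR_left)
  also have "\<dots> \<longleftrightarrow> ((\<lambda>h. norm ((f (t + h) - f t) /\<^sub>R h - d)) \<longlongrightarrow> 0) (at 0)"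
    by (rule tendsto_cong[OF ev])
  also have "\<dots> \<longleftrightarrow> ((\<lambda>h. (f (t + h) - f t) /\<^sub>R h) \<longlongrightarrow> d) (at 0)"
    unfolding tendsto_norm_zero_iff by (rule LIM_zero_iff)
  finally show ?thesis .
qed

lemma has_vector_derivative_charfun:
  assumes M: "prob_space M" and Q: "integrable M Q"
  shows "((\<lambda>t. \<integral>w. iexp (t * Q w) \<partial>M) has_vector_derivative (\<integral>w. \<i> * of_real (Q w) * iexp (t * Q w) \<partial>M)) (at t)"
proof -
  interpret prob_space M by fact
  have [measurable]: "Q \<in> borel_measurable M" using Q by auto
  have inte: "integrable M (\<lambda>w. iexp (a * Q w))" for a
    by (rule integrable_const_bound[of _ 1]) auto
  have "((\<lambda>h. ((\<integral>w. iexp ((t + h) * Q w) \<partial>M) - (\<integral>w. iexp (t * Q w) \<partial>M)) /\<^sub>R h)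
    \<longlongrightarrow> (\<integral>w. \<i> * of_real (Q w) * iexp (t * Q w) \<partial>M)) (at 0)"
    unfolding tendsto_at_iff_sequentially comp_def
  proof (intro allI impI)
    fix X :: "nat \<Rightarrow> real" assume X: "\<forall>i. X i \<in> UNIV - {0}" "X \<longlonglongrightarrow> 0"
    have eq: "((\<integral>w. iexp ((t + X i) * Q w) \<partial>M) - (\<integral>w. iexp (t * Q w) \<partial>M)) /\<^sub>R X i =
       (\<integral>w. (iexp ((t + X i) * Q w) - iexp (t * Q w)) /\<^sub>R X i \<partial>M)" for i
      by (simp only: integral_scaleR_right integral_diff[OF inte inte])
    show "(\<lambda>i. ((\<integral>w. iexp ((t + X i) * Q w) \<partial>M) - (\<integral>w. iexp (t * Q w) \<partial>M)) /\<^sub>R X i)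
       \<longlonglongrightarrow> (\<integral>w. \<i> * of_real (Q w) * iexp (t * Q w) \<partial>M)"
      unfolding eq
    proof (rule integral_dominated_convergence[where w="\<lambda>w. \<bar>Q w\<bar>"])
      show "integrable M (\<lambda>w. \<bar>Q w\<bar>)" using Q by simp
      show "AE w in M. norm ((iexp ((t + X i) * Q w) - iexp (t * Q w)) /\<^sub>R X i) \<le> \<bar>Q w\<bar>" for i
      proof (rule AE_I2)
        fix w
        have "iexp ((t + X i) * Q w) - iexp (t * Q w) = iexp (t * Q w) * (iexp (X i * Q w) - 1)"
          by (simp add: algebra_simps flip: exp_add)
        then have "norm (iexp ((t + X i) * Q w) - iexp (t * Q w)) \<le> \<bar>X i * Q w\<bar>"
          using norm_iexp_minus_1[of "X i * Q w"] by (simp add: norm_mult)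
        then show "norm ((iexp ((t + X i) * Q w) - iexp (t * Q w)) /\<^sub>R X i) \<le> \<bar>Q w\<bar>"
          using X(1) by (auto simp: abs_mult divide_simps mult.commute[of "\<bar>Q w\<bar>"])
      qed
      show "AE w in M. (\<lambda>i. (iexp ((t + X i) * Q w) - iexp (t * Q w)) /\<^sub>R X i) \<longlonglongrightarrow> \<i> * of_real (Q w) * iexp (t * Q w)"
      proof (rule AE_I2)
        fix w
        have "((\<lambda>z. exp (z * (\<i> * of_real (Q w)))) has_field_derivative (exp (of_real t * (\<i> * of_real (Q w))) * (\<i> * of_real (Q w)))) (at (of_real t))"
          by (auto intro!: derivative_eq_intros)
        from has_vector_derivative_real_field[OF this]
        have "((\<lambda>s. iexp (s * Q w)) has_vector_derivative (\<i> * of_real (Q w) * iexp (t * Q w))) (at t)"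
          by (simp add: mult_ac)
        then have "((\<lambda>h. (iexp ((t + h) * Q w) - iexp (t * Q w)) /\<^sub>R h) \<longlongrightarrow> \<i> * of_real (Q w) * iexp (t * Q w)) (at 0)"
          unfolding has_vector_derivative_iff_quotient .
        then show "(\<lambda>i. (iexp ((t + X i) * Q w) - iexp (t * Q w)) /\<^sub>R X i) \<longlonglongrightarrow> \<i> * of_real (Q w) * iexp (t * Q w)"
          using X unfolding tendsto_at_iff_sequentially comp_def by auto
      qed
    qed measurable
  qed
  then show ?thesis unfolding has_vector_derivative_iff_quotient .
qed

context gaussian_family begin

abbreviation M2 :: "('w \<times> 'w) measure" where "M2 \<equiv> M \<Otimes>\<^sub>M M"

abbreviation trace2 :: "('i \<Rightarrow> real) \<Rightarrow> real" where
  "trace2 a \<equiv> \<Sum>m\<in>I. \<Sum>n\<in>I. a m * a n * (S m n)\<^sup>2"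

abbreviation trace4 :: "('i \<Rightarrow> real) \<Rightarrow> real" where
  "trace4 a \<equiv> \<Sum>m\<in>I. \<Sum>n\<in>I. \<Sum>p\<in>I. \<Sum>q\<in>I. a m * a n * a p * a q * (S m n * S n p * S p q * S q m)"

text \<open>Rotation invariance: the two coordinates of \<open>M2\<close> carry independent copies of the family.\<close>

lemma charfun_pair:
  assumes e: "0 \<le> e"
  shows "(\<integral>z. iexp (\<Sum>m\<in>I. v m * (g m (fst z) + sqrt e * g m (snd z))) \<partial>M2) =
    (\<integral>w. iexp (\<Sum>m\<in>I. v m * (sqrt (1 + e) * g m w)) \<partial>M)"
proof -
  have "(\<integral>z. iexp (\<Sum>m\<in>I. v m * (g m (fst z) + sqrt e * g m (snd z))) \<partial>M2) =
     (\<integral>z. iexp (1 * lin v (fst z)) * iexp (sqrt e * lin v (snd z)) \<partial>M2)"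
    by (intro integral_cong refl)
       (simp add: lin_def sum.distrib sum_distrib_left ring_distribs mult_ac flip: exp_add)
  also have "\<dots> = (\<integral>w. iexp (1 * lin v w) \<partial>M) * (\<integral>w. iexp (sqrt e * lin v w) \<partial>M)"
    by (rule pair_integral_mult[OF prob_space_axioms prob_space_axioms])
       (auto intro!: integrable_const_bound[of _ 1])
  also have "\<dots> = (\<integral>w. iexp (sqrt (1 + e) * lin v w) \<partial>M)"
    unfolding lin_charfun using e by (simp add: field_simps flip: exp_add of_real_mult)
  also have "\<dots> = (\<integral>w. iexp (\<Sum>m\<in>I. v m * (sqrt (1 + e) * g m w)) \<partial>M)"
    by (intro integral_cong refl) (simp add: lin_def sum_distrib_left mult_ac)
  finally show ?thesis .
qed

definition quad :: "('i \<Rightarrow> real) \<Rightarrow> 'w \<Rightarrow> real" where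
  "quad a w = (\<Sum>m\<in>I. a m * ((g m w)\<^sup>2 - S m m))"

text \<open>The bilinear form of \<open>quad\<close> at two independent copies; \<open>carre\<close> below is its second moment in the second
  copy, given the first, a quarter of the squared gradient of \<open>quad\<close> measured by the covariance \<open>S\<close>.\<close>

definition polar :: "('i \<Rightarrow> real) \<Rightarrow> 'w \<times> 'w \<Rightarrow> real" where
  "polar a z = (\<Sum>m\<in>I. a m * (g m (fst z) * g m (snd z)))"

definition carre :: "('i \<Rightarrow> real) \<Rightarrow> 'w \<Rightarrow> real" where
  "carre a w = (\<Sum>m\<in>I. \<Sum>n\<in>I. a m * a n * S m n * (g m w * g n w))"

lemma quad_meas[measurable]: "quad a \<in> borel_measurable M"
  unfolding quad_def[abs_def] using g_meas
  by (intro borel_measurable_sum borel_measurable_times borel_measurable_diff borel_measurable_power) auto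

lemma polar_meas[measurable]: "polar a \<in> borel_measurable M2"
  unfolding polar_def[abs_def]
  by (intro borel_measurable_sum borel_measurable_times)
     (auto intro: measurable_compose[OF measurable_fst g_meas] measurable_compose[OF measurable_snd g_meas])

lemma carre_meas[measurable]: "carre a \<in> borel_measurable M"
  unfolding carre_def[abs_def] using g_meas
  by (intro borel_measurable_sum borel_measurable_times) auto

lemma quad_alt: "quad a w = (\<Sum>m\<in>I. \<Sum>n\<in>I. (if m = n then a m else 0) * (g m w * g n w)) - (\<Sum>m\<in>I. a m * S m m)"
  unfolding quad_def using finite_I
  by (simp add: if_distrib[of "\<lambda>x. x * _"] right_diff_distrib sum_subtractf power2_eq_square cong: if_cong)

lemma quad_integrable: "integrable M (quad a)" "(\<integral>w. quad a w \<partial>M) = 0" "integrable M (\<lambda>w. (quad a w)\<^sup>2)"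
proof -
  let ?Y = "\<lambda>w. (\<Sum>m\<in>I. \<Sum>n\<in>I. (if m = n then a m else 0) * (g m w * g n w))"
  note qf = quadratic_form[of "\<lambda>m n. if m = n then a m else 0"]
  have q: "quad a = (\<lambda>w. ?Y w - (\<Sum>m\<in>I. a m * S m m))" using quad_alt by blast
  show "integrable M (quad a)" unfolding q using qf(1) by simp
  have "(\<Sum>m\<in>I. \<Sum>n\<in>I. (if m = n then a m else 0) * S m n) = (\<Sum>m\<in>I. a m * S m m)"
    using finite_I by (simp add: if_distrib[of "\<lambda>x. x * _"] cong: if_cong)
  then show "(\<integral>w. quad a w \<partial>M) = 0" unfolding q using qf(1,2) by (simp add: prob_space)
  show "integrable M (\<lambda>w. (quad a w)\<^sup>2)"
    unfolding q power2_diff using qf(1,3)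
    by (intro integrable_add integrable_diff integrable_mult_left integrable_mult_right) auto
qed

lemma carre_moments:
  "integrable M (carre a)" "(\<integral>w. carre a w \<partial>M) = (trace2 a)"
  "(\<integral>w. (carre a w - (trace2 a))\<^sup>2 \<partial>M) =
     2 * (trace4 a)"
  "integrable M (\<lambda>w. (carre a w - (trace2 a))\<^sup>2)"
proof -
  note qf = quadratic_form[of "\<lambda>m n. a m * a n * S m n", folded carre_def]
  show i: "integrable M (carre a)" using qf(1) by (simp add: carre_def[abs_def])
  show e: "(\<integral>w. carre a w \<partial>M) = (trace2 a)"
    using qf(2) by (simp add: carre_def[abs_def] power2_eq_square mult_ac)
  have i2: "integrable M (\<lambda>w. (carre a w)\<^sup>2)" using qf(3) by (simp add: carre_def[abs_def])
  let ?e = "(trace2 a)"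
  show "integrable M (\<lambda>w. (carre a w - ?e)\<^sup>2)"
    unfolding power2_diff using i i2
    by (intro integrable_add integrable_diff integrable_mult_left integrable_mult_right) auto
  have "(\<integral>w. (carre a w - ?e)\<^sup>2 \<partial>M) = (\<integral>w. (carre a w)\<^sup>2 \<partial>M) - ?e\<^sup>2"
    using variance_eq[OF i i2] e by simp
  also have "(\<integral>w. (carre a w)\<^sup>2 \<partial>M) = (\<Sum>m\<in>I. \<Sum>n\<in>I. \<Sum>p\<in>I. \<Sum>q\<in>I. (a m * a n * S m n) * (a p * a q * S p q) * (S m n * S p q + S m p * S n q + S m q * S n p))"
    using qf(4) by (simp add: carre_def[abs_def])
  also have "\<dots> = (\<Sum>m\<in>I. \<Sum>n\<in>I. \<Sum>p\<in>I. \<Sum>q\<in>I. (a m * a n * (S m n)\<^sup>2) * (a p * a q * (S p q)\<^sup>2))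
     + (\<Sum>m\<in>I. \<Sum>n\<in>I. \<Sum>p\<in>I. \<Sum>q\<in>I. a m * a n * a p * a q * (S m n * S n q * S q p * S p m))
     + (trace4 a)"
    unfolding sum.distrib[symmetric]
    by (intro sum.cong refl) (simp add: S_sym power2_eq_square algebra_simps)
  also have "(\<Sum>m\<in>I. \<Sum>n\<in>I. \<Sum>p\<in>I. \<Sum>q\<in>I. a m * a n * a p * a q * (S m n * S n q * S q p * S p m)) =
     (trace4 a)"
    by (rule sum.cong[OF refl], rule sum.cong[OF refl], subst sum.swap, rule sum.cong[OF refl],
        rule sum.cong[OF refl], simp add: mult_ac)
  also have "(\<Sum>m\<in>I. \<Sum>n\<in>I. \<Sum>p\<in>I. \<Sum>q\<in>I. (a m * a n * (S m n)\<^sup>2) * (a p * a q * (S p q)\<^sup>2)) = ?e\<^sup>2"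
    by (simp only: power2_eq_square sum_distrib_right, simp only: sum_distrib_left)
  finally show "(\<integral>w. (carre a w - ?e)\<^sup>2 \<partial>M) =
     2 * (trace4 a)"
    by simp
qed

end

section \<open>The characteristic function of a quadratic form\<close>

context gaussian_family begin

text \<open>Expand \<open>quad a\<close> at the sum of the family and \<open>sqrt e\<close> times its copy. Rotation invariance replaces this sum by
  \<open>sqrt (1 + e)\<close> times the family, which changes \<open>t\<close> into \<open>t * (1 + e)\<close>; the constants \<open>S m m\<close> match since
  each term contributes one copy of \<open>1 + e\<close>.\<close>

lemma quad_scaling:
  assumes e: "0 \<le> e"
  shows "(\<integral>z. iexp (t * (quad a (fst z) + 2 * sqrt e * polar a z + e * quad a (snd z))) \<partial>M2) =
    (\<integral>w. iexp (t * (1 + e) * quad a w) \<partial>M)"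
proof -
  interpret MM: pair_prob_space M M ..
  define f where "f = (\<lambda>m x. iexp (t * (a m * (x\<^sup>2 - (1 + e) * S m m))))"
  have "(\<integral>z. iexp (t * (quad a (fst z) + 2 * sqrt e * polar a z + e * quad a (snd z))) \<partial>M2) =
     (\<integral>z. (\<Prod>m\<in>I. f m (g m (fst z) + sqrt e * g m (snd z))) \<partial>M2)"
  proof (intro integral_cong refl)
    fix z
    have "t * (quad a (fst z) + 2 * sqrt e * polar a z + e * quad a (snd z)) =
      (\<Sum>m\<in>I. t * (a m * ((g m (fst z) + sqrt e * g m (snd z))\<^sup>2 - (1 + e) * S m m)))"
      using e unfolding quad_def polar_def sum_distrib_left sum.distrib[symmetric]
      by (intro sum.cong refl) (simp add: power2_eq_square algebra_simps)
    then show "iexp (t * (quad a (fst z) + 2 * sqrt e * polar a z + e * quad a (snd z))) =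
      (\<Prod>m\<in>I. f m (g m (fst z) + sqrt e * g m (snd z)))"
      unfolding f_def by (simp add: exp_sum[OF finite_I] of_real_sum sum_distrib_left)
  qed
  also have "\<dots> = (\<integral>w. (\<Prod>m\<in>I. f m (sqrt (1 + e) * g m w)) \<partial>M)"
  proof (rule charfun_eq_imp_prod_expectation_eq[OF finite_I])
    show "prob_space M2" "prob_space M" by unfold_locales
    show "(\<lambda>z. g m (fst z) + sqrt e * g m (snd z)) \<in> borel_measurable M2" if "m \<in> I" for m
      using that by (intro borel_measurable_add borel_measurable_times)
        (auto intro: measurable_compose[OF measurable_fst g_meas] measurable_compose[OF measurable_snd g_meas])
    show "(\<lambda>w. sqrt (1 + e) * g m w) \<in> borel_measurable M" if "m \<in> I" for m
      using g_meas[OF that] by simp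
    show "f m \<in> borel_measurable borel" for m unfolding f_def by measurable
    show "norm (f m x) \<le> 1" for m x unfolding f_def by simp
  qed (rule charfun_pair[OF e])
  also have "\<dots> = (\<integral>w. iexp (t * (1 + e) * quad a w) \<partial>M)"
  proof (intro integral_cong refl)
    fix w
    have "t * (1 + e) * quad a w = (\<Sum>m\<in>I. t * (a m * ((sqrt (1 + e) * g m w)\<^sup>2 - (1 + e) * S m m)))"
      using e unfolding quad_def sum_distrib_left
      by (intro sum.cong refl) (simp add: power_mult_distrib algebra_simps)
    then show "(\<Prod>m\<in>I. f m (sqrt (1 + e) * g m w)) = iexp (t * (1 + e) * quad a w)"
      unfolding f_def by (simp add: exp_sum[OF finite_I] of_real_sum sum_distrib_left)
  qed
  finally show ?thesis .
qed

lemma weighted_polar: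
  fixes k :: "'w \<Rightarrow> complex"
  assumes k[measurable]: "k \<in> borel_measurable M" and kb: "\<And>w. norm (k w) \<le> 1"
  shows "integrable M2 (\<lambda>z. k (fst z) * of_real (polar a z))"
    "(\<integral>z. k (fst z) * of_real (polar a z) \<partial>M2) = 0"
    "integrable M2 (\<lambda>z. k (fst z) * of_real ((polar a z)\<^sup>2))"
    "(\<integral>z. k (fst z) * of_real ((polar a z)\<^sup>2) \<partial>M2) = (\<integral>w. k w * of_real (carre a w) \<partial>M)"
proof -
  have kint: "integrable M (\<lambda>w. k w * of_real (f w))" if "integrable M f" for f :: "'w \<Rightarrow> real"
  proof (rule integrable_bound[OF that])
    show "(\<lambda>w. k w * of_real (f w)) \<in> borel_measurable M" using that by measurable
    show "AE w in M. norm (k w * of_real (f w)) \<le> norm (f w)"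
      by (rule AE_I2) (simp add: norm_mult mult_left_le_one_le kb)
  qed
  have gint: "integrable M (\<lambda>w. complex_of_real (g m w))" "(\<integral>w. complex_of_real (g m w) \<partial>M) = 0" if "m \<in> I" for m
    using prod_one[OF that] by auto
  have g2int: "integrable M (\<lambda>w. complex_of_real (g m w * g n w))" "(\<integral>w. complex_of_real (g m w * g n w) \<partial>M) = of_real (S m n)"
    if "m \<in> I" "n \<in> I" for m n
    using prod_two[OF that] by (simp_all only: integrable_of_real integral_complex_of_real)
  note pm1 = pair_integral_mult[OF prob_space_axioms prob_space_axioms integrable_mult_right[OF kint[OF prod_one(1)]] gint(1)]
  have e1: "k (fst z) * of_real (polar a z) = (\<Sum>m\<in>I. of_real (a m) * (k (fst z) * of_real (g m (fst z))) * of_real (g m (snd z)))" for z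
    unfolding polar_def of_real_sum sum_distrib_left by (intro sum.cong refl) (simp add: mult_ac)
  show "integrable M2 (\<lambda>z. k (fst z) * of_real (polar a z))" unfolding e1
    by (intro integrable_sum pm1)
  show "(\<integral>z. k (fst z) * of_real (polar a z) \<partial>M2) = 0" unfolding e1
    by (subst integral_sum) (use pm1 gint in auto)
  note pm2 = pair_integral_mult[OF prob_space_axioms prob_space_axioms integrable_mult_right[OF kint[OF prod_two(1)]] g2int(1)]
  have e2: "k (fst z) * of_real ((polar a z)\<^sup>2) = (\<Sum>m\<in>I. \<Sum>n\<in>I. of_real (a m * a n) * (k (fst z) * of_real (g m (fst z) * g n (fst z))) * of_real (g m (snd z) * g n (snd z)))" for z
  proof -
    have "(polar a z)\<^sup>2 = (\<Sum>m\<in>I. \<Sum>n\<in>I. (a m * (g m (fst z) * g m (snd z))) * (a n * (g n (fst z) * g n (snd z))))"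
      by (simp only: polar_def power2_eq_square sum_product)
    then show ?thesis unfolding of_real_sum sum_distrib_left
      by (simp only: of_real_sum sum_distrib_left) (intro sum.cong refl, simp add: mult_ac)
  qed
  show "integrable M2 (\<lambda>z. k (fst z) * of_real ((polar a z)\<^sup>2))" unfolding e2
    by (intro integrable_sum pm2)
  have "(\<integral>z. k (fst z) * of_real ((polar a z)\<^sup>2) \<partial>M2) =
     (\<Sum>m\<in>I. \<Sum>n\<in>I. (\<integral>w. of_real (a m * a n) * (k w * of_real (g m w * g n w)) \<partial>M) * of_real (S m n))"
    unfolding e2
    apply (subst integral_sum, intro integrable_sum pm2, assumption, assumption, assumption, assumption)
    apply (rule sum.cong[OF refl])
    apply (subst integral_sum, intro pm2, assumption, assumption, assumption, assumption)
    apply (rule sum.cong[OF refl])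
    apply (subst pm2(2), assumption, assumption, assumption, assumption)
    apply (simp only: g2int(2))
    done
  also have "\<dots> = (\<integral>w. (\<Sum>m\<in>I. \<Sum>n\<in>I. of_real (a m * a n) * (k w * of_real (g m w * g n w)) * of_real (S m n)) \<partial>M)"
    apply (subst integral_sum, intro integrable_sum integrable_mult_left integrable_mult_right kint prod_two, assumption, assumption)
    apply (rule sum.cong[OF refl])
    apply (subst integral_sum, intro integrable_mult_left integrable_mult_right kint prod_two, assumption, assumption)
    apply (rule sum.cong[OF refl])
    apply (simp only: integral_mult_left_zero)
    done
  also have "\<dots> = (\<integral>w. k w * of_real (carre a w) \<partial>M)"
    unfolding carre_def of_real_sum sum_distrib_left
    by (intro integral_cong refl sum.cong) (simp add: mult_ac)
  finally show "(\<integral>z. k (fst z) * of_real ((polar a z)\<^sup>2) \<partial>M2) = (\<integral>w. k w * of_real (carre a w) \<partial>M)" .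
qed

text \<open>Differentiate \<open>quad_scaling\<close> at \<open>e = 0\<close>. Given the first copy, \<open>polar\<close> and \<open>quad\<close> of the second copy are
  centred, so the terms of order \<open>sqrt e\<close> and the linear terms of order \<open>e\<close> disappear, and the quadratic
  term in \<open>sqrt e * polar\<close> leaves \<open>carre\<close>. At \<open>t = 0\<close>, which the dilation fixes, the derivative vanishes
  because \<open>quad\<close> is centred.\<close>

lemma quad_charfun_derivative:
  "((\<lambda>t. \<integral>w. iexp (t * quad a w) \<partial>M) has_vector_derivative
     (- 2 * of_real t * (\<integral>w. iexp (t * quad a w) * of_real (carre a w) \<partial>M))) (at t)"
proof -
  interpret MM: pair_prob_space M M ..
  define \<psi> where "\<psi> t = (\<integral>w. iexp (t * quad a w) \<partial>M)" for t
  define D where "D = (\<integral>w. \<i> * of_real (quad a w) * iexp (t * quad a w) \<partial>M)"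
  have D: "(\<psi> has_vector_derivative D) (at t)"
    unfolding \<psi>_def D_def by (rule has_vector_derivative_charfun[OF prob_space_axioms quad_integrable(1)])
  have "D = - 2 * of_real t * (\<integral>w. iexp (t * quad a w) * of_real (carre a w) \<partial>M)"
  proof (cases "t = 0")
    case True
    then show ?thesis unfolding D_def using quad_integrable by simp
  next
    case False
    define e where "e n = inverse (real (Suc n))" for n
    have e: "0 < e n" "e n \<le> 1" for n unfolding e_def by (auto simp: field_simps)
    have e_lim: "e \<longlonglongrightarrow> 0" unfolding e_def by (rule LIMSEQ_inverse_real_of_nat)
    define k where "k w = iexp (t * quad a w)" for w
    have k[measurable]: "k \<in> borel_measurable M" and kb: "norm (k w) = 1" for w unfolding k_def by auto
    \<comment> \<open>The exponent increment is \<open>x n = sqrt (e n) * y n\<close> with \<open>y n\<close> bounded in mean square, so the remainder of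
      the exponential after its linear term is of order \<open>e n\<close>.\<close>
    define y where "y n z = t * (2 * polar a z + sqrt (e n) * quad a (snd z))" for n z
    have [measurable]: "y n \<in> borel_measurable M2" for n unfolding y_def by measurable
    define x where "x n z = sqrt (e n) * y n z" for n z
    have x: "x n z = t * (2 * sqrt (e n) * polar a z + e n * quad a (snd z))" for n z
    proof -
      have "sqrt (e n) * (sqrt (e n) * quad a (snd z)) = e n * quad a (snd z)"
        using e(1)[of n] by (simp flip: mult.assoc)
      then show ?thesis unfolding x_def y_def by (simp add: algebra_simps)
    qed
    have [measurable]: "x n \<in> borel_measurable M2" for n unfolding x_def by measurable
    let ?q = "\<lambda>n z. (iexp (x n z) - 1 - \<i> * of_real (x n z)) / of_real (e n)"
    have x2: "(x n z)\<^sup>2 = e n * (y n z)\<^sup>2" for n z unfolding x_def using e(1)[of n] by (simp add: power_mult_distrib)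
    have ik: "integrable M k" by (rule integrable_const_bound[of _ 1]) (auto simp: kb)
    have iq: "integrable M (\<lambda>w. complex_of_real (quad a w))" using quad_integrable by auto
    note kq = pair_integral_mult[OF prob_space_axioms prob_space_axioms ik iq]
    have wx: "integrable M2 (\<lambda>z. k (fst z) * of_real (x n z))" "(\<integral>z. k (fst z) * of_real (x n z) \<partial>M2) = 0" for n
    proof -
      have eq: "k (fst z) * of_real (x n z) = of_real (2 * t * sqrt (e n)) * (k (fst z) * of_real (polar a z))
         + of_real (t * e n) * (k (fst z) * of_real (quad a (snd z)))" for z
        unfolding x by (simp add: algebra_simps)
      show "integrable M2 (\<lambda>z. k (fst z) * of_real (x n z))" unfolding eq
        using kb by (intro integrable_add integrable_mult_right weighted_polar(1) k kq(1)) simp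
      show "(\<integral>z. k (fst z) * of_real (x n z) \<partial>M2) = 0" unfolding eq
        using kb weighted_polar(1,2)[OF k, of a] kq quad_integrable(2) by (subst integral_add) auto
    qed
    have quot: "(\<psi> (t + t * e n) - \<psi> t) /\<^sub>R (t * e n) =
      (\<integral>z. k (fst z) * (?q n z) \<partial>M2) / of_real t" for n
    proof -
      have "\<psi> (t + t * e n) = (\<integral>w. iexp (t * (1 + e n) * quad a w) \<partial>M)" unfolding \<psi>_def by (simp add: algebra_simps)
      also have "\<dots> = (\<integral>z. iexp (t * (quad a (fst z) + 2 * sqrt (e n) * polar a z + e n * quad a (snd z))) \<partial>M2)"
        using quad_scaling[of "e n" t a] e[of n] by simp
      also have "\<dots> = (\<integral>z. k (fst z) * iexp (x n z) \<partial>M2)"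
        unfolding k_def x by (intro integral_cong refl) (simp add: algebra_simps flip: exp_add)
      finally have 1: "\<psi> (t + t * e n) = (\<integral>z. k (fst z) * iexp (x n z) \<partial>M2)" .
      have 2: "\<psi> t = (\<integral>z. k (fst z) \<partial>M2)"
        using pair_integral_mult(2)[OF prob_space_axioms prob_space_axioms ik, of "\<lambda>_. 1"]
        by (simp add: prob_space \<psi>_def k_def)
      have i1: "integrable M2 (\<lambda>z. k (fst z) * iexp (x n z))"
        by (rule MM.integrable_const_bound[of _ 1]) (auto simp: norm_mult kb)
      have i2: "integrable M2 (\<lambda>z. k (fst z))"
        by (rule MM.integrable_const_bound[of _ 1]) (auto simp: kb)
      have "(\<integral>z. k (fst z) * (?q n z) \<partial>M2) =
         (\<integral>z. (k (fst z) * iexp (x n z) - k (fst z) - \<i> * (k (fst z) * of_real (x n z))) / of_real (e n) \<partial>M2)"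
        by (intro integral_cong refl) (simp add: algebra_simps)
      also have "\<dots> = (\<psi> (t + t * e n) - \<psi> t) / of_real (e n)"
        unfolding integral_divide_zero 1 2
        by (subst integral_diff, intro integrable_diff i1 i2, intro integrable_mult_right wx,
            subst integral_diff, intro i1, intro i2, simp add: wx)
      finally show ?thesis by (simp add: scaleR_conv_of_real divide_inverse mult_ac)
    qed
    have "(\<lambda>n. \<integral>z. k (fst z) * (?q n z) \<partial>M2)
       \<longlonglongrightarrow> (\<integral>z. k (fst z) * (- of_real ((2 * t * polar a z)\<^sup>2) / 2) \<partial>M2)"
    proof (rule integral_dominated_convergence[where w="\<lambda>z. t\<^sup>2 * (4 * (polar a z)\<^sup>2 + (quad a (snd z))\<^sup>2)"])
      have p2: "integrable M2 (\<lambda>z. (polar a z)\<^sup>2)"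
        using weighted_polar(3)[of "\<lambda>_. 1" a] by (simp del: of_real_power) (simp only: of_real_power[symmetric] complex_of_real_integrable_eq)
      have q2: "integrable M2 (\<lambda>z. (quad a (snd z))\<^sup>2)"
        using pair_integral_mult(1)[OF prob_space_axioms prob_space_axioms _ quad_integrable(3), of "\<lambda>_. 1" a] by simp
      show "integrable M2 (\<lambda>z. t\<^sup>2 * (4 * (polar a z)\<^sup>2 + (quad a (snd z))\<^sup>2))"
        using p2 q2 by simp
      show "AE z in M2. norm (k (fst z) * (?q n z))
        \<le> t\<^sup>2 * (4 * (polar a z)\<^sup>2 + (quad a (snd z))\<^sup>2)" for n
      proof (rule AE_I2)
        fix z
        have "norm (k (fst z) * (?q n z)) \<le> ((x n z)\<^sup>2 / 2) / e n"
          using divide_right_mono[OF norm_iexp_minus_2[of "x n z"], of "e n"] e(1)[of n]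
          by (simp add: norm_mult norm_divide kb less_imp_le)
        also have "\<dots> = t\<^sup>2 * ((2 * polar a z + sqrt (e n) * quad a (snd z))\<^sup>2 / 2)"
          unfolding x2 y_def using e(1)[of n] by (simp add: power_mult_distrib)
        also have "(2 * polar a z + sqrt (e n) * quad a (snd z))\<^sup>2 / 2 \<le> 4 * (polar a z)\<^sup>2 + (sqrt (e n) * quad a (snd z))\<^sup>2"
          using zero_le_power2[of "2 * polar a z - sqrt (e n) * quad a (snd z)"]
          unfolding power2_sum power2_diff power_mult_distrib by simp
        also have "(sqrt (e n) * quad a (snd z))\<^sup>2 \<le> (quad a (snd z))\<^sup>2"
          using e[of n] by (simp add: power_mult_distrib mult_left_le_one_le)
        finally show "norm (k (fst z) * (?q n z)) \<le> t\<^sup>2 * (4 * (polar a z)\<^sup>2 + (quad a (snd z))\<^sup>2)"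
          by (simp add: mult_left_mono)
      qed
      show "AE z in M2. (\<lambda>n. k (fst z) * (?q n z))
        \<longlonglongrightarrow> k (fst z) * (- of_real ((2 * t * polar a z)\<^sup>2) / 2)"
      proof (rule AE_I2)
        fix z
        have se: "(\<lambda>n. sqrt (e n)) \<longlonglongrightarrow> 0" using tendsto_real_sqrt[OF e_lim] by simp
        have "(\<lambda>n. y n z) \<longlonglongrightarrow> t * (2 * polar a z + 0 * quad a (snd z))"
          unfolding y_def by (intro tendsto_intros se)
        then have y: "(\<lambda>n. y n z) \<longlonglongrightarrow> 2 * t * polar a z" by (simp add: mult_ac)
        have "(\<lambda>n. (iexp (x n z) - 1 - \<i> * of_real (x n z)) / of_real (e n) + of_real ((y n z)\<^sup>2) / 2) \<longlonglongrightarrow> 0"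
        proof (rule Lim_null_comparison)
          show "\<forall>\<^sub>F n in sequentially. norm ((iexp (x n z) - 1 - \<i> * of_real (x n z)) / of_real (e n) + of_real ((y n z)\<^sup>2) / 2) \<le> sqrt (e n) * \<bar>y n z\<bar> ^ 3"
          proof (rule always_eventually, rule allI)
            fix n
            have "norm (iexp (x n z) - 1 - \<i> * of_real (x n z) + of_real ((x n z)\<^sup>2) / 2) \<le> \<bar>x n z\<bar> ^ 3 / 6"
              using iexp_approx1[of "x n z" 2] by (simp add: numeral_2_eq_2 fact_numeral power2_eq_square algebra_simps power3_eq_cube)
            moreover have "(iexp (x n z) - 1 - \<i> * of_real (x n z)) / of_real (e n) + of_real ((y n z)\<^sup>2) / 2 =
              (iexp (x n z) - 1 - \<i> * of_real (x n z) + of_real ((x n z)\<^sup>2) / 2) / of_real (e n)"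
              unfolding x2 using e(1)[of n] by (simp add: add_divide_distrib)
            ultimately have "norm ((iexp (x n z) - 1 - \<i> * of_real (x n z)) / of_real (e n) + of_real ((y n z)\<^sup>2) / 2) \<le> \<bar>x n z\<bar> ^ 3 / 6 / e n"
              using e(1)[of n] divide_right_mono[of _ "\<bar>x n z\<bar> ^ 3 / 6" "e n"] by (simp only: norm_divide norm_of_real) simp
            also have "\<dots> = sqrt (e n) * \<bar>y n z\<bar> ^ 3 / 6"
            proof -
              have "sqrt (e n) ^ 3 = e n * sqrt (e n)" using e(1)[of n] by (simp add: power3_eq_cube)
              then show ?thesis unfolding x_def using e(1)[of n] by (simp add: abs_mult power_mult_distrib)
            qed
            also have "\<dots> \<le> sqrt (e n) * \<bar>y n z\<bar> ^ 3" using e(1)[of n] by simp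
            finally show "norm ((iexp (x n z) - 1 - \<i> * of_real (x n z)) / of_real (e n) + of_real ((y n z)\<^sup>2) / 2) \<le> sqrt (e n) * \<bar>y n z\<bar> ^ 3" .
          qed
          have "(\<lambda>n. sqrt (e n) * \<bar>y n z\<bar> ^ 3) \<longlonglongrightarrow> 0 * \<bar>2 * t * polar a z\<bar> ^ 3"
            by (intro tendsto_intros se y)
          then show "(\<lambda>n. sqrt (e n) * \<bar>y n z\<bar> ^ 3) \<longlonglongrightarrow> 0" by simp
        qed
        moreover have "(\<lambda>n. complex_of_real ((y n z)\<^sup>2) / 2) \<longlonglongrightarrow> of_real ((2 * t * polar a z)\<^sup>2) / 2"
          by (intro tendsto_divide tendsto_of_real tendsto_power y tendsto_const) simp
        ultimately have "(\<lambda>n. ((iexp (x n z) - 1 - \<i> * of_real (x n z)) / of_real (e n) + of_real ((y n z)\<^sup>2) / 2) - of_real ((y n z)\<^sup>2) / 2)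
           \<longlonglongrightarrow> 0 - of_real ((2 * t * polar a z)\<^sup>2) / 2" by (rule tendsto_diff)
        then have "(\<lambda>n. (iexp (x n z) - 1 - \<i> * of_real (x n z)) / of_real (e n)) \<longlonglongrightarrow> - of_real ((2 * t * polar a z)\<^sup>2) / 2"
          by (simp only: add_diff_cancel_right' minus_divide_left diff_0)
        then show "(\<lambda>n. k (fst z) * (?q n z))
            \<longlonglongrightarrow> k (fst z) * (- of_real ((2 * t * polar a z)\<^sup>2) / 2)" by (rule tendsto_mult[OF tendsto_const])
      qed
    qed measurable
    moreover have "(\<integral>z. k (fst z) * (- of_real ((2 * t * polar a z)\<^sup>2) / 2) \<partial>M2) = of_real (- 2 * t\<^sup>2) * (\<integral>w. k w * of_real (carre a w) \<partial>M)"
    proof -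
      have "(\<integral>z. k (fst z) * (- of_real ((2 * t * polar a z)\<^sup>2) / 2) \<partial>M2) =
          (\<integral>z. of_real (- 2 * t\<^sup>2) * (k (fst z) * of_real ((polar a z)\<^sup>2)) \<partial>M2)"
        by (intro integral_cong refl) (simp add: power_mult_distrib)
      then show ?thesis using weighted_polar(4)[OF k, of a] kb by simp
    qed
    ultimately have L: "(\<lambda>n. \<integral>z. k (fst z) * (?q n z) \<partial>M2)
       \<longlonglongrightarrow> of_real (- 2 * t\<^sup>2) * (\<integral>w. k w * of_real (carre a w) \<partial>M)"
      by (simp only:)
    have "(\<lambda>n. (\<psi> (t + t * e n) - \<psi> t) /\<^sub>R (t * e n)) \<longlonglongrightarrow>
       (of_real (- 2 * t\<^sup>2) * (\<integral>w. k w * of_real (carre a w) \<partial>M)) / of_real t"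
      unfolding quot by (rule tendsto_divide[OF L tendsto_const]) (use False in simp)
    moreover have "(\<lambda>n. (\<psi> (t + t * e n) - \<psi> t) /\<^sub>R (t * e n)) \<longlonglongrightarrow> D"
    proof -
      have "(\<lambda>n. t * e n) \<longlonglongrightarrow> 0" using tendsto_mult[OF tendsto_const e_lim, of t] by simp
      moreover have "\<forall>i. t * e i \<in> UNIV - {0}" using False e(1) by (auto simp: less_imp_neq[symmetric])
      ultimately show ?thesis
        using D[unfolded has_vector_derivative_iff_quotient tendsto_at_iff_sequentially comp_def, rule_format, of "\<lambda>n. t * e n"]
        by blast
    qed
    ultimately have "D = (of_real (- 2 * t\<^sup>2) * (\<integral>w. k w * of_real (carre a w) \<partial>M)) / of_real t"
      using LIMSEQ_unique by blast
    then show ?thesis using False by (simp add: k_def power2_eq_square)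
  qed
  then show ?thesis using D unfolding \<psi>_def by simp
qed

text \<open>If \<open>carre\<close> were equal to its mean \<open>v / 2\<close>, the characteristic function \<open>\<psi>\<close> would solve \<open>\<psi>' t = - t * v * \<psi> t\<close>
  and be Gaussian. The error is controlled by the mean deviation of \<open>carre\<close>, and by Wick's formula
  its variance is twice the fourth trace \<open>\<kappa>\<close>.\<close>

theorem quad_charfun_near_gaussian:
  fixes a :: "'i \<Rightarrow> real" and t :: real
  defines "v \<equiv> 2 * (trace2 a)"
    and "\<kappa> \<equiv> trace4 a"
  shows "norm ((\<integral>w. iexp (t * quad a w) \<partial>M) - of_real (exp (- t\<^sup>2 * v / 2))) \<le> 2 * t\<^sup>2 * sqrt (2 * \<kappa>)"
proof -
  define \<psi> where "\<psi> s = (\<integral>w. iexp (s * quad a w) \<partial>M)" for s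
  \<comment> \<open>Multiplication by the integrating factor leaves only the fluctuation of \<open>carre\<close> in the derivative.\<close>
  define F where "F s = \<psi> s * of_real (exp (v * s\<^sup>2 / 2))" for s
  define F' where "F' s = - 2 * of_real s * of_real (exp (v * s\<^sup>2 / 2)) * (\<integral>w. iexp (s * quad a w) * of_real (carre a w - v / 2) \<partial>M)" for s
  have v2: "v / 2 = (trace2 a)" unfolding v_def by simp
  let ?f = "\<lambda>s. \<integral>w. iexp (s * quad a w) * of_real (carre a w - v / 2) \<partial>M"
  have v0: "0 \<le> v"
  proof -
    have "complex_of_real (v / 2) = (\<integral>z. 1 * of_real ((polar a z)\<^sup>2) \<partial>M2)"
      using weighted_polar(4)[of "\<lambda>_. 1" a] carre_moments(2)[of a] v2 by simp
    also have "\<dots> = of_real (\<integral>z. (polar a z)\<^sup>2 \<partial>M2)" by (simp only: mult_1 integral_complex_of_real)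
    finally have "v / 2 = (\<integral>z. (polar a z)\<^sup>2 \<partial>M2)" using of_real_eq_iff by blast
    also have "\<dots> \<ge> 0" by simp
    finally show ?thesis by simp
  qed
  have L1: "(\<integral>w. \<bar>carre a w - v / 2\<bar> \<partial>M) \<le> sqrt (2 * \<kappa>)"
  proof -
    have i: "integrable M (\<lambda>w. \<bar>carre a w - v / 2\<bar>)" using carre_moments(1) by simp
    have i2: "integrable M (\<lambda>w. \<bar>carre a w - v / 2\<bar>\<^sup>2)" using carre_moments(4)[of a] v2 by simp
    have "0 \<le> variance (\<lambda>w. \<bar>carre a w - v / 2\<bar>)" by (rule variance_positive)
    then have "(\<integral>w. \<bar>carre a w - v / 2\<bar> \<partial>M)\<^sup>2 \<le> (\<integral>w. (carre a w - v / 2)\<^sup>2 \<partial>M)" using variance_eq[OF i i2] by simp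
    also have "\<dots> = 2 * \<kappa>" using carre_moments(3)[of a] v2 unfolding \<kappa>_def by simp
    finally show ?thesis by (rule real_le_rsqrt)
  qed
  have ci: "integrable M (\<lambda>w. iexp (s * quad a w) * of_real (carre a w))" for s
    by (rule integrable_bound[OF carre_moments(1)[of a]]) (auto simp: norm_mult)
  have F_deriv: "(F has_vector_derivative F' s) (at s)" for s
  proof -
    have 1: "((\<lambda>s. of_real (exp (v * s\<^sup>2 / 2)) :: complex) has_vector_derivative of_real (v * s * exp (v * s\<^sup>2 / 2))) (at s)"
    proof -
      have "((\<lambda>s. exp (v * s\<^sup>2 / 2)) has_vector_derivative (v * s * exp (v * s\<^sup>2 / 2))) (at s)"
        unfolding has_real_derivative_iff_has_vector_derivative[symmetric] by (auto intro!: derivative_eq_intros)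
      then show ?thesis by (rule bounded_linear.has_vector_derivative[OF bounded_linear_of_real])
    qed
    have ii: "integrable M (\<lambda>w. iexp (s * quad a w))" by (rule integrable_const_bound[of _ 1]) auto
    have "(?f s) =
       (\<integral>w. iexp (s * quad a w) * of_real (carre a w) - of_real (v / 2) * iexp (s * quad a w) \<partial>M)"
      by (intro integral_cong refl) (simp add: algebra_simps)
    also have "\<dots> = (\<integral>w. iexp (s * quad a w) * of_real (carre a w) \<partial>M) - of_real (v / 2) * \<psi> s"
      unfolding \<psi>_def by (subst integral_diff[OF ci integrable_mult_right[OF ii]]) simp
    finally have split: "(?f s) =
      (\<integral>w. iexp (s * quad a w) * of_real (carre a w) \<partial>M) - of_real (v / 2) * \<psi> s" .
    have 2: "F' s = \<psi> s * of_real (v * s * exp (v * s\<^sup>2 / 2)) + (- 2 * of_real s * (\<integral>w. iexp (s * quad a w) * of_real (carre a w) \<partial>M)) * of_real (exp (v * s\<^sup>2 / 2))"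
      unfolding F'_def split by (simp add: algebra_simps)
    show ?thesis unfolding F_def[abs_def] 2
      by (rule has_vector_derivative_mult[OF quad_charfun_derivative[of a s, folded \<psi>_def] 1])
  qed
  define C where "C = 2 * \<bar>t\<bar> * exp (v * t\<^sup>2 / 2) * sqrt (2 * \<kappa>)"
  have \<kappa>0: "0 \<le> sqrt (2 * \<kappa>)" using L1 by (rule order_trans[rotated]) simp
  have bound: "norm (F' s) \<le> C" if "s \<in> {-\<bar>t\<bar>..\<bar>t\<bar>}" for s
  proof -
    have s: "\<bar>s\<bar> \<le> \<bar>t\<bar>" using that by auto
    have "norm (?f s) \<le> (\<integral>w. norm (iexp (s * quad a w) * of_real (carre a w - v / 2)) \<partial>M)"
      by (rule integral_norm_bound)
    also have "\<dots> = (\<integral>w. \<bar>carre a w - v / 2\<bar> \<partial>M)" by (simp add: norm_mult del: of_real_diff)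
    also note L1
    finally have n: "norm (?f s) \<le> sqrt (2 * \<kappa>)" .
    have "norm (F' s) = 2 * \<bar>s\<bar> * exp (v * s\<^sup>2 / 2) * norm (?f s)"
      unfolding F'_def by (simp only: norm_mult norm_minus_cancel norm_numeral norm_of_real abs_exp_cancel)
    also have "\<dots> \<le> C" unfolding C_def
      using s v0 by (intro mult_mono n) (auto intro!: mult_left_mono simp: abs_le_square_iff)
    finally show ?thesis .
  qed
  have "norm (F t - F 0) \<le> C * norm (t - 0)"
  proof (rule differentiable_bound[of "{-\<bar>t\<bar>..\<bar>t\<bar>}" F "\<lambda>s h. h *\<^sub>R F' s"])
    show "(F has_derivative (\<lambda>h. h *\<^sub>R F' s)) (at s within {-\<bar>t\<bar>..\<bar>t\<bar>})" for s
      using F_deriv[of s] unfolding has_vector_derivative_def by (rule has_derivative_at_withinI)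
    show "onorm (\<lambda>h. h *\<^sub>R F' s) \<le> C" if "s \<in> {-\<bar>t\<bar>..\<bar>t\<bar>}" for s
      using bound[OF that] by (intro onorm_le) (simp add: mult.commute[of C] mult_left_mono)
  qed auto
  moreover have "F 0 = 1" unfolding F_def \<psi>_def by (simp add: prob_space)
  ultimately have "norm (F t - 1) \<le> 2 * t\<^sup>2 * exp (v * t\<^sup>2 / 2) * sqrt (2 * \<kappa>)"
    unfolding C_def by (simp add: power2_eq_square mult_ac flip: abs_mult)
  moreover have "\<psi> t - of_real (exp (- t\<^sup>2 * v / 2)) = of_real (exp (- t\<^sup>2 * v / 2)) * (F t - 1)"
    unfolding F_def by (simp add: right_diff_distrib mult_ac flip: of_real_mult exp_add)
  ultimately have "norm (\<psi> t - of_real (exp (- t\<^sup>2 * v / 2))) \<le> exp (- t\<^sup>2 * v / 2) * (2 * t\<^sup>2 * exp (v * t\<^sup>2 / 2) * sqrt (2 * \<kappa>))"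
    by (simp add: norm_mult)
  also have "\<dots> = 2 * t\<^sup>2 * sqrt (2 * \<kappa>)" by (simp add: exp_minus mult_ac)
  finally show ?thesis unfolding \<psi>_def .
qed

end

section \<open>Symmetries of the uniform law on the sphere\<close>

text \<open>The reflection in the hyperplane orthogonal to \<open>u\<close>, the identity when \<open>u = 0\<close>. Reflections already move
  any vector to any other of the same norm, and being involutions they need no inverse.\<close>

definition reflect :: "'a::euclidean_space \<Rightarrow> 'a \<Rightarrow> 'a" where
  "reflect u x = x - (2 * (u \<bullet> x) / (u \<bullet> u)) *\<^sub>R u"

lemma reflect_reflect: "reflect u (reflect u x) = x"
  by (cases "u = 0") (auto simp: reflect_def inner_diff_right algebra_simps)

lemma orthogonal_transformation_reflect: "orthogonal_transformation (reflect u)"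
  unfolding orthogonal_transformation_def
proof
  show "linear (reflect u)"
    by (rule linearI) (auto simp: reflect_def inner_add_right algebra_simps add_divide_distrib)
  show "\<forall>v w. reflect u v \<bullet> reflect u w = v \<bullet> w"
    by (cases "u = 0") (auto simp: reflect_def inner_diff_left inner_diff_right inner_commute field_simps)
qed

lemma reflect_swap:
  assumes "norm a = norm b" shows "reflect (a - b) a = b"
proof (cases "a = b")
  case False
  have "(a - b) \<bullet> (a - b) = 2 * ((a - b) \<bullet> a)"
    using assms by (simp add: inner_diff_left inner_diff_right inner_commute norm_eq_sqrt_inner)
  moreover have "(a - b) \<bullet> (a - b) \<noteq> 0" using False by simp
  ultimately have "2 * ((a - b) \<bullet> a) / ((a - b) \<bullet> (a - b)) = 1" by simp
  then show ?thesis unfolding reflect_def by (simp only: scaleR_one) simp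
qed (simp add: reflect_def)

text \<open>By Vitali's covering theorem \<open>U\<close> is, up to a null set, a disjoint union of balls, and the images of these balls
  are disjoint balls of the same radii.\<close>

lemma lborel_involution_le:
  fixes T :: "'a::euclidean_space \<Rightarrow> 'a"
  assumes T: "orthogonal_transformation T" and U: "open U" and TU: "open (T ` U)"
  shows "emeasure lborel U \<le> emeasure lborel (T ` U)"
proof -
  define K where "K = {i. 0 < snd i \<and> ball (fst i) (snd i) \<subseteq> U}"
  obtain C where C: "countable C" "C \<subseteq> K"
    and disj: "pairwise (\<lambda>i j. disjnt (ball (fst i) (snd i)) (ball (fst j) (snd j))) C"
    and neg: "negligible (U - (\<Union>i\<in>C. ball (fst i) (snd i)))"
  proof (rule Vitali_covering_theorem_balls[of U K fst snd])
    fix x d assume x: "x \<in> U" and "(0::real) < d"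
    obtain k where k: "0 < k" "ball x k \<subseteq> U" using U x by (auto simp: open_contains_ball)
    let ?r = "min k (d/2)"
    have "(x, ?r) \<in> K" unfolding K_def using k \<open>0 < d\<close> by (auto simp: subset_iff)
    moreover have "x \<in> ball (fst (x, ?r)) (snd (x, ?r))" "snd (x, ?r) < d" using k \<open>0 < d\<close> by auto
    ultimately show "\<exists>i. i \<in> K \<and> x \<in> ball (fst i) (snd i) \<and> snd i < d" by blast
  qed
  let ?b = "\<lambda>i. ball (fst i) (snd i)"
  have N: "emeasure lborel (U - (\<Union>i\<in>C. ?b i)) = 0"
  proof -
    have "U - (\<Union>i\<in>C. ?b i) \<in> sets lborel" by (simp, intro sets.Diff borel_open U open_UN) auto
    with neg have "U - (\<Union>i\<in>C. ?b i) \<in> null_sets lborel"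
      by (simp add: negligible_iff_null_sets null_sets_completion_iff)
    then show ?thesis by auto
  qed
  have d1: "disjoint_family_on ?b C" using disj unfolding disjoint_family_on_def pairwise_def disjnt_def by blast
  have inj: "inj T" by (rule orthogonal_transformation_inj[OF T])
  have d2: "disjoint_family_on (\<lambda>i. T ` ?b i) C"
    using d1 inj unfolding disjoint_family_on_def by (metis image_Int image_empty)
  have img: "T ` ?b i = ball (T (fst i)) (snd i)" for i by (rule image_orthogonal_transformation_ball[OF T])
  have "emeasure lborel U \<le> emeasure lborel ((\<Union>i\<in>C. ?b i) \<union> (U - (\<Union>i\<in>C. ?b i)))"
    by (intro emeasure_mono, blast, simp, intro sets.Un sets.Diff borel_open U open_UN) auto
  also have "\<dots> \<le> emeasure lborel (\<Union>i\<in>C. ?b i) + emeasure lborel (U - (\<Union>i\<in>C. ?b i))"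
    by (intro emeasure_subadditive; simp; intro sets.Diff borel_open U open_UN; auto)
  also have "\<dots> = emeasure lborel (\<Union>i\<in>C. ?b i)" using N by simp
  also have "\<dots> = (\<integral>\<^sup>+i. emeasure lborel (?b i) \<partial>count_space C)"
    by (rule emeasure_UN_countable[OF _ C(1) d1]) auto
  also have "\<dots> = (\<integral>\<^sup>+i. emeasure lborel (T ` ?b i) \<partial>count_space C)"
  proof (rule nn_integral_cong)
    fix i assume "i \<in> space (count_space C)"
    then have "0 < snd i" using C(2) unfolding K_def by (auto simp: split_beta)
    then show "emeasure lborel (?b i) = emeasure lborel (T ` ?b i)" unfolding img by (simp add: emeasure_ball)
  qed
  also have "\<dots> = emeasure lborel (\<Union>i\<in>C. T ` ?b i)"
    by (rule emeasure_UN_countable[symmetric, OF _ C(1) d2]) (auto simp: img)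
  also have "\<dots> \<le> emeasure lborel (T ` U)"
  proof (rule emeasure_mono)
    have "?b i \<subseteq> U" if "i \<in> C" for i using C(2) that unfolding K_def by auto
    then show "(\<Union>i\<in>C. T ` ?b i) \<subseteq> T ` U" by blast
  qed (use TU in simp)
  finally show ?thesis .
qed

lemma orthogonal_transformation_continuous_on:
  fixes T :: "'a::euclidean_space \<Rightarrow> 'a"
  shows "orthogonal_transformation T \<Longrightarrow> continuous_on S T"
  by (intro linear_continuous_on linear_conv_bounded_linear[THEN iffD1] orthogonal_transformation_linear)

lemma lborel_involution:
  fixes T :: "'a::euclidean_space \<Rightarrow> 'a"
  assumes T: "orthogonal_transformation T" and inv: "\<And>x. T (T x) = x"
  shows "distr lborel borel T = lborel"
proof -
  have cont: "continuous_on UNIV T" using T by (rule orthogonal_transformation_continuous_on)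
  have img: "T ` U = T -` U" for U using inv by (auto simp: image_iff) metis
  have TU: "open (T ` U)" if "open U" for U unfolding img using open_vimage[OF that cont] .
  have eq: "emeasure lborel (T -` U) = emeasure lborel U" if U: "open U" for U
  proof (rule antisym)
    show "emeasure lborel U \<le> emeasure lborel (T -` U)"
      using lborel_involution_le[OF T U TU[OF U]] by (simp add: img)
    have "T ` (T ` U) = U" using inv by (auto simp: image_image)
    then show "emeasure lborel (T -` U) \<le> emeasure lborel U"
      using lborel_involution_le[OF T TU[OF U]] U by (simp add: img[of U, symmetric])
  qed
  have [measurable]: "T \<in> borel_measurable borel" using cont by (rule borel_measurable_continuous_onI)
  show ?thesis
  proof (rule lborel_eqI[symmetric])
    fix l u :: 'a assume "\<And>b. b \<in> Basis \<Longrightarrow> l \<bullet> b \<le> u \<bullet> b"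
    then show "emeasure (distr lborel borel T) (box l u) = (\<Prod>b\<in>Basis. (u - l) \<bullet> b)"
      by (subst emeasure_distr) (auto simp: eq open_box)
  qed simp
qed

lemma sgn_measurable[measurable]: "sgn \<in> borel_measurable (borel :: 'a::euclidean_space measure)"
  by (simp add: sgn_div_norm)

lemma sets_sphere_uniform[measurable_cong, simp]: "sets sphere_uniform = sets borel"
  by (simp add: sphere_uniform_def)

lemma space_sphere_uniform[simp]: "space sphere_uniform = UNIV"
  by (simp add: sphere_uniform_def)

interpretation sph: prob_space "sphere_uniform :: 'a::euclidean_space measure"
  by (rule prob_space_sphere_uniform)

interpretation sph2: pair_prob_space "sphere_uniform :: 'a::euclidean_space measure" "sphere_uniform :: 'a::euclidean_space measure" ..

lemma sphere_uniform_involution: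
  fixes T :: "'a::euclidean_space \<Rightarrow> 'a"
  assumes T: "orthogonal_transformation T" and inv: "\<And>x. T (T x) = x"
  shows "distr sphere_uniform borel T = sphere_uniform"
proof -
  have lin: "linear T" by (rule orthogonal_transformation_linear[OF T])
  have [measurable]: "T \<in> borel_measurable borel"
    using T by (intro borel_measurable_continuous_onI orthogonal_transformation_continuous_on)
  have nT: "norm (T x) = norm x" for x by (rule orthogonal_transformation_norm[OF T])
  have sgnT: "T (sgn x) = sgn (T x)" for x
    by (simp add: sgn_div_norm nT linear_cmul[OF lin])
  have U: "distr (uniform_measure lborel (cball 0 1)) borel T = uniform_measure lborel (cball 0 1)"
  proof (rule measure_eqI)
    fix A assume "A \<in> sets (distr (uniform_measure lborel (cball 0 1)) borel T)"
    then have A[measurable]: "A \<in> sets borel" by simp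
    have TA[measurable]: "T -` A \<in> sets borel" using measurable_sets[of T borel borel A] by simp
    have "cball 0 1 \<inter> T -` A = T -` (cball 0 1 \<inter> A)" by (auto simp: nT)
    then have "emeasure lborel (cball 0 1 \<inter> T -` A) = emeasure (distr lborel borel T) (cball 0 1 \<inter> A)"
      by (subst emeasure_distr) auto
    also have "\<dots> = emeasure lborel (cball 0 1 \<inter> A)" using lborel_involution[OF T inv] by simp
    finally show "emeasure (distr (uniform_measure lborel (cball 0 1)) borel T) A = emeasure (uniform_measure lborel (cball 0 1)) A"
      by (subst emeasure_distr) (auto simp: emeasure_uniform_measure)
  qed simp
  have "distr sphere_uniform borel T = distr (uniform_measure lborel (cball 0 1)) borel (\<lambda>x. T (sgn x))"
    unfolding sphere_uniform_def by (subst distr_distr) (auto simp: comp_def)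
  also have "\<dots> = distr (distr (uniform_measure lborel (cball 0 1)) borel T) borel sgn"
    by (subst distr_distr) (auto simp: comp_def sgnT)
  also have "\<dots> = sphere_uniform" unfolding U sphere_uniform_def ..
  finally show ?thesis .
qed

lemma sphere_integral_involution:
  fixes f :: "'a::euclidean_space \<Rightarrow> 'b::{banach, second_countable_topology}"
  assumes T: "orthogonal_transformation T" and inv: "\<And>x. T (T x) = x" and f[measurable]: "f \<in> borel_measurable borel"
  shows "(\<integral>x. f (T x) \<partial>sphere_uniform) = (\<integral>x. f x \<partial>sphere_uniform)"
proof -
  have [measurable]: "T \<in> borel_measurable borel"
    using T by (intro borel_measurable_continuous_onI orthogonal_transformation_continuous_on)
  have "(\<integral>x. f x \<partial>sphere_uniform) = (\<integral>x. f x \<partial>distr sphere_uniform borel T)"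
    by (simp add: sphere_uniform_involution[OF T inv])
  also have "\<dots> = (\<integral>x. f (T x) \<partial>sphere_uniform)" by (subst integral_distr) auto
  finally show ?thesis ..
qed

lemma sphere_zonal:
  fixes f :: "real \<Rightarrow> 'b::{banach, second_countable_topology}" and e e' :: "'a::euclidean_space"
  assumes f[measurable]: "f \<in> borel_measurable borel" and n: "norm e = norm e'"
  shows "(\<integral>x. f (x \<bullet> e) \<partial>sphere_uniform) = (\<integral>x. f (x \<bullet> e') \<partial>sphere_uniform)"
proof -
  let ?T = "reflect (e' - e)"
  have T: "orthogonal_transformation ?T" by (rule orthogonal_transformation_reflect)
  have "?T x \<bullet> e = x \<bullet> e'" for x
  proof -
    have "?T x \<bullet> e = ?T x \<bullet> ?T e'" using n by (simp add: reflect_swap)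
    also have "\<dots> = x \<bullet> e'" using T unfolding orthogonal_transformation_def by simp
    finally show ?thesis .
  qed
  then show ?thesis
    using sphere_integral_involution[OF T reflect_reflect, of "\<lambda>x. f (x \<bullet> e)"] by simp
qed

section \<open>One coordinate on the sphere\<close>

text \<open>Both sides integrate \<open>h\<close> against measures on the line that agree on the half-lines up to \<open>r\<close>, namely in the volume
  of a ball of radius \<open>r\<close>.\<close>

lemma nn_integral_PiM_radial:
  fixes h :: "real \<Rightarrow> ennreal" and A :: "'i set"
  assumes A: "finite A" "A \<noteq> {}" and h[measurable]: "h \<in> borel_measurable borel"
  shows "(\<integral>\<^sup>+f. h (sqrt (\<Sum>i\<in>A. (f i)\<^sup>2)) \<partial>(Pi\<^sub>M A (\<lambda>_. lborel))) =
    (\<integral>\<^sup>+r. h r * (ennreal (card A * unit_ball_vol (card A) * r ^ (card A - 1)) * indicator {0..} r) \<partial>lborel)"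
proof -
  define n where "n = card A"
  have n: "1 \<le> n" using A by (simp add: n_def Suc_leI card_gt_0_iff)
  define L where "L = (\<lambda>f::'i \<Rightarrow> real. sqrt (\<Sum>i\<in>A. (f i)\<^sup>2))"
  have [measurable]: "L \<in> borel_measurable (Pi\<^sub>M A (\<lambda>_. lborel))" unfolding L_def by measurable
  define g where "g = (\<lambda>r::real. ennreal (n * unit_ball_vol n * r ^ (n - 1)) * indicator {0..} r)"
  have [measurable]: "g \<in> borel_measurable borel" unfolding g_def by measurable
  define D1 where "D1 = distr (Pi\<^sub>M A (\<lambda>_. lborel)) borel L"
  define D2 where "D2 = density lborel g"
  have L0: "0 \<le> L f" for f unfolding L_def by (simp add: sum_nonneg)
  have d1: "emeasure D1 {..r} = ennreal (unit_ball_vol n * r ^ n)" if "0 < r" for r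
  proof -
    have "emeasure D1 {..r} = emeasure (Pi\<^sub>M A (\<lambda>_. lborel)) ({f. L f \<le> r} \<inter> space (Pi\<^sub>M A (\<lambda>_. lborel)))"
      unfolding D1_def by (subst emeasure_distr) (auto intro!: arg_cong[where f="emeasure _"])
    also have "\<dots> = ennreal (unit_ball_vol n * r ^ n)"
      using emeasure_cball_aux[OF A(1) that] by (simp add: L_def n_def)
    finally show ?thesis .
  qed
  have d10: "emeasure D1 {..0} = 0"
  proof -
    have "emeasure D1 {..0} \<le> ennreal (unit_ball_vol n * inverse (real (Suc k)) ^ n)" for k
    proof -
      have "emeasure D1 {..0} \<le> emeasure D1 {..inverse (real (Suc k))}"
        by (rule emeasure_mono) (auto simp: D1_def)
      then show ?thesis by (subst (asm) d1) auto
    qed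
    moreover have "(\<lambda>k. ennreal (unit_ball_vol n * inverse (real (Suc k)) ^ n)) \<longlonglongrightarrow> ennreal (unit_ball_vol n * 0 ^ n)"
      by (intro tendsto_ennrealI tendsto_intros LIMSEQ_inverse_real_of_nat)
    ultimately have "emeasure D1 {..0} \<le> ennreal (unit_ball_vol n * 0 ^ n)"
      using LIMSEQ_le_const by blast
    then show ?thesis using n by (simp add: power_0_left)
  qed
  have d1neg: "emeasure D1 {..r} = 0" if "r < 0" for r
    using emeasure_mono[of "{..r}" "{..0}" D1] that d10 by (auto simp: D1_def)
  have d2: "emeasure D2 {..r} = ennreal (unit_ball_vol n * r ^ n)" if "0 \<le> r" for r
  proof -
    have "emeasure D2 {..r} = (\<integral>\<^sup>+x. ennreal (n * unit_ball_vol n * x ^ (n - 1)) * indicator {0..r} x \<partial>lborel)"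
      unfolding D2_def g_def by (subst emeasure_density) (auto intro!: nn_integral_cong simp: indicator_def)
    also have "\<dots> = ennreal (unit_ball_vol n * r ^ n - unit_ball_vol n * 0 ^ n)"
      using that n by (intro nn_integral_FTC_Icc) (auto intro!: derivative_eq_intros)
    finally show ?thesis using n by (simp add: power_0_left)
  qed
  have d2neg: "emeasure D2 {..r} = 0" if "r < 0" for r
  proof -
    have "emeasure D2 {..r} = (\<integral>\<^sup>+x. g x * indicator {..r} x \<partial>lborel)"
      unfolding D2_def by (subst emeasure_density) auto
    also have "\<dots> = (\<integral>\<^sup>+x. 0 \<partial>(lborel::real measure))"
      using that by (intro nn_integral_cong) (auto simp: g_def indicator_def)
    finally have "emeasure D2 {..r} = (\<integral>\<^sup>+x. 0 \<partial>(lborel::real measure))" .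
    then show ?thesis by simp
  qed
  have "D1 = D2"
  proof (rule measure_eqI_generator_eq[where E="range (\<lambda>r::real. {..r})" and \<Omega>=UNIV and A="\<lambda>i. {..real i}"])
    show "Int_stable (range (\<lambda>r::real. {..r}))" by (auto simp: Int_stable_def intro!: rangeI)
    show "emeasure D1 X = emeasure D2 X" if "X \<in> range (\<lambda>r::real. {..r})" for X
    proof -
      from that obtain r where r: "X = {..r}" by auto
      consider "r < 0" | "r = 0" | "0 < r" by linarith
      then show ?thesis unfolding r
        using d1 d1neg d10 d2 d2neg n by cases (auto simp: power_0_left)
    qed
    show "sets D1 = sigma_sets UNIV (range (\<lambda>r::real. {..r}))" "sets D2 = sigma_sets UNIV (range (\<lambda>r::real. {..r}))"
    proof -
      have "sets (borel :: real measure) = sigma_sets UNIV (range (\<lambda>r::real. {..r}))"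
        by (subst borel_eq_atMost) (rule sets_measure_of, simp)
      then show "sets D1 = sigma_sets UNIV (range (\<lambda>r::real. {..r}))" "sets D2 = sigma_sets UNIV (range (\<lambda>r::real. {..r}))"
        unfolding D1_def D2_def by simp_all
    qed
    show "emeasure D1 {..real i} \<noteq> \<infinity>" for i
      using d1 d10 by (cases "i = 0") auto
    show "(\<Union>i. {..real i}) = UNIV" by (auto intro: real_arch_simple)
  qed auto
  then have "(\<integral>\<^sup>+r. h r \<partial>D1) = (\<integral>\<^sup>+r. h r \<partial>D2)" by simp
  then show ?thesis
    unfolding D1_def D2_def L_def g_def n_def
    by (subst (asm) nn_integral_distr, measurable, subst (asm) nn_integral_density) (auto simp: mult_ac)
qed

text \<open>The parameter \<open>u\<close> is the tangent of the angle between \<open>\<theta>\<close> and the axis of \<open>e\<close>. Write the unit ball as a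
  region of pairs \<open>(y, r)\<close>, with \<open>y\<close> the coordinate along \<open>e\<close> and \<open>r\<close> the distance to the axis, substitute
  \<open>r = \<bar>y\<bar> * u\<close> and integrate out \<open>y\<close>. Both signs of the cosine occur, one for each hemisphere.\<close>

lemma nn_integral_sphere_inner:
  fixes e :: "'a::euclidean_space" and F :: "real \<Rightarrow> ennreal"
  defines "d \<equiv> DIM('a)"
  assumes e: "e \<in> Basis" and d: "2 \<le> DIM('a)" and F[measurable]: "F \<in> borel_measurable borel"
  shows "(\<integral>\<^sup>+\<theta>. F (\<theta> \<bullet> e) \<partial>sphere_uniform) =
    ennreal (real (d - 1) * unit_ball_vol (real (d - 1)) / (d * unit_ball_vol d)) *
    (\<integral>\<^sup>+u. (F (1 / sqrt (1 + u\<^sup>2)) + F (- (1 / sqrt (1 + u\<^sup>2)))) *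
        (ennreal (u ^ (d - 2) / sqrt (1 + u\<^sup>2) ^ d) * indicator {0..} u) \<partial>lborel)"
proof -
  define n where "n = d - 1"
  have dn: "d = Suc n" and n1: "1 \<le> n" using d unfolding n_def d_def by auto
  define B where "B = (Basis :: 'a set) - {e}"
  have B: "finite B" "B \<noteq> {}" "e \<notin> B" "Basis = insert e B" "card B = n"
  proof -
    show "card B = n" using e unfolding B_def n_def d_def by (simp add: card_Diff_singleton)
    then show "B \<noteq> {}" using n1 by auto
  qed (use e in \<open>auto simp: B_def\<close>)
  define H where "H y r = F (y / sqrt (y\<^sup>2 + r\<^sup>2)) * indicator {..1} (y\<^sup>2 + r\<^sup>2)" for y r :: real
  have Hm[measurable]: "(\<lambda>z. H (f z) (g z)) \<in> borel_measurable N" if [measurable]: "f \<in> borel_measurable N" "g \<in> borel_measurable N" for f g and N :: "'z measure"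
    unfolding H_def by measurable
  define \<omega> where "\<omega> = n * unit_ball_vol n"
  have \<omega>0: "0 \<le> \<omega>" unfolding \<omega>_def by simp
  have Fs[measurable]: "(\<lambda>x::'a. F (sgn x \<bullet> e)) \<in> borel_measurable borel"
    by (rule measurable_compose[OF measurable_compose[OF sgn_measurable borel_measurable_inner[OF measurable_ident_sets borel_measurable_const]] F]) simp
  have Fc[measurable]: "(\<lambda>x::'a. F (sgn x \<bullet> e) * indicator (cball 0 1) x) \<in> borel_measurable borel"
    by (intro borel_measurable_times_ennreal Fs borel_measurable_indicator) simp
  interpret P: product_sigma_finite "\<lambda>_::'a. lborel :: real measure" by standard
  define s where "s u = 1 / sqrt (1 + u\<^sup>2)" for u :: real
  have s0: "0 < s u" for u unfolding s_def by (simp add: add_pos_nonneg)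
  have s2: "(s u)\<^sup>2 = 1 / (1 + u\<^sup>2)" for u unfolding s_def by (simp add: power_divide)
  have [measurable]: "s \<in> borel_measurable borel" unfolding s_def by measurable
  let ?J = "\<lambda>y u. indicator {..s u} \<bar>y\<bar> * (ennreal (\<omega> * u ^ (n - 1) * \<bar>y\<bar> ^ n) * indicator {0..} u)"
  have "(\<integral>\<^sup>+\<theta>. F (\<theta> \<bullet> e) \<partial>sphere_uniform) = (\<integral>\<^sup>+x. F (sgn x \<bullet> e) \<partial>uniform_measure lborel (cball 0 1))"
    unfolding sphere_uniform_def by (subst nn_integral_distr) auto
  also have "\<dots> = (\<integral>\<^sup>+x. F (sgn x \<bullet> e) * indicator (cball 0 1) x \<partial>lborel) / emeasure lborel (cball (0::'a) 1)"
    by (rule nn_integral_uniform_measure) auto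
  also have "emeasure lborel (cball (0::'a) 1) = ennreal (unit_ball_vol d)"
    by (simp add: emeasure_cball d_def)
  also have "(\<integral>\<^sup>+x. F (sgn x \<bullet> e) * indicator (cball 0 1) (x::'a) \<partial>lborel) =
     (\<integral>\<^sup>+f. F (sgn (\<Sum>b\<in>Basis. f b *\<^sub>R b) \<bullet> e) * indicator (cball 0 1) (\<Sum>b\<in>Basis. f b *\<^sub>R b :: 'a) \<partial>(Pi\<^sub>M Basis (\<lambda>_. lborel)))"
    by (subst lborel_eq, subst nn_integral_distr) auto
  also have "\<dots> = (\<integral>\<^sup>+f. H (f e) (sqrt (\<Sum>i\<in>B. (f i)\<^sup>2)) \<partial>(Pi\<^sub>M Basis (\<lambda>_. lborel)))"
  proof (rule nn_integral_cong)
    fix f :: "'a \<Rightarrow> real"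
    let ?x = "\<Sum>b\<in>Basis. f b *\<^sub>R b :: 'a"
    have 1: "?x \<bullet> b = f b" if "b \<in> Basis" for b using that by simp
    have nx: "norm ?x = sqrt ((f e)\<^sup>2 + (sqrt (\<Sum>i\<in>B. (f i)\<^sup>2))\<^sup>2)"
    proof -
      have "norm ?x = sqrt (\<Sum>b\<in>Basis. (f b)\<^sup>2)"
        by (subst norm_eq_sqrt_inner, subst euclidean_inner) (simp add: power2_eq_square)
      also have "(\<Sum>b\<in>Basis. (f b)\<^sup>2) = (f e)\<^sup>2 + (\<Sum>i\<in>B. (f i)\<^sup>2)"
        unfolding B(4) using B(1,3) by simp
      finally show ?thesis by (simp add: sum_nonneg)
    qed
    have "sgn ?x \<bullet> e = f e / norm ?x" using e by (simp add: sgn_div_norm divide_inverse mult.commute)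
    moreover have "?x \<in> cball 0 1 \<longleftrightarrow> (norm ?x)\<^sup>2 \<le> 1" by (simp add: abs_square_le_1)
    ultimately show "F (sgn ?x \<bullet> e) * indicator (cball 0 1) ?x = H (f e) (sqrt (\<Sum>i\<in>B. (f i)\<^sup>2))"
      unfolding H_def nx by (simp add: indicator_def)
  qed
  also have "\<dots> = (\<integral>\<^sup>+y. (\<integral>\<^sup>+f. H y (sqrt (\<Sum>i\<in>B. (f i)\<^sup>2)) \<partial>(Pi\<^sub>M B (\<lambda>_. lborel))) \<partial>lborel)"
  proof -
    have "(\<Sum>i\<in>B. ((x(e := y)) i)\<^sup>2) = (\<Sum>i\<in>B. (x i)\<^sup>2)" for x and y :: real
      using B(3) by (intro sum.cong) auto
    moreover have "(\<lambda>f. H (f e) (sqrt (\<Sum>i\<in>B. (f i)\<^sup>2))) \<in> borel_measurable (Pi\<^sub>M (insert e B) (\<lambda>_. lborel))"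
      by measurable
    ultimately show ?thesis unfolding B(4) using B(1,3) by (subst P.product_nn_integral_insert_rev) auto
  qed
  also have "\<dots> = (\<integral>\<^sup>+y. (\<integral>\<^sup>+r. H y r * (ennreal (\<omega> * r ^ (n - 1)) * indicator {0..} r) \<partial>lborel) \<partial>lborel)"
    by (subst nn_integral_PiM_radial[OF B(1,2)]) (simp_all add: B(5) \<omega>_def)
  also have "\<dots> = (\<integral>\<^sup>+y. (\<integral>\<^sup>+u. F (sgn y * s u) * (?J y u) \<partial>lborel) \<partial>lborel)"
  proof (rule nn_integral_cong_AE)
    have "AE y in lborel. y \<noteq> (0::real)" by (rule AE_lborel_singleton)
    then show "AE y in lborel. (\<integral>\<^sup>+r. H y r * (ennreal (\<omega> * r ^ (n - 1)) * indicator {0..} r) \<partial>lborel) =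
       (\<integral>\<^sup>+u. F (sgn y * s u) * (?J y u) \<partial>lborel)"
    proof eventually_elim
      fix y :: real assume y: "y \<noteq> 0"
      have "(\<integral>\<^sup>+r. H y r * (ennreal (\<omega> * r ^ (n - 1)) * indicator {0..} r) \<partial>lborel) =
         ennreal \<bar>\<bar>y\<bar>\<bar> * (\<integral>\<^sup>+u. H y (0 + \<bar>y\<bar> * u) * (ennreal (\<omega> * (0 + \<bar>y\<bar> * u) ^ (n - 1)) * indicator {0..} (0 + \<bar>y\<bar> * u)) \<partial>lborel)"
        using y by (intro nn_integral_real_affine) auto
      also have "\<dots> = (\<integral>\<^sup>+u. ennreal \<bar>y\<bar> * (H y (\<bar>y\<bar> * u) * (ennreal (\<omega> * (\<bar>y\<bar> * u) ^ (n - 1)) * indicator {0..} (\<bar>y\<bar> * u))) \<partial>lborel)"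
        by (subst nn_integral_cmult) auto
      also have "\<dots> = (\<integral>\<^sup>+u. F (sgn y * s u) * (?J y u) \<partial>lborel)"
      proof (rule nn_integral_cong)
        fix u :: real
        have q: "y\<^sup>2 + (\<bar>y\<bar> * u)\<^sup>2 = y\<^sup>2 * (1 + u\<^sup>2)" by (simp add: power_mult_distrib algebra_simps)
        have "sqrt (y\<^sup>2 * (1 + u\<^sup>2)) = \<bar>y\<bar> * sqrt (1 + u\<^sup>2)" by (simp add: real_sqrt_mult)
        then have c1: "y / sqrt (y\<^sup>2 + (\<bar>y\<bar> * u)\<^sup>2) = sgn y * s u" unfolding q s_def using y by (simp add: sgn_real_def)
        have c2: "y\<^sup>2 * (1 + u\<^sup>2) \<le> 1 \<longleftrightarrow> \<bar>y\<bar> \<le> s u"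
        proof -
          have "y\<^sup>2 * (1 + u\<^sup>2) \<le> 1 \<longleftrightarrow> y\<^sup>2 \<le> (s u)\<^sup>2" unfolding s2 by (simp add: field_simps add_pos_nonneg)
          also have "\<dots> \<longleftrightarrow> \<bar>y\<bar> \<le> s u" using s0[of u] by (metis abs_le_square_iff abs_of_pos)
          finally show ?thesis .
        qed
        have c3: "0 \<le> \<bar>y\<bar> * u \<longleftrightarrow> 0 \<le> u" using y by (simp add: zero_le_mult_iff)
        have c4: "ennreal \<bar>y\<bar> * ennreal (\<omega> * (\<bar>y\<bar> * u) ^ (n - 1)) = ennreal (\<omega> * u ^ (n - 1) * \<bar>y\<bar> ^ n)" if "0 \<le> u"
        proof -
          have "\<bar>y\<bar> * (\<omega> * (\<bar>y\<bar> * u) ^ (n - 1)) = \<omega> * u ^ (n - 1) * \<bar>y\<bar> ^ n"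
            using n1 by (cases n) (auto simp: power_mult_distrib)
          then show ?thesis using that \<omega>0 by (simp flip: ennreal_mult')
        qed
        show "ennreal \<bar>y\<bar> * (H y (\<bar>y\<bar> * u) * (ennreal (\<omega> * (\<bar>y\<bar> * u) ^ (n - 1)) * indicator {0..} (\<bar>y\<bar> * u))) =
            F (sgn y * s u) * (?J y u)"
        proof (cases "0 \<le> u")
          case True
          have "ennreal \<bar>y\<bar> * (H y (\<bar>y\<bar> * u) * (ennreal (\<omega> * (\<bar>y\<bar> * u) ^ (n - 1)) * indicator {0..} (\<bar>y\<bar> * u))) =
            (ennreal \<bar>y\<bar> * ennreal (\<omega> * (\<bar>y\<bar> * u) ^ (n - 1))) * (F (sgn y * s u) * indicator {..s u} \<bar>y\<bar>)"
            using c1 c2 c3 True unfolding H_def q by (simp add: indicator_def mult_ac)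
          then show ?thesis unfolding c4[OF True] using True by (simp add: mult_ac)
        qed (use c3 in simp)
      qed
      finally show "(\<integral>\<^sup>+r. H y r * (ennreal (\<omega> * r ^ (n - 1)) * indicator {0..} r) \<partial>lborel) =
         (\<integral>\<^sup>+u. F (sgn y * s u) * (?J y u) \<partial>lborel)" .
    qed
  qed
  also have "\<dots> = (\<integral>\<^sup>+u. (\<integral>\<^sup>+y. F (sgn y * s u) * (?J y u) \<partial>lborel) \<partial>lborel)"
  proof (rule lborel_pair.Fubini', goal_cases)
    have ind: "(\<lambda>z. indicator {..s (f z)} \<bar>g z\<bar> :: ennreal) \<in> borel_measurable N"
      if [measurable]: "f \<in> borel_measurable N" "g \<in> borel_measurable N" for f g and N :: "(real \<times> real) measure"
    proof -
      have "(\<lambda>z. indicator {..s (f z)} \<bar>g z\<bar> :: ennreal) = (\<lambda>z. if \<bar>g z\<bar> \<le> s (f z) then 1 else 0)" by (auto simp: indicator_def)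
      then show ?thesis by simp
    qed
    note [measurable] = ind[OF measurable_fst measurable_snd] ind[OF measurable_snd measurable_fst]
    case 1
    show ?case unfolding split_beta by measurable
  qed
  also have "\<dots> = (\<integral>\<^sup>+u. (F (s u) + F (- s u)) * (ennreal (\<omega> * u ^ (n - 1) * (s u ^ d / d)) * indicator {0..} u) \<partial>lborel)"
  proof (rule nn_integral_cong)
    fix u :: real
    show "(\<integral>\<^sup>+y. F (sgn y * s u) * (?J y u) \<partial>lborel) =
       (F (s u) + F (- s u)) * (ennreal (\<omega> * u ^ (n - 1) * (s u ^ d / d)) * indicator {0..} u)"
    proof (cases "0 \<le> u")
      case True
      have w0: "0 \<le> \<omega> * u ^ (n - 1)" using \<omega>0 True by simp
      have pos: "(\<integral>\<^sup>+y. ennreal (\<bar>y\<bar> ^ n) * indicator {0..s u} y \<partial>lborel) = ennreal (s u ^ d / d)"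
      proof -
        have "(\<integral>\<^sup>+y. ennreal (\<bar>y\<bar> ^ n) * indicator {0..s u} y \<partial>lborel) = (\<integral>\<^sup>+y. ennreal (y ^ n) * indicator {0..s u} y \<partial>lborel)"
          by (intro nn_integral_cong) (auto simp: indicator_def)
        also have "\<dots> = ennreal (s u ^ d / d - 0 ^ d / d)"
          using s0[of u] dn by (intro nn_integral_FTC_Icc) (auto intro!: derivative_eq_intros simp del: power_Suc)
        finally show ?thesis using dn by simp
      qed
      have neg: "(\<integral>\<^sup>+y. ennreal (\<bar>y\<bar> ^ n) * indicator {- s u..0} y \<partial>lborel) = ennreal (s u ^ d / d)"
        unfolding pos[symmetric]
        by (subst nn_integral_real_affine[of _ "-1" 0]) (auto intro!: nn_integral_cong simp: indicator_def)
      have "(\<integral>\<^sup>+y. F (sgn y * s u) * (?J y u) \<partial>lborel) =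
        (\<integral>\<^sup>+y. (ennreal (\<omega> * u ^ (n - 1)) * F (s u)) * (ennreal (\<bar>y\<bar> ^ n) * indicator {0..s u} y) +
             (ennreal (\<omega> * u ^ (n - 1)) * F (- s u)) * (ennreal (\<bar>y\<bar> ^ n) * indicator {- s u..0} y) \<partial>lborel)"
      proof (rule nn_integral_cong)
        fix y :: real
        show "F (sgn y * s u) * (?J y u) =
          (ennreal (\<omega> * u ^ (n - 1)) * F (s u)) * (ennreal (\<bar>y\<bar> ^ n) * indicator {0..s u} y) +
             (ennreal (\<omega> * u ^ (n - 1)) * F (- s u)) * (ennreal (\<bar>y\<bar> ^ n) * indicator {- s u..0} y)"
          unfolding ennreal_mult'[OF w0]
          using True n1 s0[of u] by (cases "y = 0"; cases "0 < y") (auto simp: indicator_def mult_ac sgn_real_def power_0_left)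
      qed
      also have "\<dots> = (ennreal (\<omega> * u ^ (n - 1)) * F (s u)) * ennreal (s u ^ d / d) + (ennreal (\<omega> * u ^ (n - 1)) * F (- s u)) * ennreal (s u ^ d / d)"
        by (subst nn_integral_add, measurable, subst nn_integral_cmult, measurable, subst nn_integral_cmult, measurable) (simp only: pos neg)
      also have "\<dots> = (F (s u) + F (- s u)) * (ennreal (\<omega> * u ^ (n - 1) * (s u ^ d / d)) * indicator {0..} u)"
        unfolding ennreal_mult'[OF w0] using True by (simp add: algebra_simps)
      finally show ?thesis .
    qed simp
  qed
  also have "\<dots> = (\<integral>\<^sup>+u. ennreal (\<omega> / d) * ((F (s u) + F (- s u)) * (ennreal (u ^ (d - 2) / sqrt (1 + u\<^sup>2) ^ d) * indicator {0..} u)) \<partial>lborel)"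
  proof (rule nn_integral_cong)
    fix u :: real
    have "\<omega> * u ^ (n - 1) * (s u ^ d / d) = (\<omega> / d) * (u ^ (d - 2) / sqrt (1 + u\<^sup>2) ^ d)"
      unfolding s_def dn by (simp add: power_divide)
    moreover have "0 \<le> \<omega> / d" using \<omega>0 by simp
    ultimately show "(F (s u) + F (- s u)) * (ennreal (\<omega> * u ^ (n - 1) * (s u ^ d / d)) * indicator {0..} u) =
      ennreal (\<omega> / d) * ((F (s u) + F (- s u)) * (ennreal (u ^ (d - 2) / sqrt (1 + u\<^sup>2) ^ d) * indicator {0..} u))"
      by (simp only: ennreal_mult' mult_ac)
  qed
  also have "\<dots> = ennreal (\<omega> / d) * (\<integral>\<^sup>+u. (F (s u) + F (- s u)) * (ennreal (u ^ (d - 2) / sqrt (1 + u\<^sup>2) ^ d) * indicator {0..} u) \<partial>lborel)"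
    by (rule nn_integral_cmult) measurable
  finally have "(\<integral>\<^sup>+\<theta>. F (\<theta> \<bullet> e) \<partial>sphere_uniform) =
     ennreal (\<omega> / d) * (\<integral>\<^sup>+u. (F (s u) + F (- s u)) * (ennreal (u ^ (d - 2) / sqrt (1 + u\<^sup>2) ^ d) * indicator {0..} u) \<partial>lborel) / ennreal (unit_ball_vol d)" .
  also have "\<dots> = (ennreal (\<omega> / d) / ennreal (unit_ball_vol d)) * (\<integral>\<^sup>+u. (F (s u) + F (- s u)) * (ennreal (u ^ (d - 2) / sqrt (1 + u\<^sup>2) ^ d) * indicator {0..} u) \<partial>lborel)"
    by (simp add: divide_ennreal_def mult_ac)
  also have "ennreal (\<omega> / d) / ennreal (unit_ball_vol d) = ennreal (real (d - 1) * unit_ball_vol (real (d - 1)) / (d * unit_ball_vol d))"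
    using \<omega>0 by (subst divide_ennreal) (auto simp: \<omega>_def n_def)
  finally show ?thesis unfolding s_def .
qed

section \<open>Concentration near the pole\<close>

definition angle_const :: "nat \<Rightarrow> real" where
  "angle_const d = real (d - 1) * unit_ball_vol (real (d - 1)) / (d * unit_ball_vol d)"

definition angle_weight :: "nat \<Rightarrow> real \<Rightarrow> real" where
  "angle_weight d u = u ^ (d - 2) / sqrt (1 + u\<^sup>2) ^ d * indicator {0..} u"

lemma angle_const_pos: "2 \<le> d \<Longrightarrow> 0 < angle_const d"
  unfolding angle_const_def by (intro divide_pos_pos mult_pos_pos) auto

lemma angle_weight_nonneg: "0 \<le> angle_weight d u"
  unfolding angle_weight_def by (simp add: indicator_def)

lemma angle_weight_meas[measurable]: "angle_weight d \<in> borel_measurable borel"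
  unfolding angle_weight_def[abs_def] by measurable

lemma angle_weight_integrable:
  assumes d: "2 \<le> DIM('a::euclidean_space)"
  shows "integrable lborel (angle_weight (DIM('a)))"
proof -
  obtain e :: 'a where e: "e \<in> Basis" using nonempty_Basis by blast
  let ?I = "\<integral>\<^sup>+u. ennreal (angle_weight (DIM('a)) u) \<partial>lborel"
  have "1 = (\<integral>\<^sup>+\<theta>. 1 \<partial>(sphere_uniform::'a measure))" by (simp add: sph.emeasure_space_1[simplified])
  also have "\<dots> = ennreal (angle_const (DIM('a))) * (\<integral>\<^sup>+u. 2 * ennreal (angle_weight (DIM('a)) u) \<partial>lborel)"
  proof -
    have "(\<integral>\<^sup>+\<theta>. 1 \<partial>(sphere_uniform::'a measure)) = ennreal (angle_const (DIM('a))) *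
      (\<integral>\<^sup>+u. (1 + 1) * (ennreal (u ^ (DIM('a) - 2) / sqrt (1 + u\<^sup>2) ^ DIM('a)) * indicator {0..} u) \<partial>lborel)"
      unfolding angle_const_def by (rule nn_integral_sphere_inner[OF e d]) simp
    also have "(\<integral>\<^sup>+u. (1 + 1) * (ennreal (u ^ (DIM('a) - 2) / sqrt (1 + u\<^sup>2) ^ DIM('a)) * indicator {0..} u) \<partial>lborel)
      = (\<integral>\<^sup>+u. 2 * ennreal (angle_weight (DIM('a)) u) \<partial>lborel)"
      by (intro nn_integral_cong) (auto simp: indicator_def angle_weight_def)
    finally show ?thesis .
  qed
  also have "(\<integral>\<^sup>+u. 2 * ennreal (angle_weight (DIM('a)) u) \<partial>lborel) = 2 * ?I"
    by (rule nn_integral_cmult) simp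
  finally have "ennreal (angle_const (DIM('a))) * (2 * ?I) = 1" ..
  then have "?I \<noteq> \<infinity>" using angle_const_pos[OF d] by (auto simp: ennreal_mult_eq_top_iff)
  then show ?thesis
    by (intro integrableI_nonneg) (auto simp: angle_weight_nonneg top.not_eq_extremum)
qed

lemma sphere_integral_inner:
  fixes e :: "'a::euclidean_space" and F :: "real \<Rightarrow> real"
  assumes e: "e \<in> Basis" and d: "2 \<le> DIM('a)" and F[measurable]: "F \<in> borel_measurable borel" and F0: "\<And>t. 0 \<le> F t"
  shows "(\<integral>\<theta>. F (\<theta> \<bullet> e) \<partial>sphere_uniform) = angle_const DIM('a) *
    (\<integral>u. (F (1 / sqrt (1 + u\<^sup>2)) + F (- (1 / sqrt (1 + u\<^sup>2)))) * angle_weight DIM('a) u \<partial>lborel)"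
proof -
  have "(\<integral>\<theta>. F (\<theta> \<bullet> e) \<partial>sphere_uniform) = enn2real (\<integral>\<^sup>+\<theta>. ennreal (F (\<theta> \<bullet> e)) \<partial>sphere_uniform)"
    by (intro integral_eq_nn_integral) (auto simp: F0)
  also have "(\<integral>\<^sup>+\<theta>. ennreal (F (\<theta> \<bullet> e)) \<partial>sphere_uniform) = ennreal (angle_const DIM('a)) *
    (\<integral>\<^sup>+u. (ennreal (F (1 / sqrt (1 + u\<^sup>2))) + ennreal (F (- (1 / sqrt (1 + u\<^sup>2))))) *
        (ennreal (u ^ (DIM('a) - 2) / sqrt (1 + u\<^sup>2) ^ DIM('a)) * indicator {0..} u) \<partial>lborel)"
    unfolding angle_const_def by (rule nn_integral_sphere_inner[OF e d]) measurable
  also have "(\<integral>\<^sup>+u. (ennreal (F (1 / sqrt (1 + u\<^sup>2))) + ennreal (F (- (1 / sqrt (1 + u\<^sup>2))))) *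
        (ennreal (u ^ (DIM('a) - 2) / sqrt (1 + u\<^sup>2) ^ DIM('a)) * indicator {0..} u) \<partial>lborel) =
     (\<integral>\<^sup>+u. ennreal ((F (1 / sqrt (1 + u\<^sup>2)) + F (- (1 / sqrt (1 + u\<^sup>2)))) * angle_weight DIM('a) u) \<partial>lborel)"
  proof (rule nn_integral_cong)
    fix u :: real
    let ?S = "F (1 / sqrt (1 + u\<^sup>2)) + F (- (1 / sqrt (1 + u\<^sup>2)))"
    have "0 \<le> ?S" using F0 by simp
    moreover have "ennreal (F (1 / sqrt (1 + u\<^sup>2))) + ennreal (F (- (1 / sqrt (1 + u\<^sup>2)))) = ennreal ?S"
      using F0 by simp
    moreover have "ennreal (u ^ (DIM('a) - 2) / sqrt (1 + u\<^sup>2) ^ DIM('a)) * indicator {0..} u = ennreal (angle_weight DIM('a) u)"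
      by (simp add: angle_weight_def indicator_def)
    ultimately show "(ennreal (F (1 / sqrt (1 + u\<^sup>2))) + ennreal (F (- (1 / sqrt (1 + u\<^sup>2))))) *
        (ennreal (u ^ (DIM('a) - 2) / sqrt (1 + u\<^sup>2) ^ DIM('a)) * indicator {0..} u) = ennreal (?S * angle_weight DIM('a) u)"
      by (simp only: ennreal_mult')
  qed
  also have "enn2real (ennreal (angle_const DIM('a)) * \<dots>) = angle_const DIM('a) *
     (\<integral>u. (F (1 / sqrt (1 + u\<^sup>2)) + F (- (1 / sqrt (1 + u\<^sup>2)))) * angle_weight DIM('a) u \<partial>lborel)"
    using angle_const_pos[OF d]
    by (subst integral_eq_nn_integral) (auto simp: enn2real_mult F0 angle_weight_nonneg)
  finally show ?thesis .
qed

lemma integrable_inverse_square: "integrable lborel (\<lambda>r::real. 1 / (1 + r)\<^sup>2 * indicator {0..} r)"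
proof -
  have "(\<integral>\<^sup>+r. ennreal (1 / (1 + r)\<^sup>2) * indicator {0..} r \<partial>lborel) = ennreal (0 - (- 1 / (1 + 0)))"
  proof (rule nn_integral_FTC_atLeast)
    show "((\<lambda>r::real. - 1 / (1 + r)) has_real_derivative 1 / (1 + r)\<^sup>2) (at r)" if "0 \<le> r" for r
      using that by (auto intro!: derivative_eq_intros simp: power2_eq_square)
    show "((\<lambda>r::real. - 1 / (1 + r)) \<longlongrightarrow> 0) at_top"
      by (intro tendsto_divide_0[OF tendsto_const] filterlim_at_top_imp_at_infinity filterlim_tendsto_add_at_top[OF tendsto_const filterlim_ident])
  qed auto
  then have "(\<integral>\<^sup>+r. ennreal (1 / (1 + r)\<^sup>2 * indicator {0..} r) \<partial>lborel) = ennreal 1"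
    by (subst nn_integral_cong[where v="\<lambda>r. ennreal (1 / (1 + r)\<^sup>2) * indicator {0..} r"]) (auto simp: indicator_def)
  then show ?thesis by (intro integrableI_nonneg) auto
qed

lemma one_minus_inverse: "0 \<le> (q::real) \<Longrightarrow> 1 - 1 / (1 + q) = q * (1 / (1 + q))"
  by (simp add: field_simps)

text \<open>In the tangent variable \<open>u\<close> the chord \<open>sqrt (2 - 2 * t)\<close> is asymptotic to \<open>u\<close> at the pole, and the density to \<open>u ^ (d - 2)\<close>,
  so \<open>u = r / R\<close> produces the limit. The opposite hemisphere is at distance at least \<open>sqrt 2\<close> from the
  pole, where the decay of \<open>f\<close> gives a contribution of order \<open>R ^ (d - 1) / R ^ d\<close>.\<close>

lemma sphere_concentration_limit:
  fixes e :: "'a::euclidean_space" and f w :: "real \<Rightarrow> real"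
  assumes e: "e \<in> Basis" and d: "2 \<le> DIM('a)"
    and f: "continuous_on UNIV f" and f0: "\<And>r. 0 \<le> f r" and fC: "\<And>r. 0 \<le> r \<Longrightarrow> f r \<le> C / (1 + r) ^ DIM('a)"
    and w: "continuous_on UNIV w" and w0: "\<And>t. 0 \<le> w t"
  shows "((\<lambda>R. R ^ (DIM('a) - 1) * (\<integral>\<theta>. w (\<theta> \<bullet> e) * f (R * sqrt (2 - 2 * (\<theta> \<bullet> e))) \<partial>sphere_uniform))
    \<longlongrightarrow> angle_const DIM('a) * (w 1 * (\<integral>r. f r * (r ^ (DIM('a) - 2) * indicator {0..} r) \<partial>lborel))) at_top"
proof -
  define d where "d = DIM('a)"
  have d2: "2 \<le> d" using d by (simp add: d_def)
  define s where "s u = 1 / sqrt (1 + u\<^sup>2)" for u :: real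
  have s0: "0 < s u" "s u \<le> 1" for u unfolding s_def by (auto simp: add_pos_nonneg)
  have scont: "continuous_on UNIV s" unfolding s_def by (intro continuous_intros) (auto simp: add_pos_nonneg less_imp_neq[symmetric])
  note [measurable] = borel_measurable_continuous_onI[OF f] borel_measurable_continuous_onI[OF w] borel_measurable_continuous_onI[OF scont]
  obtain W where W: "\<And>t. t \<in> {-1..1} \<Longrightarrow> w t \<le> W" and W0: "0 \<le> W"
  proof -
    have "compact (w ` {-1..1})" by (intro compact_continuous_image continuous_on_subset[OF w]) auto
    then obtain b where "\<forall>x\<in>w ` {-1..1}. norm x \<le> b" using compact_imp_bounded bounded_iff by metis
    then have "\<And>t. t \<in> {-1..1} \<Longrightarrow> w t \<le> max b 0" by (auto simp: le_max_iff_disj abs_le_iff)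
    then show ?thesis using that[of "max b 0"] by auto
  qed
  have C0: "0 \<le> C" using fC[of 0] f0[of 0] by simp
  define G where "G R t = w t * f (R * sqrt (2 - 2 * t))" for R t
  let ?A = "\<lambda>R. \<integral>u. G R (- s u) * angle_weight d u \<partial>lborel"
  have [measurable]: "G R \<in> borel_measurable borel" for R unfolding G_def by measurable
  have G0: "0 \<le> G R t" for R t unfolding G_def using f0 w0 by simp
  have Gle: "G R t \<le> W * (C / (1 + R * sqrt (2 - 2 * t)) ^ d)" if "0 \<le> R" "t \<in> {-1..1}" for R t
    unfolding G_def d_def using that W W0 f0 fC by (intro mult_mono) auto
  have GWC: "G R t \<le> W * C" if "0 \<le> R" "t \<in> {-1..1}" for R t
  proof -
    have "1 \<le> (1 + R * sqrt (2 - 2 * t)) ^ d" using that by (intro one_le_power) auto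
    then have "C / (1 + R * sqrt (2 - 2 * t)) ^ d \<le> C / 1" using C0 by (intro divide_left_mono) auto
    from mult_left_mono[OF this W0] show ?thesis using Gle[OF that] by simp
  qed
  have wti: "integrable lborel (angle_weight d)" unfolding d_def by (rule angle_weight_integrable[OF d])
  have st: "s u \<in> {-1..1}" "- s u \<in> {-1..1}" for u using s0[of u] by auto
  have Gi: "integrable lborel (\<lambda>u. G R (k u) * angle_weight d u)" if "0 \<le> R" "\<And>u. k u \<in> {-1..1}" and [measurable]: "k \<in> borel_measurable borel" for R k
    by (rule integrable_bound[OF integrable_mult_right[OF wti, of "W * C"]])
      (use that G0 GWC W0 C0 angle_weight_nonneg in \<open>auto intro!: mult_right_mono simp: abs_mult abs_of_nonneg\<close>)
  have main: "R ^ (d - 1) * (\<integral>\<theta>. G R (\<theta> \<bullet> e) \<partial>sphere_uniform) = angle_const d *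
     ((\<integral>r. G R (s (r / R)) * (r ^ (d - 2) * s (r / R) ^ d * indicator {0..} r) \<partial>lborel)
       + R ^ (d - 1) * (?A R))" if R: "0 < R" for R
  proof -
    have "(\<integral>\<theta>. G R (\<theta> \<bullet> e) \<partial>sphere_uniform) = angle_const d * (\<integral>u. G R (s u) * angle_weight d u + G R (- s u) * angle_weight d u \<partial>lborel)"
      unfolding d_def s_def by (subst sphere_integral_inner[OF e d]) (auto simp: G0 distrib_right)
    also have "(\<integral>u. G R (s u) * angle_weight d u + G R (- s u) * angle_weight d u \<partial>lborel) =
       (\<integral>u. G R (s u) * angle_weight d u \<partial>lborel) + (?A R)"
      using R st by (intro integral_add Gi) auto
    also have "(\<integral>u. G R (s u) * angle_weight d u \<partial>lborel) = \<bar>1 / R\<bar> *\<^sub>R (\<integral>r. G R (s (0 + 1 / R * r)) * angle_weight d (0 + 1 / R * r) \<partial>lborel)"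
      using R by (intro lborel_integral_real_affine) auto
    also have "\<dots> = (\<integral>r. (1 / R) * (G R (s (r / R)) * angle_weight d (r / R)) \<partial>lborel)" using R by simp
    finally have eq: "(\<integral>\<theta>. G R (\<theta> \<bullet> e) \<partial>sphere_uniform) = angle_const d *
      ((\<integral>r. (1 / R) * (G R (s (r / R)) * angle_weight d (r / R)) \<partial>lborel) + (?A R))" .
    have "R ^ (d - 1) * (\<integral>r. (1 / R) * (G R (s (r / R)) * angle_weight d (r / R)) \<partial>lborel) =
       (\<integral>r. R ^ (d - 1) * ((1 / R) * (G R (s (r / R)) * angle_weight d (r / R))) \<partial>lborel)" by simp
    also have "\<dots> = (\<integral>r. G R (s (r / R)) * (r ^ (d - 2) * s (r / R) ^ d * indicator {0..} r) \<partial>lborel)"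
    proof (rule integral_cong[OF refl])
      fix r
      have "R ^ (d - 1) * (1 / R) * (r / R) ^ (d - 2) = r ^ (d - 2)"
      proof -
        have "d - 1 = Suc (d - 2)" using d2 by auto
        then show ?thesis using R by (simp add: power_divide)
      qed
      moreover have "indicator {0..} (r / R) = (indicator {0..} r :: real)" using R by (simp add: indicator_def zero_le_divide_iff)
      moreover have "angle_weight d (r / R) = (r / R) ^ (d - 2) * s (r / R) ^ d * indicator {0..} (r / R)"
        unfolding angle_weight_def s_def by (simp add: power_one_over divide_inverse power_inverse)
      moreover have "R ^ (d - 1) * ((1 / R) * (G R (s (r / R)) * ((r / R) ^ (d - 2) * s (r / R) ^ d * i)))
          = G R (s (r / R)) * ((R ^ (d - 1) * (1 / R) * (r / R) ^ (d - 2)) * s (r / R) ^ d * i)" for i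
        by (simp only: mult_ac)
      ultimately show "R ^ (d - 1) * ((1 / R) * (G R (s (r / R)) * angle_weight d (r / R))) = G R (s (r / R)) * (r ^ (d - 2) * s (r / R) ^ d * indicator {0..} r)"
        by (simp only:)
    qed
    finally have X: "R ^ (d - 1) * (\<integral>r. (1 / R) * (G R (s (r / R)) * angle_weight d (r / R)) \<partial>lborel) =
      (\<integral>r. G R (s (r / R)) * (r ^ (d - 2) * s (r / R) ^ d * indicator {0..} r) \<partial>lborel)" .
    show ?thesis unfolding eq by (simp only: X distrib_left mult.left_commute[of "R ^ (d - 1)" "angle_const d"])
  qed
  have lim1: "((\<lambda>R. \<integral>r. G R (s (r / R)) * (r ^ (d - 2) * s (r / R) ^ d * indicator {0..} r) \<partial>lborel)
     \<longlongrightarrow> (\<integral>r. w 1 * f r * (r ^ (d - 2) * 1 ^ d * indicator {0..} r) \<partial>lborel)) at_top"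
  proof (rule integral_dominated_convergence_at_top[where w="\<lambda>r. W * C * (1 / (1 + r)\<^sup>2 * indicator {0..} r)"])
    show "integrable lborel (\<lambda>r. W * C * (1 / (1 + r)\<^sup>2 * indicator {0..} r))"
      by (intro integrable_mult_right integrable_inverse_square)
    show "AE r in lborel. ((\<lambda>R. G R (s (r / R)) * (r ^ (d - 2) * s (r / R) ^ d * indicator {0..} r))
        \<longlongrightarrow> w 1 * f r * (r ^ (d - 2) * 1 ^ d * indicator {0..} r)) at_top"
    proof (rule AE_I2)
      fix r :: real
      show "((\<lambda>R. G R (s (r / R)) * (r ^ (d - 2) * s (r / R) ^ d * indicator {0..} r))
        \<longlongrightarrow> w 1 * f r * (r ^ (d - 2) * 1 ^ d * indicator {0..} r)) at_top"
      proof (cases "0 \<le> r")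
        case True
        have r0: "((\<lambda>R. r / R) \<longlongrightarrow> 0) at_top"
          by (rule tendsto_divide_0[OF tendsto_const filterlim_at_top_imp_at_infinity[OF filterlim_ident]])
        have "isCont s 0" using scont by (simp add: continuous_on_eq_continuous_at)
        from isCont_tendsto_compose[OF this r0] have s1: "((\<lambda>R. s (r / R)) \<longlongrightarrow> 1) at_top" by (simp add: s_def)
        have chord: "R * sqrt (2 - 2 * s (r / R)) = r * s (r / R) * sqrt (2 / (1 + s (r / R)))" if R: "0 < R" for R
        proof -
          define \<sigma> where "\<sigma> = s (r / R)"
          have \<sigma>: "0 < \<sigma>" "\<sigma> \<le> 1" using s0 by (auto simp: \<sigma>_def)
          have "\<sigma>\<^sup>2 = 1 / (1 + (r / R)\<^sup>2)" unfolding \<sigma>_def s_def by (simp add: power_divide)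
          then have sq: "1 - \<sigma>\<^sup>2 = (r / R)\<^sup>2 * \<sigma>\<^sup>2" by (simp only: one_minus_inverse zero_le_power2)
          have "2 - 2 * \<sigma> = (1 - \<sigma>\<^sup>2) * (2 / (1 + \<sigma>))" using \<sigma> by (simp add: field_simps power2_eq_square)
          also have "\<dots> = (r * \<sigma> / R)\<^sup>2 * (2 / (1 + \<sigma>))" unfolding sq by (simp add: power_mult_distrib power_divide)
          finally have "sqrt (2 - 2 * \<sigma>) = (r * \<sigma> / R) * sqrt (2 / (1 + \<sigma>))"
            using \<sigma> R True by (simp only: real_sqrt_mult real_sqrt_abs) simp
          then show ?thesis using R unfolding \<sigma>_def by simp
        qed
        have "((\<lambda>R. r * s (r / R) * sqrt (2 / (1 + s (r / R)))) \<longlongrightarrow> r * 1 * sqrt (2 / (1 + 1))) at_top"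
          by (intro tendsto_intros s1) simp
        then have "((\<lambda>R. R * sqrt (2 - 2 * s (r / R))) \<longlongrightarrow> r * 1 * sqrt (2 / (1 + 1))) at_top"
          by (rule Lim_transform_eventually) (rule eventually_mono[OF eventually_gt_at_top[of 0]], simp add: chord)
        then have "((\<lambda>R. R * sqrt (2 - 2 * s (r / R))) \<longlongrightarrow> r) at_top" by simp
        then have f1: "((\<lambda>R. f (R * sqrt (2 - 2 * s (r / R)))) \<longlongrightarrow> f r) at_top"
          using f by (auto intro!: isCont_tendsto_compose[of _ f] simp: continuous_on_eq_continuous_at)
        have w1: "((\<lambda>R. w (s (r / R))) \<longlongrightarrow> w 1) at_top"
          using w s1 by (auto intro!: isCont_tendsto_compose[of _ w] simp: continuous_on_eq_continuous_at)
        show ?thesis unfolding G_def by (intro tendsto_intros f1 w1 s1)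
      qed simp
    qed
    show "\<forall>\<^sub>F R in at_top. AE r in lborel. norm (G R (s (r / R)) * (r ^ (d - 2) * s (r / R) ^ d * indicator {0..} r))
       \<le> W * C * (1 / (1 + r)\<^sup>2 * indicator {0..} r)"
    proof (rule eventually_mono[OF eventually_gt_at_top[of 0]], rule AE_I2)
      fix R r :: real assume R: "0 < R"
      show "norm (G R (s (r / R)) * (r ^ (d - 2) * s (r / R) ^ d * indicator {0..} r)) \<le> W * C * (1 / (1 + r)\<^sup>2 * indicator {0..} r)"
      proof (cases "0 \<le> r")
        case True
        define \<sigma> where "\<sigma> = s (r / R)"
        have \<sigma>: "0 < \<sigma>" "\<sigma> \<le> 1" using s0 by (auto simp: \<sigma>_def)
        have "\<sigma>\<^sup>2 = 1 / (1 + (r / R)\<^sup>2)" unfolding \<sigma>_def s_def by (simp add: power_divide)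
        then have "1 - \<sigma>\<^sup>2 = (r / R)\<^sup>2 * \<sigma>\<^sup>2" by (simp only: one_minus_inverse zero_le_power2)
        moreover have "1 - \<sigma>\<^sup>2 \<le> 2 - 2 * \<sigma>" using zero_le_power2[of "1 - \<sigma>"] by (simp add: power2_eq_square algebra_simps)
        ultimately have "((r / R) * \<sigma>)\<^sup>2 \<le> 2 - 2 * \<sigma>" by (simp only: power_mult_distrib)
        then have "(r / R) * \<sigma> \<le> sqrt (2 - 2 * \<sigma>)" by (rule real_le_rsqrt)
        then have "r * \<sigma> \<le> R * sqrt (2 - 2 * \<sigma>)" using R by (simp add: field_simps)
        then have "\<sigma> * (1 + r) \<le> 1 + R * sqrt (2 - 2 * \<sigma>)" using \<sigma> by (simp add: algebra_simps)
        then have p: "(\<sigma> * (1 + r)) ^ d \<le> (1 + R * sqrt (2 - 2 * \<sigma>)) ^ d" using \<sigma> True by (intro power_mono) auto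
        have pp: "0 < (\<sigma> * (1 + r)) ^ d" using \<sigma> True by simp
        have "G R \<sigma> \<le> W * (C / (1 + R * sqrt (2 - 2 * \<sigma>)) ^ d)" using R \<sigma> by (intro Gle) auto
        also have "\<dots> \<le> W * (C / (\<sigma> * (1 + r)) ^ d)"
          using p pp C0 W0 by (intro mult_left_mono divide_left_mono mult_pos_pos) auto
        finally have "G R \<sigma> * (r ^ (d - 2) * \<sigma> ^ d) \<le> W * (C / (\<sigma> * (1 + r)) ^ d) * (r ^ (d - 2) * \<sigma> ^ d)"
          using \<sigma> True by (intro mult_right_mono) auto
        also have "\<dots> = W * C * (r ^ (d - 2) / (1 + r) ^ d)" using \<sigma> by (simp add: power_mult_distrib)
        also have "r ^ (d - 2) / (1 + r) ^ d \<le> (1 + r) ^ (d - 2) / (1 + r) ^ d"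
          using True by (intro divide_right_mono power_mono) auto
        also have "(1 + r) ^ (d - 2) / (1 + r) ^ d = 1 / (1 + r)\<^sup>2"
        proof -
          have dd: "d - 2 + 2 = d" using d2 by simp
          have "(1 + r) ^ d = (1 + r) ^ (d - 2) * (1 + r)\<^sup>2" by (simp only: power_add[symmetric] dd)
          then show ?thesis using True by simp
        qed
        finally show ?thesis using True W0 C0 G0[of R \<sigma>] \<sigma> unfolding \<sigma>_def by (simp add: abs_mult mult_left_mono)
      qed simp
    qed
  qed measurable
  have lim2: "((\<lambda>R. R ^ (d - 1) * (?A R)) \<longlongrightarrow> 0) at_top"
  proof (rule tendsto_sandwich[where f="\<lambda>_. 0" and h="\<lambda>R. (W * C * (\<integral>u. angle_weight d u \<partial>lborel)) / R"])
    show "\<forall>\<^sub>F R in at_top. 0 \<le> R ^ (d - 1) * (?A R)"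
      by (rule eventually_mono[OF eventually_gt_at_top[of 0]]) (auto intro!: mult_nonneg_nonneg integral_nonneg_AE simp: G0 angle_weight_nonneg)
    show "((\<lambda>R. (W * C * (\<integral>u. angle_weight d u \<partial>lborel)) / R) \<longlongrightarrow> 0) at_top"
      by (rule tendsto_divide_0[OF tendsto_const]) (rule filterlim_at_top_imp_at_infinity[OF filterlim_ident])
    show "\<forall>\<^sub>F R in at_top. R ^ (d - 1) * (?A R) \<le> (W * C * (\<integral>u. angle_weight d u \<partial>lborel)) / R"
    proof (rule eventually_mono[OF eventually_gt_at_top[of 0]])
      fix R :: real assume R: "0 < R"
      have g: "G R (- s u) \<le> W * C / R ^ d" for u
      proof -
        have "1 \<le> sqrt (2 - 2 * (- s u))" using s0[of u] by simp
        then have "R * 1 \<le> R * sqrt (2 - 2 * (- s u))" using R by (intro mult_left_mono) auto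
        then have "R \<le> 1 + R * sqrt (2 - 2 * (- s u))" by linarith
        then have p: "R ^ d \<le> (1 + R * sqrt (2 - 2 * (- s u))) ^ d" using R by (intro power_mono) simp_all
        have "G R (- s u) \<le> W * (C / (1 + R * sqrt (2 - 2 * (- s u))) ^ d)" using R st by (intro Gle) auto
        also have "\<dots> \<le> W * (C / R ^ d)"
          using p C0 W0 R by (intro mult_left_mono divide_left_mono mult_pos_pos) (auto intro: less_le_trans[OF zero_less_power])
        finally show ?thesis by simp
      qed
      have "(?A R) \<le> (\<integral>u. W * C / R ^ d * angle_weight d u \<partial>lborel)"
        using R st wti g by (intro integral_mono Gi integrable_mult_right mult_right_mono angle_weight_nonneg) auto
      then have "R ^ (d - 1) * (?A R) \<le> R ^ (d - 1) * (W * C / R ^ d * (\<integral>u. angle_weight d u \<partial>lborel))"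
        using R by (intro mult_left_mono) auto
      also have "\<dots> = (W * C * (\<integral>u. angle_weight d u \<partial>lborel)) / R"
      proof -
        have "R ^ d = R ^ (d - 1) * R" using d2 by (metis One_nat_def Suc_pred le_eq_less_or_eq mult.commute not_numeral_le_zero not_gr_zero power_Suc)
        then show ?thesis using R by simp
      qed
      finally show "R ^ (d - 1) * (?A R) \<le> (W * C * (\<integral>u. angle_weight d u \<partial>lborel)) / R" .
    qed
  qed simp
  have "((\<lambda>R. R ^ (d - 1) * (\<integral>\<theta>. G R (\<theta> \<bullet> e) \<partial>sphere_uniform)) \<longlongrightarrow>
     angle_const d * ((\<integral>r. w 1 * f r * (r ^ (d - 2) * 1 ^ d * indicator {0..} r) \<partial>lborel) + 0)) at_top"
    by (rule Lim_transform_eventually[OF tendsto_mult[OF tendsto_const tendsto_add[OF lim1 lim2]]])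
       (rule eventually_mono[OF eventually_gt_at_top[of 0]], rule main[symmetric])
  then show ?thesis unfolding G_def d_def by (simp add: mult.assoc)
qed

section \<open>Spherical waves and Gaussian integrals\<close>

text \<open>The covariance of the wave at distance \<open>r\<close>, the same for all unit vectors \<open>e\<close>.\<close>

definition sphere_wave :: "'a::euclidean_space \<Rightarrow> real \<Rightarrow> real" where
  "sphere_wave e r = (\<integral>\<theta>. cos (r * (\<theta> \<bullet> e)) \<partial>sphere_uniform)"

lemma sphere_integrable_bounded:
  fixes f :: "'a::euclidean_space \<Rightarrow> 'b::{banach, second_countable_topology}"
  assumes "f \<in> borel_measurable borel" "\<And>x. norm (f x) \<le> C"
  shows "integrable sphere_uniform f"
  by (rule sph.integrable_const_bound[of _ C]) (use assms in auto)

lemma sphere_wave_bound: "\<bar>sphere_wave e r\<bar> \<le> 1"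
proof -
  have "\<bar>sphere_wave e r\<bar> \<le> (\<integral>\<theta>. norm (cos (r * (\<theta> \<bullet> e))) \<partial>sphere_uniform)"
    unfolding sphere_wave_def real_norm_def[symmetric] by (rule integral_norm_bound)
  also have "\<dots> \<le> (\<integral>\<theta>. 1 \<partial>(sphere_uniform :: 'a measure))"
    by (intro integral_mono sphere_integrable_bounded[of _ 1]) auto
  finally show ?thesis by (simp add: sph.prob_space[simplified])
qed

lemma sphere_wave_continuous: "continuous_on UNIV (sphere_wave (e::'a::euclidean_space))"
proof (rule continuous_at_imp_continuous_on, rule ballI)
  fix r :: real
  show "isCont (sphere_wave e) r"
    unfolding continuous_at_sequentially comp_def sphere_wave_def
  proof (intro allI impI)
    fix X :: "nat \<Rightarrow> real" assume X: "X \<longlonglongrightarrow> r"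
    show "(\<lambda>n. \<integral>\<theta>. cos (X n * (\<theta> \<bullet> e)) \<partial>sphere_uniform) \<longlonglongrightarrow> (\<integral>\<theta>. cos (r * (\<theta> \<bullet> e)) \<partial>sphere_uniform)"
      by (rule integral_dominated_convergence[where w="\<lambda>_. 1"]) (auto intro!: tendsto_intros X)
  qed
qed

lemma sphere_wave_meas[measurable]: "sphere_wave e \<in> borel_measurable borel"
  by (rule borel_measurable_continuous_onI[OF sphere_wave_continuous])

lemma sphere_cos_integral:
  fixes e z :: "'a::euclidean_space"
  assumes e: "norm e = 1"
  shows "(\<integral>\<theta>. cos (\<theta> \<bullet> z) \<partial>sphere_uniform) = sphere_wave e (norm z)"
proof -
  have "(\<integral>\<theta>. cos (\<theta> \<bullet> z) \<partial>sphere_uniform) = (\<integral>\<theta>. cos (\<theta> \<bullet> (norm z *\<^sub>R e)) \<partial>sphere_uniform)"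
    by (rule sphere_zonal) (use e in auto)
  then show ?thesis unfolding sphere_wave_def by simp
qed

lemma distr_norm_lborel:
  "distr lborel borel (norm :: 'a::euclidean_space \<Rightarrow> real) =
    density lborel (\<lambda>r. ennreal (DIM('a) * unit_ball_vol DIM('a) * r ^ (DIM('a) - 1)) * indicator {0..} r)"
proof (rule measure_eqI)
  fix A :: "real set" assume "A \<in> sets (distr lborel borel (norm :: 'a \<Rightarrow> real))"
  then have A[measurable]: "A \<in> sets borel" by simp
  have "emeasure (distr lborel borel (norm :: 'a \<Rightarrow> real)) A = (\<integral>\<^sup>+x. indicator A (norm (x::'a)) \<partial>lborel)"
    by (subst nn_integral_indicator[symmetric], simp, subst nn_integral_distr) auto
  also have "\<dots> = (\<integral>\<^sup>+f. indicator A (norm (\<Sum>b\<in>Basis. f b *\<^sub>R b :: 'a)) \<partial>(Pi\<^sub>M Basis (\<lambda>_. lborel)))"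
    by (subst lborel_eq, subst nn_integral_distr) auto
  also have "\<dots> = (\<integral>\<^sup>+f. indicator A (sqrt (\<Sum>b\<in>Basis. (f b)\<^sup>2)) \<partial>(Pi\<^sub>M (Basis::'a set) (\<lambda>_. lborel)))"
  proof (rule nn_integral_cong)
    fix f :: "'a \<Rightarrow> real"
    have "norm (\<Sum>b\<in>Basis. f b *\<^sub>R b :: 'a) = sqrt (\<Sum>b\<in>Basis. (f b)\<^sup>2)"
      by (subst norm_eq_sqrt_inner, subst euclidean_inner) (simp add: power2_eq_square)
    then show "indicator A (norm (\<Sum>b\<in>Basis. f b *\<^sub>R b :: 'a)) = (indicator A (sqrt (\<Sum>b\<in>Basis. (f b)\<^sup>2)) :: ennreal)" by simp
  qed
  also have "\<dots> = (\<integral>\<^sup>+r. indicator A r * (ennreal (DIM('a) * unit_ball_vol DIM('a) * r ^ (DIM('a) - 1)) * indicator {0..} r) \<partial>lborel)"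
    by (rule nn_integral_PiM_radial) auto
  also have "\<dots> = emeasure (density lborel (\<lambda>r. ennreal (DIM('a) * unit_ball_vol DIM('a) * r ^ (DIM('a) - 1)) * indicator {0..} r)) A"
    by (subst emeasure_density) (auto simp: mult_ac)
  finally show "emeasure (distr lborel borel (norm :: 'a \<Rightarrow> real)) A =
    emeasure (density lborel (\<lambda>r. ennreal (DIM('a) * unit_ball_vol DIM('a) * r ^ (DIM('a) - 1)) * indicator {0..} r)) A" .
qed simp

definition sphere_area :: "nat \<Rightarrow> real" where "sphere_area d = d * unit_ball_vol d"

lemma sphere_area_pos: "0 < d \<Longrightarrow> 0 < sphere_area d" unfolding sphere_area_def by simp

lemma integral_radial:
  fixes h :: "real \<Rightarrow> real"
  assumes h[measurable]: "h \<in> borel_measurable borel"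
  shows "(\<integral>x. h (norm (x::'a::euclidean_space)) \<partial>lborel) = sphere_area DIM('a) * (\<integral>r. h r * (r ^ (DIM('a) - 1) * indicator {0..} r) \<partial>lborel)"
proof -
  have "(\<integral>x. h (norm (x::'a)) \<partial>lborel) = (\<integral>r. h r \<partial>distr lborel borel (norm :: 'a \<Rightarrow> real))"
    by (subst integral_distr) auto
  also have "\<dots> = (\<integral>r. h r \<partial>density lborel (\<lambda>r. ennreal (sphere_area DIM('a) * r ^ (DIM('a) - 1) * indicator {0..} r)))"
    unfolding distr_norm_lborel sphere_area_def
    by (intro arg_cong2[where f="integral\<^sup>L"] refl arg_cong2[where f="density"]) (auto simp: indicator_def)
  also have "\<dots> = (\<integral>r. (sphere_area DIM('a) * r ^ (DIM('a) - 1) * indicator {0..} r) *\<^sub>R h r \<partial>lborel)"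
    by (rule integral_density) (auto simp: indicator_def sphere_area_def)
  also have "\<dots> = (\<integral>r. sphere_area DIM('a) * (h r * (r ^ (DIM('a) - 1) * indicator {0..} r)) \<partial>lborel)"
    by (intro integral_cong refl) (simp add: mult_ac)
  finally show ?thesis by simp
qed

lemma nn_integral_radial:
  fixes h :: "real \<Rightarrow> ennreal"
  assumes h[measurable]: "h \<in> borel_measurable borel"
  shows "(\<integral>\<^sup>+x. h (norm (x::'a::euclidean_space)) \<partial>lborel) =
    (\<integral>\<^sup>+r. h r * (ennreal (sphere_area DIM('a) * r ^ (DIM('a) - 1)) * indicator {0..} r) \<partial>lborel)"
proof -
  have "(\<integral>\<^sup>+x. h (norm (x::'a)) \<partial>lborel) = (\<integral>\<^sup>+r. h r \<partial>distr lborel borel (norm :: 'a \<Rightarrow> real))"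
    by (subst nn_integral_distr) auto
  then show ?thesis unfolding distr_norm_lborel sphere_area_def
    by (subst (asm) nn_integral_density) (auto simp: mult_ac)
qed

lemma gaussian_fourier_real:
  fixes a s :: real
  assumes s: "0 < s"
  shows "integrable lborel (\<lambda>x. iexp (a * x) * of_real (exp (- s * x\<^sup>2)))"
    "(\<integral>x. iexp (a * x) * of_real (exp (- s * x\<^sup>2)) \<partial>lborel) = of_real (sqrt (pi / s) * exp (- a\<^sup>2 / (4 * s)))"
proof -
  define c where "c = sqrt (2 * s)"
  have c: "0 < c" "c\<^sup>2 = 2 * s" using s by (auto simp: c_def)
  let ?f = "\<lambda>y::real. iexp ((a / c) * y) * of_real (std_normal_density y)"
  have fi: "integrable lborel ?f"
    by (rule integrable_bound[OF integrable_normal_density[of 1 0]]) (auto simp: norm_mult)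
  have "complex_of_real (exp (- (a / c)\<^sup>2 / 2)) = char std_normal_distribution (a / c)"
    by (simp add: char_std_normal_distribution)
  also have "\<dots> = (\<integral>y. std_normal_density y *\<^sub>R iexp ((a / c) * y) \<partial>lborel)"
    unfolding char_def by (subst integral_density) auto
  also have "\<dots> = (\<integral>y. ?f y \<partial>lborel)"
    by (intro integral_cong refl) (simp add: scaleR_conv_of_real mult.commute)
  also have "\<dots> = \<bar>c\<bar> *\<^sub>R (\<integral>x. ?f (0 + c * x) \<partial>lborel)"
    using c by (intro lborel_integral_real_affine) auto
  finally have e1: "complex_of_real (exp (- (a / c)\<^sup>2 / 2)) = c *\<^sub>R (\<integral>x. ?f (c * x) \<partial>lborel)" using c by simp
  have f: "?f (c * x) = of_real (1 / sqrt (2 * pi)) * (iexp (a * x) * of_real (exp (- s * x\<^sup>2)))" for x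
  proof -
    have "(c * x)\<^sup>2 / 2 = s * x\<^sup>2" using c by (simp add: power_mult_distrib)
    then show ?thesis using c unfolding std_normal_density_def by (simp add: mult_ac)
  qed
  have "integrable lborel (\<lambda>x. ?f (0 + c * x))" using c by (intro lborel_integrable_real_affine fi) auto
  then have "integrable lborel (\<lambda>x. of_real (sqrt (2 * pi)) * ?f (c * x))" by (intro integrable_mult_right) simp
  then show "integrable lborel (\<lambda>x. iexp (a * x) * of_real (exp (- s * x\<^sup>2)))"
    unfolding f by (simp add: mult.assoc[symmetric] flip: of_real_mult)
  have "(\<integral>x. ?f (c * x) \<partial>lborel) = of_real (1 / sqrt (2 * pi)) * (\<integral>x. iexp (a * x) * of_real (exp (- s * x\<^sup>2)) \<partial>lborel)"
    unfolding f by simp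
  with e1 have e2: "complex_of_real (exp (- (a / c)\<^sup>2 / 2)) = of_real (c / sqrt (2 * pi)) * (\<integral>x. iexp (a * x) * of_real (exp (- s * x\<^sup>2)) \<partial>lborel)"
    by (simp add: scaleR_conv_of_real)
  have "sqrt (2 * pi) / c = sqrt (pi / s)" unfolding c_def using s by (simp flip: real_sqrt_divide)
  moreover have "(a / c)\<^sup>2 / 2 = a\<^sup>2 / (4 * s)" using c by (simp add: power_divide)
  moreover have "(\<integral>x. iexp (a * x) * of_real (exp (- s * x\<^sup>2)) \<partial>lborel) = of_real (sqrt (2 * pi) / c) * complex_of_real (exp (- (a / c)\<^sup>2 / 2))"
  proof -
    have "sqrt (2 * pi) / c * (c / sqrt (2 * pi)) = 1" using c by simp
    then show ?thesis unfolding e2 mult.assoc[symmetric] of_real_mult[symmetric] by simp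
  qed
  ultimately show "(\<integral>x. iexp (a * x) * of_real (exp (- s * x\<^sup>2)) \<partial>lborel) = of_real (sqrt (pi / s) * exp (- a\<^sup>2 / (4 * s)))"
    by simp
qed

lemma gaussian_fourier:
  fixes z :: "'a::euclidean_space"
  assumes s: "0 < s"
  shows "integrable lborel (\<lambda>x::'a. exp (- s * (norm x)\<^sup>2))"
    "(\<integral>x. cos (x \<bullet> z) * exp (- s * (norm x)\<^sup>2) \<partial>lborel) = sqrt (pi / s) ^ DIM('a) * exp (- (norm z)\<^sup>2 / (4 * s))"
proof -
  interpret P: product_sigma_finite "\<lambda>_::'a. lborel :: real measure" by standard
  have nx: "(norm x)\<^sup>2 = (\<Sum>b\<in>Basis. (x \<bullet> b)\<^sup>2)" for x :: 'a
    by (subst power2_norm_eq_inner, subst euclidean_inner) (simp add: power2_eq_square)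
  have main: "integrable lborel (\<lambda>x. iexp (x \<bullet> z) * of_real (exp (- s * (norm x)\<^sup>2))) \<and>
     (\<integral>x. iexp (x \<bullet> z) * of_real (exp (- s * (norm x)\<^sup>2)) \<partial>lborel) = of_real (sqrt (pi / s) ^ DIM('a) * exp (- (norm z)\<^sup>2 / (4 * s)))" for z :: 'a
  proof -
    let ?g = "\<lambda>x::'a. iexp (x \<bullet> z) * of_real (exp (- s * (norm x)\<^sup>2))"
    have eq: "?g (\<Sum>b\<in>Basis. f b *\<^sub>R b) = (\<Prod>b\<in>Basis. iexp ((z \<bullet> b) * f b) * of_real (exp (- s * (f b)\<^sup>2)))" for f
    proof -
      have 1: "(\<Sum>b\<in>Basis. f b *\<^sub>R b) \<bullet> b = f b" if "b \<in> Basis" for b :: 'a using that by simp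
      have "?g (\<Sum>b\<in>Basis. f b *\<^sub>R b) = iexp (\<Sum>b\<in>Basis. f b * (z \<bullet> b)) * of_real (exp (\<Sum>b\<in>Basis. - s * (f b)\<^sup>2))"
        unfolding nx by (subst euclidean_inner) (simp add: 1 sum_distrib_left sum_negf)
      also have "\<dots> = (\<Prod>b\<in>Basis. iexp ((z \<bullet> b) * f b)) * (\<Prod>b\<in>Basis. of_real (exp (- s * (f b)\<^sup>2)))"
        by (simp add: exp_sum of_real_sum sum_distrib_left of_real_prod mult_ac)
      finally show ?thesis by (simp add: prod.distrib)
    qed
    have i: "integrable (Pi\<^sub>M Basis (\<lambda>_. lborel)) (\<lambda>f. ?g (\<Sum>b\<in>Basis. f b *\<^sub>R b))"
      unfolding eq by (intro P.product_integrable_prod finite_Basis gaussian_fourier_real(1)[OF s])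
    have "(\<integral>f. ?g (\<Sum>b\<in>Basis. f b *\<^sub>R b) \<partial>(Pi\<^sub>M Basis (\<lambda>_. lborel))) =
       (\<Prod>b\<in>Basis. of_real (sqrt (pi / s) * exp (- (z \<bullet> b)\<^sup>2 / (4 * s))))"
      unfolding eq by (subst P.product_integral_prod[OF finite_Basis gaussian_fourier_real(1)[OF s]])
        (simp only: gaussian_fourier_real(2)[OF s])
    also have "\<dots> = of_real (sqrt (pi / s) ^ DIM('a) * exp (- (norm z)\<^sup>2 / (4 * s)))"
    proof -
      have "(\<Prod>b\<in>Basis. exp (- (z \<bullet> b)\<^sup>2 / (4 * s))) = exp (- (norm z)\<^sup>2 / (4 * s))"
        unfolding nx by (subst exp_sum[symmetric]) (auto simp: sum_negf sum_divide_distrib)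
      then show ?thesis unfolding of_real_prod[symmetric] prod.distrib by simp
    qed
    finally show ?thesis using i
      by (subst (1 2) lborel_eq, subst integrable_distr_eq, simp, simp, subst integral_distr, simp, simp) simp
  qed
  have "integrable lborel (\<lambda>x. norm (iexp (x \<bullet> (0::'a)) * of_real (exp (- s * (norm x)\<^sup>2))))"
    using main[of 0] by (intro integrable_norm) blast
  then show "integrable lborel (\<lambda>x::'a. exp (- s * (norm x)\<^sup>2))" by simp
  have "(\<integral>x. cos (x \<bullet> z) * exp (- s * (norm x)\<^sup>2) \<partial>lborel) = (\<integral>x. Re (iexp (x \<bullet> z) * of_real (exp (- s * (norm x)\<^sup>2))) \<partial>lborel)"
    by (intro integral_cong refl) (simp add: Re_exp)
  also have "\<dots> = Re (\<integral>x. iexp (x \<bullet> z) * of_real (exp (- s * (norm x)\<^sup>2)) \<partial>lborel)"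
    using main[of z] by (intro integral_Re) blast
  finally show "(\<integral>x. cos (x \<bullet> z) * exp (- s * (norm x)\<^sup>2) \<partial>lborel) = sqrt (pi / s) ^ DIM('a) * exp (- (norm z)\<^sup>2 / (4 * s))"
    using main[of z] by simp
qed

text \<open>Integrating in polar coordinates, the spherical wave is the angular mean of the plane wave, so this is the
  Fourier transform of a Gaussian.\<close>

lemma sphere_wave_gaussian:
  fixes e :: "'a::euclidean_space"
  assumes e: "norm e = 1" and s: "0 < s" and a: "0 \<le> a"
  shows "integrable lborel (\<lambda>r. exp (- s * r\<^sup>2) * (r ^ (DIM('a) - 1) * indicator {0..} r))"
    "(\<integral>r. sphere_wave e (r * a) * exp (- s * r\<^sup>2) * (r ^ (DIM('a) - 1) * indicator {0..} r) \<partial>lborel) =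
     sqrt (pi / s) ^ DIM('a) * exp (- a\<^sup>2 / (4 * s)) / sphere_area DIM('a)"
proof -
  have A: "0 < sphere_area DIM('a)" by (rule sphere_area_pos) simp
  have gi: "integrable lborel (\<lambda>x::'a. exp (- s * (norm x)\<^sup>2))" by (rule gaussian_fourier(1)[OF s])
  have "(\<integral>\<^sup>+r. ennreal (exp (- s * r\<^sup>2) * (r ^ (DIM('a) - 1) * indicator {0..} r)) \<partial>lborel) < \<infinity>"
  proof -
    have "(\<integral>\<^sup>+x. ennreal (exp (- s * (norm (x::'a))\<^sup>2)) \<partial>lborel) < \<infinity>"
      using gi unfolding integrable_iff_bounded by simp
    then have "(\<integral>\<^sup>+r. ennreal (exp (- s * r\<^sup>2)) * (ennreal (sphere_area DIM('a) * r ^ (DIM('a) - 1)) * indicator {0..} r) \<partial>lborel) < \<infinity>"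
      by (subst (asm) nn_integral_radial) auto
    also have "(\<integral>\<^sup>+r. ennreal (exp (- s * r\<^sup>2)) * (ennreal (sphere_area DIM('a) * r ^ (DIM('a) - 1)) * indicator {0..} r) \<partial>lborel) =
       (\<integral>\<^sup>+r. ennreal (sphere_area DIM('a)) * ennreal (exp (- s * r\<^sup>2) * (r ^ (DIM('a) - 1) * indicator {0..} r)) \<partial>lborel)"
      using A by (intro nn_integral_cong) (auto simp: indicator_def mult_ac simp flip: ennreal_mult')
    also have "\<dots> = ennreal (sphere_area DIM('a)) * (\<integral>\<^sup>+r. ennreal (exp (- s * r\<^sup>2) * (r ^ (DIM('a) - 1) * indicator {0..} r)) \<partial>lborel)"
      by (rule nn_integral_cmult) simp
    finally show ?thesis using A by (auto simp: ennreal_mult_less_top)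
  qed
  then show "integrable lborel (\<lambda>r. exp (- s * r\<^sup>2) * (r ^ (DIM('a) - 1) * indicator {0..} r))"
    by (intro integrableI_nonneg) (auto simp: indicator_def)
  interpret S: pair_sigma_finite "sphere_uniform :: 'a measure" "lborel :: 'a measure" ..
  have ii: "integrable (sphere_uniform \<Otimes>\<^sub>M lborel) (\<lambda>(\<eta>::'a, x::'a). cos (\<eta> \<bullet> (a *\<^sub>R x)) * exp (- s * (norm x)\<^sup>2))"
  proof (rule S.Fubini_integrable)
    show "(\<lambda>(\<eta>::'a, x::'a). cos (\<eta> \<bullet> (a *\<^sub>R x)) * exp (- s * (norm x)\<^sup>2)) \<in> borel_measurable (sphere_uniform \<Otimes>\<^sub>M lborel)"
      by measurable
    have i1: "integrable lborel (\<lambda>x::'a. cos (\<eta> \<bullet> (a *\<^sub>R x)) * exp (- s * (norm x)\<^sup>2))" for \<eta> :: 'a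
      by (rule integrable_bound[OF gi]) (auto simp: abs_mult intro!: mult_left_le_one_le)
    then show "AE \<eta> in (sphere_uniform :: 'a measure). integrable lborel (\<lambda>x::'a. case (\<eta>, x) of (\<eta>, x) \<Rightarrow> cos (\<eta> \<bullet> (a *\<^sub>R x)) * exp (- s * (norm x)\<^sup>2))" by simp
    show "integrable sphere_uniform (\<lambda>\<eta>::'a. \<integral>x. norm (case (\<eta>, x) of (\<eta>, x::'a) \<Rightarrow> cos (\<eta> \<bullet> (a *\<^sub>R x)) * exp (- s * (norm x)\<^sup>2)) \<partial>lborel)"
    proof (rule sphere_integrable_bounded)
      fix \<eta> :: 'a
      have "(\<integral>x. norm (cos (\<eta> \<bullet> (a *\<^sub>R x)) * exp (- s * (norm x)\<^sup>2)) \<partial>lborel) \<le> (\<integral>x. exp (- s * (norm (x::'a))\<^sup>2) \<partial>lborel)"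
        by (intro integral_mono integrable_norm i1 gi) (auto simp: abs_mult intro!: mult_left_le_one_le)
      then show "norm (\<integral>x. norm (case (\<eta>, x) of (\<eta>, x::'a) \<Rightarrow> cos (\<eta> \<bullet> (a *\<^sub>R x)) * exp (- s * (norm x)\<^sup>2)) \<partial>lborel) \<le> (\<integral>x. exp (- s * (norm (x::'a))\<^sup>2) \<partial>lborel)"
        by simp
    qed measurable
  qed
  have "sqrt (pi / s) ^ DIM('a) * exp (- a\<^sup>2 / (4 * s)) = (\<integral>\<eta>. sqrt (pi / s) ^ DIM('a) * exp (- a\<^sup>2 / (4 * s)) \<partial>(sphere_uniform :: 'a measure))"
    by (simp add: sph.prob_space[simplified])
  also have "\<dots> = (\<integral>\<eta>. (\<integral>x. cos (\<eta> \<bullet> (a *\<^sub>R x)) * exp (- s * (norm x)\<^sup>2) \<partial>lborel) \<partial>(sphere_uniform :: 'a measure))"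
  proof (rule integral_cong_AE)
    show "AE \<eta> in (sphere_uniform :: 'a measure). sqrt (pi / s) ^ DIM('a) * exp (- a\<^sup>2 / (4 * s)) = (\<integral>x. cos (\<eta> \<bullet> (a *\<^sub>R x)) * exp (- s * (norm x)\<^sup>2) \<partial>lborel)"
      using AE_sphere_uniform
    proof eventually_elim
      fix \<eta> :: 'a assume "norm \<eta> = 1"
      then show "sqrt (pi / s) ^ DIM('a) * exp (- a\<^sup>2 / (4 * s)) = (\<integral>x. cos (\<eta> \<bullet> (a *\<^sub>R x)) * exp (- s * (norm x)\<^sup>2) \<partial>lborel)"
        using gaussian_fourier(2)[OF s, of "a *\<^sub>R \<eta>"] by (simp add: inner_commute mult_ac)
    qed
  qed measurable
  also have "\<dots> = (\<integral>x. (\<integral>\<eta>. cos (\<eta> \<bullet> (a *\<^sub>R x)) * exp (- s * (norm x)\<^sup>2) \<partial>(sphere_uniform :: 'a measure)) \<partial>lborel)"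
    by (rule S.Fubini_integral[symmetric, OF ii])
  also have "\<dots> = (\<integral>x. sphere_wave e (norm (x::'a) * a) * exp (- s * (norm x)\<^sup>2) \<partial>lborel)"
    using sphere_cos_integral[OF e, of "a *\<^sub>R _"] a by (simp add: mult.commute)
  also have "\<dots> = sphere_area DIM('a) * (\<integral>r. sphere_wave e (r * a) * exp (- s * r\<^sup>2) * (r ^ (DIM('a) - 1) * indicator {0..} r) \<partial>lborel)"
    by (rule integral_radial) measurable
  finally show "(\<integral>r. sphere_wave e (r * a) * exp (- s * r\<^sup>2) * (r ^ (DIM('a) - 1) * indicator {0..} r) \<partial>lborel) =
     sqrt (pi / s) ^ DIM('a) * exp (- a\<^sup>2 / (4 * s)) / sphere_area DIM('a)"
    using A by (simp add: field_simps)
qed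

section \<open>The Riesz kernel\<close>

lemma nn_integral_inverse_substitution:
  fixes f :: "real \<Rightarrow> real"
  assumes f[measurable]: "f \<in> borel_measurable borel" and f0: "\<And>x. 0 \<le> f x"
  shows "(\<integral>\<^sup>+x. ennreal (f x) * indicator {0<..} x \<partial>lborel) =
    (\<integral>\<^sup>+x. ennreal (f (1 / x) / x\<^sup>2) * indicator {0<..} x \<partial>lborel)"
proof -
  define J where "J n = {1 / real (Suc n)..real (Suc n)}" for n
  have J: "x \<in> J n \<Longrightarrow> 0 < x" for x n unfolding J_def by (auto intro: less_le_trans[of 0 "1 / real (Suc n)"])
  have Jmono: "J n \<subseteq> J (Suc n)" for n unfolding J_def by (auto simp: field_simps intro: order_trans)
  have Jev: "\<forall>\<^sub>F n in sequentially. x \<in> J n" if x: "0 < x" for x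
  proof -
    obtain N where N: "x \<le> real N" "1 / x \<le> real N"
      using real_arch_simple[of "max x (1 / x)"] by auto
    show ?thesis
    proof (rule eventually_sequentiallyI[of N])
      fix n assume "N \<le> n"
      then have "x \<le> real (Suc n)" "1 / x \<le> real (Suc n)" using N by linarith+
      then show "x \<in> J n" using x unfolding J_def by (auto simp: field_simps)
    qed
  qed
  have inc: "incseq (\<lambda>n x. g x * (indicator (J n) x :: ennreal))" for g :: "real \<Rightarrow> ennreal"
    by (intro incseq_SucI le_funI mult_left_mono) (use Jmono in \<open>auto simp: indicator_def\<close>)
  have lim: "(\<lambda>n. \<integral>\<^sup>+x. g x * indicator (J n) x \<partial>lborel) \<longlonglongrightarrow> (\<integral>\<^sup>+x. g x * indicator {0<..} x \<partial>lborel)"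
    if [measurable]: "g \<in> borel_measurable borel" for g :: "real \<Rightarrow> ennreal"
  proof (rule nn_integral_LIMSEQ[OF inc])
    show "(\<lambda>x. g x * indicator (J n) x) \<in> borel_measurable lborel" for n unfolding J_def by measurable
    show "(\<lambda>i. g x * indicator (J i) x) \<longlonglongrightarrow> g x * indicator {0<..} x" for x
    proof (cases "0 < x")
      case True
      have "\<forall>\<^sub>F n in sequentially. g x * indicator (J n) x = g x * (indicator {0<..} x :: ennreal)"
        by (rule eventually_mono[OF Jev[OF True]]) (use True in simp)
      then show ?thesis by (rule tendsto_eventually)
    next
      case False
      then have "indicator (J n) x = (0 :: ennreal)" for n using J[of x n] by (auto simp: indicator_def)
      then show ?thesis using False by simp
    qed
  qed
  have step: "(\<integral>\<^sup>+x. ennreal (f x) * indicator (J n) x \<partial>lborel) = (\<integral>\<^sup>+x. ennreal (f (1 / x) / x\<^sup>2) * indicator (J n) x \<partial>lborel)" for n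
  proof -
    define m where "m = real (Suc n)"
    have m: "1 \<le> m" unfolding m_def by simp
    have "(\<integral>\<^sup>+x. ennreal (f x) * indicator (J n) x \<partial>lborel) = ennreal \<bar>-1\<bar> * (\<integral>\<^sup>+x. ennreal (f (0 + (-1) * x)) * indicator (J n) (0 + (-1) * x) \<partial>lborel)"
      unfolding J_def by (intro nn_integral_real_affine) auto
    also have "\<dots> = (\<integral>\<^sup>+x. ennreal (f (- x)) * indicator {(\<lambda>x. - 1 / x) (1 / m)..(\<lambda>x. - 1 / x) m} x \<partial>lborel)"
      using m by (auto intro!: nn_integral_cong simp: indicator_def J_def m_def)
    also have "\<dots> = (\<integral>\<^sup>+x. ennreal (f (- (- 1 / x)) * (1 / x\<^sup>2)) * indicator {1 / m..m} x \<partial>lborel)"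
    proof -
      have "(\<integral>\<^sup>+x. ennreal (f (- x) * indicator {(\<lambda>x. - 1 / x) (1 / m)..(\<lambda>x. - 1 / x) m} x) \<partial>lborel) =
        (\<integral>\<^sup>+x. ennreal (f (- ((\<lambda>x. - 1 / x) x)) * (1 / x\<^sup>2) * indicator {1 / m..m} x) \<partial>lborel)"
      proof (rule nn_integral_substitution[where f="\<lambda>x. f (- x)" and g="\<lambda>x. - 1 / x" and g'="\<lambda>x. 1 / x\<^sup>2" and a="1 / m" and b=m])
        show "set_borel_measurable borel {- 1 / (1 / m)..- 1 / m} (\<lambda>x. f (- x))" unfolding set_borel_measurable_def by measurable
        have p: "0 < x" if "x \<in> {1 / m..m}" for x using that m by (auto intro: less_le_trans[of 0 "1 / m"])
        show "((\<lambda>x. - 1 / x) has_real_derivative 1 / x\<^sup>2) (at x)" if "x \<in> {1 / m..m}" for x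
          using p[OF that] by (auto intro!: derivative_eq_intros simp: power2_eq_square)
        show "continuous_on {1 / m..m} (\<lambda>x. 1 / x\<^sup>2)" using p by (intro continuous_intros) (fastforce dest: p)
        show "1 / m \<le> m" using m by (simp add: field_simps) (metis mult_mono' mult_1 zero_le_one)
      qed auto
      moreover have "ennreal (a * indicator A x) = ennreal a * indicator A x" for a x :: real and A :: "real set"
        by (simp add: indicator_def)
      ultimately show ?thesis by (simp only:)
    qed
    also have "\<dots> = (\<integral>\<^sup>+x. ennreal (f (1 / x) / x\<^sup>2) * indicator (J n) x \<partial>lborel)" unfolding J_def m_def by simp
    finally show ?thesis .
  qed
  show ?thesis
    using LIMSEQ_unique[OF lim[of "\<lambda>x. ennreal (f x)"]] lim[of "\<lambda>x. ennreal (f (1 / x) / x\<^sup>2)"] by (simp add: step)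
qed

lemma nn_integral_Gamma:
  fixes x b :: real
  assumes x: "0 < x" and b: "0 < b"
  shows "(\<integral>\<^sup>+t. ennreal (t powr (x - 1) * exp (- b * t)) * indicator {0<..} t \<partial>lborel) = ennreal (Gamma x / b powr x)"
proof -
  have "ennreal (Gamma x) = (\<integral>\<^sup>+t. ennreal (indicator {0..} t * t powr (x - 1) / exp t) \<partial>lborel)"
    by (rule Gamma_conv_nn_integral_real[OF x])
  also have "\<dots> = ennreal \<bar>b\<bar> * (\<integral>\<^sup>+t. ennreal (indicator {0..} (0 + b * t) * (0 + b * t) powr (x - 1) / exp (0 + b * t)) \<partial>lborel)"
    using b by (intro nn_integral_real_affine) auto
  also have "\<dots> = (\<integral>\<^sup>+t. ennreal b * ennreal (indicator {0..} (b * t) * (b * t) powr (x - 1) / exp (b * t)) \<partial>lborel)"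
    using b by (subst nn_integral_cmult) auto
  also have "\<dots> = (\<integral>\<^sup>+t. ennreal (b powr x) * (ennreal (t powr (x - 1) * exp (- b * t)) * indicator {0<..} t) \<partial>lborel)"
  proof (rule nn_integral_cong_AE)
    have "AE t in lborel. t \<noteq> (0::real)" by (rule AE_lborel_singleton)
    then show "AE t in lborel. ennreal b * ennreal (indicator {0..} (b * t) * (b * t) powr (x - 1) / exp (b * t)) =
       ennreal (b powr x) * (ennreal (t powr (x - 1) * exp (- b * t)) * indicator {0<..} t)"
    proof eventually_elim
      fix t :: real assume t: "t \<noteq> 0"
      show "ennreal b * ennreal (indicator {0..} (b * t) * (b * t) powr (x - 1) / exp (b * t)) =
       ennreal (b powr x) * (ennreal (t powr (x - 1) * exp (- b * t)) * indicator {0<..} t)"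
      proof (cases "0 < t")
        case True
        have "b * ((b * t) powr (x - 1) / exp (b * t)) = b powr x * (t powr (x - 1) * exp (- b * t))"
          using b True by (simp add: powr_mult exp_minus powr_diff field_simps)
        then show ?thesis using True b by (simp flip: ennreal_mult')
      next
        case False
        then have "\<not> 0 \<le> b * t" using t b by (simp add: zero_le_mult_iff)
        then show ?thesis using False by simp
      qed
    qed
  qed
  also have "\<dots> = ennreal (b powr x) * (\<integral>\<^sup>+t. ennreal (t powr (x - 1) * exp (- b * t)) * indicator {0<..} t \<partial>lborel)"
    by (rule nn_integral_cmult) measurable
  finally have "ennreal (1 / b powr x) * ennreal (Gamma x) =
     (ennreal (1 / b powr x) * ennreal (b powr x)) * (\<integral>\<^sup>+t. ennreal (t powr (x - 1) * exp (- b * t)) * indicator {0<..} t \<partial>lborel)"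
    by (simp add: mult.assoc)
  moreover have "ennreal (1 / b powr x) * ennreal (b powr x) = 1" using b by (simp flip: ennreal_mult')
  moreover have "ennreal (1 / b powr x) * ennreal (Gamma x) = ennreal (Gamma x / b powr x)" using b by (simp flip: ennreal_mult')
  ultimately show ?thesis by simp
qed

text \<open>The substitution \<open>s \<mapsto> 1 / s\<close> turns the exponent into a linear one and the integral into a Gamma integral.\<close>

lemma nn_integral_riesz_kernel:
  fixes k :: real
  assumes k: "0 < k" and d: "2 \<le> d"
  shows "(\<integral>\<^sup>+s. ennreal (s powr (- 1 / 2) * (sqrt (pi / s) ^ d * exp (- k\<^sup>2 / (4 * s)))) * indicator {0<..} s \<partial>lborel) =
    ennreal (sqrt pi ^ d * Gamma ((real d - 1) / 2) * 2 ^ (d - 1) / k ^ (d - 1))"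
proof -
  have "(\<integral>\<^sup>+s. ennreal (s powr (- 1 / 2) * (sqrt (pi / s) ^ d * exp (- k\<^sup>2 / (4 * s)))) * indicator {0<..} s \<partial>lborel) =
     (\<integral>\<^sup>+s. ennreal (\<bar>s\<bar> powr (- 1 / 2) * (sqrt (pi / \<bar>s\<bar>) ^ d * exp (- k\<^sup>2 / (4 * s)))) * indicator {0<..} s \<partial>lborel)"
    by (intro nn_integral_cong) (auto simp: indicator_def)
  also have "\<dots> = (\<integral>\<^sup>+s. ennreal (\<bar>1 / s\<bar> powr (- 1 / 2) * (sqrt (pi / \<bar>1 / s\<bar>) ^ d * exp (- k\<^sup>2 / (4 * (1 / s)))) / s\<^sup>2) * indicator {0<..} s \<partial>lborel)"
    by (rule nn_integral_inverse_substitution) auto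
  also have "\<dots> = (\<integral>\<^sup>+s. ennreal (sqrt pi ^ d) * (ennreal (s powr ((real d - 1) / 2 - 1) * exp (- (k\<^sup>2 / 4) * s)) * indicator {0<..} s) \<partial>lborel)"
  proof (rule nn_integral_cong)
    fix s :: real
    show "ennreal (\<bar>1 / s\<bar> powr (- 1 / 2) * (sqrt (pi / \<bar>1 / s\<bar>) ^ d * exp (- k\<^sup>2 / (4 * (1 / s)))) / s\<^sup>2) * indicator {0<..} s =
       ennreal (sqrt pi ^ d) * (ennreal (s powr ((real d - 1) / 2 - 1) * exp (- (k\<^sup>2 / 4) * s)) * indicator {0<..} s)"
    proof (cases "0 < s")
      case True
      have 1: "\<bar>1 / s\<bar> powr (- 1 / 2) = s powr (1 / 2)" using True by (simp add: powr_minus powr_divide)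
      have 2: "sqrt (pi / \<bar>1 / s\<bar>) ^ d = sqrt pi ^ d * s powr (real d / 2)"
        using True by (simp add: real_sqrt_mult power_mult_distrib powr_half_sqrt[symmetric] powr_powr flip: powr_realpow)
      have 3: "s\<^sup>2 = s powr 2" using True by simp
      have "s powr (1 / 2) * s powr (real d / 2) / s powr 2 = s powr ((real d - 1) / 2 - 1)"
        unfolding powr_add[symmetric] powr_diff[symmetric] by (simp add: field_simps)
      moreover have ee: "exp (- k\<^sup>2 / (4 * (1 / s))) = exp (- (k\<^sup>2 / 4) * s)" by simp
      moreover have "A * (P * B * E) / C = P * ((A * B / C) * E)" for A P B E C :: real by simp
      ultimately have "\<bar>1 / s\<bar> powr (- 1 / 2) * (sqrt (pi / \<bar>1 / s\<bar>) ^ d * exp (- k\<^sup>2 / (4 * (1 / s)))) / s\<^sup>2 =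
        sqrt pi ^ d * (s powr ((real d - 1) / 2 - 1) * exp (- (k\<^sup>2 / 4) * s))"
        unfolding 1 2 3
        by (simp only:)
      then show ?thesis using True by (simp add: ennreal_mult')
    qed simp
  qed
  also have "\<dots> = ennreal (sqrt pi ^ d) * (\<integral>\<^sup>+s. ennreal (s powr ((real d - 1) / 2 - 1) * exp (- (k\<^sup>2 / 4) * s)) * indicator {0<..} s \<partial>lborel)"
    by (rule nn_integral_cmult) measurable
  also have "\<dots> = ennreal (sqrt pi ^ d) * ennreal (Gamma ((real d - 1) / 2) / (k\<^sup>2 / 4) powr ((real d - 1) / 2))"
    using k d by (subst nn_integral_Gamma) auto
  also have "(k\<^sup>2 / 4) powr ((real d - 1) / 2) = (k / 2) ^ (d - 1)"
  proof -
    have "k\<^sup>2 / 4 = (k / 2) powr 2" using k by (simp add: power_divide)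
    moreover have "2 * ((real d - 1) / 2) = real (d - 1)" using d by (simp add: of_nat_diff)
    ultimately have "(k\<^sup>2 / 4) powr ((real d - 1) / 2) = (k / 2) powr (real (d - 1))" by (simp only: powr_powr)
    then show ?thesis using k by (simp add: powr_realpow)
  qed
  also have "ennreal (sqrt pi ^ d) * ennreal (Gamma ((real d - 1) / 2) / (k / 2) ^ (d - 1)) =
     ennreal (sqrt pi ^ d * Gamma ((real d - 1) / 2) * 2 ^ (d - 1) / k ^ (d - 1))"
    using k d by (subst ennreal_mult'[symmetric]) (auto simp: power_divide)
  finally show ?thesis .
qed

lemma integrable_lborel_pair_mult:
  fixes f :: "'a::euclidean_space \<Rightarrow> real" and g :: "'b::euclidean_space \<Rightarrow> real"
  assumes f: "integrable lborel f" and g: "integrable lborel g"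
  shows "integrable (lborel \<Otimes>\<^sub>M lborel) (\<lambda>z. f (fst z) * g (snd z))"
proof -
  have [measurable]: "f \<in> borel_measurable borel" "g \<in> borel_measurable borel" using f g by auto
  show ?thesis
  proof (rule lborel_pair.Fubini_integrable)
    show "integrable lborel (\<lambda>x. \<integral>y. norm (f (fst (x, y)) * g (snd (x, y))) \<partial>lborel)"
      using f by (simp add: abs_mult)
    show "AE x in lborel. integrable lborel (\<lambda>y. f (fst (x, y)) * g (snd (x, y)))" using g by simp
  qed measurable
qed

abbreviation lborel2 :: "('a::euclidean_space \<times> 'a) measure" where "lborel2 \<equiv> lborel \<Otimes>\<^sub>M lborel"

abbreviation riesz_energy :: "('a::euclidean_space \<Rightarrow> real) \<Rightarrow> real" where
  "riesz_energy \<phi> \<equiv> \<integral>z. \<phi> (fst z) * \<phi> (snd z) / norm (fst z - snd z) ^ (DIM('a) - 1) \<partial>lborel2"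

text \<open>The exponent \<open>d - 1\<close> is below the dimension, so the kernel is integrable near the diagonal, where one
  factor \<open>\<phi>\<close> is bounded; away from the diagonal the kernel itself is bounded.\<close>

lemma riesz_energy_integrable:
  fixes \<phi> :: "'a::euclidean_space \<Rightarrow> real"
  assumes \<phi>: "integrable lborel \<phi>" and M: "\<And>x. \<bar>\<phi> x\<bar> \<le> M"
  shows "integrable lborel2 (\<lambda>z. \<phi> (fst z) * \<phi> (snd z) / norm (fst z - snd z) ^ (DIM('a) - 1))"
proof -
  let ?k = "\<lambda>x y. indicator {..1} (norm (x - y)) / norm (x - y) ^ (DIM('a) - 1) :: real"
  have [measurable]: "\<phi> \<in> borel_measurable borel" using \<phi> by auto
  have M0: "0 \<le> M" using M[of 0] by simp
  define L1 where "L1 = (\<integral>\<^sup>+x. ennreal \<bar>\<phi> x\<bar> \<partial>lborel)"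
  have L1: "L1 < \<infinity>" using \<phi> unfolding L1_def integrable_iff_bounded by simp
  define A where "A = ennreal (sphere_area DIM('a))"
  have ker: "(\<integral>\<^sup>+y. ennreal (?k x y) \<partial>lborel) \<le> A" for x :: 'a
  proof -
    have "(\<integral>\<^sup>+y. ennreal (?k x y) \<partial>lborel) =
      (\<integral>\<^sup>+y. ennreal (indicator {..1} (norm (- x + y)) / norm (- x + y) ^ (DIM('a) - 1)) \<partial>lborel)"
      by (simp add: norm_minus_commute)
    also have "\<dots> = (\<integral>\<^sup>+w. ennreal (indicator {..1} (norm w) / norm w ^ (DIM('a) - 1)) \<partial>distr lborel borel ((+) (- x)))"
      by (subst nn_integral_distr) auto
    also have "\<dots> = (\<integral>\<^sup>+w. ennreal (indicator {..1} (norm (w::'a)) / norm w ^ (DIM('a) - 1)) \<partial>lborel)"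
      by (simp add: lborel_distr_plus)
    also have "\<dots> = (\<integral>\<^sup>+r. ennreal (indicator {..1} r / r ^ (DIM('a) - 1)) * (ennreal (sphere_area DIM('a) * r ^ (DIM('a) - 1)) * indicator {0..} r) \<partial>lborel)"
      by (rule nn_integral_radial) measurable
    also have "\<dots> \<le> (\<integral>\<^sup>+r. A * indicator {0..1::real} r \<partial>lborel)"
    proof (rule nn_integral_mono)
      fix r :: real
      have "1 / r ^ (DIM('a) - 1) * (sphere_area DIM('a) * r ^ (DIM('a) - 1)) \<le> sphere_area DIM('a)"
        using sphere_area_pos[of "DIM('a)"] by (cases "r ^ (DIM('a) - 1) = 0") auto
      then show "ennreal (indicator {..1} r / r ^ (DIM('a) - 1)) * (ennreal (sphere_area DIM('a) * r ^ (DIM('a) - 1)) * indicator {0..} r) \<le> A * indicator {0..1} r"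
        unfolding A_def by (auto simp: indicator_def ennreal_leI simp flip: ennreal_mult')
    qed
    also have "\<dots> = A" by (subst nn_integral_cmult_indicator) auto
    finally show ?thesis .
  qed
  have inner: "(\<integral>\<^sup>+y. ennreal (\<bar>\<phi> y\<bar> / norm (x - y) ^ (DIM('a) - 1)) \<partial>lborel) \<le> ennreal M * A + L1" for x :: 'a
  proof -
    have "(\<integral>\<^sup>+y. ennreal (\<bar>\<phi> y\<bar> / norm (x - y) ^ (DIM('a) - 1)) \<partial>lborel) \<le>
      (\<integral>\<^sup>+y. ennreal M * ennreal (?k x y) + ennreal \<bar>\<phi> y\<bar> \<partial>lborel)"
    proof (rule nn_integral_mono)
      fix y :: 'a
      have "\<bar>\<phi> y\<bar> / norm (x - y) ^ (DIM('a) - 1) \<le> M * (?k x y) + \<bar>\<phi> y\<bar>"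
      proof (cases "norm (x - y) \<le> 1")
        case True
        have "\<bar>\<phi> y\<bar> / norm (x - y) ^ (DIM('a) - 1) \<le> M / norm (x - y) ^ (DIM('a) - 1)" using M by (intro divide_right_mono) auto
        then show ?thesis using True by simp
      next
        case False
        then have "1 \<le> norm (x - y) ^ (DIM('a) - 1)" by (intro one_le_power) auto
        then have "\<bar>\<phi> y\<bar> / norm (x - y) ^ (DIM('a) - 1) \<le> \<bar>\<phi> y\<bar> / 1" by (intro divide_left_mono) auto
        then show ?thesis using False by simp
      qed
      then have "ennreal (\<bar>\<phi> y\<bar> / norm (x - y) ^ (DIM('a) - 1)) \<le> ennreal (M * (?k x y) + \<bar>\<phi> y\<bar>)"
        by (rule ennreal_leI)
      also have "\<dots> = ennreal M * ennreal (?k x y) + ennreal \<bar>\<phi> y\<bar>"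
        unfolding ennreal_mult'[OF M0, symmetric] using M0 by (intro ennreal_plus) auto
      finally show "ennreal (\<bar>\<phi> y\<bar> / norm (x - y) ^ (DIM('a) - 1)) \<le> ennreal M * ennreal (?k x y) + ennreal \<bar>\<phi> y\<bar>" .
    qed
    also have "\<dots> = ennreal M * (\<integral>\<^sup>+y. ennreal (?k x y) \<partial>lborel) + L1"
      unfolding L1_def by (subst nn_integral_add, measurable, subst nn_integral_cmult) auto
    also have "\<dots> \<le> ennreal M * A + L1" by (intro add_right_mono mult_left_mono ker) auto
    finally show ?thesis .
  qed
  show ?thesis
    unfolding integrable_iff_bounded
  proof
    have "(\<integral>\<^sup>+z. ennreal (norm (\<phi> (fst z) * \<phi> (snd z) / norm (fst z - snd z) ^ (DIM('a) - 1))) \<partial>lborel2) =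
      (\<integral>\<^sup>+x. (\<integral>\<^sup>+y. ennreal (norm (\<phi> x * \<phi> y / norm (x - y) ^ (DIM('a) - 1))) \<partial>lborel) \<partial>lborel)"
    proof -
      have m: "(\<lambda>z. ennreal (norm (\<phi> (fst z) * \<phi> (snd z) / norm (fst z - snd z) ^ (DIM('a) - 1)))) \<in> borel_measurable lborel2"
        by measurable
      show ?thesis using lborel.nn_integral_fst[OF m] by (simp only: fst_conv snd_conv)
    qed
    also have "\<dots> = (\<integral>\<^sup>+x. ennreal \<bar>\<phi> x\<bar> * (\<integral>\<^sup>+y. ennreal (\<bar>\<phi> y\<bar> / norm (x - y) ^ (DIM('a) - 1)) \<partial>lborel) \<partial>lborel)"
      by (subst nn_integral_cmult[symmetric]) (auto intro!: nn_integral_cong simp: abs_mult simp flip: ennreal_mult')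
    also have "\<dots> \<le> (\<integral>\<^sup>+x. ennreal \<bar>\<phi> x\<bar> * (ennreal M * A + L1) \<partial>lborel)"
      by (intro nn_integral_mono mult_left_mono inner) auto
    also have "\<dots> = L1 * (ennreal M * A + L1)" unfolding L1_def by (rule nn_integral_multc) measurable
    also have "\<dots> < \<infinity>" using L1 by (auto simp: ennreal_mult_less_top A_def)
    finally show "(\<integral>\<^sup>+z. ennreal (norm (\<phi> (fst z) * \<phi> (snd z) / norm (fst z - snd z) ^ (DIM('a) - 1))) \<partial>lborel2) < \<infinity>" .
  qed measurable
qed

section \<open>Riesz energy in spherical frequencies\<close>

definition riesz_const :: "nat \<Rightarrow> real" where
  "riesz_const d = sqrt pi ^ d * Gamma ((real d - 1) / 2) * 2 ^ (d - 1) / (sqrt pi * sphere_area d)"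

text \<open>Formally the integral of \<open>sphere_wave e (r * k) * r ^ (d - 2)\<close> in \<open>r\<close> is a multiple of \<open>1 / k ^ (d - 1)\<close>, but it
  does not converge absolutely. Writing \<open>r ^ (d - 2)\<close> as \<open>r ^ (d - 1)\<close> times a superposition of Gaussians makes the
  inner integrals explicit, and the order of the outer two may be exchanged because \<open>\<Psi>\<close> is nonnegative.\<close>

theorem spherical_energy_eq_riesz_energy:
  fixes \<phi> :: "'a::euclidean_space \<Rightarrow> real" and e :: 'a
  defines "\<Psi> \<equiv> \<lambda>r. \<integral>z. \<phi> (fst z) * \<phi> (snd z) * sphere_wave e (r * norm (fst z - snd z)) \<partial>lborel2"
  assumes e: "norm e = 1" and d: "2 \<le> DIM('a)" and \<phi>: "integrable lborel \<phi>" and M: "\<And>x. \<bar>\<phi> x\<bar> \<le> M"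
    and \<Psi>0: "\<And>r. 0 \<le> \<Psi> r"
    and int: "integrable lborel (\<lambda>r. \<Psi> r * (r ^ (DIM('a) - 2) * indicator {0..} r))"
  shows "(\<integral>r. \<Psi> r * (r ^ (DIM('a) - 2) * indicator {0..} r) \<partial>lborel) =
    riesz_const DIM('a) * riesz_energy \<phi>"
proof -
  define d where "d = DIM('a)"
  have d2: "2 \<le> d" using d by (simp add: d_def)
  let ?I = "\<integral>r. \<Psi> r * (r ^ (d - 2) * indicator {0..} r) \<partial>lborel"
  define \<omega> where "\<omega> = sphere_area d"
  have \<omega>: "0 < \<omega>" unfolding \<omega>_def using d2 by (intro sphere_area_pos) auto
  define LL where "LL = (lborel \<Otimes>\<^sub>M lborel :: ('a \<times> 'a) measure)"
  interpret LL: sigma_finite_measure LL unfolding LL_def by (rule lborel_pair.sigma_finite_measure_axioms)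
  interpret RL: pair_sigma_finite "lborel :: real measure" LL ..
  define F where "F z = \<phi> (fst z) * \<phi> (snd z)" for z :: "'a \<times> 'a"
  define k where "k z = norm (fst z - snd z)" for z :: "'a \<times> 'a"
  have [measurable]: "\<phi> \<in> borel_measurable borel" using \<phi> by auto
  have [measurable]: "F \<in> borel_measurable LL" "k \<in> borel_measurable LL"
    unfolding F_def[abs_def] k_def[abs_def] LL_def by measurable
  have Fi: "integrable LL F" unfolding LL_def F_def[abs_def] by (rule integrable_lborel_pair_mult[OF \<phi> \<phi>])
  have \<Psi>_eq: "\<Psi> r = (\<integral>z. F z * sphere_wave e (r * k z) \<partial>LL)" for r
    unfolding \<Psi>_def F_def k_def LL_def ..
  have [measurable]: "\<Psi> \<in> borel_measurable borel" unfolding \<Psi>_eq[abs_def] by measurable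
  have \<Psi>b: "\<bar>\<Psi> r\<bar> \<le> (\<integral>z. \<bar>F z\<bar> \<partial>LL)" for r
  proof -
    have "\<bar>\<Psi> r\<bar> \<le> (\<integral>z. norm (F z * sphere_wave e (r * k z)) \<partial>LL)"
      unfolding \<Psi>_eq real_norm_def[symmetric] by (rule integral_norm_bound)
    also have "\<dots> \<le> (\<integral>z. \<bar>F z\<bar> \<partial>LL)"
    proof (rule integral_mono)
      have "integrable LL (\<lambda>z. F z * sphere_wave e (r * k z))"
        by (rule integrable_bound[OF Fi]) (auto simp: abs_mult intro!: mult_left_le sphere_wave_bound)
      then show "integrable LL (\<lambda>z. norm (F z * sphere_wave e (r * k z)))" by (rule integrable_norm)
    qed (use Fi sphere_wave_bound in \<open>auto simp: abs_mult intro!: mult_left_le\<close>)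
    finally show ?thesis .
  qed
  define g where "g s r = exp (- s * r\<^sup>2) * (r ^ (d - 1) * indicator {0..} r)" for s r :: real
  have [measurable]: "g s \<in> borel_measurable borel" for s unfolding g_def[abs_def] by measurable
  have g0: "0 \<le> g s r" for s r unfolding g_def by (simp add: indicator_def)
  have gi: "integrable lborel (g s)" if "0 < s" for s
    using sphere_wave_gaussian(1)[OF e that, of 0] unfolding g_def[abs_def] d_def by simp
  define E where "E s z = sqrt (pi / s) ^ d * exp (- (k z)\<^sup>2 / (4 * s))" for s z
  have E0: "0 \<le> E s z" if "0 < s" for s z unfolding E_def using that by simp
  have gE: "(\<integral>r. sphere_wave e (r * k z) * g s r \<partial>lborel) = E s z / \<omega>" if "0 < s" for s z
    using sphere_wave_gaussian(2)[OF e that, of "k z"] unfolding g_def E_def \<omega>_def d_def by (simp add: k_def mult.assoc)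
  define H where "H s = (\<integral>r. \<Psi> r * g s r \<partial>lborel)" for s
  have Hi: "integrable lborel (\<lambda>r. \<Psi> r * g s r)" if "0 < s" for s
  proof (rule integrable_bound[OF integrable_mult_right[OF gi[OF that], of "\<integral>z. \<bar>F z\<bar> \<partial>LL"]])
    have "0 \<le> (\<integral>z. \<bar>F z\<bar> \<partial>LL)" by simp
    then show "AE r in lborel. norm (\<Psi> r * g s r) \<le> norm ((\<integral>z. \<bar>F z\<bar> \<partial>LL) * g s r)"
      using \<Psi>b g0 by (auto simp: abs_mult intro!: mult_right_mono)
  qed measurable
  have H: "H s = (\<integral>z. F z * E s z / \<omega> \<partial>LL)" if s: "0 < s" for s
  proof -
    have fi: "integrable (lborel \<Otimes>\<^sub>M LL) (\<lambda>(r, z). F z * sphere_wave e (r * k z) * g s r)"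
    proof (rule RL.Fubini_integrable)
      have b: "norm (F z * sphere_wave e (r * k z) * g s r) \<le> \<bar>F z\<bar> * g s r" for z r
        using g0[of s r] sphere_wave_bound[of e "r * k z"] by (auto simp: abs_mult intro!: mult_right_mono mult_left_le)
      have i1: "integrable LL (\<lambda>z. F z * sphere_wave e (r * k z) * g s r)" for r
        by (rule integrable_bound[OF integrable_mult_left[OF integrable_abs[OF Fi], of "g s r"]])
           (use b g0 in \<open>auto simp: abs_mult\<close>)
      then show "AE r in lborel. integrable LL (\<lambda>z. case (r, z) of (r, z) \<Rightarrow> F z * sphere_wave e (r * k z) * g s r)" by simp
      have "(\<integral>z. norm (F z * sphere_wave e (r * k z) * g s r) \<partial>LL) \<le> (\<integral>z. \<bar>F z\<bar> * g s r \<partial>LL)" for r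
        using Fi b by (intro integral_mono integrable_norm i1) auto
      then have "(\<integral>z. norm (F z * sphere_wave e (r * k z) * g s r) \<partial>LL) \<le> (\<integral>z. \<bar>F z\<bar> \<partial>LL) * g s r" for r by simp
      moreover have "0 \<le> (\<integral>z. norm (F z * sphere_wave e (r * k z) * g s r) \<partial>LL)" for r by simp
      ultimately show "integrable lborel (\<lambda>r. \<integral>z. norm (case (r, z) of (r, z) \<Rightarrow> F z * sphere_wave e (r * k z) * g s r) \<partial>LL)"
        by (intro integrable_bound[OF integrable_mult_right[OF gi[OF s], of "\<integral>z. \<bar>F z\<bar> \<partial>LL"]] AE_I2)
           (auto intro: order_trans[OF _ abs_ge_self])
    qed measurable
    have "H s = (\<integral>r. (\<integral>z. F z * sphere_wave e (r * k z) * g s r \<partial>LL) \<partial>lborel)"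
      unfolding H_def \<Psi>_eq by simp
    also have "\<dots> = (\<integral>z. (\<integral>r. F z * sphere_wave e (r * k z) * g s r \<partial>lborel) \<partial>LL)"
      by (rule RL.Fubini_integral[symmetric, OF fi])
    also have "\<dots> = (\<integral>z. F z * (E s z / \<omega>) \<partial>LL)" by (simp only: mult.assoc integral_mult_right_zero gE[OF s])
    finally show ?thesis by simp
  qed
  define c where "c = 1 / sqrt pi"
  have c0: "0 < c" by (simp add: c_def)
  define i where "i s = indicator {0<..} s * s powr (- 1 / 2)" for s :: real
  have i0: "0 \<le> i s" for s unfolding i_def by (simp add: indicator_def)
  have [measurable]: "i \<in> borel_measurable borel" unfolding i_def[abs_def] by measurable
  \<comment> \<open>The factor 1/r as a superposition of Gaussians.\<close>
  have inv: "ennreal (1 / r) = (\<integral>\<^sup>+s. ennreal (c * (i s * exp (- s * r\<^sup>2))) \<partial>lborel)" if r: "0 < r" for r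
  proof -
    have "(\<integral>\<^sup>+s. ennreal (c * (i s * exp (- s * r\<^sup>2))) \<partial>lborel) = (\<integral>\<^sup>+s. ennreal c * (ennreal (s powr (1 / 2 - 1) * exp (- r\<^sup>2 * s)) * indicator {0<..} s) \<partial>lborel)"
      using c0 by (intro nn_integral_cong) (auto simp: i_def indicator_def ennreal_mult' mult.commute)
    also have "\<dots> = ennreal c * ennreal (Gamma (1 / 2) / (r\<^sup>2) powr (1 / 2))"
      using r by (subst nn_integral_cmult, measurable, subst nn_integral_Gamma) auto
    also have "\<dots> = ennreal (1 / r)"
      using r c0 by (subst ennreal_mult'[symmetric]) (auto simp: c_def Gamma_one_half_real powr_half_sqrt)
    finally show ?thesis ..
  qed
  have "ennreal ?I = (\<integral>\<^sup>+r. ennreal (\<Psi> r * (r ^ (d - 2) * indicator {0..} r)) \<partial>lborel)"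
    using int \<Psi>0 unfolding d_def by (intro nn_integral_eq_integral[symmetric]) (auto simp: indicator_def)
  also have "\<dots> = (\<integral>\<^sup>+r. (\<integral>\<^sup>+s. ennreal (c * i s) * ennreal (\<Psi> r * g s r) \<partial>lborel) \<partial>lborel)"
  proof (rule nn_integral_cong_AE)
    have "AE r in lborel. r \<noteq> (0::real)" by (rule AE_lborel_singleton)
    then show "AE r in lborel. ennreal (\<Psi> r * (r ^ (d - 2) * indicator {0..} r)) = (\<integral>\<^sup>+s. ennreal (c * i s) * ennreal (\<Psi> r * g s r) \<partial>lborel)"
    proof eventually_elim
      fix r :: real assume "r \<noteq> 0"
      show "ennreal (\<Psi> r * (r ^ (d - 2) * indicator {0..} r)) = (\<integral>\<^sup>+s. ennreal (c * i s) * ennreal (\<Psi> r * g s r) \<partial>lborel)"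
      proof (cases "0 < r")
        case True
        have P0: "0 \<le> \<Psi> r * r ^ (d - 1)" using \<Psi>0 True by simp
        have "r ^ (d - 2) = r ^ (d - 1) * (1 / r)"
        proof -
          have "d - 1 = Suc (d - 2)" using d2 by auto
          then show ?thesis using True by simp
        qed
        then have "ennreal (\<Psi> r * (r ^ (d - 2) * indicator {0..} r)) = ennreal (\<Psi> r * r ^ (d - 1)) * ennreal (1 / r)"
          using True P0 by (subst ennreal_mult'[symmetric]) auto
        also have "\<dots> = (\<integral>\<^sup>+s. ennreal (\<Psi> r * r ^ (d - 1)) * ennreal (c * (i s * exp (- s * r\<^sup>2))) \<partial>lborel)"
          unfolding inv[OF True] by (rule nn_integral_cmult[symmetric]) measurable
        also have "\<dots> = (\<integral>\<^sup>+s. ennreal (c * i s) * ennreal (\<Psi> r * g s r) \<partial>lborel)"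
        proof (rule nn_integral_cong)
          fix s
          have "(\<Psi> r * r ^ (d - 1)) * (c * (i s * exp (- s * r\<^sup>2))) = (c * i s) * (\<Psi> r * g s r)"
            unfolding g_def using True by simp
          moreover have "0 \<le> c * i s" using c0 i0 by simp
          ultimately show "ennreal (\<Psi> r * r ^ (d - 1)) * ennreal (c * (i s * exp (- s * r\<^sup>2))) = ennreal (c * i s) * ennreal (\<Psi> r * g s r)"
            using P0 by (simp only: ennreal_mult'[symmetric])
        qed
        finally show ?thesis .
      next
        case False
        then have "r < 0" using \<open>r \<noteq> 0\<close> by simp
        then show ?thesis by (simp add: g_def)
      qed
    qed
  qed
  also have "\<dots> = (\<integral>\<^sup>+s. (\<integral>\<^sup>+r. ennreal (c * i s) * ennreal (\<Psi> r * g s r) \<partial>lborel) \<partial>lborel)"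
  proof (rule lborel_pair.Fubini', goal_cases)
    case 1
    show ?case unfolding split_beta g_def by measurable
  qed
  also have "\<dots> = (\<integral>\<^sup>+s. ennreal (c * i s * H s) \<partial>lborel)"
  proof (rule nn_integral_cong)
    fix s :: real
    show "(\<integral>\<^sup>+r. ennreal (c * i s) * ennreal (\<Psi> r * g s r) \<partial>lborel) = ennreal (c * i s * H s)"
    proof (cases "0 < s")
      case True
      have "(\<integral>\<^sup>+r. ennreal (\<Psi> r * g s r) \<partial>lborel) = ennreal (H s)"
        unfolding H_def using Hi[OF True] \<Psi>0 g0 by (intro nn_integral_eq_integral) auto
      then show ?thesis using c0 i0[of s] by (simp add: nn_integral_cmult ennreal_mult')
    next
      case False
      then have "i s = 0" by (simp add: i_def)
      then show ?thesis by simp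
    qed
  qed
  finally have nnA: "ennreal ?I = (\<integral>\<^sup>+s. ennreal (c * i s * H s) \<partial>lborel)" .
  have H0: "0 \<le> c * i s * H s" for s
    unfolding H_def using c0 i0 \<Psi>0 g0 by (intro mult_nonneg_nonneg integral_nonneg_AE) auto
  have [measurable]: "H \<in> borel_measurable borel" unfolding H_def[abs_def] g_def by measurable
  have A: "?I = (\<integral>s. c * i s * H s \<partial>lborel)"
  proof -
    have "(\<integral>s. c * i s * H s \<partial>lborel) = enn2real (\<integral>\<^sup>+s. ennreal (c * i s * H s) \<partial>lborel)"
      by (rule integral_eq_nn_integral) (use H0 in auto)
    also have "\<dots> = enn2real (ennreal ?I)" unfolding nnA ..
    also have "\<dots> = ?I"
      using \<Psi>0 by (intro enn2real_ennreal integral_nonneg_AE AE_I2) (auto simp: indicator_def)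
    finally show ?thesis ..
  qed
  define \<rho> where "\<rho> = sqrt pi ^ d * Gamma ((real d - 1) / 2) * 2 ^ (d - 1)"
  have \<rho>0: "0 < \<rho>" unfolding \<rho>_def using d2 by (intro mult_pos_pos Gamma_real_pos) auto
  have kern: "(\<integral>\<^sup>+s. ennreal (i s * E s z) \<partial>lborel) = ennreal (\<rho> / k z ^ (d - 1))" if "0 < k z" for z
  proof -
    have "(\<integral>\<^sup>+s. ennreal (i s * E s z) \<partial>lborel) = (\<integral>\<^sup>+s. ennreal (s powr (- 1 / 2) * (sqrt (pi / s) ^ d * exp (- (k z)\<^sup>2 / (4 * s)))) * indicator {0<..} s \<partial>lborel)"
      unfolding i_def E_def by (intro nn_integral_cong) (auto simp: indicator_def)
    also have "\<dots> = ennreal (\<rho> / k z ^ (d - 1))" unfolding \<rho>_def by (rule nn_integral_riesz_kernel[OF that d2])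
    finally show ?thesis .
  qed
  have iE0: "0 \<le> i s * E s z" for s z
    using E0[of s z] i0[of s] by (cases "0 < s") (auto simp: i_def)
  have iEm[measurable]: "(\<lambda>(s, z). i s * E s z) \<in> borel_measurable (lborel \<Otimes>\<^sub>M LL)" unfolding E_def by measurable
  have iEm1[measurable]: "(\<lambda>s. i s * E s z) \<in> borel_measurable borel" for z unfolding E_def by measurable
  have iEm2[measurable]: "(\<lambda>z. i s * E s z) \<in> borel_measurable LL" for s unfolding E_def by measurable
  have kpos: "AE z in LL. 0 < k z"
  proof -
    have "AE x in (lborel :: 'a measure). AE y in (lborel :: 'a measure). 0 < k (x, y)"
    proof (rule AE_I2)
      fix x :: 'a
      have "AE y in lborel. y \<noteq> x" by (rule AE_lborel_singleton)
      then show "AE y in lborel. 0 < k (x, y)" by eventually_elim (auto simp: k_def)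
    qed
    moreover have "{z \<in> space lborel2. 0 < k z} \<in> sets lborel2"
      unfolding k_def by measurable
    ultimately show ?thesis unfolding LL_def by (intro lborel_pair.AE_pair_measure) auto
  qed
  have Ri: "integrable LL (\<lambda>z. F z / k z ^ (d - 1))"
    unfolding LL_def F_def k_def d_def by (rule riesz_energy_integrable[OF \<phi> M])
  have kernB: "integrable lborel (\<lambda>s. i s * E s z)" "(\<integral>s. i s * E s z \<partial>lborel) = \<rho> / k z ^ (d - 1)" if "0 < k z" for z
  proof -
    show "integrable lborel (\<lambda>s. i s * E s z)"
      by (intro integrableI_nonneg) (use iE0 kern[OF that] in auto)
    show "(\<integral>s. i s * E s z \<partial>lborel) = \<rho> / k z ^ (d - 1)"
      using kern[OF that] \<rho>0 that iE0 by (subst integral_eq_nn_integral) auto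
  qed
  interpret LR: pair_sigma_finite LL "lborel :: real measure" ..
  have fi: "integrable (LL \<Otimes>\<^sub>M lborel) (\<lambda>(z, s). F z * (i s * E s z))"
  proof -
    show ?thesis
    proof (rule LR.Fubini_integrable)
      show "(\<lambda>(z, s). F z * (i s * E s z)) \<in> borel_measurable (LL \<Otimes>\<^sub>M lborel)" unfolding E_def by measurable
      show "AE z in LL. integrable lborel (\<lambda>s. case (z, s) of (z, s) \<Rightarrow> F z * (i s * E s z))"
        using kpos by eventually_elim (use kernB in auto)
      have m1: "(\<lambda>z. \<integral>s. norm (F z * (i s * E s z)) \<partial>lborel) \<in> borel_measurable LL" unfolding E_def by measurable
      have "AE z in LL. \<rho> * \<bar>F z / k z ^ (d - 1)\<bar> = (\<integral>s. norm (case (z, s) of (z, s) \<Rightarrow> F z * (i s * E s z)) \<partial>lborel)"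
        using kpos
      proof eventually_elim
        fix z assume z: "0 < k z"
        have "(\<integral>s. norm (F z * (i s * E s z)) \<partial>lborel) = (\<integral>s. \<bar>F z\<bar> * (i s * E s z) \<partial>lborel)"
          by (intro integral_cong refl) (simp only: real_norm_def abs_mult[of "F z"] abs_of_nonneg[OF iE0])
        then show "\<rho> * \<bar>F z / k z ^ (d - 1)\<bar> = (\<integral>s. norm (case (z, s) of (z, s) \<Rightarrow> F z * (i s * E s z)) \<partial>lborel)"
          using kernB(2)[OF z] z by (simp add: abs_mult)
      qed
      then show "integrable LL (\<lambda>z. \<integral>s. norm (case (z, s) of (z, s) \<Rightarrow> F z * (i s * E s z)) \<partial>lborel)"
        using m1 by (intro integrable_cong_AE_imp[OF integrable_mult_right[OF integrable_abs[OF Ri]]]) (auto simp only: split)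
    qed
  qed
  have fi': "integrable (lborel \<Otimes>\<^sub>M LL) (\<lambda>(s, z). F z * (i s * E s z))"
    using LR.integrable_product_swap[OF fi] by (simp add: split_beta)
  have "(\<integral>s. c * i s * H s \<partial>lborel) = (\<integral>s. (c / \<omega>) * (\<integral>z. F z * (i s * E s z) \<partial>LL) \<partial>lborel)"
  proof (rule integral_cong[OF refl])
    fix s :: real
    show "c * i s * H s = (c / \<omega>) * (\<integral>z. F z * (i s * E s z) \<partial>LL)"
    proof (cases "0 < s")
      case True
      have "(\<integral>z. F z * E s z / \<omega> \<partial>LL) = (\<integral>z. F z * E s z \<partial>LL) / \<omega>" by simp
      moreover have "(\<integral>z. F z * (i s * E s z) \<partial>LL) = i s * (\<integral>z. F z * E s z \<partial>LL)"
        by (subst integral_mult_right_zero[symmetric]) (intro integral_cong refl, simp add: mult_ac)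
      ultimately show ?thesis unfolding H[OF True] by simp
    next
      case False
      then have "i s = 0" by (simp add: i_def)
      then show ?thesis by simp
    qed
  qed
  also have "\<dots> = (c / \<omega>) * (\<integral>s. (\<integral>z. F z * (i s * E s z) \<partial>LL) \<partial>lborel)" by simp
  also have "(\<integral>s. (\<integral>z. F z * (i s * E s z) \<partial>LL) \<partial>lborel) = (\<integral>z. (\<integral>s. F z * (i s * E s z) \<partial>lborel) \<partial>LL)"
    by (rule RL.Fubini_integral[symmetric, OF fi'])
  also have "\<dots> = (\<integral>z. \<rho> * (F z / k z ^ (d - 1)) \<partial>LL)"
  proof (rule integral_cong_AE)
    show "AE z in LL. (\<integral>s. F z * (i s * E s z) \<partial>lborel) = \<rho> * (F z / k z ^ (d - 1))"
      using kpos by eventually_elim (simp add: kernB)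
  qed (unfold E_def, measurable)
  also have "\<dots> = \<rho> * (\<integral>z. F z / k z ^ (d - 1) \<partial>LL)" by (rule integral_mult_right_zero)
  finally have "(\<integral>s. c * i s * H s \<partial>lborel) = (c / \<omega> * \<rho>) * (\<integral>z. F z / k z ^ (d - 1) \<partial>LL)" by simp
  moreover have "c / \<omega> * \<rho> = riesz_const d" unfolding c_def \<omega>_def \<rho>_def riesz_const_def by simp
  ultimately have "(\<integral>s. c * i s * H s \<partial>lborel) = riesz_const d * (\<integral>z. F z / k z ^ (d - 1) \<partial>LL)"
    by (simp only:)
  with A have "?I = riesz_const d * (\<integral>z. F z / k z ^ (d - 1) \<partial>LL)"
    by (simp only:)
  then show ?thesis unfolding d_def F_def k_def LL_def .
qed

section \<open>Schwartz functions and the Fourier transform\<close>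

lemma integrable_norm_decay:
  "integrable lborel (\<lambda>x::'a::euclidean_space. 1 / (1 + norm x) ^ (DIM('a) + 1))"
proof (rule integrableI_nonneg)
  let ?A = "sphere_area DIM('a)"
  have A: "0 < ?A" by (rule sphere_area_pos) simp
  have "(\<integral>\<^sup>+x. ennreal (1 / (1 + norm (x::'a)) ^ (DIM('a) + 1)) \<partial>lborel) =
     (\<integral>\<^sup>+r. ennreal (1 / (1 + r) ^ (DIM('a) + 1)) * (ennreal (?A * r ^ (DIM('a) - 1)) * indicator {0..} r) \<partial>lborel)"
    by (rule nn_integral_radial) measurable
  also have "\<dots> \<le> (\<integral>\<^sup>+r. ennreal ?A * ennreal (1 / (1 + r)\<^sup>2 * indicator {0..} r) \<partial>lborel)"
  proof (rule nn_integral_mono)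
    fix r :: real
    show "ennreal (1 / (1 + r) ^ (DIM('a) + 1)) * (ennreal (?A * r ^ (DIM('a) - 1)) * indicator {0..} r) \<le> ennreal ?A * ennreal (1 / (1 + r)\<^sup>2 * indicator {0..} r)"
    proof (cases "0 \<le> r")
      case True
      have dd: "DIM('a) - 1 + 2 = DIM('a) + 1" using DIM_positive[where 'a='a] by linarith
      have p: "(1 + r) ^ (DIM('a) + 1) = (1 + r) ^ (DIM('a) - 1) * (1 + r)\<^sup>2" by (simp only: power_add[symmetric] dd)
      have "r ^ (DIM('a) - 1) / (1 + r) ^ (DIM('a) + 1) \<le> (1 + r) ^ (DIM('a) - 1) / (1 + r) ^ (DIM('a) + 1)"
        using True by (intro divide_right_mono power_mono) auto
      also have "\<dots> = 1 / (1 + r)\<^sup>2" unfolding p using True by simp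
      finally have "?A * (r ^ (DIM('a) - 1) / (1 + r) ^ (DIM('a) + 1)) \<le> ?A * (1 / (1 + r)\<^sup>2)"
        using A by (intro mult_left_mono) auto
      then show ?thesis using True A
        by (simp add: ennreal_mult'[symmetric] ennreal_leI mult.commute)
    qed simp
  qed
  also have "\<dots> = ennreal ?A * (\<integral>\<^sup>+r. ennreal (1 / (1 + r)\<^sup>2 * indicator {0..} r) \<partial>lborel)"
    by (rule nn_integral_cmult) measurable
  also have "\<dots> < \<infinity>"
    using integrable_inverse_square unfolding integrable_iff_bounded by (auto simp: ennreal_mult_less_top indicator_def)
  finally show "(\<integral>\<^sup>+x. ennreal (1 / (1 + norm (x::'a)) ^ (DIM('a) + 1)) \<partial>lborel) < \<infinity>" .
qed auto

lemma has_derivative_along: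
  fixes f :: "'a::euclidean_space \<Rightarrow> real"
  assumes "f differentiable (at (x + t *\<^sub>R b))"
  shows "((\<lambda>s. f (x + s *\<^sub>R b)) has_real_derivative partial_deriv b f (x + t *\<^sub>R b)) (at t)"
proof -
  obtain f' where f': "(f has_derivative f') (at (x + t *\<^sub>R b))" using assms unfolding differentiable_def by blast
  have lin: "linear f'" using f' by (rule has_derivative_linear)
  have g: "((\<lambda>s. f (y + s *\<^sub>R b)) has_real_derivative f' b) (at u)" if "y + u *\<^sub>R b = x + t *\<^sub>R b" for y u
  proof -
    have "((\<lambda>s. y + s *\<^sub>R b) has_derivative (\<lambda>s. s *\<^sub>R b)) (at u)" by (auto intro!: derivative_eq_intros)
    from has_derivative_compose[OF this, of f f'] f' that
    have "((\<lambda>s. f (y + s *\<^sub>R b)) has_derivative (\<lambda>s. f' (s *\<^sub>R b))) (at u)" by simp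
    then show ?thesis by (simp add: has_field_derivative_def linear_cmul[OF lin] mult.commute[of _ "f' b"])
  qed
  have "partial_deriv b f (x + t *\<^sub>R b) = f' b"
    unfolding partial_deriv_def by (rule DERIV_imp_deriv[OF g]) simp
  then show ?thesis using g[of x t] by simp
qed

lemma partials_Nil[simp]: "partials [] f = f" by (simp add: partials_def)
lemma partials_Cons: "partials (b # bs) f = partial_deriv b (partials bs f)" by (simp add: partials_def)

lemma smooth_fun_partials_continuous:
  assumes "smooth_fun f" "bs \<in> lists Basis"
  shows "continuous_on UNIV (partials bs f)" "partials bs f \<in> borel_measurable borel"
proof -
  show c: "continuous_on UNIV (partials bs f)"
    using assms unfolding smooth_fun_def by (intro differentiable_imp_continuous_on) (auto simp: differentiable_on_def)
  show "partials bs f \<in> borel_measurable borel" by (rule borel_measurable_continuous_onI[OF c])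
qed

lemma schwartz_decay:
  assumes "\<phi> \<in> schwartz_space" "bs \<in> lists Basis"
  obtains C where "0 \<le> C" "\<And>x. \<bar>partials bs \<phi> x\<bar> \<le> C / (1 + norm x) ^ k"
proof -
  have "bdd_above (range (\<lambda>x. (1 + norm x) ^ k * \<bar>partials bs \<phi> x\<bar>))"
    using assms unfolding schwartz_space_def by auto
  then obtain C where C: "\<And>x. (1 + norm x) ^ k * \<bar>partials bs \<phi> x\<bar> \<le> C" unfolding bdd_above_def by auto
  have p: "0 < (1 + norm x) ^ k" for x :: 'a by (intro zero_less_power) (simp add: add_pos_nonneg)
  have "0 \<le> C" using C[of 0] by (meson abs_ge_zero mult_nonneg_nonneg order_trans p less_imp_le)
  moreover have "\<bar>partials bs \<phi> x\<bar> \<le> C / (1 + norm x) ^ k" for x using C[of x] p[of x] by (simp add: pos_le_divide_eq mult.commute)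
  ultimately show ?thesis by (rule that)
qed

lemma schwartz_smooth: "\<phi> \<in> schwartz_space \<Longrightarrow> smooth_fun \<phi>" unfolding schwartz_space_def by simp

lemma schwartz_partials_integrable:
  fixes \<phi> :: "'a::euclidean_space \<Rightarrow> real"
  assumes "\<phi> \<in> schwartz_space" "bs \<in> lists Basis"
  shows "integrable lborel (partials bs \<phi>)"
proof -
  obtain C where C: "0 \<le> C" "\<And>x. \<bar>partials bs \<phi> x\<bar> \<le> C / (1 + norm x) ^ (DIM('a) + 1)" using schwartz_decay[OF assms] by blast
  show ?thesis
  proof (rule integrable_bound[OF integrable_mult_right[OF integrable_norm_decay, of C]])
    show "partials bs \<phi> \<in> borel_measurable lborel" using smooth_fun_partials_continuous(2)[OF schwartz_smooth assms(2)] assms(1) by simp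
    show "AE x in lborel. norm (partials bs \<phi> x) \<le> norm (C * (1 / (1 + norm x) ^ (DIM('a) + 1)))"
      using C by (auto intro!: AE_I2)
  qed
qed

definition fourier :: "('a::euclidean_space \<Rightarrow> real) \<Rightarrow> 'a \<Rightarrow> complex" where
  "fourier f v = (\<integral>x. of_real (f x) * iexp (x \<bullet> v) \<partial>lborel)"

lemma fourier_integrable:
  assumes "integrable lborel f"
  shows "integrable lborel (\<lambda>x. of_real (f x) * iexp (x \<bullet> v))"
proof -
  have [measurable]: "f \<in> borel_measurable borel" using assms by auto
  show ?thesis by (rule integrable_bound[OF assms]) (auto simp: norm_mult)
qed

lemma fourier_bound:
  assumes "integrable lborel f"
  shows "norm (fourier f v) \<le> (\<integral>x. \<bar>f x\<bar> \<partial>lborel)"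
  unfolding fourier_def by (rule order_trans[OF integral_norm_bound]) (simp add: norm_mult)

lemma fourier_continuous:
  assumes f: "integrable lborel f"
  shows "continuous_on UNIV (fourier f)"
proof (rule continuous_at_imp_continuous_on, rule ballI)
  have [measurable]: "f \<in> borel_measurable borel" using f by auto
  fix v :: 'a
  show "isCont (fourier f) v"
    unfolding continuous_at_sequentially comp_def fourier_def
  proof (intro allI impI)
    fix X assume X: "X \<longlonglongrightarrow> v"
    show "(\<lambda>n. \<integral>x. of_real (f x) * iexp (x \<bullet> X n) \<partial>lborel) \<longlonglongrightarrow> (\<integral>x. of_real (f x) * iexp (x \<bullet> v) \<partial>lborel)"
    proof (rule integral_dominated_convergence[where w="\<lambda>x. \<bar>f x\<bar>"])
      show "AE x in lborel. (\<lambda>n. of_real (f x) * iexp (x \<bullet> X n)) \<longlonglongrightarrow> of_real (f x) * iexp (x \<bullet> v)"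
        by (auto intro!: AE_I2 tendsto_intros X)
    qed (use f in \<open>auto simp: norm_mult\<close>)
  qed
qed

lemma fourier_translate:
  assumes f: "integrable lborel f"
  shows "fourier (\<lambda>x. f (x + t *\<^sub>R b)) v = iexp (- t * (b \<bullet> v)) * fourier f v"
proof -
  have [measurable]: "f \<in> borel_measurable borel" using f by auto
  have "fourier f v = (\<integral>x. of_real (f x) * iexp (x \<bullet> v) \<partial>distr lborel borel ((+) (t *\<^sub>R b)))"
    unfolding fourier_def by (simp add: lborel_distr_plus)
  also have "\<dots> = (\<integral>x. of_real (f (t *\<^sub>R b + x)) * iexp ((t *\<^sub>R b + x) \<bullet> v) \<partial>lborel)"
    by (rule integral_distr) auto
  also have "\<dots> = (\<integral>x. iexp (t * (b \<bullet> v)) * (of_real (f (x + t *\<^sub>R b)) * iexp (x \<bullet> v)) \<partial>lborel)"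
    by (intro integral_cong refl) (simp add: inner_add_left exp_add distrib_left add.commute mult_ac)
  also have "\<dots> = iexp (t * (b \<bullet> v)) * fourier (\<lambda>x. f (x + t *\<^sub>R b)) v" unfolding fourier_def by simp
  finally show ?thesis by (simp add: mult.assoc[symmetric] flip: exp_add)
qed

text \<open>A translation of the function is a modulation of the transform, so difference quotients have explicit
  transforms; both sides pass to the limit by dominated convergence.\<close>

lemma fourier_partial:
  fixes \<phi> :: "'a::euclidean_space \<Rightarrow> real"
  assumes \<phi>: "\<phi> \<in> schwartz_space" and bs: "b # bs \<in> lists Basis"
  shows "fourier (partials (b # bs) \<phi>) v = - \<i> * of_real (b \<bullet> v) * fourier (partials bs \<phi>) v"
proof -
  define f where "f = partials bs \<phi>"
  define g where "g = partials (b # bs) \<phi>"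
  have bs': "bs \<in> lists Basis" and b: "b \<in> Basis" using bs by auto
  have fi: "integrable lborel f" unfolding f_def by (rule schwartz_partials_integrable[OF \<phi> bs'])
  have [measurable]: "f \<in> borel_measurable borel" "g \<in> borel_measurable borel"
    unfolding f_def g_def using smooth_fun_partials_continuous(2)[OF schwartz_smooth[OF \<phi>]] bs bs' by auto
  have der: "((\<lambda>s. f (x + s *\<^sub>R b)) has_real_derivative g (x + t *\<^sub>R b)) (at t)" for x t
    unfolding f_def g_def partials_Cons
    by (rule has_derivative_along) (use schwartz_smooth[OF \<phi>] bs' in \<open>auto simp: smooth_fun_def\<close>)
  define k where "k = DIM('a) + 1"
  obtain C where C: "0 \<le> C" "\<And>x. \<bar>g x\<bar> \<le> C / (1 + norm x) ^ k" unfolding g_def using schwartz_decay[OF \<phi> bs] by blast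
  define e where "e n = inverse (real (Suc n))" for n
  have e: "0 < e n" "e n \<le> 1" for n unfolding e_def by (auto simp: field_simps)
  have e_lim: "e \<longlonglongrightarrow> 0" unfolding e_def by (rule LIMSEQ_inverse_real_of_nat)
  define q where "q n x = (f (x + e n *\<^sub>R b) - f x) / e n" for n x
  have [measurable]: "q n \<in> borel_measurable borel" for n unfolding q_def[abs_def] by measurable
  have qb: "\<bar>q n x\<bar> \<le> C * 2 ^ k * (1 / (1 + norm x) ^ k)" for n x
  proof -
    obtain z where z: "0 < z" "z < e n" "f (x + e n *\<^sub>R b) - f (x + 0 *\<^sub>R b) = (e n - 0) * g (x + z *\<^sub>R b)"
      using MVT2[OF e(1)[of n], of "\<lambda>s. f (x + s *\<^sub>R b)" "\<lambda>s. g (x + s *\<^sub>R b)"] der by blast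
    then have "q n x = g (x + z *\<^sub>R b)" unfolding q_def using e(1)[of n] by simp
    then have "\<bar>q n x\<bar> \<le> C / (1 + norm (x + z *\<^sub>R b)) ^ k" using C(2) by simp
    moreover have "1 + norm x \<le> 2 * (1 + norm (x + z *\<^sub>R b))"
    proof -
      have "norm x \<le> norm (x + z *\<^sub>R b) + norm (z *\<^sub>R b)" using norm_triangle_ineq4[of "x + z *\<^sub>R b" "z *\<^sub>R b"] by simp
      also have "norm (z *\<^sub>R b) \<le> 1" using z e(2)[of n] b by simp
      finally have "norm x \<le> norm (x + z *\<^sub>R b) + 1" by simp
      then have "1 + norm x \<le> 2 + norm (x + z *\<^sub>R b)" by simp
      also have "\<dots> \<le> 2 * (1 + norm (x + z *\<^sub>R b))" by simp
      finally show ?thesis .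
    qed
    then have "(1 + norm x) ^ k \<le> (2 * (1 + norm (x + z *\<^sub>R b))) ^ k" by (intro power_mono) auto
    then have "(1 + norm x) ^ k \<le> 2 ^ k * (1 + norm (x + z *\<^sub>R b)) ^ k" by (simp only: power_mult_distrib)
    moreover have p: "0 < (1 + norm y) ^ k" for y :: 'a by (intro zero_less_power) (simp add: add_pos_nonneg)
    ultimately have "1 / (1 + norm (x + z *\<^sub>R b)) ^ k \<le> 2 ^ k * (1 / (1 + norm x) ^ k)"
      using p[of x] p[of "x + z *\<^sub>R b"] by (simp add: field_simps)
    then have "C * (1 / (1 + norm (x + z *\<^sub>R b)) ^ k) \<le> C * (2 ^ k * (1 / (1 + norm x) ^ k))" using C(1) by (rule mult_left_mono)
    with \<open>\<bar>q n x\<bar> \<le> _\<close> show ?thesis by simp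
  qed
  have "(\<lambda>n. fourier (q n) v) \<longlonglongrightarrow> fourier g v"
    unfolding fourier_def
  proof (rule integral_dominated_convergence[where w="\<lambda>x. C * 2 ^ k * (1 / (1 + norm x) ^ k)"])
    show "integrable lborel (\<lambda>x::'a. C * 2 ^ k * (1 / (1 + norm x) ^ k))"
      unfolding k_def by (intro integrable_mult_right integrable_norm_decay)
    show "AE x in lborel. norm (complex_of_real (q n x) * iexp (x \<bullet> v)) \<le> C * 2 ^ k * (1 / (1 + norm x) ^ k)" for n
      using qb by (intro AE_I2) (simp only: norm_mult norm_of_real norm_exp_i_times mult_1_right)
    show "AE x in lborel. (\<lambda>n. complex_of_real (q n x) * iexp (x \<bullet> v)) \<longlonglongrightarrow> complex_of_real (g x) * iexp (x \<bullet> v)"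
    proof (rule AE_I2)
      fix x
      have "((\<lambda>h. (f (x + (0 + h) *\<^sub>R b) - f (x + 0 *\<^sub>R b)) / h) \<longlongrightarrow> g (x + 0 *\<^sub>R b)) (at 0)"
        using der[of x 0] unfolding DERIV_def .
      then have "(\<lambda>n. q n x) \<longlonglongrightarrow> g x"
        using e(1) e_lim unfolding tendsto_at_iff_sequentially comp_def q_def by (auto simp: less_imp_neq[symmetric])
      then show "(\<lambda>n. complex_of_real (q n x) * iexp (x \<bullet> v)) \<longlonglongrightarrow> complex_of_real (g x) * iexp (x \<bullet> v)"
        by (intro tendsto_intros)
    qed
  qed measurable
  moreover have "fourier (q n) v = (iexp (- e n * (b \<bullet> v)) - 1) / of_real (e n) * fourier f v" for n
  proof -
    have ti: "integrable lborel (\<lambda>x. f (x + e n *\<^sub>R b))"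
    proof -
      have "integrable (distr lborel borel ((+) (e n *\<^sub>R b))) f" using fi by (simp add: lborel_distr_plus)
      then show ?thesis by (subst (asm) integrable_distr_eq) (auto simp: add.commute)
    qed
    have "fourier (q n) v = (\<integral>x. (of_real (f (x + e n *\<^sub>R b)) * iexp (x \<bullet> v) - of_real (f x) * iexp (x \<bullet> v)) / of_real (e n) \<partial>lborel)"
      unfolding fourier_def q_def by (intro integral_cong refl) (simp add: algebra_simps)
    also have "\<dots> = (fourier (\<lambda>x. f (x + e n *\<^sub>R b)) v - fourier f v) / of_real (e n)"
      unfolding integral_divide_zero fourier_def
      by (subst integral_diff[OF fourier_integrable[OF ti] fourier_integrable[OF fi]]) simp
    finally show ?thesis unfolding fourier_translate[OF fi] by (simp add: field_simps)
  qed
  moreover have "(\<lambda>n. (iexp (- e n * (b \<bullet> v)) - 1) / of_real (e n) * fourier f v) \<longlonglongrightarrow> (- \<i> * of_real (b \<bullet> v)) * fourier f v"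
  proof -
    have "((\<lambda>z. exp (z * (- \<i> * of_real (b \<bullet> v)))) has_field_derivative (- \<i> * of_real (b \<bullet> v))) (at 0)"
      by (auto intro!: derivative_eq_intros)
    then have l: "((\<lambda>h. (exp (h * (- \<i> * of_real (b \<bullet> v))) - 1) / h) \<longlongrightarrow> - \<i> * of_real (b \<bullet> v)) (at 0)"
      unfolding DERIV_def by simp
    have l1: "(\<lambda>n. complex_of_real (e n)) \<longlonglongrightarrow> 0" using tendsto_of_real[OF e_lim] by simp
    have l2: "complex_of_real (e n) \<in> UNIV - {0}" for n using e(1)[of n] by simp
    have "(\<lambda>n. (exp (of_real (e n) * (- \<i> * of_real (b \<bullet> v))) - 1) / of_real (e n)) \<longlonglongrightarrow> - \<i> * of_real (b \<bullet> v)"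
      using l[unfolded tendsto_at_iff_sequentially comp_def, rule_format, of "\<lambda>n. complex_of_real (e n)", OF l2 l1] .
    then have "(\<lambda>n. (iexp (- e n * (b \<bullet> v)) - 1) / of_real (e n)) \<longlonglongrightarrow> - \<i> * of_real (b \<bullet> v)"
      by (simp add: mult_ac)
    then show ?thesis by (intro tendsto_intros)
  qed
  ultimately show ?thesis unfolding f_def g_def using LIMSEQ_unique by simp
qed

lemma fourier_decay:
  fixes \<phi> :: "'a::euclidean_space \<Rightarrow> real"
  assumes \<phi>: "\<phi> \<in> schwartz_space"
  obtains C where "0 \<le> C" "\<And>v. norm (fourier \<phi> v) \<le> C / (1 + norm v) ^ n"
proof -
  define N where "N m b = (\<integral>x. \<bar>partials (replicate m b) \<phi> x\<bar> \<partial>lborel)" for m and b :: 'a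
  have N0: "0 \<le> N m b" for m b unfolding N_def by simp
  have rep: "replicate m b \<in> lists Basis" if "b \<in> Basis" for m and b :: 'a using that by (auto simp: in_lists_conv_set)
  have pow: "fourier (partials (replicate m b) \<phi>) v = (- \<i> * of_real (b \<bullet> v)) ^ m * fourier \<phi> v" if "b \<in> Basis" for m b v
  proof (induction m)
    case (Suc m)
    show ?case using fourier_partial[OF \<phi>, of b "replicate m b" v] rep[OF that, of "Suc m"] by (simp add: Suc)
  qed simp
  have bb: "\<bar>b \<bullet> v\<bar> ^ m * norm (fourier \<phi> v) \<le> N m b" if "b \<in> Basis" for m b v
  proof -
    have "\<bar>b \<bullet> v\<bar> ^ m * norm (fourier \<phi> v) = norm (fourier (partials (replicate m b) \<phi>) v)"
      unfolding pow[OF that] by (simp add: norm_mult norm_power)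
    also have "\<dots> \<le> N m b" unfolding N_def by (rule fourier_bound[OF schwartz_partials_integrable[OF \<phi> rep[OF that]]])
    finally show ?thesis .
  qed
  define D where "D = real DIM('a)"
  define C where "C = 2 ^ n * ((\<Sum>b\<in>(Basis::'a set). N 0 b) + D ^ n * (\<Sum>b\<in>(Basis::'a set). N n b))"
  have D1: "1 \<le> D" unfolding D_def using DIM_positive[where 'a='a] by linarith
  have main: "(1 + norm v) ^ n * norm (fourier \<phi> v) \<le> C" for v
  proof -
    have "\<exists>b\<in>Basis. norm v \<le> D * \<bar>b \<bullet> v\<bar>"
    proof (rule ccontr)
      assume "\<not> ?thesis"
      then have "\<And>b. b \<in> Basis \<Longrightarrow> \<bar>v \<bullet> b\<bar> < norm v / D" using D1 by (auto simp: not_le inner_commute field_simps)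
      then have "(\<Sum>b\<in>Basis. \<bar>v \<bullet> b\<bar>) < (\<Sum>b\<in>(Basis::'a set). norm v / D)" by (intro sum_strict_mono) auto
      also have "\<dots> = norm v" using D1 by (simp add: D_def)
      finally show False using norm_le_l1[of v] by simp
    qed
    then obtain b where b: "b \<in> Basis" "norm v \<le> D * \<bar>b \<bullet> v\<bar>" by auto
    have "(1 + norm v) ^ n \<le> (2 * max 1 (norm v)) ^ n" by (intro power_mono) auto
    also have "\<dots> = 2 ^ n * (max 1 (norm v)) ^ n" by (rule power_mult_distrib)
    also have "(max 1 (norm v)) ^ n \<le> 1 + norm v ^ n" by (simp add: max_def)
    also have "norm v ^ n \<le> (D * \<bar>b \<bullet> v\<bar>) ^ n" by (intro power_mono b) auto
    finally have "(1 + norm v) ^ n \<le> 2 ^ n * (1 + D ^ n * \<bar>b \<bullet> v\<bar> ^ n)" by (simp add: power_mult_distrib)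
    then have "(1 + norm v) ^ n * norm (fourier \<phi> v) \<le> 2 ^ n * (1 + D ^ n * \<bar>b \<bullet> v\<bar> ^ n) * norm (fourier \<phi> v)"
      by (rule mult_right_mono) simp
    also have "\<dots> = 2 ^ n * (\<bar>b \<bullet> v\<bar> ^ 0 * norm (fourier \<phi> v) + D ^ n * (\<bar>b \<bullet> v\<bar> ^ n * norm (fourier \<phi> v)))"
      by (simp add: algebra_simps)
    also have "\<dots> \<le> 2 ^ n * (N 0 b + D ^ n * N n b)"
      using D1 by (intro mult_left_mono add_mono bb b) auto
    also have "\<dots> \<le> C" unfolding C_def using D1 b N0
      by (intro mult_left_mono add_mono member_le_sum) auto
    finally show ?thesis .
  qed
  have p: "0 < (1 + norm x) ^ n" for x :: 'a by (intro zero_less_power) (simp add: add_pos_nonneg)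
  have "0 \<le> C" unfolding C_def using D1 N0 by (intro mult_nonneg_nonneg add_nonneg_nonneg sum_nonneg) auto
  moreover have "norm (fourier \<phi> v) \<le> C / (1 + norm v) ^ n" for v
    using main[of v] p[of v] by (simp add: pos_le_divide_eq mult.commute)
  ultimately show ?thesis by (rule that)
qed

lemma partials_dilate:
  fixes \<phi> :: "'a::euclidean_space \<Rightarrow> real"
  assumes \<phi>: "smooth_fun \<phi>" and R: "0 < R" and bs: "bs \<in> lists Basis"
  shows "partials bs (dilate R \<phi>) = (\<lambda>x. partials bs \<phi> (x /\<^sub>R R) / R ^ length bs)"
  using bs
proof (induction bs)
  case Nil
  show ?case by (simp add: dilate_def)
next
  case (Cons b bs)
  have "partial_deriv b (\<lambda>x. partials bs \<phi> (x /\<^sub>R R) / R ^ length bs) x = partial_deriv b (partials bs \<phi>) (x /\<^sub>R R) / R ^ Suc (length bs)" for x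
    unfolding partial_deriv_def[of b "\<lambda>x. partials bs \<phi> (x /\<^sub>R R) / R ^ length bs"]
  proof (rule DERIV_imp_deriv)
    have "partials bs \<phi> differentiable (at (x /\<^sub>R R + 0 *\<^sub>R b))" using \<phi> Cons by (auto simp: smooth_fun_def)
    from has_derivative_along[OF this]
    have 1: "((\<lambda>s. partials bs \<phi> (x /\<^sub>R R + s *\<^sub>R b)) has_real_derivative partial_deriv b (partials bs \<phi>) (x /\<^sub>R R)) (at (inverse R * 0))" by simp
    have 2: "((\<lambda>t. inverse R * t) has_real_derivative inverse R) (at 0)" by (auto intro!: derivative_eq_intros)
    have "((\<lambda>t. partials bs \<phi> (x /\<^sub>R R + (inverse R * t) *\<^sub>R b)) has_real_derivative partial_deriv b (partials bs \<phi>) (x /\<^sub>R R) * inverse R) (at 0)"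
      using DERIV_chain2[OF 1 2] .
    then have "((\<lambda>t. partials bs \<phi> (x /\<^sub>R R + (inverse R * t) *\<^sub>R b) / R ^ length bs) has_real_derivative partial_deriv b (partials bs \<phi>) (x /\<^sub>R R) * inverse R / R ^ length bs) (at 0)"
      by (rule DERIV_cdivide)
    then show "((\<lambda>t. partials bs \<phi> ((x + t *\<^sub>R b) /\<^sub>R R) / R ^ length bs) has_real_derivative partial_deriv b (partials bs \<phi>) (x /\<^sub>R R) / R ^ Suc (length bs)) (at 0)"
      by (simp add: scaleR_add_right divide_inverse mult_ac)
  qed
  then show ?case using Cons by (simp add: partials_Cons)
qed

lemma dilate_schwartz:
  fixes \<phi> :: "'a::euclidean_space \<Rightarrow> real"
  assumes \<phi>: "\<phi> \<in> schwartz_space" and R: "0 < R"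
  shows "dilate R \<phi> \<in> schwartz_space"
proof -
  have s: "smooth_fun \<phi>" by (rule schwartz_smooth[OF \<phi>])
  have "smooth_fun (dilate R \<phi>)"
    unfolding smooth_fun_def
  proof (intro ballI allI)
    fix bs :: "'a list" and x assume bs: "bs \<in> lists Basis"
    have "partials bs \<phi> differentiable (at (x /\<^sub>R R))" using s bs by (auto simp: smooth_fun_def)
    moreover have "(\<lambda>x. x /\<^sub>R R) differentiable (at x)" by (simp add: differentiable_def) (auto intro!: exI derivative_eq_intros)
    ultimately have "(\<lambda>x. partials bs \<phi> (x /\<^sub>R R)) differentiable (at x)" using differentiable_compose by blast
    then show "partials bs (dilate R \<phi>) differentiable (at x)"
      unfolding partials_dilate[OF s R bs] divide_inverse by (intro differentiable_mult) auto
  qed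
  moreover have "bdd_above (range (\<lambda>x. (1 + norm x) ^ k * \<bar>partials bs (dilate R \<phi>) x\<bar>))" if bs: "bs \<in> lists Basis" for k bs
  proof -
    obtain C where C: "0 \<le> C" "\<And>x. \<bar>partials bs \<phi> x\<bar> \<le> C / (1 + norm x) ^ k" using schwartz_decay[OF \<phi> bs] by blast
    have p: "0 < (1 + norm x) ^ k" for x :: 'a by (intro zero_less_power) (simp add: add_pos_nonneg)
    have "(1 + norm x) ^ k * \<bar>partials bs (dilate R \<phi>) x\<bar> \<le> max 1 R ^ k * C / R ^ length bs" for x
    proof -
      have "1 + norm x \<le> max 1 R * (1 + norm (x /\<^sub>R R))"
      proof -
        have "norm x = R * norm (x /\<^sub>R R)" using R by simp
        also have "\<dots> \<le> max 1 R * norm (x /\<^sub>R R)" by (intro mult_right_mono) auto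
        finally show ?thesis by (simp add: distrib_left add_mono)
      qed
      then have "(1 + norm x) ^ k \<le> (max 1 R * (1 + norm (x /\<^sub>R R))) ^ k" by (intro power_mono) auto
      also have "\<dots> = max 1 R ^ k * (1 + norm (x /\<^sub>R R)) ^ k" by (rule power_mult_distrib)
      finally have 1: "(1 + norm x) ^ k \<le> max 1 R ^ k * (1 + norm (x /\<^sub>R R)) ^ k" .
      have "(1 + norm x) ^ k * \<bar>partials bs \<phi> (x /\<^sub>R R)\<bar> \<le> max 1 R ^ k * (1 + norm (x /\<^sub>R R)) ^ k * (C / (1 + norm (x /\<^sub>R R)) ^ k)"
        by (intro mult_mono 1 C(2)) auto
      also have "\<dots> = max 1 R ^ k * C"
      proof -
        define P where "P = (1 + norm (x /\<^sub>R R)) ^ k"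
        have "0 < P" unfolding P_def by (rule p)
        then show ?thesis unfolding P_def[symmetric] by simp
      qed
      finally have "(1 + norm x) ^ k * \<bar>partials bs \<phi> (x /\<^sub>R R)\<bar> / R ^ length bs \<le> max 1 R ^ k * C / R ^ length bs"
        using R by (intro divide_right_mono) auto
      then show ?thesis unfolding partials_dilate[OF s R bs] using R by (simp add: abs_mult)
    qed
    then show ?thesis by (intro bdd_aboveI2)
  qed
  ultimately show ?thesis unfolding schwartz_space_def by simp
qed

section \<open>Joint law of the derivatives of the wave\<close>

text \<open>The amplitude at frequency \<open>\<theta>\<close> of the derivative along \<open>bs\<close> at \<open>x\<close>. Cutting it off outside the unit sphere makes
  it bounded and does not affect integrals against \<open>sphere_uniform\<close>.\<close>

definition mode :: "'a::euclidean_space list \<Rightarrow> 'a \<Rightarrow> 'a \<Rightarrow> complex" where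
  "mode bs x \<theta> = (if norm \<theta> = 1 then (\<Prod>b\<leftarrow>bs. \<i> * of_real (\<theta> \<bullet> b)) * iexp (x \<bullet> \<theta>) else 0)"

lemma mode_Cons: "mode (b # bs) x \<theta> = \<i> * of_real (\<theta> \<bullet> b) * mode bs x \<theta>"
  by (simp add: mode_def)

lemma mode_shift: "mode bs (x + t *\<^sub>R b) \<theta> = iexp (t * (b \<bullet> \<theta>)) * mode bs x \<theta>"
  by (simp add: mode_def inner_add_left distrib_left exp_add mult_ac)

lemma mode_uminus: "mode bs x (- \<theta>) = cnj (mode bs x \<theta>)"
  by (induction bs) (simp_all add: mode_Cons, simp add: mode_def exp_cnj)

lemma mode_meas[measurable]: "mode bs x \<in> borel_measurable borel"
proof (induction bs)
  case Nil
  have "mode [] x = (\<lambda>\<theta>. if norm \<theta> = 1 then iexp (x \<bullet> \<theta>) else 0)" by (auto simp: mode_def)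
  then show ?case by simp
next
  case (Cons b bs)
  have [measurable]: "mode bs x \<in> borel_measurable borel" by fact
  show ?case unfolding mode_Cons[abs_def] by measurable
qed

lemma norm_mode_le:
  assumes "bs \<in> lists Basis"
  shows "norm (mode bs x \<theta>) \<le> 1"
  using assms
proof (induction bs)
  case (Cons b bs)
  show ?case
  proof (cases "norm \<theta> = 1")
    case True
    have "\<bar>\<theta> \<bullet> b\<bar> \<le> 1" using Basis_le_norm[of b \<theta>] Cons True by auto
    then show ?thesis unfolding mode_Cons norm_mult using Cons by (auto intro!: mult_le_one)
  qed (simp add: mode_def)
qed (simp add: mode_def)

text \<open>A triple \<open>(a, bs, x)\<close> stands for the multiple by \<open>a\<close> of the derivative along \<open>bs\<close> at \<open>x\<close>. Lists allow an
  outermost derivative to be replaced formally by a difference quotient (\<open>quotient_step\<close>, of step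
  \<open>1 / (j + 1)\<close>), which lowers the order by one.\<close>

definition field_sum :: "('a::euclidean_space \<Rightarrow> real) \<Rightarrow> (real \<times> 'a list \<times> 'a) list \<Rightarrow> real" where
  "field_sum f xs = (\<Sum>(a, bs, x)\<leftarrow>xs. a * partials bs f x)"

definition mode_sum :: "(real \<times> 'a::euclidean_space list \<times> 'a) list \<Rightarrow> 'a \<Rightarrow> complex" where
  "mode_sum xs \<theta> = (\<Sum>(a, bs, x)\<leftarrow>xs. of_real a * mode bs x \<theta>)"

definition weight_sum :: "(real \<times> 'a::euclidean_space list \<times> 'a) list \<Rightarrow> real" where
  "weight_sum xs = (\<Sum>(a, bs, x)\<leftarrow>xs. \<bar>a\<bar>)"

definition quotient_step :: "nat \<Rightarrow> real \<times> 'a::euclidean_space list \<times> 'a \<Rightarrow> (real \<times> 'a list \<times> 'a) list" where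
  "quotient_step j = (\<lambda>(a, bs, x). case bs of [] \<Rightarrow> [(a, [], x)]
     | b # cs \<Rightarrow> [(a * real (Suc j), cs, x + inverse (real (Suc j)) *\<^sub>R b), (- (a * real (Suc j)), cs, x)])"

definition quotient_list :: "nat \<Rightarrow> (real \<times> 'a::euclidean_space list \<times> 'a) list \<Rightarrow> (real \<times> 'a list \<times> 'a) list" where
  "quotient_list j xs = concat (map (quotient_step j) xs)"

definition order_at_most :: "nat \<Rightarrow> (real \<times> 'a::euclidean_space list \<times> 'a) list \<Rightarrow> bool" where
  "order_at_most n xs \<longleftrightarrow> (\<forall>(a, bs, x)\<in>set xs. bs \<in> lists Basis \<and> length bs \<le> n)"

lemma field_sum_simps[simp]: "field_sum f [] = 0" "field_sum f ((a, bs, x) # xs) = a * partials bs f x + field_sum f xs"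
  "field_sum f (xs @ ys) = field_sum f xs + field_sum f ys"
  by (simp_all add: field_sum_def)
lemma mode_sum_simps[simp]: "mode_sum [] \<theta> = 0" "mode_sum ((a, bs, x) # xs) \<theta> = of_real a * mode bs x \<theta> + mode_sum xs \<theta>"
  "mode_sum (xs @ ys) \<theta> = mode_sum xs \<theta> + mode_sum ys \<theta>"
  by (simp_all add: mode_sum_def)
lemma weight_sum_simps[simp]: "weight_sum [] = 0" "weight_sum ((a, bs, x) # xs) = \<bar>a\<bar> + weight_sum xs"
  by (simp_all add: weight_sum_def)
lemma quotient_list_simps[simp]: "quotient_list j [] = []" "quotient_list j (y # xs) = quotient_step j y @ quotient_list j xs"
  by (simp_all add: quotient_list_def)
lemma order_at_most_simps[simp]: "order_at_most n []" "order_at_most n ((a, bs, x) # xs) \<longleftrightarrow> bs \<in> lists Basis \<and> length bs \<le> n \<and> order_at_most n xs"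
  "order_at_most n (xs @ ys) \<longleftrightarrow> order_at_most n xs \<and> order_at_most n ys"
  by (simp_all add: order_at_most_def ball_Un)

lemma mode_sum_meas[measurable]: "mode_sum xs \<in> borel_measurable borel"
proof (induction xs)
  case (Cons y xs)
  obtain a bs x where y: "y = (a, bs, x)" by (cases y)
  have [measurable]: "mode_sum xs \<in> borel_measurable borel" by fact
  show ?case unfolding y mode_sum_simps[abs_def] by measurable
qed simp

lemma order_quotient_list: "order_at_most (Suc n) xs \<Longrightarrow> order_at_most n (quotient_list j xs)"
  by (induction xs) (auto simp: quotient_step_def split: list.splits)

text \<open>The difference quotient of a plane wave in a unit direction is bounded by one whatever the step, which
  provides the domination for the limit of vanishing steps.\<close>

lemma norm_quotient_list_le: "order_at_most n xs \<Longrightarrow> norm (mode_sum (quotient_list j xs) \<theta>) \<le> weight_sum xs"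
proof (induction xs)
  case (Cons y xs)
  obtain a bs x where y: "y = (a, bs, x)" by (cases y)
  have "norm (mode_sum (quotient_step j (a, bs, x)) \<theta>) \<le> \<bar>a\<bar>"
  proof (cases bs)
    case Nil
    then show ?thesis using norm_mode_le[of "[]" x \<theta>] by (auto simp: quotient_step_def norm_mult intro: mult_left_le)
  next
    case (Cons b cs)
    define k where "k = real (Suc j)"
    have k: "0 < k" unfolding k_def by simp
    have b: "b \<in> Basis" "cs \<in> lists Basis" using Cons.prems unfolding y Cons by auto
    have "mode_sum (quotient_step j (a, bs, x)) \<theta> = of_real a * (of_real k * (iexp (inverse k * (b \<bullet> \<theta>)) - 1) * mode cs x \<theta>)"
      unfolding Cons quotient_step_def k_def by (simp add: mode_shift algebra_simps)
    also have "norm \<dots> = \<bar>a\<bar> * (k * norm (iexp (inverse k * (b \<bullet> \<theta>)) - 1) * norm (mode cs x \<theta>))"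
      using k by (simp add: norm_mult)
    also have "\<dots> \<le> \<bar>a\<bar> * 1"
    proof (cases "norm \<theta> = 1")
      case True
      have "k * norm (iexp (inverse k * (b \<bullet> \<theta>)) - 1) \<le> k * \<bar>inverse k * (b \<bullet> \<theta>)\<bar>"
        by (rule mult_left_mono[OF norm_iexp_minus_1]) (use k in simp)
      also have "\<dots> = \<bar>\<theta> \<bullet> b\<bar>" using k by (simp add: abs_mult inner_commute)
      also have "\<dots> \<le> 1" using Basis_le_norm[OF b(1), of \<theta>] True by simp
      finally have kk: "k * norm (iexp (inverse k * (b \<bullet> \<theta>)) - 1) \<le> 1" .
      show ?thesis by (rule mult_left_mono[OF mult_le_one[OF kk norm_ge_zero norm_mode_le[OF b(2)]]]) simp
    qed (simp add: mode_def)
    finally show ?thesis by simp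
  qed
  then show ?case
    using norm_triangle_ineq[of "mode_sum (quotient_step j (a, bs, x)) \<theta>" "mode_sum (quotient_list j xs) \<theta>"] Cons unfolding y by auto
qed simp

lemma inverse_Suc_tendsto: "(\<lambda>j. inverse (real (Suc j))) \<longlonglongrightarrow> 0" "inverse (real (Suc j)) \<in> UNIV - {0}"
  using LIMSEQ_inverse_real_of_nat by auto

lemma field_sum_quotient_tendsto:
  assumes "smooth_fun f" "order_at_most n xs"
  shows "(\<lambda>j. field_sum f (quotient_list j xs)) \<longlonglongrightarrow> field_sum f xs"
  using assms(2)
proof (induction xs)
  case (Cons y xs)
  obtain a bs x where y: "y = (a, bs, x)" by (cases y)
  have "(\<lambda>j. field_sum f (quotient_step j (a, bs, x))) \<longlonglongrightarrow> a * partials bs f x"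
  proof (cases bs)
    case (Cons b cs)
    have cs: "cs \<in> lists Basis" using Cons.prems unfolding y Cons by auto
    have "partials cs f differentiable at (x + 0 *\<^sub>R b)" using assms(1) cs unfolding smooth_fun_def by auto
    from has_derivative_along[OF this]
    have l: "((\<lambda>h. (partials cs f (x + (0 + h) *\<^sub>R b) - partials cs f (x + 0 *\<^sub>R b)) / h) \<longlongrightarrow> partial_deriv b (partials cs f) (x + 0 *\<^sub>R b)) (at 0)"
      unfolding DERIV_def .
    have "(\<lambda>j. (partials cs f (x + (0 + inverse (real (Suc j))) *\<^sub>R b) - partials cs f (x + 0 *\<^sub>R b)) / inverse (real (Suc j))) \<longlonglongrightarrow> partial_deriv b (partials cs f) (x + 0 *\<^sub>R b)"
      using l[unfolded tendsto_at_iff_sequentially comp_def, rule_format, OF inverse_Suc_tendsto(2,1)] .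
    from tendsto_mult[OF tendsto_const[of a] this]
    show ?thesis unfolding Cons quotient_step_def by (simp add: partials_Cons algebra_simps divide_inverse)
  qed (simp add: quotient_step_def)
  from tendsto_add[OF this Cons.IH] show ?case using Cons.prems unfolding y by simp
qed simp

lemma mode_sum_quotient_tendsto:
  "(\<lambda>j. mode_sum (quotient_list j xs) \<theta>) \<longlonglongrightarrow> mode_sum xs \<theta>"
proof (induction xs)
  case (Cons y xs)
  obtain a bs x where y: "y = (a, bs, x)" by (cases y)
  have "(\<lambda>j. mode_sum (quotient_step j (a, bs, x)) \<theta>) \<longlonglongrightarrow> of_real a * mode bs x \<theta>"
  proof (cases bs)
    case (Cons b cs)
    have "((\<lambda>z. exp (z * (\<i> * of_real (b \<bullet> \<theta>)))) has_field_derivative (\<i> * of_real (b \<bullet> \<theta>))) (at 0)"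
      by (auto intro!: derivative_eq_intros)
    then have l: "((\<lambda>h. (exp (h * (\<i> * of_real (b \<bullet> \<theta>))) - 1) / h) \<longlongrightarrow> \<i> * of_real (b \<bullet> \<theta>)) (at 0)"
      unfolding DERIV_def by simp
    have l1: "(\<lambda>j. complex_of_real (inverse (real (Suc j)))) \<longlonglongrightarrow> 0" using tendsto_of_real[OF inverse_Suc_tendsto(1)] by (simp only: of_real_0)
    have l2: "complex_of_real (inverse (real (Suc j))) \<in> UNIV - {0}" for j using inverse_Suc_tendsto(2)[of j] by (simp del: of_nat_Suc)
    have "(\<lambda>j. (exp (of_real (inverse (real (Suc j))) * (\<i> * of_real (b \<bullet> \<theta>))) - 1) / of_real (inverse (real (Suc j)))) \<longlonglongrightarrow> \<i> * of_real (b \<bullet> \<theta>)"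
      using l[unfolded tendsto_at_iff_sequentially comp_def, rule_format, OF l2 l1] .
    from tendsto_mult[OF tendsto_const[of "of_real a"] tendsto_mult[OF this tendsto_const[of "mode cs x \<theta>"]]]
    show ?thesis unfolding Cons quotient_step_def
      by (simp add: mode_shift mode_Cons algebra_simps divide_inverse inner_commute del: of_nat_Suc)
  qed (simp add: quotient_step_def)
  from tendsto_add[OF this Cons.IH] show ?case unfolding y by simp
qed simp

lemma gaussian_law_conv:
  assumes s: "0 \<le> s"
  shows "gaussian_law m s = distr std_normal_distribution borel (\<lambda>x. m + s * x)"
proof (cases "s = 0")
  case True
  interpret N: real_distribution std_normal_distribution by (rule real_dist_normal_dist)
  have "distr std_normal_distribution borel (\<lambda>x. m + s * x) = distr std_normal_distribution borel (\<lambda>_. m)" using True by simp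
  also have "\<dots> = return borel m" by (rule N.distr_const) simp
  finally show ?thesis using True by (simp add: gaussian_law_def)
next
  case False
  interpret N: real_distribution std_normal_distribution by (rule real_dist_normal_dist)
  have "distributed std_normal_distribution lborel (\<lambda>x. x) std_normal_density"
    unfolding distributed_def by (auto simp: distr_id2)
  from N.normal_density_affine[OF this, of s m] False s
  have "distr std_normal_distribution lborel (\<lambda>x. m + s * x) = density lborel (normal_density m s)"
    unfolding distributed_def by simp
  moreover have "distr std_normal_distribution lborel (\<lambda>x. m + s * x) = distr std_normal_distribution borel (\<lambda>x. m + s * x)"
    by (intro distr_cong) auto
  ultimately show ?thesis using False by (simp add: gaussian_law_def)
qed

lemma gaussian_variable_moments:
  assumes M: "prob_space M" and Y: "gaussian_variable M Y" and m0: "(\<integral>w. Y w \<partial>M) = 0"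
  shows "integrable M Y" "integrable M (\<lambda>w. (Y w)\<^sup>2)"
    "(\<integral>w. iexp (t * Y w) \<partial>M) = of_real (exp (- t\<^sup>2 * (\<integral>w. (Y w)\<^sup>2 \<partial>M) / 2))"
proof -
  have [measurable]: "Y \<in> borel_measurable M" using Y unfolding gaussian_variable_def by simp
  obtain m s where s: "0 \<le> s" and d: "distr M borel Y = distr std_normal_distribution borel (\<lambda>x. m + s * x)"
    using Y gaussian_law_conv unfolding gaussian_variable_def by metis
  interpret N: real_distribution std_normal_distribution by (rule real_dist_normal_dist)
  have i1: "integrable std_normal_distribution (\<lambda>x. x)"
    using integrable_std_normal_distribution_moment[of 1] by (simp only: power_one_right)
  note i2 = integrable_std_normal_distribution_moment[of 2]
  have o1: "(\<integral>x. x \<partial>std_normal_distribution) = 0"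
    using integral_std_normal_distribution_moment_odd[of 1, OF odd_one] by (simp only: power_one_right)
  have e2: "(\<integral>x. x\<^sup>2 \<partial>std_normal_distribution) = 1"
    using std_normal_distribution_even_moments(1)[of 1] by simp
  have int_iff: "integrable M (\<lambda>w. h (Y w)) \<longleftrightarrow> integrable std_normal_distribution (\<lambda>x. h (m + s * x))"
    if [measurable]: "h \<in> borel_measurable borel" for h :: "real \<Rightarrow> real"
  proof -
    have "integrable M (\<lambda>w. h (Y w)) \<longleftrightarrow> integrable (distr M borel Y) h" by (rule integrable_distr_eq[symmetric]) auto
    also have "\<dots> \<longleftrightarrow> integrable std_normal_distribution (\<lambda>x. h (m + s * x))"
      unfolding d by (rule integrable_distr_eq) auto
    finally show ?thesis .
  qed
  have int_eq: "(\<integral>w. h (Y w) \<partial>M) = (\<integral>x. h (m + s * x) \<partial>std_normal_distribution)"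
    if [measurable]: "h \<in> borel_measurable borel" for h :: "real \<Rightarrow> 'z::{banach, second_countable_topology}"
  proof -
    have "(\<integral>w. h (Y w) \<partial>M) = (\<integral>x. h x \<partial>distr M borel Y)" by (rule integral_distr[symmetric]) auto
    also have "\<dots> = (\<integral>x. h (m + s * x) \<partial>std_normal_distribution)"
      unfolding d by (rule integral_distr) auto
    finally show ?thesis .
  qed
  have "integrable std_normal_distribution (\<lambda>x. m + s * x)"
    by (intro integrable_add integrable_mult_right N.integrable_const i1)
  then show "integrable M Y" by (rule int_iff[of "\<lambda>x. x", THEN iffD2, rotated]) simp
  have "(\<integral>w. Y w \<partial>M) = (\<integral>x. m + s * x \<partial>std_normal_distribution)" by (rule int_eq) simp
  also have "\<dots> = (\<integral>x. m \<partial>std_normal_distribution) + (\<integral>x. s * x \<partial>std_normal_distribution)"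
    by (rule integral_add[OF N.integrable_const integrable_mult_right[OF i1]])
  also have "\<dots> = m" by (simp only: lebesgue_integral_const N.prob_space integral_mult_right_zero o1) simp
  finally have "(\<integral>w. Y w \<partial>M) = m" .
  then have m: "m = 0" using m0 by simp
  have sq: "(m + s * x)\<^sup>2 = s\<^sup>2 * x\<^sup>2" for x by (simp add: m power_mult_distrib)
  have "integrable std_normal_distribution (\<lambda>x. (m + s * x)\<^sup>2)"
    unfolding sq by (intro integrable_mult_right i2)
  then show "integrable M (\<lambda>w. (Y w)\<^sup>2)" by (rule int_iff[of "\<lambda>x. x\<^sup>2", THEN iffD2, rotated]) simp
  have "(\<integral>w. (Y w)\<^sup>2 \<partial>M) = (\<integral>x. (m + s * x)\<^sup>2 \<partial>std_normal_distribution)" by (rule int_eq) simp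
  then have v: "(\<integral>w. (Y w)\<^sup>2 \<partial>M) = s\<^sup>2" by (simp only: sq integral_mult_right_zero e2 mult_1_right)
  have "(\<integral>w. iexp (t * Y w) \<partial>M) = (\<integral>x. iexp (t * (m + s * x)) \<partial>std_normal_distribution)"
    by (rule int_eq) measurable
  also have "\<dots> = char std_normal_distribution (t * s)" unfolding char_def m by (simp only: mult.assoc add_0)
  also have "\<dots> = of_real (exp (- t\<^sup>2 * (\<integral>w. (Y w)\<^sup>2 \<partial>M) / 2))" unfolding v by (simp add: char_std_normal_distribution power_mult_distrib)
  finally show "(\<integral>w. iexp (t * Y w) \<partial>M) = of_real (exp (- t\<^sup>2 * (\<integral>w. (Y w)\<^sup>2 \<partial>M) / 2))" .
qed

lemma sum_list_collect_points:
  fixes h :: "'a \<Rightarrow> 'c::real_vector" and xs :: "(real \<times> 'b \<times> 'a) list"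
  assumes "finite G" "(\<lambda>(a, bs, x). x) ` set xs \<subseteq> G"
  shows "(\<Sum>(a, bs, x)\<leftarrow>xs. a *\<^sub>R h x) = (\<Sum>x\<in>G. (\<Sum>(a, bs, y)\<leftarrow>xs. if y = x then a else 0) *\<^sub>R h x)"
  using assms(2)
proof (induction xs)
  case (Cons z xs)
  obtain a bs y where z: "z = (a, bs, y)" by (cases z)
  have "(\<Sum>x\<in>G. (if y = x then a else 0) *\<^sub>R h x) = a *\<^sub>R h y"
    using Cons.prems assms(1) unfolding z by (simp add: if_distrib[of "\<lambda>c. c *\<^sub>R _"] cong: if_cong)
  then show ?case using Cons unfolding z by (simp add: scaleR_add_left sum.distrib)
qed simp

text \<open>Smoothness is required of every sample; \<open>berry_smooth_modification\<close> reduces the almost sure case to this one.\<close>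

locale smooth_berry = prob_space M for M :: "'w measure" +
  fixes B :: "'w \<Rightarrow> 'a::euclidean_space \<Rightarrow> real"
  assumes gauss: "centered_gaussian_process M UNIV (\<lambda>x \<omega>. B \<omega> x)"
    and covar: "\<And>x y. complex_of_real (\<integral>\<omega>. B \<omega> x * B \<omega> y \<partial>M) = (\<integral>\<theta>. iexp ((x - y) \<bullet> \<theta>) \<partial>sphere_uniform)"
    and smooth: "\<And>\<omega>. smooth_fun (B \<omega>)"
begin

lemma B_gaussian: "gaussian_variable M (\<lambda>\<omega>. \<Sum>x\<in>F. a x * B \<omega> x)" if "finite F"
  using gauss that unfolding centered_gaussian_process_def by auto

lemma B_var: "gaussian_variable M (\<lambda>\<omega>. B \<omega> x)" "(\<integral>\<omega>. B \<omega> x \<partial>M) = 0"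
  using B_gaussian[of "{x}" "\<lambda>_. 1"] gauss unfolding centered_gaussian_process_def by auto

lemma B_meas[measurable]: "(\<lambda>\<omega>. B \<omega> x) \<in> borel_measurable M"
  using B_var(1)[of x] unfolding gaussian_variable_def by simp

lemma B_int: "integrable M (\<lambda>\<omega>. B \<omega> x)" "integrable M (\<lambda>\<omega>. (B \<omega> x)\<^sup>2)"
  by (rule gaussian_variable_moments[OF prob_space_axioms B_var])+

lemma B_prod_int: "integrable M (\<lambda>\<omega>. B \<omega> x * B \<omega> y)"
proof (rule integrable_bound[OF integrable_add[OF B_int(2)[of x] B_int(2)[of y]]])
  show "AE \<omega> in M. norm (B \<omega> x * B \<omega> y) \<le> norm ((B \<omega> x)\<^sup>2 + (B \<omega> y)\<^sup>2)"
  proof (rule AE_I2)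
    fix \<omega>
    have "2 * (\<bar>B \<omega> x\<bar> * \<bar>B \<omega> y\<bar>) \<le> (B \<omega> x)\<^sup>2 + (B \<omega> y)\<^sup>2"
      using zero_le_power2[of "\<bar>B \<omega> x\<bar> - \<bar>B \<omega> y\<bar>"] by (simp add: power2_diff)
    moreover have "0 \<le> \<bar>B \<omega> x\<bar> * \<bar>B \<omega> y\<bar>" by simp
    ultimately have "\<bar>B \<omega> x\<bar> * \<bar>B \<omega> y\<bar> \<le> (B \<omega> x)\<^sup>2 + (B \<omega> y)\<^sup>2" by linarith
    then show "norm (B \<omega> x * B \<omega> y) \<le> norm ((B \<omega> x)\<^sup>2 + (B \<omega> y)\<^sup>2)" by (simp add: abs_mult)
  qed
qed measurable

lemma charfun_point_values:
  assumes F: "finite F"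
  shows "(\<integral>\<omega>. iexp (\<Sum>x\<in>F. a x * B \<omega> x) \<partial>M) =
    of_real (exp (- (\<integral>\<theta>. (norm (\<Sum>x\<in>F. a x *\<^sub>R mode [] x \<theta>))\<^sup>2 \<partial>sphere_uniform) / 2))"
proof -
  let ?Y = "\<lambda>\<omega>. \<Sum>x\<in>F. a x * B \<omega> x"
  have m0: "(\<integral>\<omega>. ?Y \<omega> \<partial>M) = 0"
    by (subst integral_sum) (auto intro!: integrable_mult_right B_int simp: B_var(2))
  have sq: "(?Y \<omega>)\<^sup>2 = (\<Sum>x\<in>F. \<Sum>y\<in>F. a x * a y * (B \<omega> x * B \<omega> y))" for \<omega>
    by (simp add: power2_eq_square sum_product mult_ac)
  have isq: "(\<integral>\<omega>. (?Y \<omega>)\<^sup>2 \<partial>M) = (\<Sum>x\<in>F. \<Sum>y\<in>F. a x * a y * (\<integral>\<omega>. B \<omega> x * B \<omega> y \<partial>M))"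
    unfolding sq by (simp add: integral_sum integrable_sum B_prod_int)
  have ie: "integrable (sphere_uniform :: 'a measure) (\<lambda>\<theta>. iexp (z \<bullet> \<theta>))" for z :: 'a
    by (rule sphere_integrable_bounded[of _ 1]) auto
  have "complex_of_real (\<integral>\<omega>. (?Y \<omega>)\<^sup>2 \<partial>M) = (\<Sum>x\<in>F. \<Sum>y\<in>F. of_real (a x * a y) * (\<integral>\<theta>. iexp ((x - y) \<bullet> \<theta>) \<partial>sphere_uniform))"
    unfolding isq of_real_sum of_real_mult covar ..
  also have "\<dots> = (\<integral>\<theta>. (\<Sum>x\<in>F. \<Sum>y\<in>F. of_real (a x * a y) * iexp ((x - y) \<bullet> \<theta>)) \<partial>sphere_uniform)"
    by (simp add: integral_sum integrable_sum ie)
  also have "\<dots> = (\<integral>\<theta>. of_real ((norm (\<Sum>x\<in>F. a x *\<^sub>R mode [] x \<theta>))\<^sup>2) \<partial>sphere_uniform)"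
  proof (rule integral_cong_AE)
    show "AE \<theta> in (sphere_uniform :: 'a measure). (\<Sum>x\<in>F. \<Sum>y\<in>F. of_real (a x * a y) * iexp ((x - y) \<bullet> \<theta>)) = of_real ((norm (\<Sum>x\<in>F. a x *\<^sub>R mode [] x \<theta>))\<^sup>2)"
      using AE_sphere_uniform
    proof eventually_elim
      fix \<theta> :: 'a assume n: "norm \<theta> = 1"
      have "of_real ((norm (\<Sum>x\<in>F. a x *\<^sub>R mode [] x \<theta>))\<^sup>2) = (\<Sum>x\<in>F. a x *\<^sub>R mode [] x \<theta>) * cnj (\<Sum>x\<in>F. a x *\<^sub>R mode [] x \<theta>)"
        by (simp add: complex_norm_square del: of_real_power)
      also have "\<dots> = (\<Sum>x\<in>F. \<Sum>y\<in>F. of_real (a x * a y) * iexp ((x - y) \<bullet> \<theta>))"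
        unfolding cnj_sum sum_product
        by (intro sum.cong refl) (simp add: mode_def n scaleR_conv_of_real exp_cnj inner_diff_left right_diff_distrib exp_diff exp_minus field_simps)
      finally show "(\<Sum>x\<in>F. \<Sum>y\<in>F. of_real (a x * a y) * iexp ((x - y) \<bullet> \<theta>)) = of_real ((norm (\<Sum>x\<in>F. a x *\<^sub>R mode [] x \<theta>))\<^sup>2)" ..
    qed
  qed measurable
  also have "\<dots> = of_real (\<integral>\<theta>. (norm (\<Sum>x\<in>F. a x *\<^sub>R mode [] x \<theta>))\<^sup>2 \<partial>sphere_uniform)"
    by (rule integral_complex_of_real)
  finally have "(\<integral>\<omega>. (?Y \<omega>)\<^sup>2 \<partial>M) = (\<integral>\<theta>. (norm (\<Sum>x\<in>F. a x *\<^sub>R mode [] x \<theta>))\<^sup>2 \<partial>sphere_uniform)"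
    using of_real_eq_iff by blast
  then show ?thesis
    using gaussian_variable_moments(3)[OF prob_space_axioms B_gaussian[OF F] m0, of 1] by simp
qed

lemma field_sum_meas[measurable]: "order_at_most n xs \<Longrightarrow> (\<lambda>\<omega>. field_sum (B \<omega>) xs) \<in> borel_measurable M"
proof (induction n arbitrary: xs)
  case 0
  then show ?case
  proof (induction xs)
    case (Cons y xs)
    obtain a bs x where y: "y = (a, bs, x)" by (cases y)
    have [measurable]: "(\<lambda>\<omega>. field_sum (B \<omega>) xs) \<in> borel_measurable M" using Cons unfolding y by simp
    show ?case using Cons.prems unfolding y by simp
  qed simp
next
  case (Suc n)
  have m: "(\<lambda>\<omega>. field_sum (B \<omega>) (quotient_list j xs)) \<in> borel_measurable M" for j
    by (rule Suc.IH[OF order_quotient_list[OF Suc.prems]])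
  show ?case by (rule borel_measurable_LIMSEQ_real[OF field_sum_quotient_tendsto[OF smooth Suc.prems] m])
qed

text \<open>Induction on the order: along difference quotients both the field and the spectral amplitudes converge, and
  at order zero the claim is that the field is Gaussian with the prescribed covariance.\<close>

theorem charfun_field_sum:
  assumes "order_at_most n xs"
  shows "(\<integral>\<omega>. iexp (field_sum (B \<omega>) xs) \<partial>M) = of_real (exp (- (\<integral>\<theta>. (norm (mode_sum xs \<theta>))\<^sup>2 \<partial>sphere_uniform) / 2))"
  using assms
proof (induction n arbitrary: xs)
  case 0
  define F where "F = (\<lambda>(a::real, bs::'a list, x::'a). x) ` set xs"
  define c where "c x = (\<Sum>(a, bs, y)\<leftarrow>xs. if y = x then a else 0)" for x
  have F: "finite F" unfolding F_def by simp
  have nil: "bs = []" if "(a, bs, x) \<in> set xs" for a bs x using 0 that unfolding order_at_most_def by fastforce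
  have f1: "field_sum (B \<omega>) xs = (\<Sum>x\<in>F. c x * B \<omega> x)" for \<omega>
  proof -
    have "field_sum (B \<omega>) xs = (\<Sum>(a, bs, x)\<leftarrow>xs. a *\<^sub>R B \<omega> x)"
      unfolding field_sum_def by (intro arg_cong[where f=sum_list] map_cong refl) (auto dest!: nil)
    also have "\<dots> = (\<Sum>x\<in>F. c x *\<^sub>R B \<omega> x)" unfolding c_def by (rule sum_list_collect_points[OF F]) (simp add: F_def)
    finally show ?thesis by simp
  qed
  have f2: "mode_sum xs \<theta> = (\<Sum>x\<in>F. c x *\<^sub>R mode [] x \<theta>)" for \<theta>
  proof -
    have "mode_sum xs \<theta> = (\<Sum>(a, bs, x)\<leftarrow>xs. a *\<^sub>R mode [] x \<theta>)"
      unfolding mode_sum_def by (intro arg_cong[where f=sum_list] map_cong refl) (auto dest!: nil simp: scaleR_conv_of_real)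
    also have "\<dots> = (\<Sum>x\<in>F. c x *\<^sub>R mode [] x \<theta>)" unfolding c_def by (rule sum_list_collect_points[OF F]) (simp add: F_def)
    finally show ?thesis .
  qed
  show ?case unfolding f1 f2 by (rule charfun_point_values[OF F])
next
  case (Suc n)
  let ?q = "\<lambda>j. quotient_list j xs"
  note [measurable] = field_sum_meas[OF Suc.prems] field_sum_meas[OF order_quotient_list[OF Suc.prems]]
  have "(\<lambda>j. \<integral>\<omega>. iexp (field_sum (B \<omega>) (?q j)) \<partial>M) \<longlonglongrightarrow> (\<integral>\<omega>. iexp (field_sum (B \<omega>) xs) \<partial>M)"
    by (rule integral_dominated_convergence[where w="\<lambda>_. 1"])
       (auto intro!: AE_I2 tendsto_intros field_sum_quotient_tendsto[OF smooth Suc.prems])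
  moreover have "(\<lambda>j. \<integral>\<theta>. (norm (mode_sum (?q j) \<theta>))\<^sup>2 \<partial>sphere_uniform) \<longlonglongrightarrow> (\<integral>\<theta>. (norm (mode_sum xs \<theta>))\<^sup>2 \<partial>sphere_uniform)"
  proof (rule integral_dominated_convergence[where w="\<lambda>_. (weight_sum xs)\<^sup>2"])
    show "AE \<theta> in (sphere_uniform :: 'a measure). (\<lambda>j. (norm (mode_sum (?q j) \<theta>))\<^sup>2) \<longlonglongrightarrow> (norm (mode_sum xs \<theta>))\<^sup>2"
      by (intro AE_I2 tendsto_intros mode_sum_quotient_tendsto)
    show "AE \<theta> in (sphere_uniform :: 'a measure). norm ((norm (mode_sum (?q j) \<theta>))\<^sup>2) \<le> (weight_sum xs)\<^sup>2" for j
      using norm_quotient_list_le[OF Suc.prems] by (auto intro!: AE_I2 power_mono)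
  qed auto
  then have "(\<lambda>j. complex_of_real (exp (- (\<integral>\<theta>. (norm (mode_sum (?q j) \<theta>))\<^sup>2 \<partial>sphere_uniform) / 2))) \<longlonglongrightarrow>
      of_real (exp (- (\<integral>\<theta>. (norm (mode_sum xs \<theta>))\<^sup>2 \<partial>sphere_uniform) / 2))"
    by (intro tendsto_intros) auto
  moreover have "(\<integral>\<omega>. iexp (field_sum (B \<omega>) (?q j)) \<partial>M) = of_real (exp (- (\<integral>\<theta>. (norm (mode_sum (?q j) \<theta>))\<^sup>2 \<partial>sphere_uniform) / 2))" for j
    by (rule Suc.IH[OF order_quotient_list[OF Suc.prems]])
  ultimately show ?case using LIMSEQ_unique by auto
qed

end

section \<open>Traces of kernels on the sphere\<close>

abbreviation sph_pair :: "('a::euclidean_space \<times> 'a) measure" where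
  "sph_pair \<equiv> sphere_uniform \<Otimes>\<^sub>M sphere_uniform"

abbreviation sph_quad :: "(('a::euclidean_space \<times> 'a) \<times> ('a \<times> 'a)) measure" where
  "sph_quad \<equiv> sph_pair \<Otimes>\<^sub>M sph_pair"

lemma prob_space_sph_pair: "prob_space (sph_pair :: ('a::euclidean_space \<times> 'a) measure)"
  by unfold_locales

lemma prob_space_sph_quad: "prob_space (sph_quad :: (('a::euclidean_space \<times> 'a) \<times> ('a \<times> 'a)) measure)"
proof -
  interpret P: prob_space "sph_pair :: ('a \<times> 'a) measure" by (rule prob_space_sph_pair)
  interpret PP: pair_prob_space "sph_pair :: ('a \<times> 'a) measure" "sph_pair :: ('a \<times> 'a) measure" ..
  show ?thesis by unfold_locales
qed

lemma sum_mult_four: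
  fixes f g h k :: "'i \<Rightarrow> 'c::comm_ring_1"
  shows "(\<Sum>m\<in>I. f m) * (\<Sum>n\<in>I. g n) * (\<Sum>p\<in>I. h p) * (\<Sum>q\<in>I. k q) =
    (\<Sum>m\<in>I. \<Sum>n\<in>I. \<Sum>p\<in>I. \<Sum>q\<in>I. f m * g n * h p * k q)"
  by (simp only: mult.assoc sum_distrib_right) (simp only: sum_distrib_left mult.assoc)

locale spectral_family =
  fixes I :: "'i set" and u :: "'i \<Rightarrow> 'a::euclidean_space \<Rightarrow> complex" and S :: "'i \<Rightarrow> 'i \<Rightarrow> real" and a :: "'i \<Rightarrow> real"
  assumes fin: "finite I"
    and u_meas[measurable]: "\<And>m. u m \<in> borel_measurable borel"
    and u_bound: "\<And>m \<theta>. m \<in> I \<Longrightarrow> norm (u m \<theta>) \<le> 1"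
    and S_int: "\<And>m n. m \<in> I \<Longrightarrow> n \<in> I \<Longrightarrow> complex_of_real (S m n) = (\<integral>\<theta>. u m \<theta> * cnj (u n \<theta>) \<partial>sphere_uniform)"
begin

definition kern :: "'a \<Rightarrow> 'a \<Rightarrow> complex" where
  "kern x y = (\<Sum>m\<in>I. of_real (a m) * u m x * cnj (u m y))"

lemma cnj_meas[measurable]: "(\<lambda>x. cnj (u m x)) \<in> borel_measurable borel"
  by (rule measurable_compose[OF u_meas borel_measurable_continuous_onI]) (intro continuous_intros)

lemma uu_int: "m \<in> I \<Longrightarrow> n \<in> I \<Longrightarrow> integrable sphere_uniform (\<lambda>\<theta>. u m \<theta> * cnj (u n \<theta>))"
  by (rule sphere_integrable_bounded[of _ 1]) (auto simp: norm_mult intro!: mult_le_one u_bound)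

lemma kern_sym: "kern y x = cnj (kern x y)"
  unfolding kern_def by (simp add: mult_ac)

text \<open>Each covariance is an integral over one point of the sphere, and summing over the indices contracts the
  amplitudes into kernels; \<open>trace_four\<close> is the same computation with four points.\<close>

lemma trace_two:
  "complex_of_real (\<Sum>m\<in>I. \<Sum>n\<in>I. a m * a n * (S m n)\<^sup>2) = (\<integral>z. of_real ((norm (kern (fst z) (snd z)))\<^sup>2) \<partial>sph_pair)"
  (is "?L = ?R")
proof -
  have e: "complex_of_real (S m n * S n m) = (\<integral>z. (u m (fst z) * cnj (u n (fst z))) * (u n (snd z) * cnj (u m (snd z))) \<partial>sph_pair)"
    and i: "integrable sph_pair (\<lambda>z. (u m (fst z) * cnj (u n (fst z))) * (u n (snd z) * cnj (u m (snd z))))"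
    if "m \<in> I" "n \<in> I" for m n
    using pair_integral_mult[OF prob_space_sphere_uniform prob_space_sphere_uniform uu_int[OF that] uu_int[OF that(2,1)]]
    unfolding of_real_mult S_int[OF that] S_int[OF that(2,1)] by simp_all
  have sym: "S m n = S n m" if "m \<in> I" "n \<in> I" for m n
  proof -
    have "complex_of_real (S m n) = cnj (complex_of_real (S n m))"
      unfolding S_int[OF that] S_int[OF that(2,1)] by (subst integral_cnj[symmetric]) (simp add: mult.commute)
    then show ?thesis by simp
  qed
  have "?L = (\<Sum>m\<in>I. \<Sum>n\<in>I. of_real (a m * a n) * of_real (S m n * S n m))"
    unfolding of_real_sum by (intro sum.cong refl) (simp add: sym power2_eq_square)
  also have "\<dots> = (\<Sum>m\<in>I. \<Sum>n\<in>I. of_real (a m * a n) * (\<integral>z. (u m (fst z) * cnj (u n (fst z))) * (u n (snd z) * cnj (u m (snd z))) \<partial>sph_pair))"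
    by (intro sum.cong refl) (simp only: e)
  also have "\<dots> = (\<integral>z. (\<Sum>m\<in>I. \<Sum>n\<in>I. of_real (a m * a n) * ((u m (fst z) * cnj (u n (fst z))) * (u n (snd z) * cnj (u m (snd z))))) \<partial>sph_pair)"
    by (simp add: integral_sum integrable_sum i)
  also have "\<dots> = ?R"
  proof (rule integral_cong[OF refl])
    fix z :: "'a \<times> 'a"
    have "(\<Sum>m\<in>I. \<Sum>n\<in>I. of_real (a m * a n) * ((u m (fst z) * cnj (u n (fst z))) * (u n (snd z) * cnj (u m (snd z))))) = kern (fst z) (snd z) * kern (snd z) (fst z)"
      unfolding kern_def sum_product by (intro sum.cong refl) (simp add: mult_ac)
    also have "\<dots> = of_real ((norm (kern (fst z) (snd z)))\<^sup>2)"
      unfolding kern_sym[of "snd z" "fst z"] by (rule complex_norm_square[symmetric])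
    finally show "(\<Sum>m\<in>I. \<Sum>n\<in>I. of_real (a m * a n) * ((u m (fst z) * cnj (u n (fst z))) * (u n (snd z) * cnj (u m (snd z))))) = of_real ((norm (kern (fst z) (snd z)))\<^sup>2)" .
  qed
  finally show ?thesis .
qed

definition loop :: "(('a \<times> 'a) \<times> ('a \<times> 'a)) \<Rightarrow> complex" where
  "loop z = kern (fst (fst z)) (snd (snd z)) * kern (snd (fst z)) (fst (fst z)) * kern (fst (snd z)) (snd (fst z)) * kern (snd (snd z)) (fst (snd z))"

lemma trace_four:
  "complex_of_real (\<Sum>m\<in>I. \<Sum>n\<in>I. \<Sum>p\<in>I. \<Sum>q\<in>I. a m * a n * a p * a q * (S m n * S n p * S p q * S q m)) = (\<integral>z. loop z \<partial>sph_quad)"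
  (is "?L = ?R")
proof -
  let ?f = "\<lambda>m n p z. (u m (fst z) * cnj (u n (fst z))) * (u n (snd z) * cnj (u p (snd z)))"
  have e: "complex_of_real (S m n * S n p) = (\<integral>z. ?f m n p z \<partial>sph_pair)"
    and i: "integrable sph_pair (?f m n p)"
    if "m \<in> I" "n \<in> I" "p \<in> I" for m n p
    using pair_integral_mult[OF prob_space_sphere_uniform prob_space_sphere_uniform uu_int[OF that(1,2)] uu_int[OF that(2,3)]]
    unfolding of_real_mult S_int[OF that(1,2)] S_int[OF that(2,3)] by simp_all
  have e4: "complex_of_real (S m n * S n p) * of_real (S p q * S q m) = (\<integral>z. ?f m n p (fst z) * ?f p q m (snd z) \<partial>sph_quad)"
    and i4: "integrable sph_quad (\<lambda>z. ?f m n p (fst z) * ?f p q m (snd z))"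
    if "m \<in> I" "n \<in> I" "p \<in> I" "q \<in> I" for m n p q
    using pair_integral_mult[OF prob_space_sph_pair prob_space_sph_pair i[OF that(1,2,3)] i[OF that(3,4,1)]]
    unfolding e[OF that(1,2,3)] e[OF that(3,4,1)] by simp_all
  have "?L = (\<Sum>m\<in>I. \<Sum>n\<in>I. \<Sum>p\<in>I. \<Sum>q\<in>I. of_real (a m * a n * a p * a q) * (complex_of_real (S m n * S n p) * of_real (S p q * S q m)))"
    unfolding of_real_sum by (intro sum.cong refl) (simp add: mult_ac)
  also have "\<dots> = (\<Sum>m\<in>I. \<Sum>n\<in>I. \<Sum>p\<in>I. \<Sum>q\<in>I. of_real (a m * a n * a p * a q) * (\<integral>z. ?f m n p (fst z) * ?f p q m (snd z) \<partial>sph_quad))"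
    by (intro sum.cong refl) (simp only: e4)
  also have "\<dots> = (\<integral>z. (\<Sum>m\<in>I. \<Sum>n\<in>I. \<Sum>p\<in>I. \<Sum>q\<in>I. of_real (a m * a n * a p * a q) * (?f m n p (fst z) * ?f p q m (snd z))) \<partial>sph_quad)"
    by (simp add: integral_sum integrable_sum i4)
  also have "\<dots> = ?R"
  proof (rule integral_cong[OF refl])
    fix z :: "('a \<times> 'a) \<times> ('a \<times> 'a)"
    show "(\<Sum>m\<in>I. \<Sum>n\<in>I. \<Sum>p\<in>I. \<Sum>q\<in>I. of_real (a m * a n * a p * a q) * (?f m n p (fst z) * ?f p q m (snd z))) = loop z"
      unfolding loop_def kern_def sum_mult_four by (intro sum.cong refl) (simp add: mult_ac)
  qed
  finally show ?thesis .
qed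

end

text \<open>Schur's test. Bounding the product of two opposite edges of the cycle by half the sum of their squares leaves one
  square and two free edges, and integrating over the free endpoints costs a factor \<open>D\<close> each.\<close>

lemma nn_integral_four_cycle_le:
  fixes h :: "'a::euclidean_space \<Rightarrow> 'a \<Rightarrow> ennreal"
  assumes h[measurable]: "(\<lambda>(x, y). h x y) \<in> borel_measurable (borel \<Otimes>\<^sub>M borel)"
    and sym: "\<And>x y. h x y = h y x" and D: "\<And>x. (\<integral>\<^sup>+y. h x y \<partial>sphere_uniform) \<le> D"
  shows "(\<integral>\<^sup>+z. h (fst (fst z)) (snd (snd z)) * h (snd (fst z)) (fst (fst z)) * h (fst (snd z)) (snd (fst z)) * h (snd (snd z)) (fst (snd z)) \<partial>sph_quad)
     \<le> D\<^sup>2 * (\<integral>\<^sup>+z. (h (fst z) (snd z))\<^sup>2 \<partial>sph_pair)"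
proof -
  let ?\<sigma> = "sphere_uniform :: 'a measure"
  have hm[measurable]: "(\<lambda>z. h (f z) (g z)) \<in> borel_measurable N" if [measurable]: "f \<in> borel_measurable N" "g \<in> borel_measurable N" for f g and N :: "'z measure"
    using measurable_compose[OF measurable_Pair[OF that] h] by simp
  interpret P: prob_space "sph_pair :: ('a \<times> 'a) measure" by (rule prob_space_sph_pair)
  have D': "(\<integral>\<^sup>+y. h y x \<partial>?\<sigma>) \<le> D" for x using D[of x] sym by simp
  define J where "J = (\<integral>\<^sup>+x. \<integral>\<^sup>+y. (h x y)\<^sup>2 \<partial>?\<sigma> \<partial>?\<sigma>)"
  have pairJ: "(\<integral>\<^sup>+z. (h (fst z) (snd z))\<^sup>2 \<partial>sph_pair) = J"
    unfolding J_def by (subst sph.nn_integral_fst[symmetric]) auto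
  have T1: "(\<integral>\<^sup>+x1. \<integral>\<^sup>+x2. \<integral>\<^sup>+x3. \<integral>\<^sup>+x4. (h x1 x4)\<^sup>2 * (h x2 x1 * h x4 x3) \<partial>?\<sigma> \<partial>?\<sigma> \<partial>?\<sigma> \<partial>?\<sigma>) \<le> D\<^sup>2 * J"
  proof -
    have "(\<integral>\<^sup>+x3. \<integral>\<^sup>+x4. (h x1 x4)\<^sup>2 * (h x2 x1 * h x4 x3) \<partial>?\<sigma> \<partial>?\<sigma>) \<le> h x2 x1 * (D * (\<integral>\<^sup>+x4. (h x1 x4)\<^sup>2 \<partial>?\<sigma>))" for x1 x2
    proof -
      have "(\<integral>\<^sup>+x3. \<integral>\<^sup>+x4. (h x1 x4)\<^sup>2 * (h x2 x1 * h x4 x3) \<partial>?\<sigma> \<partial>?\<sigma>) = (\<integral>\<^sup>+x4. \<integral>\<^sup>+x3. (h x1 x4)\<^sup>2 * (h x2 x1 * h x4 x3) \<partial>?\<sigma> \<partial>?\<sigma>)"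
        by (rule sph2.Fubini') (auto simp: split_beta)
      also have "\<dots> = (\<integral>\<^sup>+x4. (h x2 x1 * (h x1 x4)\<^sup>2) * (\<integral>\<^sup>+x3. h x4 x3 \<partial>?\<sigma>) \<partial>?\<sigma>)"
        by (subst nn_integral_cmult[symmetric]) (auto intro!: nn_integral_cong simp: mult_ac)
      also have "\<dots> \<le> (\<integral>\<^sup>+x4. (h x2 x1 * (h x1 x4)\<^sup>2) * D \<partial>?\<sigma>)"
        by (intro nn_integral_mono mult_left_mono D) auto
      also have "\<dots> = (\<integral>\<^sup>+x4. (h x2 x1 * D) * (h x1 x4)\<^sup>2 \<partial>?\<sigma>)" by (simp add: mult_ac)
      also have "\<dots> = (h x2 x1 * D) * (\<integral>\<^sup>+x4. (h x1 x4)\<^sup>2 \<partial>?\<sigma>)" by (rule nn_integral_cmult) auto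
      finally show ?thesis by (simp add: mult_ac)
    qed
    then have "(\<integral>\<^sup>+x1. \<integral>\<^sup>+x2. \<integral>\<^sup>+x3. \<integral>\<^sup>+x4. (h x1 x4)\<^sup>2 * (h x2 x1 * h x4 x3) \<partial>?\<sigma> \<partial>?\<sigma> \<partial>?\<sigma> \<partial>?\<sigma>) \<le>
      (\<integral>\<^sup>+x1. \<integral>\<^sup>+x2. h x2 x1 * (D * (\<integral>\<^sup>+x4. (h x1 x4)\<^sup>2 \<partial>?\<sigma>)) \<partial>?\<sigma> \<partial>?\<sigma>)"
      by (intro nn_integral_mono)
    also have "\<dots> = (\<integral>\<^sup>+x1. (\<integral>\<^sup>+x2. h x2 x1 \<partial>?\<sigma>) * (D * (\<integral>\<^sup>+x4. (h x1 x4)\<^sup>2 \<partial>?\<sigma>)) \<partial>?\<sigma>)"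
      by (subst nn_integral_multc) auto
    also have "\<dots> \<le> (\<integral>\<^sup>+x1. D * (D * (\<integral>\<^sup>+x4. (h x1 x4)\<^sup>2 \<partial>?\<sigma>)) \<partial>?\<sigma>)"
      by (intro nn_integral_mono mult_right_mono D') auto
    also have "\<dots> = D * (D * J)"
      unfolding J_def by (subst nn_integral_cmult, measurable, subst nn_integral_cmult, measurable)
    finally show ?thesis by (simp add: power2_eq_square mult_ac)
  qed
  have T2: "(\<integral>\<^sup>+x1. \<integral>\<^sup>+x2. \<integral>\<^sup>+x3. \<integral>\<^sup>+x4. (h x3 x2)\<^sup>2 * (h x2 x1 * h x4 x3) \<partial>?\<sigma> \<partial>?\<sigma> \<partial>?\<sigma> \<partial>?\<sigma>) \<le> D\<^sup>2 * J"
  proof -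
    have "(\<integral>\<^sup>+x3. \<integral>\<^sup>+x4. (h x3 x2)\<^sup>2 * (h x2 x1 * h x4 x3) \<partial>?\<sigma> \<partial>?\<sigma>) \<le> h x2 x1 * (D * (\<integral>\<^sup>+x3. (h x2 x3)\<^sup>2 \<partial>?\<sigma>))" for x1 x2
    proof -
      have "(\<integral>\<^sup>+x3. \<integral>\<^sup>+x4. (h x3 x2)\<^sup>2 * (h x2 x1 * h x4 x3) \<partial>?\<sigma> \<partial>?\<sigma>) = (\<integral>\<^sup>+x3. (h x2 x1 * (h x2 x3)\<^sup>2) * (\<integral>\<^sup>+x4. h x4 x3 \<partial>?\<sigma>) \<partial>?\<sigma>)"
        by (subst nn_integral_cmult[symmetric]) (auto intro!: nn_integral_cong simp: mult_ac sym[of _ x2])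
      also have "\<dots> \<le> (\<integral>\<^sup>+x3. (h x2 x1 * (h x2 x3)\<^sup>2) * D \<partial>?\<sigma>)"
        by (intro nn_integral_mono mult_left_mono D') auto
      also have "\<dots> = (\<integral>\<^sup>+x3. (h x2 x1 * D) * (h x2 x3)\<^sup>2 \<partial>?\<sigma>)" by (simp add: mult_ac)
      also have "\<dots> = (h x2 x1 * D) * (\<integral>\<^sup>+x3. (h x2 x3)\<^sup>2 \<partial>?\<sigma>)" by (rule nn_integral_cmult) auto
      finally show ?thesis by (simp add: mult_ac)
    qed
    then have "(\<integral>\<^sup>+x1. \<integral>\<^sup>+x2. \<integral>\<^sup>+x3. \<integral>\<^sup>+x4. (h x3 x2)\<^sup>2 * (h x2 x1 * h x4 x3) \<partial>?\<sigma> \<partial>?\<sigma> \<partial>?\<sigma> \<partial>?\<sigma>) \<le>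
      (\<integral>\<^sup>+x1. \<integral>\<^sup>+x2. h x2 x1 * (D * (\<integral>\<^sup>+x3. (h x2 x3)\<^sup>2 \<partial>?\<sigma>)) \<partial>?\<sigma> \<partial>?\<sigma>)"
      by (intro nn_integral_mono)
    also have "\<dots> = (\<integral>\<^sup>+x2. \<integral>\<^sup>+x1. h x2 x1 * (D * (\<integral>\<^sup>+x3. (h x2 x3)\<^sup>2 \<partial>?\<sigma>)) \<partial>?\<sigma> \<partial>?\<sigma>)"
      by (rule sph2.Fubini') (simp add: split_beta)
    also have "\<dots> = (\<integral>\<^sup>+x2. (\<integral>\<^sup>+x1. h x2 x1 \<partial>?\<sigma>) * (D * (\<integral>\<^sup>+x3. (h x2 x3)\<^sup>2 \<partial>?\<sigma>)) \<partial>?\<sigma>)"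
      by (subst nn_integral_multc) auto
    also have "\<dots> \<le> (\<integral>\<^sup>+x2. D * (D * (\<integral>\<^sup>+x3. (h x2 x3)\<^sup>2 \<partial>?\<sigma>)) \<partial>?\<sigma>)"
      by (intro nn_integral_mono mult_right_mono D) auto
    also have "\<dots> = D * (D * J)"
      unfolding J_def by (subst nn_integral_cmult, measurable, subst nn_integral_cmult, measurable)
    finally show ?thesis by (simp add: power2_eq_square mult_ac)
  qed
  have fub: "(\<integral>\<^sup>+z. f z \<partial>sph_quad) = (\<integral>\<^sup>+x1. \<integral>\<^sup>+x2. \<integral>\<^sup>+x3. \<integral>\<^sup>+x4. f ((x1, x2), (x3, x4)) \<partial>?\<sigma> \<partial>?\<sigma> \<partial>?\<sigma> \<partial>?\<sigma>)"
    if [measurable]: "f \<in> borel_measurable sph_quad" for f :: "('a \<times> 'a) \<times> ('a \<times> 'a) \<Rightarrow> ennreal"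
  proof -
    have "(\<integral>\<^sup>+z. f z \<partial>sph_quad) = (\<integral>\<^sup>+p. \<integral>\<^sup>+q. f (p, q) \<partial>sph_pair \<partial>sph_pair)"
      by (rule sigma_finite_measure.nn_integral_fst[OF prob_space_imp_sigma_finite[OF prob_space_sph_pair], symmetric]) measurable
    also have "\<dots> = (\<integral>\<^sup>+p. \<integral>\<^sup>+x3. \<integral>\<^sup>+x4. f (p, (x3, x4)) \<partial>?\<sigma> \<partial>?\<sigma> \<partial>sph_pair)"
      by (intro nn_integral_cong sph.nn_integral_fst[symmetric]) measurable
    also have "\<dots> = (\<integral>\<^sup>+x1. \<integral>\<^sup>+x2. \<integral>\<^sup>+x3. \<integral>\<^sup>+x4. f ((x1, x2), (x3, x4)) \<partial>?\<sigma> \<partial>?\<sigma> \<partial>?\<sigma> \<partial>?\<sigma>)"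
      by (rule sph.nn_integral_fst[symmetric]) measurable
    finally show ?thesis .
  qed
  let ?c = "\<lambda>z. h (fst (fst z)) (snd (snd z)) * h (snd (fst z)) (fst (fst z)) * h (fst (snd z)) (snd (fst z)) * h (snd (snd z)) (fst (snd z))"
  let ?t1 = "\<lambda>z. (h (fst (fst z)) (snd (snd z)))\<^sup>2 * (h (snd (fst z)) (fst (fst z)) * h (snd (snd z)) (fst (snd z)))"
  let ?t2 = "\<lambda>z. (h (fst (snd z)) (snd (fst z)))\<^sup>2 * (h (snd (fst z)) (fst (fst z)) * h (snd (snd z)) (fst (snd z)))"
  have amgm: "2 * (x * y) \<le> x\<^sup>2 + y\<^sup>2" for x y :: ennreal
  proof (cases "x = \<top> \<or> y = \<top>")
    case False
    then obtain r s where "x = ennreal r" "0 \<le> r" "y = ennreal s" "0 \<le> s" by (metis ennreal_cases)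
    moreover have "2 * (r * s) \<le> r\<^sup>2 + s\<^sup>2" using zero_le_power2[of "r - s"] by (simp add: power2_diff)
    ultimately show ?thesis
      by (simp add: ennreal_mult'[symmetric] ennreal_power ennreal_plus[symmetric] ennreal_leI del: ennreal_plus flip: ennreal_numeral)
  qed (auto simp: power2_eq_square ennreal_mult_eq_top_iff top_add add_top)
  have "2 * (\<integral>\<^sup>+z. ?c z \<partial>sph_quad) = (\<integral>\<^sup>+z. 2 * ?c z \<partial>sph_quad)" by (rule nn_integral_cmult[symmetric]) measurable
  also have "\<dots> \<le> (\<integral>\<^sup>+z. ?t1 z + ?t2 z \<partial>sph_quad)"
  proof (rule nn_integral_mono)
    fix z :: "('a \<times> 'a) \<times> ('a \<times> 'a)"
    have "2 * ?c z = (2 * (h (fst (fst z)) (snd (snd z)) * h (fst (snd z)) (snd (fst z)))) * (h (snd (fst z)) (fst (fst z)) * h (snd (snd z)) (fst (snd z)))"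
      by (simp add: mult_ac)
    also have "\<dots> \<le> ((h (fst (fst z)) (snd (snd z)))\<^sup>2 + (h (fst (snd z)) (snd (fst z)))\<^sup>2) * (h (snd (fst z)) (fst (fst z)) * h (snd (snd z)) (fst (snd z)))"
      by (intro mult_right_mono amgm) auto
    finally show "2 * ?c z \<le> ?t1 z + ?t2 z" by (simp add: distrib_right)
  qed
  also have "\<dots> = (\<integral>\<^sup>+z. ?t1 z \<partial>sph_quad) + (\<integral>\<^sup>+z. ?t2 z \<partial>sph_quad)" by (rule nn_integral_add) measurable
  also have "\<dots> \<le> D\<^sup>2 * J + D\<^sup>2 * J"
    by (intro add_mono) (subst fub, measurable, use T1 T2 in simp)+
  also have "\<dots> = 2 * (D\<^sup>2 * J)" by (simp add: mult_2)
  finally have "2 * (\<integral>\<^sup>+z. ?c z \<partial>sph_quad) \<le> 2 * (D\<^sup>2 * J)" .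
  then have "(\<integral>\<^sup>+z. ?c z \<partial>sph_quad) \<le> D\<^sup>2 * J"
    by (subst (asm) ennreal_mult_le_mult_iff) auto
  then show ?thesis unfolding pairJ .
qed

section \<open>Discretisation of the quadratic functional\<close>

lemma sum_prod_list_length:
  fixes f :: "'a \<Rightarrow> 'c::comm_semiring_1"
  assumes "finite A"
  shows "(\<Sum>bs\<in>{bs. set bs \<subseteq> A \<and> length bs = j}. \<Prod>b\<leftarrow>bs. f b) = (\<Sum>b\<in>A. f b) ^ j"
proof (induction j)
  case 0
  have "{bs. set bs \<subseteq> A \<and> length bs = 0} = {[]}" by auto
  then show ?case by simp
next
  case (Suc j)
  let ?L = "{bs. set bs \<subseteq> A \<and> length bs = j}"
  have "(\<Sum>bs\<in>{bs. set bs \<subseteq> A \<and> length bs = Suc j}. \<Prod>b\<leftarrow>bs. f b) = (\<Sum>z\<in>?L \<times> A. \<Prod>b\<leftarrow>snd z # fst z. f b)"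
    unfolding lists_length_Suc_eq by (subst sum.reindex) (auto simp: inj_on_def split_beta)
  also have "\<dots> = (\<Sum>bs\<in>?L. \<Sum>b\<in>A. f b * (\<Prod>b\<leftarrow>bs. f b))"
    by (simp add: sum.cartesian_product split_beta)
  also have "\<dots> = (\<Sum>b\<in>A. f b) * (\<Sum>bs\<in>?L. \<Prod>b\<leftarrow>bs. f b)"
    by (simp add: sum_distrib_right[symmetric] sum_distrib_left[symmetric] mult.commute)
  finally show ?case using Suc by simp
qed

definition wave_kernel :: "(real \<Rightarrow> real) \<Rightarrow> ('a::euclidean_space \<Rightarrow> complex) \<Rightarrow> 'a \<Rightarrow> 'a \<Rightarrow> complex" where
  "wave_kernel p g \<theta> \<eta> = (if norm \<theta> = 1 \<and> norm \<eta> = 1 then of_real (p (\<theta> \<bullet> \<eta>)) * g (\<theta> - \<eta>) else 0)"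

lemma mode_product:
  assumes "norm \<theta> = 1" "norm \<eta> = 1"
  shows "mode bs y \<theta> * cnj (mode bs y \<eta>) = (\<Prod>b\<leftarrow>bs. of_real ((\<theta> \<bullet> b) * (\<eta> \<bullet> b))) * iexp (y \<bullet> (\<theta> - \<eta>))"
proof (induction bs)
  case Nil
  show ?case using assms by (simp add: mode_def exp_cnj inner_diff_right right_diff_distrib exp_diff exp_minus field_simps)
next
  case (Cons b bs)
  then show ?case unfolding mode_Cons by (simp add: mult_ac)
qed

lemma simple_function_integral_sum:
  fixes h :: "'a::euclidean_space \<Rightarrow> 'c::{banach, second_countable_topology}" and F :: "'a \<Rightarrow> 'a"
  assumes \<phi>: "integrable lborel \<phi>" and F[measurable]: "F \<in> borel_measurable borel" and fin: "finite (range F)"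
  shows "(\<integral>x. \<phi> x *\<^sub>R h (F x) \<partial>lborel) = (\<Sum>y\<in>range F. (\<integral>x. \<phi> x * indicator (F -` {y}) x \<partial>lborel) *\<^sub>R h y)"
proof -
  have [measurable]: "F -` {y} \<in> sets borel" for y using measurable_sets[OF F, of "{y}"] by simp
  have i: "integrable lborel (\<lambda>x. \<phi> x * indicator (F -` {y}) x)" for y
    by (rule integrable_bound[OF \<phi>]) (use \<phi> in \<open>auto simp: indicator_def\<close>)
  have "\<phi> x *\<^sub>R h (F x) = (\<Sum>y\<in>range F. (\<phi> x * indicator (F -` {y}) x) *\<^sub>R h y)" for x
  proof -
    have "(\<Sum>y\<in>range F. (\<phi> x * indicator (F -` {y}) x) *\<^sub>R h y) = (\<Sum>y\<in>range F. if y = F x then \<phi> x *\<^sub>R h y else 0)"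
      by (intro sum.cong refl) (auto simp: indicator_def)
    then show ?thesis using fin by simp
  qed
  then have "(\<integral>x. \<phi> x *\<^sub>R h (F x) \<partial>lborel) = (\<integral>x. (\<Sum>y\<in>range F. (\<phi> x * indicator (F -` {y}) x) *\<^sub>R h y) \<partial>lborel)" by simp
  also have "\<dots> = (\<Sum>y\<in>range F. (\<integral>x. (\<phi> x * indicator (F -` {y}) x) *\<^sub>R h y \<partial>lborel))"
    by (rule integral_sum) (intro integrable_scaleR_left i)
  also have "\<dots> = (\<Sum>y\<in>range F. (\<integral>x. \<phi> x * indicator (F -` {y}) x \<partial>lborel) *\<^sub>R h y)"
    by (intro sum.cong refl integral_scaleR_left) (use i in auto)
  finally show ?thesis .
qed

lemma simple_approximation_identity:
  obtains F :: "nat \<Rightarrow> 'a::euclidean_space \<Rightarrow> 'a"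
  where "\<And>n. F n \<in> borel_measurable borel" "\<And>n. finite (range (F n))" "\<And>x. (\<lambda>n. F n x) \<longlonglongrightarrow> x"
proof -
  have "(\<lambda>x. x) \<in> borel_measurable (borel :: 'a measure)" by simp
  from borel_measurable_implies_sequence_metric[OF this, of 0] obtain F
    where F: "\<And>i. simple_function borel (F i)" "\<And>x. x \<in> space (borel :: 'a measure) \<Longrightarrow> (\<lambda>i. F i x) \<longlonglongrightarrow> x" by blast
  show ?thesis
    using F by (intro that[of F]) (auto simp: simple_function_def intro: borel_measurable_simple_function)
qed

context smooth_berry begin

text \<open>The samples are indexed by a word of directions together with a point.\<close>

definition pfield :: "'a list \<times> 'a \<Rightarrow> 'w \<Rightarrow> real" where
  "pfield m \<omega> = partials (fst m) (B \<omega>) (snd m)"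

abbreviation pmode :: "'a list \<times> 'a \<Rightarrow> 'a \<Rightarrow> complex" where
  "pmode m \<equiv> mode (fst m) (snd m)"

definition pcov :: "'a list \<times> 'a \<Rightarrow> 'a list \<times> 'a \<Rightarrow> real" where
  "pcov m n = (\<integral>\<theta>. Re (pmode m \<theta> * cnj (pmode n \<theta>)) \<partial>sphere_uniform)"

lemma cnj_mode_meas[measurable]: "(\<lambda>\<theta>. cnj (mode bs x \<theta>)) \<in> borel_measurable borel"
  by (rule measurable_compose[OF mode_meas borel_measurable_continuous_onI]) (intro continuous_intros)

lemma pmode_prod_int:
  assumes "fst m \<in> lists Basis" "fst n \<in> lists Basis"
  shows "integrable sphere_uniform (\<lambda>\<theta>. pmode m \<theta> * cnj (pmode n \<theta>))"
  by (rule sphere_integrable_bounded[of _ 1]) (use assms in \<open>auto simp: norm_mult intro!: mult_le_one norm_mode_le\<close>)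

lemma pcov_complex:
  assumes "fst m \<in> lists Basis" "fst n \<in> lists Basis"
  shows "complex_of_real (pcov m n) = (\<integral>\<theta>. pmode m \<theta> * cnj (pmode n \<theta>) \<partial>sphere_uniform)"
proof -
  let ?J = "\<integral>\<theta>. pmode m \<theta> * cnj (pmode n \<theta>) \<partial>sphere_uniform"
  have "?J = (\<integral>\<theta>. pmode m (- \<theta>) * cnj (pmode n (- \<theta>)) \<partial>sphere_uniform)"
    by (rule sphere_integral_involution[of uminus, symmetric])
       (auto simp: orthogonal_transformation_def linear_iff)
  also have "\<dots> = cnj ?J"
    unfolding mode_uminus by (subst integral_cnj[symmetric]) simp
  finally have "Im ?J = 0" by (metis Reals_cnj_iff complex_is_Real_iff)
  moreover have "Re ?J = pcov m n" unfolding pcov_def by (rule integral_Re[OF pmode_prod_int[OF assms], symmetric])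
  ultimately show ?thesis by (simp add: complex_eq_iff)
qed

lemma pfield_meas:
  assumes "fst m \<in> lists Basis"
  shows "pfield m \<in> borel_measurable M"
proof -
  have "(\<lambda>\<omega>. field_sum (B \<omega>) [(1, fst m, snd m)]) \<in> borel_measurable M"
    by (rule field_sum_meas[of "length (fst m)"]) (use assms in \<open>auto simp: order_at_most_def\<close>)
  then show ?thesis by (simp add: pfield_def[abs_def] field_sum_def prod.case_eq_if)
qed

lemma gaussian_family_pfield:
  assumes I: "finite I" "\<And>m. m \<in> I \<Longrightarrow> fst m \<in> lists Basis"
  shows "gaussian_family M I pfield pcov"
proof
  show "finite I" by fact
  show "pfield m \<in> borel_measurable M" if "m \<in> I" for m using pfield_meas I(2)[OF that] by simp
  show "pcov m n = pcov n m" for m n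
    unfolding pcov_def by (intro integral_cong refl) (simp add: mult.commute)
  fix v :: "'a list \<times> 'a \<Rightarrow> real"
  obtain l where l: "set l = I" "distinct l" using finite_distinct_list[OF I(1)] by blast
  define xs where "xs = map (\<lambda>m. (v m, fst m, snd m)) l"
  have ord: "order_at_most (\<Sum>m\<in>I. length (fst m)) xs"
    unfolding order_at_most_def xs_def using I(2)
    using member_le_sum[OF _ _ I(1), of _ "\<lambda>m. length (fst m)"] by (simp add: l(1) split_beta image_image)
  have f: "field_sum (B \<omega>) xs = (\<Sum>m\<in>I. v m * pfield m \<omega>)" for \<omega>
    unfolding field_sum_def xs_def l(1)[symmetric] pfield_def
    by (simp add: sum.distinct_set_conv_list[OF l(2)] comp_def split_beta)
  have g: "mode_sum xs \<theta> = (\<Sum>m\<in>I. of_real (v m) * pmode m \<theta>)" for \<theta>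
    unfolding mode_sum_def xs_def l(1)[symmetric]
    by (simp add: sum.distinct_set_conv_list[OF l(2)] comp_def split_beta)
  have n2: "(norm (mode_sum xs \<theta>))\<^sup>2 = (\<Sum>m\<in>I. \<Sum>n\<in>I. v m * v n * Re (pmode m \<theta> * cnj (pmode n \<theta>)))" for \<theta>
  proof -
    have "complex_of_real ((norm (mode_sum xs \<theta>))\<^sup>2) = (\<Sum>m\<in>I. \<Sum>n\<in>I. of_real (v m * v n) * (pmode m \<theta> * cnj (pmode n \<theta>)))"
      unfolding complex_norm_square g cnj_sum sum_product by (intro sum.cong refl) (simp add: mult_ac)
    then have "(norm (mode_sum xs \<theta>))\<^sup>2 = Re (\<Sum>m\<in>I. \<Sum>n\<in>I. of_real (v m * v n) * (pmode m \<theta> * cnj (pmode n \<theta>)))"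
      by (metis Re_complex_of_real)
    also have "\<dots> = (\<Sum>m\<in>I. \<Sum>n\<in>I. v m * v n * Re (pmode m \<theta> * cnj (pmode n \<theta>)))"
      unfolding Re_sum by (intro sum.cong refl) (simp only: Re_complex_of_real times_complex.sel Im_complex_of_real mult_zero_left diff_zero)
    finally show ?thesis .
  qed
  have ri: "integrable sphere_uniform (\<lambda>\<theta>. Re (pmode m \<theta> * cnj (pmode n \<theta>)))" if "m \<in> I" "n \<in> I" for m n
    using pmode_prod_int[OF I(2)[OF that(1)] I(2)[OF that(2)]] by (rule integrable_Re)
  have "(\<integral>\<theta>. (norm (mode_sum xs \<theta>))\<^sup>2 \<partial>sphere_uniform) = (\<Sum>m\<in>I. \<Sum>n\<in>I. v m * v n * pcov m n)"
    unfolding n2 pcov_def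
    by (simp add: integral_sum integrable_sum ri del: times_complex.sel)
  with charfun_field_sum[OF ord]
  show "(\<integral>\<omega>. iexp (\<Sum>m\<in>I. v m * pfield m \<omega>) \<partial>M) = of_real (exp (- (\<Sum>m\<in>I. \<Sum>n\<in>I. v m * v n * pcov m n) / 2))"
    unfolding f by simp
qed

lemma pcov_diag: "pcov (bs, y) (bs, y) = pcov (bs, 0) (bs, 0)"
proof -
  have "mode bs y \<theta> * cnj (mode bs y \<theta>) = mode bs 0 \<theta> * cnj (mode bs 0 \<theta>)" for \<theta>
    by (cases "norm \<theta> = 1") (simp_all add: mode_product, simp add: mode_def)
  then show ?thesis unfolding pcov_def by simp
qed

text \<open>The frequencies are unit vectors, so the squared amplitudes of all derivatives of order \<open>j\<close> add up to one. Hence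
  every gradient norm squared has mean one and subtracting \<open>1\<close> is the same as centring.\<close>

lemma sum_pcov_diag: "(\<Sum>bs\<in>{bs. set bs \<subseteq> Basis \<and> length bs = j}. pcov (bs, 0) (bs, 0)) = 1"
proof -
  let ?L = "{bs. set bs \<subseteq> (Basis::'a set) \<and> length bs = j}"
  have "complex_of_real (\<Sum>bs\<in>?L. pcov (bs, 0) (bs, 0)) = (\<Sum>bs\<in>?L. (\<integral>\<theta>. mode bs 0 \<theta> * cnj (mode bs 0 \<theta>) \<partial>sphere_uniform))"
    unfolding of_real_sum by (intro sum.cong refl) (subst pcov_complex, auto)
  also have "\<dots> = (\<integral>\<theta>. (\<Sum>bs\<in>?L. mode bs 0 \<theta> * cnj (mode bs 0 \<theta>)) \<partial>sphere_uniform)"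
    by (rule integral_sum[symmetric]) (use pmode_prod_int[of "(_, 0)" "(_, 0)"] in auto)
  also have "\<dots> = (\<integral>\<theta>. 1 \<partial>(sphere_uniform :: 'a measure))"
  proof (rule integral_cong_AE)
    show "AE \<theta> in (sphere_uniform :: 'a measure). (\<Sum>bs\<in>?L. mode bs 0 \<theta> * cnj (mode bs 0 \<theta>)) = 1"
      using AE_sphere_uniform
    proof eventually_elim
      fix \<theta> :: 'a assume n: "norm \<theta> = 1"
      have "(\<Sum>bs\<in>?L. mode bs 0 \<theta> * cnj (mode bs 0 \<theta>)) = (\<Sum>bs\<in>?L. \<Prod>b\<leftarrow>bs. of_real ((\<theta> \<bullet> b) * (\<theta> \<bullet> b)))"
        by (simp add: mode_product[OF n n])
      also have "\<dots> = (\<Sum>b\<in>Basis. of_real ((\<theta> \<bullet> b) * (\<theta> \<bullet> b))) ^ j" by (rule sum_prod_list_length) simp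
      also have "\<dots> = of_real (\<theta> \<bullet> \<theta>) ^ j" by (subst euclidean_inner) simp
      also have "\<dots> = 1" using n by (simp add: dot_square_norm)
      finally show "(\<Sum>bs\<in>?L. mode bs 0 \<theta> * cnj (mode bs 0 \<theta>)) = 1" .
    qed
  qed auto
  also have "\<dots> = 1" by (simp add: sph.prob_space[simplified])
  finally show ?thesis by (simp only: of_real_eq_1_iff)
qed

lemma partials_eval_meas:
  fixes F :: "'a \<Rightarrow> 'a"
  assumes bs: "bs \<in> lists Basis" and F[measurable]: "F \<in> borel_measurable borel" and fin: "finite (range F)"
  shows "(\<lambda>z. partials bs (B (fst z)) (F (snd z))) \<in> borel_measurable (M \<Otimes>\<^sub>M lborel)"
proof -
  have [measurable]: "F -` {y} \<in> sets borel" for y using measurable_sets[OF F, of "{y}"] by simp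
  have [measurable]: "(\<lambda>z. pfield (bs, y) (fst z)) \<in> borel_measurable (M \<Otimes>\<^sub>M (lborel :: 'a measure))" for y
    by (rule measurable_compose[OF measurable_fst pfield_meas]) (use bs in simp)
  have "partials bs (B (fst z)) (F (snd z)) = (\<Sum>y\<in>range F. pfield (bs, y) (fst z) * indicator (F -` {y}) (snd z))" for z :: "'w \<times> 'a"
  proof -
    have "(\<Sum>y\<in>range F. pfield (bs, y) (fst z) * indicator (F -` {y}) (snd z)) = (\<Sum>y\<in>range F. if y = F (snd z) then pfield (bs, y) (fst z) else 0)"
      by (intro sum.cong refl) (auto simp: indicator_def)
    then show ?thesis using fin by (simp add: pfield_def)
  qed
  then show ?thesis by simp
qed

text \<open>Continuity in the point gives joint measurability: evaluation at simple functions converging to the identity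
  is measurable.\<close>

lemma partials_joint_meas:
  assumes bs: "bs \<in> lists Basis"
  shows "(\<lambda>z. partials bs (B (fst z)) (snd z)) \<in> borel_measurable (M \<Otimes>\<^sub>M lborel)"
proof -
  obtain F :: "nat \<Rightarrow> 'a \<Rightarrow> 'a" where F: "\<And>n. F n \<in> borel_measurable borel" "\<And>n. finite (range (F n))" "\<And>x. (\<lambda>n. F n x) \<longlonglongrightarrow> x"
    using simple_approximation_identity by blast
  show ?thesis
  proof (rule borel_measurable_LIMSEQ_real[OF _ partials_eval_meas[OF bs F(1,2)]])
    fix z :: "'w \<times> 'a"
    have "isCont (partials bs (B (fst z))) (snd z)"
      using smooth_fun_partials_continuous(1)[OF smooth bs] by (simp add: continuous_on_eq_continuous_at)
    then show "(\<lambda>n. partials bs (B (fst z)) (F n (snd z))) \<longlonglongrightarrow> partials bs (B (fst z)) (snd z)"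
      by (rule isCont_tendsto_compose[OF _ F(3)])
  qed
qed

lemma second_moment: "bs \<in> lists Basis \<Longrightarrow> (\<integral>\<^sup>+\<omega>. ennreal ((partials bs (B \<omega>) y)\<^sup>2) \<partial>M) = ennreal (pcov (bs, 0) (bs, 0))"
proof -
  assume bs: "bs \<in> lists Basis"
  have "gaussian_family M {(bs, y)} pfield pcov"
    by (rule gaussian_family_pfield) (simp_all add: bs del: in_lists_conv_set)
  then interpret G: gaussian_family M "{(bs, y)}" pfield pcov .
  have "integrable M (\<lambda>\<omega>. (partials bs (B \<omega>) y)\<^sup>2)" "(\<integral>\<omega>. (partials bs (B \<omega>) y)\<^sup>2 \<partial>M) = pcov (bs, 0) (bs, 0)"
    using G.prod_two[of "(bs, y)" "(bs, y)"] by (simp_all add: pfield_def power2_eq_square pcov_diag[of bs y])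
  then show ?thesis by (subst nn_integral_eq_integral) auto
qed

text \<open>The map \<open>F\<close> is the identity for the functional itself, and has finite range for its approximations by
  finite quadratic forms.\<close>

definition smoothed_square :: "('a \<Rightarrow> real) \<Rightarrow> ('a \<Rightarrow> 'a) \<Rightarrow> 'a list \<Rightarrow> 'w \<Rightarrow> real" where
  "smoothed_square \<phi> F bs \<omega> = (\<integral>x. \<phi> x * ((partials bs (B \<omega>) (F x))\<^sup>2 - pcov (bs, 0) (bs, 0)) \<partial>lborel)"

context
  fixes \<phi> :: "'a \<Rightarrow> real" and bs :: "'a list"
  assumes \<phi>: "integrable lborel \<phi>" and bs: "bs \<in> lists Basis"
begin

interpretation PL: pair_sigma_finite M "lborel :: 'a measure" ..

lemma \<phi>_meas[measurable]: "\<phi> \<in> borel_measurable borel" using \<phi> by auto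

lemma square_integrable_eval:
  assumes m[measurable]: "(\<lambda>z. partials bs (B (fst z)) (F (snd z))) \<in> borel_measurable (M \<Otimes>\<^sub>M lborel)"
  shows "(\<integral>\<^sup>+z. ennreal (norm (\<phi> (snd z) * (partials bs (B (fst z)) (F (snd z)))\<^sup>2)) \<partial>(M \<Otimes>\<^sub>M lborel)) =
     (\<integral>\<^sup>+x. ennreal \<bar>\<phi> x\<bar> \<partial>lborel) * ennreal (pcov (bs, 0) (bs, 0))"
    and "integrable (M \<Otimes>\<^sub>M lborel) (\<lambda>z. \<phi> (snd z) * (partials bs (B (fst z)) (F (snd z)))\<^sup>2)"
proof -
  have m2: "(\<lambda>\<omega>. partials bs (B \<omega>) (F x)) \<in> borel_measurable M" for x
    using pfield_meas[of "(bs, F x)"] bs by (simp add: pfield_def[abs_def])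
  have "(\<integral>\<^sup>+z. ennreal (norm (\<phi> (snd z) * (partials bs (B (fst z)) (F (snd z)))\<^sup>2)) \<partial>(M \<Otimes>\<^sub>M lborel)) =
    (\<integral>\<^sup>+x. (\<integral>\<^sup>+\<omega>. ennreal (norm (\<phi> x * (partials bs (B \<omega>) (F x))\<^sup>2)) \<partial>M) \<partial>lborel)"
    by (subst PL.nn_integral_snd[symmetric]) auto
  also have "\<dots> = (\<integral>\<^sup>+x. ennreal \<bar>\<phi> x\<bar> * (\<integral>\<^sup>+\<omega>. ennreal ((partials bs (B \<omega>) (F x))\<^sup>2) \<partial>M) \<partial>lborel)"
    using m2 by (subst nn_integral_cmult[symmetric]) (auto intro!: nn_integral_cong simp: abs_mult ennreal_mult')
  also have "\<dots> = (\<integral>\<^sup>+x. ennreal \<bar>\<phi> x\<bar> \<partial>lborel) * ennreal (pcov (bs, 0) (bs, 0))"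
    unfolding second_moment[OF bs] by (rule nn_integral_multc) measurable
  finally show e: "(\<integral>\<^sup>+z. ennreal (norm (\<phi> (snd z) * (partials bs (B (fst z)) (F (snd z)))\<^sup>2)) \<partial>(M \<Otimes>\<^sub>M lborel)) =
     (\<integral>\<^sup>+x. ennreal \<bar>\<phi> x\<bar> \<partial>lborel) * ennreal (pcov (bs, 0) (bs, 0))" .
  show "integrable (M \<Otimes>\<^sub>M lborel) (\<lambda>z. \<phi> (snd z) * (partials bs (B (fst z)) (F (snd z)))\<^sup>2)"
    unfolding integrable_iff_bounded e using \<phi> unfolding integrable_iff_bounded by (auto simp: ennreal_mult_less_top)
qed

lemma const_integrable: "integrable (M \<Otimes>\<^sub>M lborel) (\<lambda>z. \<phi> (snd z) * s)"
proof (rule PL.Fubini_integrable)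
  show "integrable M (\<lambda>\<omega>. \<integral>x. norm (\<phi> (snd (\<omega>, x)) * s) \<partial>lborel)" by simp
  show "AE \<omega> in M. integrable lborel (\<lambda>x. \<phi> (snd (\<omega>, x)) * s)" using \<phi> by simp
qed measurable

lemma smoothed_square_props:
  assumes m[measurable]: "(\<lambda>z. partials bs (B (fst z)) (F (snd z))) \<in> borel_measurable (M \<Otimes>\<^sub>M lborel)"
  shows "AE \<omega> in M. integrable lborel (\<lambda>x. \<phi> x * (partials bs (B \<omega>) (F x))\<^sup>2)"
    "integrable M (smoothed_square \<phi> F bs)" "(\<integral>\<omega>. smoothed_square \<phi> F bs \<omega> \<partial>M) = 0"
proof -
  note i = square_integrable_eval(2)[OF m]
  show "AE \<omega> in M. integrable lborel (\<lambda>x. \<phi> x * (partials bs (B \<omega>) (F x))\<^sup>2)"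
    using PL.AE_integrable_fst'[OF i] by simp
  let ?f = "\<lambda>z. \<phi> (snd z) * ((partials bs (B (fst z)) (F (snd z)))\<^sup>2 - pcov (bs, 0) (bs, 0))"
  have fi: "integrable (M \<Otimes>\<^sub>M lborel) ?f"
    unfolding right_diff_distrib by (intro integrable_diff i const_integrable)
  show "integrable M (smoothed_square \<phi> F bs)"
    using PL.integrable_fst'[OF fi] by (simp add: smoothed_square_def[abs_def])
  have "(\<integral>\<omega>. smoothed_square \<phi> F bs \<omega> \<partial>M) = (\<integral>\<omega>. (\<integral>x. ?f (\<omega>, x) \<partial>lborel) \<partial>M)" by (simp add: smoothed_square_def)
  also have "\<dots> = (\<integral>x. (\<integral>\<omega>. ?f (\<omega>, x) \<partial>M) \<partial>lborel)"
    by (rule PL.Fubini_integral[of "\<lambda>\<omega> x. ?f (\<omega>, x)", symmetric]) (use fi in \<open>simp add: split_beta'\<close>)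
  also have "\<dots> = (\<integral>x. 0 \<partial>(lborel :: 'a measure))"
  proof (rule integral_cong[OF refl])
    fix x
    have "gaussian_family M {(bs, F x)} pfield pcov"
      by (rule gaussian_family_pfield) (simp_all add: bs del: in_lists_conv_set)
    then interpret G: gaussian_family M "{(bs, F x)}" pfield pcov .
    have "integrable M (\<lambda>\<omega>. (partials bs (B \<omega>) (F x))\<^sup>2)" "(\<integral>\<omega>. (partials bs (B \<omega>) (F x))\<^sup>2 \<partial>M) = pcov (bs, 0) (bs, 0)"
      using G.prod_two[of "(bs, F x)" "(bs, F x)"] by (simp_all add: pfield_def power2_eq_square pcov_diag[of bs "F x"])
    then show "(\<integral>\<omega>. ?f (\<omega>, x) \<partial>M) = 0" by (simp add: prob_space)
  qed
  finally show "(\<integral>\<omega>. smoothed_square \<phi> F bs \<omega> \<partial>M) = 0" by simp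
qed

text \<open>The field is stationary, so the integrands for all \<open>F n\<close> have the same norm in mean as the limiting one, and
  Scheffe's lemma turns pointwise convergence into convergence in mean.\<close>

lemma smoothed_square_approx:
  assumes F: "\<And>n. F n \<in> borel_measurable borel" "\<And>n. finite (range (F n))" "\<And>x. (\<lambda>n. F n x) \<longlonglongrightarrow> x"
  shows "(\<lambda>n. \<integral>\<omega>. \<bar>smoothed_square \<phi> (F n) bs \<omega> - smoothed_square \<phi> (\<lambda>x. x) bs \<omega>\<bar> \<partial>M) \<longlonglongrightarrow> 0"
proof -
  let ?\<delta> = "\<lambda>n. \<integral>\<omega>. \<bar>smoothed_square \<phi> (F n) bs \<omega> - smoothed_square \<phi> (\<lambda>x. x) bs \<omega>\<bar> \<partial>M"
  note m[measurable] = partials_eval_meas[OF bs F(1,2)] partials_joint_meas[OF bs]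
  let ?G = "\<lambda>n z. \<phi> (snd z) * (partials bs (B (fst z)) (F n (snd z)))\<^sup>2"
  let ?H = "\<lambda>z. \<phi> (snd z) * (partials bs (B (fst z)) (snd z))\<^sup>2"
  note iG = square_integrable_eval[OF m(1)] and iH = square_integrable_eval[of "\<lambda>x. x", OF m(2)]
  have L: "(\<lambda>n. \<integral>\<^sup>+z. ennreal (norm (?G n z - ?H z)) \<partial>(M \<Otimes>\<^sub>M lborel)) \<longlonglongrightarrow> 0"
  proof (rule Scheffe_lemma1)
    show "integrable (M \<Otimes>\<^sub>M lborel) (?G n)" for n by (rule iG(2))
    show "integrable (M \<Otimes>\<^sub>M lborel) ?H" by (rule iH(2))
    show "AE z in M \<Otimes>\<^sub>M lborel. (\<lambda>n. ?G n z) \<longlonglongrightarrow> ?H z"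
    proof (rule AE_I2)
      fix z :: "'w \<times> 'a"
      have "isCont (partials bs (B (fst z))) (snd z)"
        using smooth_fun_partials_continuous(1)[OF smooth bs] by (simp add: continuous_on_eq_continuous_at)
      then have "(\<lambda>n. partials bs (B (fst z)) (F n (snd z))) \<longlonglongrightarrow> partials bs (B (fst z)) (snd z)"
        by (rule isCont_tendsto_compose[OF _ F(3)])
      then show "(\<lambda>n. ?G n z) \<longlonglongrightarrow> ?H z" by (intro tendsto_intros)
    qed
    show "limsup (\<lambda>n. \<integral>\<^sup>+z. ennreal (norm (?G n z)) \<partial>(M \<Otimes>\<^sub>M lborel)) \<le> (\<integral>\<^sup>+z. ennreal (norm (?H z)) \<partial>(M \<Otimes>\<^sub>M lborel))"
      unfolding iG(1) iH(1) by (simp add: Limsup_const)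
  qed
  have le: "ennreal (?\<delta> n) \<le> (\<integral>\<^sup>+z. ennreal (norm (?G n z - ?H z)) \<partial>(M \<Otimes>\<^sub>M lborel))" for n
  proof -
    note pG = smoothed_square_props[OF m(1)] and pH = smoothed_square_props[of "\<lambda>x. x", OF m(2)]
    have "ennreal (?\<delta> n) =
      (\<integral>\<^sup>+\<omega>. ennreal \<bar>smoothed_square \<phi> (F n) bs \<omega> - smoothed_square \<phi> (\<lambda>x. x) bs \<omega>\<bar> \<partial>M)"
      using pG(2) pH(2) by (intro nn_integral_eq_integral[symmetric]) auto
    also have "\<dots> \<le> (\<integral>\<^sup>+\<omega>. (\<integral>\<^sup>+x. ennreal (norm (?G n (\<omega>, x) - ?H (\<omega>, x))) \<partial>lborel) \<partial>M)"
    proof (rule nn_integral_mono_AE)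
      show "AE \<omega> in M. ennreal \<bar>smoothed_square \<phi> (F n) bs \<omega> - smoothed_square \<phi> (\<lambda>x. x) bs \<omega>\<bar> \<le> (\<integral>\<^sup>+x. ennreal (norm (?G n (\<omega>, x) - ?H (\<omega>, x))) \<partial>lborel)"
        using pG(1)[of n] pH(1)
      proof eventually_elim
        fix \<omega> assume 1: "integrable lborel (\<lambda>x. \<phi> x * (partials bs (B \<omega>) (F n x))\<^sup>2)" and 2: "integrable lborel (\<lambda>x. \<phi> x * (partials bs (B \<omega>) x)\<^sup>2)"
        have 3: "integrable lborel (\<lambda>x. \<phi> x * pcov (bs, 0) (bs, 0))" using \<phi> by simp
        have "smoothed_square \<phi> (F n) bs \<omega> - smoothed_square \<phi> (\<lambda>x. x) bs \<omega> = (\<integral>x. ?G n (\<omega>, x) - ?H (\<omega>, x) \<partial>lborel)"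
          unfolding smoothed_square_def right_diff_distrib fst_conv snd_conv
          by (simp only: integral_diff[OF 1 3] integral_diff[OF 2 3] integral_diff[OF 1 2])
        moreover have "ennreal (norm (\<integral>x. ?G n (\<omega>, x) - ?H (\<omega>, x) \<partial>lborel)) \<le> (\<integral>\<^sup>+x. ennreal (norm (?G n (\<omega>, x) - ?H (\<omega>, x))) \<partial>lborel)"
          using 1 2 by (intro integral_norm_bound_ennreal) simp
        ultimately show "ennreal \<bar>smoothed_square \<phi> (F n) bs \<omega> - smoothed_square \<phi> (\<lambda>x. x) bs \<omega>\<bar> \<le> (\<integral>\<^sup>+x. ennreal (norm (?G n (\<omega>, x) - ?H (\<omega>, x))) \<partial>lborel)"
          by simp
      qed
    qed
    also have "\<dots> = (\<integral>\<^sup>+z. ennreal (norm (?G n z - ?H z)) \<partial>(M \<Otimes>\<^sub>M lborel))"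
      by (rule lborel.nn_integral_fst) measurable
    finally show ?thesis .
  qed
  have "(\<lambda>n. ennreal (?\<delta> n)) \<longlonglongrightarrow> 0"
    by (rule tendsto_sandwich[OF _ _ tendsto_const L]) (use le in auto)
  then have "(\<lambda>n. ennreal (?\<delta> n)) \<longlonglongrightarrow> ennreal 0" by simp
  then show ?thesis by (subst (asm) tendsto_ennreal_iff) auto
qed

end
end

section \<open>Quadratic functionals of the wave\<close>

definition sampled_fourier :: "('a::euclidean_space \<Rightarrow> real) \<Rightarrow> ('a \<Rightarrow> 'a) \<Rightarrow> 'a \<Rightarrow> complex" where
  "sampled_fourier \<phi> F v = (\<integral>x. of_real (\<phi> x) * iexp (F x \<bullet> v) \<partial>lborel)"

definition weight_poly :: "(nat \<Rightarrow> real) \<Rightarrow> nat \<Rightarrow> real \<Rightarrow> real" where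
  "weight_poly c k t = (\<Sum>j\<le>k. c j * t ^ j)"

definition four_cycle :: "('a \<Rightarrow> 'a \<Rightarrow> complex) \<Rightarrow> (('a \<times> 'a) \<times> ('a \<times> 'a)) \<Rightarrow> complex" where
  "four_cycle W z = W (fst (fst z)) (snd (snd z)) * W (snd (fst z)) (fst (fst z)) * W (fst (snd z)) (snd (fst z)) * W (snd (snd z)) (fst (snd z))"

definition words_upto :: "nat \<Rightarrow> 'a::euclidean_space list set" where
  "words_upto k = (\<Union>j\<le>k. {bs. set bs \<subseteq> Basis \<and> length bs = j})"

lemma finite_words_upto: "finite (words_upto k)"
  unfolding words_upto_def by (intro finite_UN_I finite_lists_length_eq) auto

lemma words_upto_D: "bs \<in> words_upto k \<Longrightarrow> bs \<in> lists Basis"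
  by (auto simp: words_upto_def)

lemma sum_words_upto:
  "(\<Sum>bs\<in>words_upto k. f bs) = (\<Sum>j\<le>k. \<Sum>bs\<in>{bs. set bs \<subseteq> Basis \<and> length bs = j}. f bs)"
  unfolding words_upto_def by (rule sum.UNION_disjoint) (auto intro: finite_lists_length_eq)

lemma sampled_fourier_tendsto:
  assumes \<phi>: "integrable lborel \<phi>" and F[measurable]: "\<And>n. F n \<in> borel_measurable borel" and lim: "\<And>x. (\<lambda>n. F n x) \<longlonglongrightarrow> x"
  shows "(\<lambda>n. sampled_fourier \<phi> (F n) v) \<longlonglongrightarrow> fourier \<phi> v"
  unfolding sampled_fourier_def fourier_def
proof (rule integral_dominated_convergence[where w="\<lambda>x. \<bar>\<phi> x\<bar>"])
  have [measurable]: "\<phi> \<in> borel_measurable borel" using \<phi> by auto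
  show "(\<lambda>x. complex_of_real (\<phi> x) * iexp (x \<bullet> v)) \<in> borel_measurable lborel" by measurable
  show "(\<lambda>x. complex_of_real (\<phi> x) * iexp (F n x \<bullet> v)) \<in> borel_measurable lborel" for n by measurable
  show "AE x in lborel. (\<lambda>n. complex_of_real (\<phi> x) * iexp (F n x \<bullet> v)) \<longlonglongrightarrow> complex_of_real (\<phi> x) * iexp (x \<bullet> v)"
    by (intro AE_I2 tendsto_intros lim)
qed (use \<phi> in \<open>auto simp: norm_mult\<close>)

lemma abs_weight_poly_le:
  assumes "\<bar>t\<bar> \<le> 1"
  shows "\<bar>weight_poly c k t\<bar> \<le> (\<Sum>j\<le>k. \<bar>c j\<bar>)"
proof -
  have "\<bar>weight_poly c k t\<bar> \<le> (\<Sum>j\<le>k. \<bar>c j * t ^ j\<bar>)" unfolding weight_poly_def by (rule sum_abs)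
  also have "\<dots> \<le> (\<Sum>j\<le>k. \<bar>c j\<bar>)"
    by (rule sum_mono) (use assms in \<open>auto simp: abs_mult power_abs intro!: mult_left_le power_le_one\<close>)
  finally show ?thesis .
qed

lemma abs_inner_unit: "norm \<theta> = 1 \<Longrightarrow> norm \<eta> = 1 \<Longrightarrow> \<bar>\<theta> \<bullet> \<eta>\<bar> \<le> (1::real)"
  using Cauchy_Schwarz_ineq2[of \<theta> \<eta>] by simp

lemma norm_wave_kernel_le:
  "norm (wave_kernel (weight_poly c k) g \<theta> \<eta>) \<le> (\<Sum>j\<le>k. \<bar>c j\<bar>) * norm (g (\<theta> - \<eta>))"
  unfolding wave_kernel_def
  by (auto simp: norm_mult abs_inner_unit intro!: mult_right_mono abs_weight_poly_le mult_nonneg_nonneg sum_nonneg)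

context smooth_berry begin

definition energy :: "(nat \<Rightarrow> real) \<Rightarrow> nat \<Rightarrow> ('a \<Rightarrow> real) \<Rightarrow> 'w \<Rightarrow> real" where
  "energy c k \<phi> \<omega> = (\<Sum>j\<le>k. c j * (\<integral>x. \<phi> x * ((grad_norm j (B \<omega>) x)\<^sup>2 - 1) \<partial>lborel))"

lemma energy_eq:
  assumes \<phi>: "integrable lborel \<phi>"
  shows "AE \<omega> in M. energy c k \<phi> \<omega> = (\<Sum>bs\<in>words_upto k. c (length bs) * smoothed_square \<phi> (\<lambda>x. x) bs \<omega>)"
proof -
  have "AE \<omega> in M. \<forall>bs\<in>words_upto k. integrable lborel (\<lambda>x. \<phi> x * (partials bs (B \<omega>) x)\<^sup>2)"
    using smoothed_square_props(1)[OF \<phi> _ partials_joint_meas] words_upto_D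
    by (subst AE_ball_countable) (auto simp: finite_words_upto intro!: countable_finite)
  then show ?thesis
  proof eventually_elim
    fix \<omega> assume i: "\<forall>bs\<in>words_upto k. integrable lborel (\<lambda>x. \<phi> x * (partials bs (B \<omega>) x)\<^sup>2)"
    have "(\<integral>x. \<phi> x * ((grad_norm j (B \<omega>) x)\<^sup>2 - 1) \<partial>lborel) =
      (\<Sum>bs\<in>{bs. set bs \<subseteq> Basis \<and> length bs = j}. smoothed_square \<phi> (\<lambda>x. x) bs \<omega>)" if "j \<le> k" for j
    proof -
      let ?L = "{bs. set bs \<subseteq> (Basis::'a set) \<and> length bs = j}"
      have "\<phi> x * ((grad_norm j (B \<omega>) x)\<^sup>2 - 1) = (\<Sum>bs\<in>?L. \<phi> x * ((partials bs (B \<omega>) x)\<^sup>2 - pcov (bs, 0) (bs, 0)))" for x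
        unfolding grad_norm_def sum_distrib_left[symmetric] sum_subtractf sum_pcov_diag
        by (subst real_sqrt_pow2) (auto intro: sum_nonneg)
      then have "(\<integral>x. \<phi> x * ((grad_norm j (B \<omega>) x)\<^sup>2 - 1) \<partial>lborel) =
         (\<integral>x. (\<Sum>bs\<in>?L. \<phi> x * ((partials bs (B \<omega>) x)\<^sup>2 - pcov (bs, 0) (bs, 0))) \<partial>lborel)" by simp
      also have "\<dots> = (\<Sum>bs\<in>?L. smoothed_square \<phi> (\<lambda>x. x) bs \<omega>)"
        unfolding smoothed_square_def
      proof (rule integral_sum)
        fix bs assume "bs \<in> ?L"
        then have "bs \<in> words_upto k" using that by (auto simp: words_upto_def)
        then show "integrable lborel (\<lambda>x. \<phi> x * ((partials bs (B \<omega>) x)\<^sup>2 - pcov (bs, 0) (bs, 0)))"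
          using i \<phi> by (simp add: right_diff_distrib)
      qed
      finally show ?thesis .
    qed
    then show "energy c k \<phi> \<omega> = (\<Sum>bs\<in>words_upto k. c (length bs) * smoothed_square \<phi> (\<lambda>x. x) bs \<omega>)"
      unfolding energy_def sum_words_upto by (simp add: sum_distrib_left)
  qed
qed

definition sampled_energy :: "(nat \<Rightarrow> real) \<Rightarrow> nat \<Rightarrow> ('a \<Rightarrow> real) \<Rightarrow> ('a \<Rightarrow> 'a) \<Rightarrow> 'w \<Rightarrow> real" where
  "sampled_energy c k \<phi> F \<omega> = (\<Sum>bs\<in>words_upto k. c (length bs) * smoothed_square \<phi> F bs \<omega>)"

lemma sampled_energy_props:
  assumes \<phi>: "integrable lborel \<phi>"
    and m: "\<And>bs. bs \<in> words_upto k \<Longrightarrow> (\<lambda>z. partials bs (B (fst z)) (F (snd z))) \<in> borel_measurable (M \<Otimes>\<^sub>M lborel)"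
  shows "integrable M (sampled_energy c k \<phi> F)" "(\<integral>\<omega>. sampled_energy c k \<phi> F \<omega> \<partial>M) = 0"
  unfolding sampled_energy_def[abs_def]
  using smoothed_square_props(2,3)[OF \<phi> words_upto_D m]
  by (auto simp: integral_sum intro!: integrable_sum)

text \<open>For \<open>F\<close> of finite range the functional is a quadratic form in finitely many derivatives, and the kernel of its
  traces is \<open>wave_kernel\<close> with the Fourier transform sampled through \<open>F\<close>.\<close>

lemma sampled_energy_charfun:
  fixes c :: "nat \<Rightarrow> real" and k :: nat and t :: real
  assumes \<phi>: "integrable lborel \<phi>" and F: "F \<in> borel_measurable borel" "finite (range F)"
  defines "W \<equiv> wave_kernel (weight_poly c k) (sampled_fourier \<phi> F)"
  shows "norm ((\<integral>\<omega>. iexp (t * sampled_energy c k \<phi> F \<omega>) \<partial>M) -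
      of_real (exp (- t\<^sup>2 * (2 * Re (\<integral>z. of_real ((norm (W (fst z) (snd z)))\<^sup>2) \<partial>sph_pair)) / 2)))
    \<le> 2 * t\<^sup>2 * sqrt (2 * Re (\<integral>z. four_cycle W z \<partial>sph_quad))"
    and "(\<lambda>z. W (fst z) (snd z)) \<in> borel_measurable (borel \<Otimes>\<^sub>M borel)"
proof -
  define I where "I = (words_upto k :: 'a list set) \<times> range F"
  define w where "w y = (\<integral>x. \<phi> x * indicator (F -` {y}) x \<partial>lborel)" for y
  define a where "a m = c (length (fst m)) * w (snd m)" for m :: "'a list \<times> 'a"
  have I: "finite I" by (simp add: I_def finite_words_upto F(2))
  have I2: "fst m \<in> lists Basis" if "m \<in> I" for m
    using words_upto_D[of "fst m" k] that by (simp add: I_def mem_Times_iff del: in_lists_conv_set)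
  have gf: "gaussian_family M I pfield pcov" by (rule gaussian_family_pfield[OF I I2])
  have sf: "spectral_family I pmode pcov"
    by unfold_locales (simp_all add: I I2 pcov_complex norm_mode_le del: in_lists_conv_set)
  interpret G: gaussian_family M I pfield pcov by (rule gf)
  interpret S: spectral_family I pmode pcov a by (rule sf)
  note sfi = simple_function_integral_sum[OF \<phi> F, folded w_def]
  have q: "G.quad a \<omega> = sampled_energy c k \<phi> F \<omega>" for \<omega>
  proof -
    have "G.quad a \<omega> = (\<Sum>bs\<in>words_upto k. \<Sum>y\<in>range F. a (bs, y) * ((pfield (bs, y) \<omega>)\<^sup>2 - pcov (bs, y) (bs, y)))"
      unfolding G.quad_def unfolding I_def by (simp add: sum.cartesian_product split_beta)
    also have "\<dots> = (\<Sum>bs\<in>words_upto k. c (length bs) * (\<Sum>y\<in>range F. w y *\<^sub>R ((partials bs (B \<omega>) y)\<^sup>2 - pcov (bs, 0) (bs, 0))))"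
      unfolding sum_distrib_left by (intro sum.cong refl) (subst pcov_diag, simp add: a_def pfield_def)
    also have "\<dots> = sampled_energy c k \<phi> F \<omega>"
      unfolding sampled_energy_def smoothed_square_def using sfi[of "\<lambda>y. (partials _ (B \<omega>) y)\<^sup>2 - pcov (_, 0) (_, 0)"] by simp
    finally show ?thesis .
  qed
  have k: "S.kern = W"
  proof (intro ext)
    fix \<theta> \<eta> :: 'a
    show "S.kern \<theta> \<eta> = W \<theta> \<eta>"
    proof (cases "norm \<theta> = 1 \<and> norm \<eta> = 1")
      case False
      then show ?thesis unfolding S.kern_def W_def wave_kernel_def by (auto simp: mode_def intro!: sum.neutral)
    next
      case True
      let ?P = "\<lambda>bs. \<Prod>b\<leftarrow>bs. complex_of_real ((\<theta> \<bullet> b) * (\<eta> \<bullet> b))"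
      have "S.kern \<theta> \<eta> = (\<Sum>bs\<in>words_upto k. \<Sum>y\<in>range F. of_real (a (bs, y)) * mode bs y \<theta> * cnj (mode bs y \<eta>))"
        unfolding S.kern_def unfolding I_def by (simp add: sum.cartesian_product split_beta)
      also have "\<dots> = (\<Sum>bs\<in>words_upto k. of_real (c (length bs)) * ?P bs * (\<Sum>y\<in>range F. w y *\<^sub>R iexp (y \<bullet> (\<theta> - \<eta>))))"
        unfolding sum_distrib_left
        by (intro sum.cong refl) (use True in \<open>simp only: mult.assoc mode_product, simp add: a_def scaleR_conv_of_real mult_ac\<close>)
      also have "(\<Sum>y\<in>range F. w y *\<^sub>R iexp (y \<bullet> (\<theta> - \<eta>))) = sampled_fourier \<phi> F (\<theta> - \<eta>)"
        using sfi[of "\<lambda>y. iexp (y \<bullet> (\<theta> - \<eta>))"] unfolding sampled_fourier_def scaleR_conv_of_real by simp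
      also have "(\<Sum>bs\<in>words_upto k. of_real (c (length bs)) * ?P bs * sampled_fourier \<phi> F (\<theta> - \<eta>)) =
          (\<Sum>j\<le>k. of_real (c j) * (\<Sum>bs\<in>{bs. set bs \<subseteq> Basis \<and> length bs = j}. ?P bs)) * sampled_fourier \<phi> F (\<theta> - \<eta>)"
        unfolding sum_words_upto sum_distrib_right sum_distrib_left by (intro sum.cong refl) simp
      also have "(\<Sum>j\<le>k. of_real (c j) * (\<Sum>bs\<in>{bs. set bs \<subseteq> Basis \<and> length bs = j}. ?P bs)) = of_real (weight_poly c k (\<theta> \<bullet> \<eta>))"
        unfolding sum_prod_list_length[OF finite_Basis] weight_poly_def euclidean_inner[of \<theta> \<eta>] by simp
      finally show ?thesis unfolding W_def wave_kernel_def using True by simp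
    qed
  qed
  have l: "S.loop = four_cycle W" unfolding S.loop_def[abs_def] k four_cycle_def[abs_def] ..
  have v: "(\<Sum>m\<in>I. \<Sum>n\<in>I. a m * a n * (pcov m n)\<^sup>2) = Re (\<integral>z. of_real ((norm (W (fst z) (snd z)))\<^sup>2) \<partial>sph_pair)"
    unfolding k[symmetric] S.trace_two[symmetric] by simp
  have \<kappa>: "(\<Sum>m\<in>I. \<Sum>n\<in>I. \<Sum>p\<in>I. \<Sum>q\<in>I. a m * a n * a p * a q * (pcov m n * pcov n p * pcov p q * pcov q m)) =
      Re (\<integral>z. four_cycle W z \<partial>sph_quad)"
    unfolding l[symmetric] S.trace_four[symmetric] by simp
  show "norm ((\<integral>\<omega>. iexp (t * sampled_energy c k \<phi> F \<omega>) \<partial>M) -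
      of_real (exp (- t\<^sup>2 * (2 * Re (\<integral>z. of_real ((norm (W (fst z) (snd z)))\<^sup>2) \<partial>sph_pair)) / 2)))
    \<le> 2 * t\<^sup>2 * sqrt (2 * Re (\<integral>z. four_cycle W z \<partial>sph_quad))"
    using G.quad_charfun_near_gaussian[of t a] unfolding q v \<kappa> .
  show "(\<lambda>z. W (fst z) (snd z)) \<in> borel_measurable (borel \<Otimes>\<^sub>M borel)"
    unfolding k[symmetric] S.kern_def by measurable
qed


lemma energy_meas[measurable]:
  assumes [measurable]: "\<phi> \<in> borel_measurable borel"
  shows "energy c k \<phi> \<in> borel_measurable M"
proof -
  have [measurable]: "(\<lambda>z. grad_norm j (B (fst z)) (snd z)) \<in> borel_measurable (M \<Otimes>\<^sub>M lborel)" for j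
    unfolding grad_norm_def using partials_joint_meas
    by (intro borel_measurable_sqrt borel_measurable_sum borel_measurable_power measurable_compose[OF _ borel_measurable_sqrt]) auto
  have "(\<lambda>\<omega>. \<integral>x. \<phi> x * ((grad_norm j (B \<omega>) x)\<^sup>2 - 1) \<partial>lborel) \<in> borel_measurable M" for j
  proof (rule lborel.borel_measurable_lebesgue_integral)
    have "(\<lambda>z. \<phi> (snd z) * ((grad_norm j (B (fst z)) (snd z))\<^sup>2 - 1)) \<in> borel_measurable (M \<Otimes>\<^sub>M lborel)" by measurable
    then show "(\<lambda>(\<omega>, x). \<phi> x * ((grad_norm j (B \<omega>) x)\<^sup>2 - 1)) \<in> borel_measurable (M \<Otimes>\<^sub>M lborel)"
      by (simp add: split_beta')
  qed
  then show ?thesis unfolding energy_def[abs_def] by simp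
qed

text \<open>The sampled kernels are uniformly bounded and converge pointwise, so both traces in \<open>sampled_energy_charfun\<close>
  converge; Schur's test then bounds the fourth one through the row integrals \<open>D\<close>.\<close>

theorem energy_charfun_near_gaussian:
  fixes c :: "nat \<Rightarrow> real" and k :: nat and t D :: real
  assumes \<phi>: "integrable lborel \<phi>"
  defines "W \<equiv> wave_kernel (weight_poly c k) (fourier \<phi>)"
  defines "v \<equiv> 2 * (\<integral>z. (norm (W (fst z) (snd z)))\<^sup>2 \<partial>sph_pair)"
  assumes D: "0 \<le> D" "\<And>\<theta>. (\<integral>\<^sup>+\<eta>. ennreal (norm (W \<theta> \<eta>)) \<partial>sphere_uniform) \<le> ennreal D"
  shows "integrable M (energy c k \<phi>)" "(\<integral>\<omega>. energy c k \<phi> \<omega> \<partial>M) = 0"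
    "norm ((\<integral>\<omega>. iexp (t * energy c k \<phi> \<omega>) \<partial>M) - of_real (exp (- t\<^sup>2 * v / 2))) \<le> 2 * t\<^sup>2 * (D * sqrt v)"
proof -
  let ?\<delta> = "\<lambda>F bs. \<integral>\<omega>. \<bar>smoothed_square \<phi> F bs \<omega> - smoothed_square \<phi> (\<lambda>x. x) bs \<omega>\<bar> \<partial>M"
  have \<phi>m[measurable]: "\<phi> \<in> borel_measurable borel" using \<phi> by auto
  obtain F :: "nat \<Rightarrow> 'a \<Rightarrow> 'a" where F: "\<And>n. F n \<in> borel_measurable borel" "\<And>n. finite (range (F n))" "\<And>x. (\<lambda>n. F n x) \<longlonglongrightarrow> x"
    using simple_approximation_identity by blast
  define Q where "Q = sampled_energy c k \<phi> (\<lambda>x. x)"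
  define Qn where "Qn n = sampled_energy c k \<phi> (F n)" for n
  define Wn where "Wn n = wave_kernel (weight_poly c k) (sampled_fourier \<phi> (F n))" for n
  have Qp: "integrable M Q" "(\<integral>\<omega>. Q \<omega> \<partial>M) = 0"
    unfolding Q_def using sampled_energy_props[OF \<phi> partials_joint_meas[OF words_upto_D]] by auto
  have Qnp: "integrable M (Qn n)" for n
    unfolding Qn_def using sampled_energy_props(1)[OF \<phi> partials_eval_meas[OF words_upto_D F(1,2)]] by auto
  have eQ: "AE \<omega> in M. energy c k \<phi> \<omega> = Q \<omega>"
    using energy_eq[OF \<phi>] unfolding Q_def sampled_energy_def .
  have Qm[measurable]: "Q \<in> borel_measurable M" "Qn n \<in> borel_measurable M" for n using Qp Qnp[of n] by auto
  show "integrable M (energy c k \<phi>)"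
    by (subst integrable_cong_AE[OF _ _ eQ]) (use Qp in auto)
  show "(\<integral>\<omega>. energy c k \<phi> \<omega> \<partial>M) = 0"
    by (subst integral_cong_AE[OF _ _ eQ]) (use Qp in auto)
  have char: "(\<integral>\<omega>. iexp (t * energy c k \<phi> \<omega>) \<partial>M) = (\<integral>\<omega>. iexp (t * Q \<omega>) \<partial>M)"
    by (rule integral_cong_AE) (use eQ in \<open>auto elim: eventually_mono\<close>)
  have L1: "(\<lambda>n. \<integral>\<omega>. \<bar>Qn n \<omega> - Q \<omega>\<bar> \<partial>M) \<longlonglongrightarrow> 0"
  proof -
    have i: "integrable M (\<lambda>\<omega>. \<bar>smoothed_square \<phi> (F n) bs \<omega> - smoothed_square \<phi> (\<lambda>x. x) bs \<omega>\<bar>)" if "bs \<in> words_upto k" for n bs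
      using smoothed_square_props(2)[OF \<phi> words_upto_D[OF that] partials_joint_meas[OF words_upto_D[OF that]]]
        smoothed_square_props(2)[OF \<phi> words_upto_D[OF that] partials_eval_meas[OF words_upto_D[OF that] F(1,2)], of n] by simp
    have "(\<integral>\<omega>. \<bar>Qn n \<omega> - Q \<omega>\<bar> \<partial>M) \<le> (\<Sum>bs\<in>words_upto k. \<bar>c (length bs)\<bar> * (?\<delta> (F n) bs))" for n
    proof -
      have "(\<integral>\<omega>. \<bar>Qn n \<omega> - Q \<omega>\<bar> \<partial>M) \<le> (\<integral>\<omega>. (\<Sum>bs\<in>words_upto k. \<bar>c (length bs)\<bar> * \<bar>smoothed_square \<phi> (F n) bs \<omega> - smoothed_square \<phi> (\<lambda>x. x) bs \<omega>\<bar>) \<partial>M)"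
      proof (rule Bochner_Integration.integral_mono)
        show "integrable M (\<lambda>\<omega>. \<Sum>bs\<in>words_upto k. \<bar>c (length bs)\<bar> * \<bar>smoothed_square \<phi> (F n) bs \<omega> - smoothed_square \<phi> (\<lambda>x. x) bs \<omega>\<bar>)"
          using i by (intro integrable_sum integrable_mult_right) auto
        fix \<omega>
        have "Qn n \<omega> - Q \<omega> = (\<Sum>bs\<in>words_upto k. c (length bs) * (smoothed_square \<phi> (F n) bs \<omega> - smoothed_square \<phi> (\<lambda>x. x) bs \<omega>))"
          unfolding Qn_def Q_def sampled_energy_def by (simp add: right_diff_distrib sum_subtractf)
        then show "\<bar>Qn n \<omega> - Q \<omega>\<bar> \<le> (\<Sum>bs\<in>words_upto k. \<bar>c (length bs)\<bar> * \<bar>smoothed_square \<phi> (F n) bs \<omega> - smoothed_square \<phi> (\<lambda>x. x) bs \<omega>\<bar>)"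
          by (simp only: abs_mult[symmetric] sum_abs)
      qed (use Qp Qnp in simp)
      also have "\<dots> = (\<Sum>bs\<in>words_upto k. \<bar>c (length bs)\<bar> * (?\<delta> (F n) bs))"
        using i by (subst integral_sum) auto
      finally show ?thesis .
    qed
    then have le: "\<forall>n. norm (\<integral>\<omega>. \<bar>Qn n \<omega> - Q \<omega>\<bar> \<partial>M) \<le> (\<Sum>bs\<in>words_upto k. \<bar>c (length bs)\<bar> * (?\<delta> (F n) bs))"
      by (subst real_norm_def, subst abs_of_nonneg) auto
    have "(\<lambda>n. \<Sum>bs\<in>words_upto k. \<bar>c (length bs)\<bar> * (?\<delta> (F n) bs)) \<longlonglongrightarrow> (\<Sum>bs\<in>(words_upto k :: 'a list set). \<bar>c (length bs)\<bar> * 0)"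
      by (intro tendsto_sum tendsto_mult tendsto_const smoothed_square_approx[OF \<phi> words_upto_D F])
    then have g0: "(\<lambda>n. \<Sum>bs\<in>words_upto k. \<bar>c (length bs)\<bar> * (?\<delta> (F n) bs)) \<longlonglongrightarrow> 0"
      by (simp only: mult_zero_right sum.neutral_const)
    show ?thesis by (rule Lim_null_comparison[OF always_eventually[OF le] g0])
  qed
  have charconv: "(\<lambda>n. \<integral>\<omega>. iexp (t * Qn n \<omega>) \<partial>M) \<longlonglongrightarrow> (\<integral>\<omega>. iexp (t * Q \<omega>) \<partial>M)"
  proof (rule LIM_zero_cancel)
    note bnd = charfun_lipschitz[OF prob_space_axioms Qnp Qp(1), of t]
    have "(\<lambda>n. \<bar>t\<bar> * (\<integral>\<omega>. \<bar>Qn n \<omega> - Q \<omega>\<bar> \<partial>M)) \<longlonglongrightarrow> 0" using tendsto_mult[OF tendsto_const L1, of "\<bar>t\<bar>"] by simp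
    then show "(\<lambda>n. (\<integral>\<omega>. iexp (t * Qn n \<omega>) \<partial>M) - (\<integral>\<omega>. iexp (t * Q \<omega>) \<partial>M)) \<longlonglongrightarrow> 0"
      by (rule Lim_null_comparison[OF always_eventually, rotated]) (intro allI bnd)
  qed
  define K where "K = (\<Sum>j\<le>k. \<bar>c j\<bar>) * (\<integral>x. \<bar>\<phi> x\<bar> \<partial>lborel)"
  have K0: "0 \<le> K" unfolding K_def by (intro mult_nonneg_nonneg sum_nonneg) auto
  have WnK: "norm (Wn n \<theta> \<eta>) \<le> K" for n \<theta> \<eta>
  proof -
    have "norm (sampled_fourier \<phi> (F n) (\<theta> - \<eta>)) \<le> (\<integral>x. \<bar>\<phi> x\<bar> \<partial>lborel)"
      unfolding sampled_fourier_def by (rule order_trans[OF integral_norm_bound]) (simp add: norm_mult)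
    then show ?thesis unfolding Wn_def K_def
      by (intro order_trans[OF norm_wave_kernel_le[of c k]] mult_left_mono sum_nonneg) auto
  qed
  have Wlim: "(\<lambda>n. Wn n \<theta> \<eta>) \<longlonglongrightarrow> W \<theta> \<eta>" for \<theta> \<eta>
    unfolding Wn_def W_def wave_kernel_def using sampled_fourier_tendsto[OF \<phi> F(1,3), of "\<theta> - \<eta>"]
    by (auto intro!: tendsto_intros)
  have Wnm: "(\<lambda>z. Wn n (fst z) (snd z)) \<in> borel_measurable (borel \<Otimes>\<^sub>M borel)" for n
    unfolding Wn_def by (rule sampled_energy_charfun(2)[OF \<phi> F(1,2)])
  have Wm: "(\<lambda>z. W (fst z) (snd z)) \<in> borel_measurable (borel \<Otimes>\<^sub>M borel)"
    by (rule borel_measurable_LIMSEQ_metric[OF Wnm]) (rule Wlim)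
  have comp4: "(\<lambda>z. V (f z) (g z)) \<in> borel_measurable N"
    if "(\<lambda>z. V (fst z) (snd z)) \<in> borel_measurable (borel \<Otimes>\<^sub>M borel)" "f \<in> measurable N borel" "g \<in> measurable N borel"
    for V :: "'a \<Rightarrow> 'a \<Rightarrow> complex" and f g and N :: "(('a \<times> 'a) \<times> ('a \<times> 'a)) measure"
    using measurable_compose[OF measurable_Pair[OF that(2,3)] that(1)] by simp
  interpret P4: prob_space "sph_quad :: (('a \<times> 'a) \<times> ('a \<times> 'a)) measure" by (rule prob_space_sph_quad)
  have sp: "sets (sph_pair :: ('a \<times> 'a) measure) = sets (borel \<Otimes>\<^sub>M borel)" by (intro sets_pair_measure_cong) auto
  have Wm2[measurable]: "(\<lambda>z. W (fst z) (snd z)) \<in> borel_measurable sph_pair" "(\<lambda>z. Wn n (fst z) (snd z)) \<in> borel_measurable sph_pair" for n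
    using Wm Wnm[of n] unfolding measurable_cong_sets[OF sp refl] by auto
  have c4: "four_cycle V \<in> borel_measurable sph_quad"
    if "(\<lambda>z. V (fst z) (snd z)) \<in> borel_measurable (borel \<Otimes>\<^sub>M borel)" for V :: "'a \<Rightarrow> 'a \<Rightarrow> complex"
    unfolding four_cycle_def[abs_def] by (intro borel_measurable_times comp4[OF that]; measurable)
  have norm4: "norm (four_cycle V z) \<le> K * K * K * K" if "\<And>\<theta> \<eta>. norm (V \<theta> \<eta>) \<le> K" for V :: "'a \<Rightarrow> 'a \<Rightarrow> complex" and z
    unfolding four_cycle_def norm_mult by (intro mult_mono that mult_nonneg_nonneg norm_ge_zero K0)
  have vlim: "(\<lambda>n. \<integral>z. complex_of_real ((norm (Wn n (fst z) (snd z)))\<^sup>2) \<partial>sph_pair) \<longlonglongrightarrow> (\<integral>z. of_real ((norm (W (fst z) (snd z)))\<^sup>2) \<partial>sph_pair)"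
    by (rule integral_dominated_convergence[where w="\<lambda>_. K\<^sup>2"])
       (auto intro!: AE_I2 tendsto_intros Wlim power_mono WnK simp: norm_power)
  have \<kappa>lim: "(\<lambda>n. \<integral>z. four_cycle (Wn n) z \<partial>sph_quad) \<longlonglongrightarrow> (\<integral>z. four_cycle W z \<partial>sph_quad)"
  proof (rule integral_dominated_convergence[where w="\<lambda>_. K * K * K * K"])
    show "AE z in sph_quad. (\<lambda>n. four_cycle (Wn n) z) \<longlonglongrightarrow> four_cycle W z"
      unfolding four_cycle_def by (intro AE_I2 tendsto_intros Wlim)
    show "AE z in sph_quad. norm (four_cycle (Wn n) z) \<le> K * K * K * K" for n
      by (intro AE_I2 norm4 WnK)
  qed (simp_all add: c4 Wm Wnm)
  define V where "V = (\<integral>z. (norm (W (fst z) (snd z)))\<^sup>2 \<partial>sph_pair)"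
  have V: "(\<integral>z. complex_of_real ((norm (W (fst z) (snd z)))\<^sup>2) \<partial>sph_pair) = of_real V"
    unfolding V_def by (rule integral_complex_of_real)
  define \<kappa> where "\<kappa> = Re (\<integral>z. four_cycle W z \<partial>sph_quad)"
  have main: "norm ((\<integral>\<omega>. iexp (t * Q \<omega>) \<partial>M) - of_real (exp (- t\<^sup>2 * (2 * V) / 2))) \<le> 2 * t\<^sup>2 * sqrt (2 * \<kappa>)"
  proof (rule LIMSEQ_le)
    show "(\<lambda>n. 2 * t\<^sup>2 * sqrt (2 * Re (\<integral>z. four_cycle (Wn n) z \<partial>sph_quad))) \<longlonglongrightarrow> 2 * t\<^sup>2 * sqrt (2 * \<kappa>)"
      unfolding \<kappa>_def by (intro tendsto_intros \<kappa>lim)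
    show "(\<lambda>n. norm ((\<integral>\<omega>. iexp (t * Qn n \<omega>) \<partial>M) - of_real (exp (- t\<^sup>2 * (2 * Re (\<integral>z. of_real ((norm (Wn n (fst z) (snd z)))\<^sup>2) \<partial>sph_pair)) / 2)))) \<longlonglongrightarrow>
       norm ((\<integral>\<omega>. iexp (t * Q \<omega>) \<partial>M) - of_real (exp (- t\<^sup>2 * (2 * V) / 2)))"
      using tendsto_Re[OF vlim[unfolded V]] by (intro tendsto_intros charconv) simp_all
    show "\<exists>N. \<forall>n\<ge>N. norm ((\<integral>\<omega>. iexp (t * Qn n \<omega>) \<partial>M) - of_real (exp (- t\<^sup>2 * (2 * Re (\<integral>z. of_real ((norm (Wn n (fst z) (snd z)))\<^sup>2) \<partial>sph_pair)) / 2))) \<le> 2 * t\<^sup>2 * sqrt (2 * Re (\<integral>z. four_cycle (Wn n) z \<partial>sph_quad))"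
      using sampled_energy_charfun(1)[OF \<phi> F(1,2), of t c k, folded Qn_def Wn_def] by blast
  qed
  have V0: "0 \<le> V" unfolding V_def by simp
  have \<kappa>le: "\<kappa> \<le> D\<^sup>2 * V"
  proof -
    have "ennreal \<kappa> \<le> ennreal (norm (\<integral>z. four_cycle W z \<partial>sph_quad))" unfolding \<kappa>_def by (intro ennreal_leI complex_Re_le_cmod)
    also have "\<dots> \<le> (\<integral>\<^sup>+z. ennreal (norm (four_cycle W z)) \<partial>sph_quad)"
    proof (rule integral_norm_bound_ennreal)
      have "norm (W \<theta> \<eta>) \<le> K" for \<theta> \<eta> by (rule LIMSEQ_le_const2[OF tendsto_norm[OF Wlim]]) (use WnK in auto)
      then show "integrable sph_quad (four_cycle W)"
        by (intro P4.integrable_const_bound[of _ "K * K * K * K"] c4 Wm AE_I2 norm4)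
    qed
    also have "\<dots> = (\<integral>\<^sup>+z. ennreal (norm (W (fst (fst z)) (snd (snd z)))) * ennreal (norm (W (snd (fst z)) (fst (fst z)))) * ennreal (norm (W (fst (snd z)) (snd (fst z)))) * ennreal (norm (W (snd (snd z)) (fst (snd z)))) \<partial>sph_quad)"
      by (intro nn_integral_cong) (simp add: four_cycle_def norm_mult ennreal_mult')
    also have "\<dots> \<le> (ennreal D)\<^sup>2 * (\<integral>\<^sup>+z. (ennreal (norm (W (fst z) (snd z))))\<^sup>2 \<partial>sph_pair)"
    proof (rule nn_integral_four_cycle_le)
      show "(\<lambda>(x, y). ennreal (norm (W x y))) \<in> borel_measurable (borel \<Otimes>\<^sub>M borel)"
        using Wm by (simp add: split_beta')
      show "ennreal (norm (W x y)) = ennreal (norm (W y x))" for x y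
      proof -
        have "fourier \<phi> (- v) = cnj (fourier \<phi> v)" for v
          unfolding fourier_def by (subst integral_cnj[symmetric]) (simp add: exp_cnj)
        from this[of "x - y"] have "norm (fourier \<phi> (x - y)) = norm (fourier \<phi> (y - x))" by simp
        then show ?thesis unfolding W_def wave_kernel_def by (auto simp: norm_mult inner_commute)
      qed
      show "(\<integral>\<^sup>+y. ennreal (norm (W x y)) \<partial>sphere_uniform) \<le> ennreal D" for x by (rule D(2))
    qed
    also have "(\<integral>\<^sup>+z. (ennreal (norm (W (fst z) (snd z))))\<^sup>2 \<partial>sph_pair) = (\<integral>\<^sup>+z. ennreal ((norm (W (fst z) (snd z)))\<^sup>2) \<partial>sph_pair)"
      by (simp add: ennreal_power)
    also have "\<dots> = ennreal V"
    proof -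
      have "norm (W \<theta> \<eta>) \<le> K" for \<theta> \<eta> by (rule LIMSEQ_le_const2[OF tendsto_norm[OF Wlim]]) (use WnK in auto)
      then have "integrable sph_pair (\<lambda>z. (norm (W (fst z) (snd z)))\<^sup>2)"
        by (intro finite_measure.integrable_const_bound[OF prob_space.finite_measure[OF prob_space_sph_pair], of _ "K\<^sup>2"]) (auto intro!: AE_I2 power_mono)
      then show ?thesis unfolding V_def by (rule nn_integral_eq_integral) simp
    qed
    finally have "ennreal \<kappa> \<le> ennreal (D\<^sup>2 * V)" using D(1) V0 by (simp add: ennreal_power ennreal_mult')
    then show ?thesis using D(1) V0 by (subst (asm) ennreal_le_iff) auto
  qed
  have "sqrt (2 * \<kappa>) \<le> sqrt (D\<^sup>2 * (2 * V))" using \<kappa>le by simp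
  also have "\<dots> = D * sqrt (2 * V)" using D(1) by (simp add: real_sqrt_mult)
  finally have "2 * t\<^sup>2 * sqrt (2 * \<kappa>) \<le> 2 * t\<^sup>2 * (D * sqrt (2 * V))" by (intro mult_left_mono) auto
  with main show "norm ((\<integral>\<omega>. iexp (t * energy c k \<phi> \<omega>) \<partial>M) - of_real (exp (- t\<^sup>2 * v / 2))) \<le> 2 * t\<^sup>2 * (D * sqrt v)"
    unfolding char v_def V_def[symmetric] by linarith
qed

end

section \<open>Spectral energy of a test function\<close>

lemma fubini_bounded_kernel:
  fixes g :: "'b \<Rightarrow> real" and h :: "'b \<Rightarrow> 'c \<Rightarrow> real"
  assumes N: "sigma_finite_measure N" and P: "prob_space P" and g: "integrable N g"
    and h[measurable]: "(\<lambda>z. h (fst z) (snd z)) \<in> borel_measurable (N \<Otimes>\<^sub>M P)" and b: "\<And>x s. \<bar>h x s\<bar> \<le> b"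
  shows "(\<integral>x. g x * (\<integral>s. h x s \<partial>P) \<partial>N) = (\<integral>s. (\<integral>x. g x * h x s \<partial>N) \<partial>P)"
proof -
  interpret N: sigma_finite_measure N by (rule N)
  interpret P: prob_space P by (rule P)
  interpret NP: pair_sigma_finite N P ..
  have [measurable]: "g \<in> borel_measurable N" using g by auto
  have hx: "(\<lambda>s. h x s) \<in> borel_measurable P" if "x \<in> space N" for x
    using measurable_compose[OF measurable_Pair1'[OF that] h] by simp
  have gi: "integrable (N \<Otimes>\<^sub>M P) (\<lambda>z. b * g (fst z))"
  proof (rule NP.Fubini_integrable)
    show "integrable N (\<lambda>x. \<integral>s. norm (b * g (fst (x, s))) \<partial>P)" using g by simp
  qed auto
  have "integrable (N \<Otimes>\<^sub>M P) (\<lambda>z. g (fst z) * h (fst z) (snd z))"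
  proof (rule integrable_bound[OF gi])
    show "AE z in N \<Otimes>\<^sub>M P. norm (g (fst z) * h (fst z) (snd z)) \<le> norm (b * g (fst z))"
    proof (rule AE_I2)
      fix z
      have "\<bar>h (fst z) (snd z)\<bar> \<le> \<bar>b\<bar>" by (rule order_trans[OF b abs_ge_self])
      from mult_right_mono[OF this, of "\<bar>g (fst z)\<bar>"]
      show "norm (g (fst z) * h (fst z) (snd z)) \<le> norm (b * g (fst z))" by (simp add: abs_mult mult.commute)
    qed
  qed measurable
  then have i: "integrable (N \<Otimes>\<^sub>M P) (\<lambda>(x, s). g x * h x s)" by (simp add: split_beta')
  have "(\<integral>x. g x * (\<integral>s. h x s \<partial>P) \<partial>N) = (\<integral>x. (\<integral>s. g x * h x s \<partial>P) \<partial>N)" by simp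
  also have "\<dots> = (\<integral>s. (\<integral>x. g x * h x s \<partial>N) \<partial>P)" by (rule NP.Fubini_integral[OF i, symmetric])
  finally show ?thesis .
qed

lemma sigma_finite_lborel2: "sigma_finite_measure (lborel2 :: ('a::euclidean_space \<times> 'a) measure)"
  by (rule lborel_pair.sigma_finite_measure_axioms)

lemma norm_fourier_squared:
  fixes \<phi> :: "'a::euclidean_space \<Rightarrow> real"
  assumes \<phi>: "integrable lborel \<phi>"
  shows "(norm (fourier \<phi> v))\<^sup>2 = (\<integral>z. \<phi> (fst z) * \<phi> (snd z) * cos ((fst z - snd z) \<bullet> v) \<partial>lborel2)"
proof -
  have [measurable]: "\<phi> \<in> borel_measurable borel" using \<phi> by auto
  let ?f = "\<lambda>z. complex_of_real (\<phi> (fst z) * \<phi> (snd z)) * iexp ((fst z - snd z) \<bullet> v)"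
  have i: "integrable lborel2 ?f"
    by (rule integrable_bound[OF integrable_lborel_pair_mult[OF \<phi> \<phi>]]) (auto simp: norm_mult)
  have "complex_of_real ((norm (fourier \<phi> v))\<^sup>2) = fourier \<phi> v * cnj (fourier \<phi> v)" by (rule complex_norm_square)
  also have "cnj (fourier \<phi> v) = (\<integral>y. complex_of_real (\<phi> y) * cnj (iexp (y \<bullet> v)) \<partial>lborel)"
    unfolding fourier_def by (subst integral_cnj[symmetric]) simp
  also have "fourier \<phi> v * \<dots> = (\<integral>x. (\<integral>y. ?f (x, y) \<partial>lborel) \<partial>lborel)"
  proof -
    have "?f (x, y) = (complex_of_real (\<phi> x) * iexp (x \<bullet> v)) * (complex_of_real (\<phi> y) * cnj (iexp (y \<bullet> v)))" for x y
      by (simp add: inner_diff_left right_diff_distrib exp_diff exp_cnj exp_minus field_simps)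
    then show ?thesis unfolding fourier_def by (simp only: integral_mult_right_zero integral_mult_left_zero)
  qed
  also have "\<dots> = (\<integral>z. ?f z \<partial>lborel2)" by (rule lborel_pair.integral_fst'[OF i])
  finally have "(norm (fourier \<phi> v))\<^sup>2 = Re (\<integral>z. ?f z \<partial>lborel2)" by (metis Re_complex_of_real)
  also have "\<dots> = (\<integral>z. Re (?f z) \<partial>lborel2)" by (rule integral_Re[OF i, symmetric])
  also have "\<dots> = (\<integral>z. \<phi> (fst z) * \<phi> (snd z) * cos ((fst z - snd z) \<bullet> v) \<partial>lborel2)"
    by (intro integral_cong refl) (simp add: cis_conv_exp[symmetric])
  finally show ?thesis .
qed

lemma fourier_dilate:
  fixes \<phi> :: "'a::euclidean_space \<Rightarrow> real"
  assumes \<phi>[measurable]: "\<phi> \<in> borel_measurable borel" and R: "0 < R"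
  shows "fourier (dilate R \<phi>) v = of_real (R ^ DIM('a)) * fourier \<phi> (R *\<^sub>R v)"
proof -
  have "fourier (dilate R \<phi>) v = (\<integral>x. of_real (\<phi> (x /\<^sub>R R)) * iexp (x \<bullet> v) \<partial>density (distr lborel borel (\<lambda>x. 0 + R *\<^sub>R x)) (\<lambda>_. \<bar>R\<bar> ^ DIM('a)))"
    unfolding fourier_def dilate_def using R by (subst lborel_affine[of R 0]) auto
  also have "\<dots> = (\<integral>x. R ^ DIM('a) *\<^sub>R (of_real (\<phi> x) * iexp ((R *\<^sub>R x) \<bullet> v)) \<partial>lborel)"
    using R by (subst integral_density; (subst integral_distr)?) (auto simp: ennreal_power)
  also have "\<dots> = of_real (R ^ DIM('a)) * fourier \<phi> (R *\<^sub>R v)"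
    unfolding fourier_def by (simp add: scaleR_conv_of_real)
  finally show ?thesis .
qed

context
  fixes \<phi> :: "'a::euclidean_space \<Rightarrow> real" and e :: 'a
  assumes \<phi>: "\<phi> \<in> schwartz_space" and e: "e \<in> Basis"
begin

lemma int_\<phi>: "integrable lborel \<phi>" and meas_\<phi>[measurable]: "\<phi> \<in> borel_measurable borel"
  using schwartz_partials_integrable[OF \<phi>, of "[]"] by (auto simp: partials_Nil)

definition spherical_energy :: "real \<Rightarrow> real" where
  "spherical_energy r = (\<integral>z. \<phi> (fst z) * \<phi> (snd z) * sphere_wave e (r * norm (fst z - snd z)) \<partial>lborel2)"

lemma int_\<phi>2: "integrable lborel2 (\<lambda>z. \<phi> (fst z) * \<phi> (snd z))"
  by (rule integrable_lborel_pair_mult[OF int_\<phi> int_\<phi>])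

text \<open>The spherical mean of the squared modulus of the Fourier transform on the sphere of radius \<open>\<bar>r\<bar>\<close>; this form shows
  positivity and decay.\<close>

lemma spherical_energy_fourier: "spherical_energy r = (\<integral>\<eta>. (norm (fourier \<phi> (r *\<^sub>R \<eta>)))\<^sup>2 \<partial>sphere_uniform)"
proof -
  have "spherical_energy r = (\<integral>z. (\<phi> (fst z) * \<phi> (snd z)) * (\<integral>\<eta>. cos ((fst z - snd z) \<bullet> (r *\<^sub>R \<eta>)) \<partial>sphere_uniform) \<partial>lborel2)"
    unfolding spherical_energy_def
  proof (intro integral_cong refl)
    fix z :: "'a \<times> 'a"
    have "(\<integral>\<eta>. cos ((fst z - snd z) \<bullet> (r *\<^sub>R \<eta>)) \<partial>sphere_uniform) = (\<integral>\<eta>. cos (\<eta> \<bullet> (r *\<^sub>R (fst z - snd z))) \<partial>sphere_uniform)"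
      by (simp add: inner_commute)
    also have "\<dots> = sphere_wave e (norm (r *\<^sub>R (fst z - snd z)))" by (rule sphere_cos_integral) (use e in auto)
    also have "\<dots> = sphere_wave e (r * norm (fst z - snd z))"
      by (cases "0 \<le> r") (simp_all add: sphere_wave_def)
    finally show "\<phi> (fst z) * \<phi> (snd z) * sphere_wave e (r * norm (fst z - snd z)) =
      \<phi> (fst z) * \<phi> (snd z) * (\<integral>\<eta>. cos ((fst z - snd z) \<bullet> (r *\<^sub>R \<eta>)) \<partial>sphere_uniform)" by simp
  qed
  also have "\<dots> = (\<integral>\<eta>. (\<integral>z. (\<phi> (fst z) * \<phi> (snd z)) * cos ((fst z - snd z) \<bullet> (r *\<^sub>R \<eta>)) \<partial>lborel2) \<partial>sphere_uniform)"
    by (rule fubini_bounded_kernel[OF sigma_finite_lborel2 prob_space_sphere_uniform int_\<phi>2, where b=1]) auto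
  finally show ?thesis unfolding norm_fourier_squared[OF int_\<phi>] .
qed

lemma spherical_energy_nonneg: "0 \<le> spherical_energy r"
  unfolding spherical_energy_fourier by simp

lemma fourier_meas[measurable]: "fourier \<phi> \<in> borel_measurable borel"
  by (rule borel_measurable_continuous_onI[OF fourier_continuous[OF int_\<phi>]])

lemma spherical_energy_decay:
  obtains C where "0 \<le> C" "\<And>r. 0 \<le> r \<Longrightarrow> spherical_energy r \<le> C / (1 + r) ^ DIM('a)"
proof -
  obtain C where C: "0 \<le> C" "\<And>v. norm (fourier \<phi> v) \<le> C / (1 + norm v) ^ DIM('a)" using fourier_decay[OF \<phi>] by blast
  have C1: "norm (fourier \<phi> v) \<le> C" for v
    using order_trans[OF C(2)[of v], of C] C(1) by (simp add: divide_le_eq mult_left_le one_le_power mult_le_cancel_left1)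
  have "spherical_energy r \<le> C\<^sup>2 / (1 + r) ^ DIM('a)" if r: "0 \<le> r" for r
  proof -
    have "spherical_energy r \<le> (\<integral>\<eta>. C\<^sup>2 / (1 + r) ^ DIM('a) \<partial>(sphere_uniform :: 'a measure))"
      unfolding spherical_energy_fourier
    proof (rule integral_mono_AE)
      show "integrable sphere_uniform (\<lambda>\<eta>. (norm (fourier \<phi> (r *\<^sub>R \<eta>)))\<^sup>2)"
        by (rule sphere_integrable_bounded[of _ "C\<^sup>2"]) (auto intro!: power_mono C1)
      show "AE \<eta> in sphere_uniform. (norm (fourier \<phi> (r *\<^sub>R \<eta>)))\<^sup>2 \<le> C\<^sup>2 / (1 + r) ^ DIM('a)"
        using AE_sphere_uniform
      proof eventually_elim
        fix \<eta> :: 'a assume n: "norm \<eta> = 1"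
        have "(norm (fourier \<phi> (r *\<^sub>R \<eta>)))\<^sup>2 \<le> C * (C / (1 + r) ^ DIM('a))"
          unfolding power2_eq_square using C(2)[of "r *\<^sub>R \<eta>"] n r
          by (intro mult_mono C1) (auto simp: C(1))
        then show "(norm (fourier \<phi> (r *\<^sub>R \<eta>)))\<^sup>2 \<le> C\<^sup>2 / (1 + r) ^ DIM('a)" by (simp add: power2_eq_square)
      qed
    qed simp
    then show ?thesis by (simp add: sph.prob_space[simplified])
  qed
  then show ?thesis by (intro that[of "C\<^sup>2"]) auto
qed

lemma spherical_energy_continuous: "continuous_on UNIV spherical_energy"
proof (rule continuous_at_imp_continuous_on, rule ballI)
  fix r :: real
  show "isCont spherical_energy r"
    unfolding continuous_at_sequentially comp_def spherical_energy_def
  proof (intro allI impI)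
    fix X assume X: "X \<longlonglongrightarrow> r"
    show "(\<lambda>n. \<integral>z. \<phi> (fst z) * \<phi> (snd z) * sphere_wave e (X n * norm (fst z - snd z)) \<partial>lborel2) \<longlonglongrightarrow>
      (\<integral>z. \<phi> (fst z) * \<phi> (snd z) * sphere_wave e (r * norm (fst z - snd z)) \<partial>lborel2)"
    proof (rule integral_dominated_convergence[where w="\<lambda>z. \<bar>\<phi> (fst z) * \<phi> (snd z)\<bar>"])
      show "integrable lborel2 (\<lambda>z. \<bar>\<phi> (fst z) * \<phi> (snd z)\<bar>)" using int_\<phi>2 by simp
      have c: "isCont (sphere_wave e) s" for s using sphere_wave_continuous[of e] by (simp add: continuous_on_eq_continuous_at)
      show "AE z in lborel2. (\<lambda>n. \<phi> (fst z) * \<phi> (snd z) * sphere_wave e (X n * norm (fst z - snd z))) \<longlonglongrightarrow> \<phi> (fst z) * \<phi> (snd z) * sphere_wave e (r * norm (fst z - snd z))"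
        by (intro AE_I2 tendsto_intros isCont_tendsto_compose[OF c] X)
      show "AE z in lborel2. norm (\<phi> (fst z) * \<phi> (snd z) * sphere_wave e (X n * norm (fst z - snd z))) \<le> \<bar>\<phi> (fst z) * \<phi> (snd z)\<bar>" for n
        using sphere_wave_bound by (auto intro!: AE_I2 mult_left_le simp: abs_mult)
    qed measurable
  qed
qed

lemma spherical_energy_integrable:
  assumes d: "2 \<le> DIM('a)"
  shows "integrable lborel (\<lambda>r. spherical_energy r * (r ^ (DIM('a) - 2) * indicator {0..} r))"
proof -
  have [measurable]: "spherical_energy \<in> borel_measurable borel" by (rule borel_measurable_continuous_onI[OF spherical_energy_continuous])
  obtain C where C: "0 \<le> C" "\<And>r. 0 \<le> r \<Longrightarrow> spherical_energy r \<le> C / (1 + r) ^ DIM('a)" using spherical_energy_decay by blast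
  have "integrable lborel (\<lambda>r::real. C * (1 / (1 + r)\<^sup>2 * indicator {0..} r))" using integrable_inverse_square by (rule integrable_mult_right)
  then show ?thesis
  proof (rule integrable_bound)
    show "AE r in lborel. norm (spherical_energy r * (r ^ (DIM('a) - 2) * indicator {0..} r)) \<le> norm (C * (1 / (1 + r)\<^sup>2 * indicator {0..} r))"
    proof (rule AE_I2)
      fix r :: real
      show "norm (spherical_energy r * (r ^ (DIM('a) - 2) * indicator {0..} r)) \<le> norm (C * (1 / (1 + r)\<^sup>2 * indicator {0..} r))"
      proof (cases "0 \<le> r")
        case True
        have dd: "(1 + r) ^ DIM('a) = (1 + r) ^ (DIM('a) - 2) * (1 + r)\<^sup>2"
          using d by (metis le_add_diff_inverse2 power_add)
        have "spherical_energy r * r ^ (DIM('a) - 2) \<le> C / (1 + r) ^ DIM('a) * (1 + r) ^ (DIM('a) - 2)"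
          using True C by (intro mult_mono power_mono) auto
        also have "\<dots> = C * (1 / (1 + r)\<^sup>2)" unfolding dd using True by (simp add: field_simps)
        finally show ?thesis using True C(1) spherical_energy_nonneg[of r] by (simp add: abs_mult)
      qed simp
    qed
  qed measurable
qed

end

section \<open>Radial averaging on the sphere\<close>

lemma unit_chord:
  fixes x y :: "'a::euclidean_space"
  assumes "norm x = 1" "norm y = 1"
  shows "norm (x - y) = sqrt (2 - 2 * (x \<bullet> y))"
proof -
  have "(norm (x - y))\<^sup>2 = 2 - 2 * (x \<bullet> y)"
    using dot_norm_neg[of x y] assms by simp
  then show ?thesis by (rule real_sqrt_unique[symmetric]) simp
qed

text \<open>The left side is a radial function of \<open>\<zeta>\<close> because reflections preserve \<open>fst s \<bullet> snd s\<close>. Averaging it over the directions of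
  \<open>\<zeta>\<close> replaces the cosine by a spherical wave in the chord, and then everything depends on
  the angle between the two points alone.\<close>

lemma pair_cos_radial:
  fixes e \<zeta> :: "'a::euclidean_space" and w :: "real \<Rightarrow> real"
  assumes e: "norm e = 1" and w[measurable]: "w \<in> borel_measurable borel" and b: "\<And>t. \<bar>w t\<bar> \<le> b"
  shows "(\<integral>s. w (fst s \<bullet> snd s) * cos ((fst s - snd s) \<bullet> \<zeta>) \<partial>sph_pair) =
    (\<integral>\<theta>. w (\<theta> \<bullet> e) * sphere_wave e (norm \<zeta> * sqrt (2 - 2 * (\<theta> \<bullet> e))) \<partial>sphere_uniform)"
proof -
  let ?Z = "\<integral>\<theta>. w (\<theta> \<bullet> e) * sphere_wave e (norm \<zeta> * sqrt (2 - 2 * (\<theta> \<bullet> e))) \<partial>sphere_uniform"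
  note sph_pair_bounded = finite_measure.integrable_const_bound[OF prob_space.finite_measure[OF prob_space_sph_pair], where B=b]
  have b0: "0 \<le> b" using b[of 0] by linarith
  have bb: "\<bar>w t * x\<bar> \<le> b" if "\<bar>x\<bar> \<le> 1" for t x
    using mult_mono[OF b that b0, of t] by (simp add: abs_mult)
  define k where "k \<zeta> = (\<integral>s. w (fst s \<bullet> snd s) * cos ((fst s - snd s) \<bullet> \<zeta>) \<partial>sph_pair)" for \<zeta> :: 'a
  define g where "g \<zeta> x = (\<integral>y. w (x \<bullet> y) * cos ((x - y) \<bullet> \<zeta>) \<partial>sphere_uniform)" for \<zeta> x :: 'a
  have gm[measurable]: "g \<zeta> \<in> borel_measurable borel" for \<zeta>
  proof -
    have "g \<zeta> \<in> borel_measurable (sphere_uniform :: 'a measure)"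
      unfolding g_def by (rule sph.borel_measurable_lebesgue_integral) measurable
    then show ?thesis by (simp add: measurable_cong_sets[OF sets_sphere_uniform refl])
  qed
  have ki: "k \<zeta> = (\<integral>x. g \<zeta> x \<partial>sphere_uniform)" for \<zeta>
  proof -
    have "integrable sph_pair (\<lambda>s. w (fst s \<bullet> snd s) * cos ((fst s - snd s) \<bullet> \<zeta>))"
      by (rule sph_pair_bounded) (auto intro!: AE_I2 bb)
    from sph2.integral_fst'[OF this] show ?thesis unfolding k_def g_def by simp
  qed
  have kT: "k (T \<zeta>) = k \<zeta>" if T: "orthogonal_transformation T" and inv: "\<And>x. T (T x) = x" for T and \<zeta> :: 'a
  proof -
    have i: "T x \<bullet> T y = x \<bullet> y" for x y using T unfolding orthogonal_transformation_def by simp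
    have d: "T (x - y) = T x - T y" for x y using orthogonal_transformation_linear[OF T] by (rule linear_diff)
    have c: "(x - y) \<bullet> T \<zeta> = (T x - T y) \<bullet> \<zeta>" for x y using i[of "x - y" "T \<zeta>"] by (simp add: d inv)
    have "g (T \<zeta>) x = g \<zeta> (T x)" for x
    proof -
      have "g (T \<zeta>) x = (\<integral>y. w (T x \<bullet> T y) * cos ((T x - T y) \<bullet> \<zeta>) \<partial>sphere_uniform)" unfolding g_def c i ..
      also have "\<dots> = g \<zeta> (T x)" unfolding g_def
        by (rule sphere_integral_involution[OF T inv, of "\<lambda>y. w (T x \<bullet> y) * cos ((T x - y) \<bullet> \<zeta>)"]) measurable
      finally show ?thesis .
    qed
    then have "g (T \<zeta>) = (\<lambda>x. g \<zeta> (T x))" by (rule ext)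
    then have "k (T \<zeta>) = (\<integral>x. g \<zeta> (T x) \<partial>sphere_uniform)" unfolding ki by simp
    also have "\<dots> = k \<zeta>" unfolding ki by (rule sphere_integral_involution[OF T inv gm])
    finally show ?thesis .
  qed
  have ku: "k (norm \<zeta> *\<^sub>R u) = k \<zeta>" if "norm u = 1" for u
  proof -
    have "reflect (\<zeta> - norm \<zeta> *\<^sub>R u) \<zeta> = norm \<zeta> *\<^sub>R u" by (rule reflect_swap) (use that in simp)
    then show ?thesis using kT[OF orthogonal_transformation_reflect reflect_reflect, of "\<zeta> - norm \<zeta> *\<^sub>R u" \<zeta>] by simp
  qed
  have meas_k[measurable]: "(\<lambda>u. k (norm \<zeta> *\<^sub>R u)) \<in> borel_measurable borel"
  proof -
    have "(\<lambda>u. k (norm \<zeta> *\<^sub>R u)) \<in> borel_measurable (sphere_uniform :: 'a measure)"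
      unfolding k_def by (rule sigma_finite_measure.borel_measurable_lebesgue_integral[OF prob_space_imp_sigma_finite[OF prob_space_sph_pair]]) measurable
    then show ?thesis by (simp add: measurable_cong_sets[OF sets_sphere_uniform refl])
  qed
  have "k \<zeta> = (\<integral>u. k \<zeta> \<partial>(sphere_uniform :: 'a measure))" by (simp add: sph.prob_space[simplified])
  also have "\<dots> = (\<integral>u. k (norm \<zeta> *\<^sub>R (u::'a)) \<partial>sphere_uniform)"
    by (rule integral_cong_AE) (use AE_sphere_uniform ku in \<open>auto elim: eventually_mono\<close>)
  also have "\<dots> = (\<integral>s. w (fst s \<bullet> snd s) * (\<integral>u. cos ((fst s - snd s) \<bullet> (norm \<zeta> *\<^sub>R (u::'a))) \<partial>sphere_uniform) \<partial>sph_pair)"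
  proof -
    have "integrable sph_pair (\<lambda>s. w (fst s \<bullet> (snd s :: 'a)))" by (rule sph_pair_bounded) (auto intro!: AE_I2 b)
    note * = fubini_bounded_kernel[OF prob_space_imp_sigma_finite[OF prob_space_sph_pair] prob_space_sphere_uniform this, where b=1]
    have "(\<integral>s. w (fst s \<bullet> snd s) * (\<integral>u. cos ((fst s - snd s) \<bullet> (norm \<zeta> *\<^sub>R (u::'a))) \<partial>sphere_uniform) \<partial>sph_pair) =
      (\<integral>u. (\<integral>s. w (fst s \<bullet> snd s) * cos ((fst s - snd s) \<bullet> (norm \<zeta> *\<^sub>R (u::'a))) \<partial>sph_pair) \<partial>sphere_uniform)"
      by (rule *) auto
    then show ?thesis unfolding k_def by (rule sym)
  qed
  also have "\<dots> = (\<integral>s. w (fst s \<bullet> snd s) * sphere_wave e (norm \<zeta> * norm (fst s - snd s :: 'a)) \<partial>sph_pair)"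
  proof (intro integral_cong refl arg_cong2[where f=times])
    fix s :: "'a \<times> 'a"
    have "(\<integral>u. cos ((fst s - snd s) \<bullet> (norm \<zeta> *\<^sub>R (u::'a))) \<partial>sphere_uniform) = (\<integral>u. cos (u \<bullet> (norm \<zeta> *\<^sub>R (fst s - snd s))) \<partial>sphere_uniform)"
      by (simp add: inner_commute)
    also have "\<dots> = sphere_wave e (norm (norm \<zeta> *\<^sub>R (fst s - snd s)))" by (rule sphere_cos_integral[OF e])
    finally show "(\<integral>u. cos ((fst s - snd s) \<bullet> (norm \<zeta> *\<^sub>R (u::'a))) \<partial>sphere_uniform) = sphere_wave e (norm \<zeta> * norm (fst s - snd s :: 'a))" by simp
  qed
  also have "\<dots> = (\<integral>x. (\<integral>y. w (x \<bullet> y) * sphere_wave e (norm \<zeta> * norm (x - y :: 'a)) \<partial>sphere_uniform) \<partial>sphere_uniform)"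
  proof -
    have "integrable sph_pair (\<lambda>s. w (fst s \<bullet> snd s) * sphere_wave e (norm \<zeta> * norm (fst s - snd s :: 'a)))"
      by (rule sph_pair_bounded) (auto intro!: AE_I2 bb sphere_wave_bound)
    from sph2.integral_fst'[OF this] show ?thesis by simp
  qed
  also have "\<dots> = (\<integral>x. ?Z \<partial>(sphere_uniform :: 'a measure))"
  proof (rule integral_cong_AE)
    show "(\<lambda>x. \<integral>y. w (x \<bullet> y) * sphere_wave e (norm \<zeta> * norm (x - y :: 'a)) \<partial>sphere_uniform) \<in> borel_measurable (sphere_uniform :: 'a measure)"
      by (rule sph.borel_measurable_lebesgue_integral) measurable
    show "AE x in sphere_uniform. (\<integral>y. w (x \<bullet> y) * sphere_wave e (norm \<zeta> * norm (x - y :: 'a)) \<partial>sphere_uniform) = ?Z"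
      using AE_sphere_uniform
    proof eventually_elim
      fix x :: 'a assume x: "norm x = 1"
      have "(\<integral>y. w (x \<bullet> y) * sphere_wave e (norm \<zeta> * norm (x - y :: 'a)) \<partial>sphere_uniform) = (\<integral>y. w (y \<bullet> x) * sphere_wave e (norm \<zeta> * sqrt (2 - 2 * (y \<bullet> x))) \<partial>sphere_uniform)"
      proof (rule integral_cong_AE)
        show "AE y in sphere_uniform. w (x \<bullet> y) * sphere_wave e (norm \<zeta> * norm (x - y :: 'a)) = w (y \<bullet> x) * sphere_wave e (norm \<zeta> * sqrt (2 - 2 * (y \<bullet> x)))"
          using AE_sphere_uniform
        proof eventually_elim
          fix y :: 'a assume y: "norm y = 1"
          show "w (x \<bullet> y) * sphere_wave e (norm \<zeta> * norm (x - y :: 'a)) = w (y \<bullet> x) * sphere_wave e (norm \<zeta> * sqrt (2 - 2 * (y \<bullet> x)))"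
            unfolding unit_chord[OF x y] by (simp add: inner_commute)
        qed
      qed measurable
      also have "\<dots> = ?Z"
        by (rule sphere_zonal[of "\<lambda>t. w t * sphere_wave e (norm \<zeta> * sqrt (2 - 2 * t))"]) (use e x in simp_all)
      finally show "(\<integral>y. w (x \<bullet> y) * sphere_wave e (norm \<zeta> * norm (x - y :: 'a)) \<partial>sphere_uniform) = ?Z" .
    qed
  qed simp
  also have "\<dots> = ?Z"
    by (simp add: sph.prob_space[simplified])
  finally show ?thesis unfolding k_def .
qed

lemma spectral_energy_zonal:
  fixes \<phi> :: "'a::euclidean_space \<Rightarrow> real"
  assumes \<phi>: "\<phi> \<in> schwartz_space" and e: "e \<in> Basis" and w[measurable]: "w \<in> borel_measurable borel" and b: "\<And>t. \<bar>w t\<bar> \<le> b" and R: "0 \<le> R"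
  shows "(\<integral>s. w (fst s \<bullet> snd s) * (norm (fourier \<phi> (R *\<^sub>R (fst s - snd s))))\<^sup>2 \<partial>sph_pair) =
    (\<integral>\<theta>. w (\<theta> \<bullet> e) * spherical_energy \<phi> e (R * sqrt (2 - 2 * (\<theta> \<bullet> e))) \<partial>sphere_uniform)"
proof -
  have [measurable]: "\<phi> \<in> borel_measurable borel" by (rule meas_\<phi>[OF \<phi> e])
  have b0: "0 \<le> b" using b[of 0] by linarith
  have bb: "\<bar>w t * x\<bar> \<le> b" if "\<bar>x\<bar> \<le> 1" for t x
    using mult_mono[OF b that b0, of t] by (simp add: abs_mult)
  have "(\<integral>s. w (fst s \<bullet> snd s) * (norm (fourier \<phi> (R *\<^sub>R (fst s - snd s))))\<^sup>2 \<partial>sph_pair) =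
    (\<integral>s. (\<integral>z. (\<phi> (fst z) * \<phi> (snd z)) * (w (fst s \<bullet> snd s) * cos ((fst s - snd s) \<bullet> (R *\<^sub>R (fst z - snd z)))) \<partial>lborel2) \<partial>sph_pair)"
    unfolding norm_fourier_squared[OF int_\<phi>[OF \<phi> e]] integral_mult_right_zero[symmetric]
    by (intro integral_cong refl) (simp add: inner_commute)
  also have "\<dots> = (\<integral>z. (\<phi> (fst z) * \<phi> (snd z)) * (\<integral>s. w (fst s \<bullet> snd s) * cos ((fst s - snd s) \<bullet> (R *\<^sub>R (fst z - snd z))) \<partial>sph_pair) \<partial>lborel2)"
    by (rule fubini_bounded_kernel[OF sigma_finite_lborel2 prob_space_sph_pair int_\<phi>2[OF \<phi> e], where b=b, symmetric])
       (auto intro!: bb)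
  also have "\<dots> = (\<integral>z. (\<phi> (fst z) * \<phi> (snd z)) * (\<integral>\<theta>. w (\<theta> \<bullet> e) * sphere_wave e (norm (R *\<^sub>R (fst z - snd z)) * sqrt (2 - 2 * (\<theta> \<bullet> e))) \<partial>sphere_uniform) \<partial>lborel2)"
    by (subst pair_cos_radial[OF _ w b]) (use e in auto)
  also have "\<dots> = (\<integral>\<theta>. (\<integral>z. (\<phi> (fst z) * \<phi> (snd z)) * (w (\<theta> \<bullet> e) * sphere_wave e (norm (R *\<^sub>R (fst z - snd z)) * sqrt (2 - 2 * (\<theta> \<bullet> e)))) \<partial>lborel2) \<partial>sphere_uniform)"
    by (rule fubini_bounded_kernel[OF sigma_finite_lborel2 prob_space_sphere_uniform int_\<phi>2[OF \<phi> e], where b=b])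
       (auto intro!: bb sphere_wave_bound)
  also have "\<dots> = (\<integral>\<theta>. w (\<theta> \<bullet> e) * spherical_energy \<phi> e (R * sqrt (2 - 2 * (\<theta> \<bullet> e))) \<partial>sphere_uniform)"
    unfolding spherical_energy_def[OF \<phi> e] integral_mult_right_zero[symmetric]
    by (intro integral_cong refl) (use R in \<open>simp add: mult_ac\<close>)
  finally show ?thesis .
qed

section \<open>Variance and kernel bounds under dilation\<close>

lemma unit_ball_vol_times: "0 < d \<Longrightarrow> real d * unit_ball_vol (real d) = 2 * pi powr (real d / 2) / Gamma (real d / 2)"
proof -
  assume d: "0 < d"
  have G: "Gamma (real d / 2 + 1) = real d / 2 * Gamma (real d / 2)"
    using d by (intro Gamma_plus1) (auto elim!: nonpos_Ints_cases)
  show ?thesis unfolding unit_ball_vol_def G using d Gamma_real_pos[of "real d / 2"] by (simp add: field_simps)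
qed

text \<open>Here \<open>riesz_const\<close> comes from the passage to the Riesz energy, \<open>angle_const\<close> from the density of the angle at the
  pole, and the factor \<open>2\<close> from the variance of a quadratic form.\<close>

lemma K_const_squared:
  assumes d: "2 \<le> d"
  shows "2 * angle_const d * riesz_const d = (K_const d)\<^sup>2"
proof -
  define a where "a = Gamma (real d / 2)"
  define b where "b = Gamma ((real d - 1) / 2)"
  define s where "s = pi powr (real d / 2)"
  have pos: "0 < a" "0 < b" "0 < s" unfolding a_def b_def s_def using d by (auto intro!: Gamma_real_pos)
  have s1: "pi powr ((real d - 1) / 2) = s / sqrt pi"
    unfolding s_def by (simp add: diff_divide_distrib powr_diff powr_half_sqrt)
  have s2: "sqrt pi ^ d = s"
    unfolding s_def by (simp add: powr_half_sqrt[symmetric] powr_realpow[symmetric] powr_powr)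
  have dd: "real (d - 1) = real d - 1" using d by simp
  have 1: "real d * unit_ball_vol (real d) = 2 * s / a" unfolding a_def s_def using d by (intro unit_ball_vol_times) simp
  have 2: "real (d - 1) * unit_ball_vol (real (d - 1)) = 2 * (s / sqrt pi) / b"
    using unit_ball_vol_times[of "d - 1"] d unfolding dd b_def s1 by simp
  have k: "(2 powr ((real d - 1) / 2))\<^sup>2 = 2 ^ (d - 1)"
  proof -
    have "(2 powr ((real d - 1) / 2))\<^sup>2 = (2::real) powr real (d - 1)"
      unfolding dd by (simp add: power2_eq_square powr_add[symmetric])
    then show ?thesis by (simp only: powr_realpow zero_less_numeral)
  qed
  have "2 * angle_const d * riesz_const d = 2 ^ (d - 1) * a\<^sup>2 / pi"
    unfolding angle_const_def riesz_const_def sphere_area_def 1 2 s2 b_def[symmetric]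
    using pos by (simp add: field_simps power2_eq_square)
  also have "\<dots> = (K_const d)\<^sup>2" unfolding K_const_def a_def[symmetric] power_divide power_mult_distrib k by simp
  finally show ?thesis .
qed

text \<open>Dilation multiplies the squared transform by \<open>R ^ (2 * d)\<close> and stretches its argument by \<open>R\<close>. After radial averaging the
  integral over pairs is one over a single angle, which concentrates at the pole; there the
  polynomial takes the value \<open>p 1\<close>.\<close>

lemma dilated_variance_limit:
  fixes \<phi> :: "'a::euclidean_space \<Rightarrow> real" and c :: "nat \<Rightarrow> real" and k :: nat
  assumes d: "2 \<le> DIM('a)" and \<phi>: "\<phi> \<in> schwartz_space"
  shows "((\<lambda>R. 2 * (\<integral>s. (norm (wave_kernel (weight_poly c k) (fourier (dilate R \<phi>)) (fst s) (snd s)))\<^sup>2 \<partial>sph_pair) / R ^ (DIM('a) + 1)) \<longlongrightarrow>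
    (K_const DIM('a))\<^sup>2 * (\<Sum>j\<le>k. c j)\<^sup>2 * riesz_energy \<phi>) at_top"
proof -
  let ?d = "DIM('a)"
  let ?W = "\<lambda>R s. norm (wave_kernel (weight_poly c k) (fourier (dilate R \<phi>)) (fst s) (snd s))"
  obtain e :: 'a where e: "e \<in> Basis" using nonempty_Basis by blast
  have \<phi>m[measurable]: "\<phi> \<in> borel_measurable borel" by (rule meas_\<phi>[OF \<phi> e])
  have [measurable]: "fourier \<phi> \<in> borel_measurable borel" by (rule fourier_meas[OF \<phi> e])
  \<comment> \<open>The polynomial is unbounded on the line, but only its values at cosines matter.\<close>
  define w where "w t = (weight_poly c k (max (- 1) (min 1 t)))\<^sup>2" for t
  let ?I = "\<lambda>R. \<integral>\<theta>. w (\<theta> \<bullet> e) * spherical_energy \<phi> e (R * sqrt (2 - 2 * (\<theta> \<bullet> e))) \<partial>sphere_uniform"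
  have wc: "continuous_on UNIV w" unfolding w_def weight_poly_def by (intro continuous_intros)
  then have wm[measurable]: "w \<in> borel_measurable borel" by (rule borel_measurable_continuous_onI)
  have wb: "\<bar>w t\<bar> \<le> (\<Sum>j\<le>k. \<bar>c j\<bar>)\<^sup>2" for t
    unfolding w_def using abs_weight_poly_le[of "max (- 1) (min 1 t)" c k]
    by (simp add: abs_le_square_iff[symmetric] del: sum_abs)
  obtain C where C: "0 \<le> C" "\<And>r. 0 \<le> r \<Longrightarrow> spherical_energy \<phi> e r \<le> C / (1 + r) ^ ?d"
    using spherical_energy_decay[OF \<phi> e] by blast
  obtain M where M: "\<And>x. \<bar>\<phi> x\<bar> \<le> M"
  proof -
    obtain C' where C': "\<And>x. \<bar>partials [] \<phi> x\<bar> \<le> C' / (1 + norm x) ^ 0" using schwartz_decay[OF \<phi>, of "[]" 0] by auto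
    then show ?thesis by (intro that[of C']) (simp add: partials_Nil)
  qed
  define E where "E = (\<integral>z. \<phi> (fst z) * \<phi> (snd z) / norm (fst z - snd z) ^ (?d - 1) \<partial>lborel2)"
  have rz: "(\<integral>r. spherical_energy \<phi> e r * (r ^ (?d - 2) * indicator {0..} r) \<partial>lborel) = riesz_const ?d * E"
    unfolding E_def spherical_energy_def[OF \<phi> e]
    by (rule spherical_energy_eq_riesz_energy[OF _ d int_\<phi>[OF \<phi> e] M])
       (use e spherical_energy_nonneg[OF \<phi> e] spherical_energy_integrable[OF \<phi> e d] in \<open>auto simp: spherical_energy_def[OF \<phi> e]\<close>)
  have V: "(\<integral>s. (?W R s)\<^sup>2 \<partial>sph_pair) =
     (R ^ ?d)\<^sup>2 * (?I R)" if R: "0 < R" for R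
  proof -
    have AEp: "AE s in sph_pair. norm (fst s :: 'a) = 1 \<and> norm (snd s :: 'a) = 1"
    proof -
      have "{s \<in> space sph_pair. norm (fst s :: 'a) = 1 \<and> norm (snd s :: 'a) = 1} \<in> sets sph_pair" by measurable
      moreover have "AE x in sphere_uniform. AE y in sphere_uniform. norm (fst (x, y) :: 'a) = 1 \<and> norm (snd (x, y) :: 'a) = 1"
        using AE_sphere_uniform by eventually_elim (use AE_sphere_uniform in simp)
      ultimately show ?thesis by (rule sph2.AE_pair_measure)
    qed
    have fd: "fourier (dilate R \<phi>) = (\<lambda>v. of_real (R ^ ?d) * fourier \<phi> (R *\<^sub>R v))" using fourier_dilate[OF \<phi>m R] by blast
    have "(\<integral>s. (?W R s)\<^sup>2 \<partial>sph_pair) =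
      (\<integral>s. (R ^ ?d)\<^sup>2 * (w (fst s \<bullet> snd s) * (norm (fourier \<phi> (R *\<^sub>R (fst s - snd s))))\<^sup>2) \<partial>sph_pair)"
    proof (rule integral_cong_AE)
      show "(\<lambda>s. (?W R s)\<^sup>2) \<in> borel_measurable sph_pair"
        unfolding wave_kernel_def fd weight_poly_def by measurable
      show "AE s in sph_pair. (?W R s)\<^sup>2 =
         (R ^ ?d)\<^sup>2 * (w (fst s \<bullet> snd s) * (norm (fourier \<phi> (R *\<^sub>R (fst s - snd s))))\<^sup>2)"
        using AEp
      proof eventually_elim
        fix s :: "'a \<times> 'a" assume n: "norm (fst s) = 1 \<and> norm (snd s) = 1"
        then have "\<bar>fst s \<bullet> snd s\<bar> \<le> 1" by (intro abs_inner_unit) auto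
        then have "max (- 1) (min 1 (fst s \<bullet> snd s)) = fst s \<bullet> snd s" by linarith
        then have "w (fst s \<bullet> snd s) = (weight_poly c k (fst s \<bullet> snd s))\<^sup>2" unfolding w_def by simp
        then show "(?W R s)\<^sup>2 =
         (R ^ ?d)\<^sup>2 * (w (fst s \<bullet> snd s) * (norm (fourier \<phi> (R *\<^sub>R (fst s - snd s))))\<^sup>2)"
          unfolding wave_kernel_def fd using n R by (simp add: norm_mult norm_power power_mult_distrib)
      qed
    qed measurable
    then show ?thesis using spectral_energy_zonal[OF \<phi> e wm wb, of R] R by simp
  qed
  have w1: "w 1 = (\<Sum>j\<le>k. c j)\<^sup>2" by (simp add: w_def weight_poly_def)
  have lim: "((\<lambda>R. R ^ (?d - 1) * (?I R)) \<longlongrightarrow>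
     angle_const ?d * (w 1 * (riesz_const ?d * E))) at_top"
    unfolding rz[symmetric]
    by (rule sphere_concentration_limit[OF e d spherical_energy_continuous[OF \<phi> e] spherical_energy_nonneg[OF \<phi> e] C(2) wc]) (simp_all add: w_def)
  have "((\<lambda>R. 2 * (R ^ (?d - 1) * (?I R))) \<longlongrightarrow>
     2 * (angle_const ?d * (w 1 * (riesz_const ?d * E)))) at_top"
    by (rule tendsto_mult[OF tendsto_const lim])
  also have "2 * (angle_const ?d * (w 1 * (riesz_const ?d * E))) = (K_const ?d)\<^sup>2 * (\<Sum>j\<le>k. c j)\<^sup>2 * E"
    unfolding K_const_squared[OF d, symmetric] w1 by simp
  finally show ?thesis unfolding E_def
  proof (rule Lim_transform_eventually)
    show "\<forall>\<^sub>F R in at_top. 2 * (R ^ (?d - 1) * (?I R)) =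
      2 * (\<integral>s. (?W R s)\<^sup>2 \<partial>sph_pair) / R ^ (?d + 1)"
      using eventually_gt_at_top[of 0]
    proof eventually_elim
      fix R :: real assume R: "0 < R"
      have "(R ^ ?d)\<^sup>2 = R ^ (?d - 1) * R ^ (?d + 1)"
        unfolding power2_eq_square power_add[symmetric] using d by (intro arg_cong[where f="\<lambda>n. R ^ n"]) simp
      then show "2 * (R ^ (?d - 1) * (?I R)) =
        2 * (\<integral>s. (?W R s)\<^sup>2 \<partial>sph_pair) / R ^ (?d + 1)"
        unfolding V[OF R] using R by simp
    qed
  qed
qed

text \<open>A row integral of the dilated kernel is of order \<open>R ^ d / R ^ (d - 1)\<close>: the factor \<open>R ^ d\<close> comes from dilation and the
  other from concentration. For \<open>d \<ge> 2\<close> this is smaller than the normalisation.\<close>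

lemma dilated_schur_bound:
  fixes \<phi> :: "'a::euclidean_space \<Rightarrow> real" and c :: "nat \<Rightarrow> real" and k :: nat
  assumes d: "2 \<le> DIM('a)" and \<phi>: "\<phi> \<in> schwartz_space"
  obtains D where "\<And>R. 0 < R \<Longrightarrow> 0 \<le> D R"
    "\<And>R \<theta>. 0 < R \<Longrightarrow> (\<integral>\<^sup>+\<eta>. ennreal (norm (wave_kernel (weight_poly c k) (fourier (dilate R \<phi>)) \<theta> \<eta>)) \<partial>sphere_uniform) \<le> ennreal (D R)"
    "((\<lambda>R. D R / R powr ((real DIM('a) + 1) / 2)) \<longlongrightarrow> 0) at_top"
proof -
  let ?d = "DIM('a)"
  let ?c = "\<lambda>\<theta> \<eta>. sqrt (2 - 2 * (\<eta> \<bullet> \<theta>)) :: real"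
  let ?W = "\<lambda>R \<theta> \<eta>. norm (wave_kernel (weight_poly c k) (fourier (dilate R \<phi>)) \<theta> \<eta>)"
  obtain e :: 'a where e: "e \<in> Basis" using nonempty_Basis by blast
  have \<phi>m[measurable]: "\<phi> \<in> borel_measurable borel" by (rule meas_\<phi>[OF \<phi> e])
  have [measurable]: "fourier \<phi> \<in> borel_measurable borel" by (rule fourier_meas[OF \<phi> e])
  obtain C where C: "0 \<le> C" "\<And>v. norm (fourier \<phi> v) \<le> C / (1 + norm v) ^ ?d" using fourier_decay[OF \<phi>] by blast
  define P where "P = (\<Sum>j\<le>k. \<bar>c j\<bar>)"
  have P0: "0 \<le> P" unfolding P_def by (intro sum_nonneg) auto
  define f where "f r = C / (1 + \<bar>r\<bar>) ^ ?d" for r :: real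
  have fc: "continuous_on UNIV f" unfolding f_def by (intro continuous_intros) (auto simp: add_nonneg_eq_0_iff)
  then have fm[measurable]: "f \<in> borel_measurable borel" by (rule borel_measurable_continuous_onI)
  have f0: "0 \<le> f r" for r unfolding f_def using C(1) by simp
  have fC: "f r \<le> C" for r
    unfolding f_def using C(1) one_le_power[of "1 + \<bar>r\<bar>" ?d] by (simp add: divide_le_eq mult_le_cancel_left1)
  define J where "J R = (\<integral>\<theta>. f (R * sqrt (2 - 2 * (\<theta> \<bullet> e))) \<partial>sphere_uniform)" for R
  have J0: "0 \<le> J R" for R unfolding J_def by (simp add: f0)
  define D where "D R = P * R ^ ?d * J R" for R
  have 1: "0 \<le> D R" if "0 < R" for R unfolding D_def using that P0 J0 by simp
  have 2: "(\<integral>\<^sup>+\<eta>. ennreal (?W R \<theta> \<eta>) \<partial>sphere_uniform) \<le> ennreal (D R)" if R: "0 < R" for R \<theta>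
  proof (cases "norm \<theta> = 1")
    case False
    then show ?thesis by (simp add: wave_kernel_def)
  next
    case True
    have "(\<integral>\<^sup>+\<eta>. ennreal (?W R \<theta> \<eta>) \<partial>sphere_uniform) \<le>
      (\<integral>\<^sup>+\<eta>. ennreal (P * R ^ ?d * f (R * (?c \<theta> \<eta>))) \<partial>sphere_uniform)"
    proof (rule nn_integral_mono_AE)
      show "AE \<eta> in sphere_uniform. ennreal (?W R \<theta> \<eta>) \<le> ennreal (P * R ^ ?d * f (R * (?c \<theta> \<eta>)))"
        using AE_sphere_uniform
      proof eventually_elim
        fix \<eta> :: 'a assume n: "norm \<eta> = 1"
        have ch: "norm (R *\<^sub>R (\<theta> - \<eta>)) = \<bar>R * (?c \<theta> \<eta>)\<bar>"
        proof -
          have "(?c \<theta> \<eta>) = norm (\<theta> - \<eta>)" using unit_chord[OF True n] by (simp add: inner_commute)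
          then show ?thesis by (simp add: abs_mult)
        qed
        have "norm (fourier (dilate R \<phi>) (\<theta> - \<eta>)) = R ^ ?d * norm (fourier \<phi> (R *\<^sub>R (\<theta> - \<eta>)))"
          unfolding fourier_dilate[OF \<phi>m R] using R by (simp add: norm_mult norm_power)
        also have "\<dots> \<le> R ^ ?d * f (R * (?c \<theta> \<eta>))"
          using C(2)[of "R *\<^sub>R (\<theta> - \<eta>)"] R unfolding f_def ch by (intro mult_left_mono) auto
        finally have "P * norm (fourier (dilate R \<phi>) (\<theta> - \<eta>)) \<le> P * (R ^ ?d * f (R * (?c \<theta> \<eta>)))"
          by (intro mult_left_mono P0)
        then show "ennreal (?W R \<theta> \<eta>) \<le> ennreal (P * R ^ ?d * f (R * (?c \<theta> \<eta>)))"
          using norm_wave_kernel_le[of c k "fourier (dilate R \<phi>)" \<theta> \<eta>] unfolding P_def[symmetric] by (intro ennreal_leI) (simp add: mult.assoc)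
      qed
    qed
    also have "\<dots> = ennreal (\<integral>\<eta>. P * R ^ ?d * f (R * (?c \<theta> \<eta>)) \<partial>sphere_uniform)"
    proof (rule nn_integral_eq_integral)
      have "integrable sphere_uniform (\<lambda>\<eta>. f (R * (?c \<theta> \<eta>)))"
        by (rule sphere_integrable_bounded[of _ C]) (use f0 fC in auto)
      then show "integrable sphere_uniform (\<lambda>\<eta>. P * R ^ ?d * f (R * (?c \<theta> \<eta>)))" by (rule integrable_mult_right)
      show "AE \<eta> in sphere_uniform. 0 \<le> P * R ^ ?d * f (R * (?c \<theta> \<eta>))" using R P0 f0 by simp
    qed
    also have "(\<integral>\<eta>. P * R ^ ?d * f (R * (?c \<theta> \<eta>)) \<partial>sphere_uniform) = D R"
      unfolding D_def J_def integral_mult_right_zero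
      by (subst sphere_zonal[of "\<lambda>t. f (R * sqrt (2 - 2 * t))" \<theta> e]) (use True e in auto)
    finally show ?thesis .
  qed
  have lim: "((\<lambda>R. R ^ (?d - 1) * (\<integral>\<theta>. 1 * f (R * sqrt (2 - 2 * (\<theta> \<bullet> e))) \<partial>sphere_uniform)) \<longlongrightarrow>
      angle_const ?d * (1 * (\<integral>r. f r * (r ^ (?d - 2) * indicator {0..} r) \<partial>lborel))) at_top"
    by (rule sphere_concentration_limit[OF e d fc f0, of C "\<lambda>_. 1"]) (auto simp: f_def)
  have z: "((\<lambda>R::real. R powr (- ((real ?d - 1) / 2))) \<longlongrightarrow> 0) at_top"
    by (rule tendsto_neg_powr[OF _ filterlim_ident]) (use d in simp)
  have "((\<lambda>R. P * (R ^ (?d - 1) * J R) * R powr (- ((real ?d - 1) / 2))) \<longlongrightarrow> 0) at_top"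
    using tendsto_mult[OF tendsto_mult[OF tendsto_const[of P] lim] z] by (simp add: J_def)
  then have 3: "((\<lambda>R. D R / R powr ((real ?d + 1) / 2)) \<longlongrightarrow> 0) at_top"
  proof (rule Lim_transform_eventually)
    show "\<forall>\<^sub>F R in at_top. P * (R ^ (?d - 1) * J R) * R powr (- ((real ?d - 1) / 2)) = D R / R powr ((real ?d + 1) / 2)"
      using eventually_gt_at_top[of 0]
    proof eventually_elim
      fix R :: real assume R: "0 < R"
      have "R ^ (?d - 1) * R powr (- ((real ?d - 1) / 2)) = R powr ((real ?d - 1) + - ((real ?d - 1) / 2))"
        unfolding powr_add using R d by (simp add: powr_realpow[symmetric] of_nat_diff)
      also have "(real ?d - 1) + - ((real ?d - 1) / 2) = real ?d - (real ?d + 1) / 2" by (simp add: field_simps)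
      also have "R powr \<dots> = R ^ ?d / R powr ((real ?d + 1) / 2)" using R by (simp add: powr_diff powr_realpow)
      finally have "P * J R * (R ^ (?d - 1) * R powr (- ((real ?d - 1) / 2))) = P * J R * (R ^ ?d / R powr ((real ?d + 1) / 2))" by simp
      then show "P * (R ^ (?d - 1) * J R) * R powr (- ((real ?d - 1) / 2)) = D R / R powr ((real ?d + 1) / 2)"
        unfolding D_def by (simp add: mult_ac)
    qed
  qed
  show ?thesis by (rule that[OF 1 2 3])
qed

section \<open>Reduction to smooth samples and to characteristic functions\<close>

lemma smooth_fun_zero: "smooth_fun (\<lambda>_. 0)"
proof -
  have "partials bs (\<lambda>_. 0) = (\<lambda>_. 0)" for bs :: "'a list"
    by (induction bs) (simp_all add: partials_Nil partials_Cons partial_deriv_def fun_eq_iff)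
  then show ?thesis unfolding smooth_fun_def by simp
qed

text \<open>Setting the field to zero on a null set changes neither the finite-dimensional laws nor the covariance.\<close>

lemma berry_smooth_modification:
  fixes B :: "'w \<Rightarrow> 'a::euclidean_space \<Rightarrow> real"
  assumes B: "berry_random_wave M B"
  obtains B' where "smooth_berry M B'" "AE \<omega> in M. B' \<omega> = B \<omega>"
proof -
  interpret prob_space M using B unfolding berry_random_wave_def by simp
  have gp: "centered_gaussian_process M UNIV (\<lambda>x \<omega>. B \<omega> x)"
    and cov: "\<And>x y. complex_of_real (\<integral>\<omega>. B \<omega> x * B \<omega> y \<partial>M) = (\<integral>\<theta>. iexp ((x - y) \<bullet> \<theta>) \<partial>sphere_uniform)"
    and sm: "AE \<omega> in M. smooth_fun (B \<omega>)"
    using B unfolding berry_random_wave_def by auto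
  have gpD: "gaussian_variable M (\<lambda>\<omega>. \<Sum>t\<in>F. a t * B \<omega> t)" if "finite F" for F a
    using gp[unfolded centered_gaussian_process_def, THEN conjunct1, rule_format, of F a] that by simp
  have Bm[measurable]: "(\<lambda>\<omega>. B \<omega> x) \<in> borel_measurable M" for x
  proof -
    have "gaussian_variable M (\<lambda>\<omega>. \<Sum>t\<in>{x}. 1 * B \<omega> t)" by (rule gpD) simp
    then show ?thesis unfolding gaussian_variable_def by simp
  qed
  obtain N where N: "\<And>\<omega>. \<omega> \<in> space M - N \<Longrightarrow> smooth_fun (B \<omega>)" "N \<in> null_sets M"
    using AE_E3[OF sm] by auto
  have Ns[measurable]: "N \<in> sets M" using N(2) by auto
  define B' where "B' \<omega> = (if \<omega> \<in> space M - N then B \<omega> else (\<lambda>_. 0))" for \<omega>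
  have ae: "AE \<omega> in M. B' \<omega> = B \<omega>"
    using AE_not_in[OF N(2)] AE_space by eventually_elim (simp add: B'_def)
  have B'm[measurable]: "(\<lambda>\<omega>. B' \<omega> x) \<in> borel_measurable M" for x
  proof -
    have "(\<lambda>\<omega>. if \<omega> \<in> space M - N then B \<omega> x else 0) \<in> borel_measurable M" by measurable
    then show ?thesis unfolding B'_def by (simp add: if_distrib[where f="\<lambda>f. f x"])
  qed
  have "smooth_berry M B'"
  proof
    show "centered_gaussian_process M UNIV (\<lambda>x \<omega>. B' \<omega> x)"
      unfolding centered_gaussian_process_def
    proof (intro conjI allI ballI impI)
      fix F :: "'a set" and a :: "'a \<Rightarrow> real" assume F: "finite F \<and> F \<subseteq> UNIV"
      then have g: "gaussian_variable M (\<lambda>\<omega>. \<Sum>t\<in>F. a t * B \<omega> t)" by (intro gpD) simp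
      have "distr M borel (\<lambda>\<omega>. \<Sum>t\<in>F. a t * B' \<omega> t) = distr M borel (\<lambda>\<omega>. \<Sum>t\<in>F. a t * B \<omega> t)"
        by (rule distr_cong_AE) (use ae in \<open>auto elim!: eventually_mono\<close>)
      then show "gaussian_variable M (\<lambda>\<omega>. \<Sum>t\<in>F. a t * B' \<omega> t)" using g unfolding gaussian_variable_def by simp
    next
      fix t
      have "(\<integral>\<omega>. B' \<omega> t \<partial>M) = (\<integral>\<omega>. B \<omega> t \<partial>M)"
        by (rule integral_cong_AE) (use ae in \<open>auto elim!: eventually_mono\<close>)
      then show "integral\<^sup>L M (\<lambda>\<omega>. B' \<omega> t) = 0" using gp unfolding centered_gaussian_process_def by simp
    qed
    fix x y
    have "(\<integral>\<omega>. B' \<omega> x * B' \<omega> y \<partial>M) = (\<integral>\<omega>. B \<omega> x * B \<omega> y \<partial>M)"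
      by (rule integral_cong_AE) (use ae in \<open>auto elim!: eventually_mono\<close>)
    then show "complex_of_real (\<integral>\<omega>. B' \<omega> x * B' \<omega> y \<partial>M) = (\<integral>\<theta>. iexp ((x - y) \<bullet> \<theta>) \<partial>sphere_uniform)" using cov by simp
  next
    fix \<omega> show "smooth_fun (B' \<omega>)" using N(1) smooth_fun_zero by (auto simp: B'_def)
  qed
  then show ?thesis using ae by (rule that)
qed

lemma converges_in_law_charfun:
  fixes Y :: "real \<Rightarrow> 'w \<Rightarrow> real" and Z :: "'v \<Rightarrow> real"
  assumes M: "prob_space M" and N: "prob_space N" and Z: "Z \<in> borel_measurable N"
    and Y: "\<And>R. 0 < R \<Longrightarrow> Y R \<in> borel_measurable M"
    and conv: "\<And>t. ((\<lambda>R. \<integral>\<omega>. iexp (t * Y R \<omega>) \<partial>M) \<longlongrightarrow> (\<integral>v. iexp (t * Z v) \<partial>N)) at_top"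
  shows "converges_in_law M Y N Z"
  unfolding converges_in_law_def
proof (intro allI impI)
  fix r :: "nat \<Rightarrow> real" assume r: "filterlim r at_top sequentially"
  \<comment> \<open>Measurability of \<open>Y R\<close> is available for \<open>R > 0\<close> only, and the modification of \<open>r\<close> alters finitely many terms.\<close>
  define q where "q n = max 1 (r n)" for n
  have q0: "0 < q n" for n unfolding q_def by simp
  have qr: "\<forall>\<^sub>F n in sequentially. r n = q n"
    using r[unfolded filterlim_at_top, rule_format, of 1] by eventually_elim (simp add: q_def)
  have q: "filterlim q at_top sequentially" by (rule filterlim_mono_eventually[OF r order_refl order_refl qr])
  have "weak_conv_m (\<lambda>n. distr M borel (Y (q n))) (distr N borel Z)"
  proof (rule levy_continuity)
    show "real_distribution (distr M borel (Y (q n)))" for n by (rule prob_space.real_distribution_distr[OF M Y[OF q0]])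
    show "real_distribution (distr N borel Z)" by (rule prob_space.real_distribution_distr[OF N Z])
    show "(\<lambda>n. char (distr M borel (Y (q n))) t) \<longlonglongrightarrow> char (distr N borel Z) t" for t
      using filterlim_compose[OF conv[of t] q] Y[OF q0] Z by (simp add: char_def integral_distr)
  qed
  then have w: "(\<lambda>n. cdf (distr M borel (Y (q n))) x) \<longlonglongrightarrow> cdf (distr N borel Z) x" if "isCont (cdf (distr N borel Z)) x" for x
    using that unfolding weak_conv_m_def weak_conv_def by blast
  show "weak_conv_m (\<lambda>n. distr M borel (Y (r n))) (distr N borel Z)"
    unfolding weak_conv_m_def weak_conv_def
  proof (intro allI impI)
    fix x assume "isCont (cdf (distr N borel Z)) x"
    then show "(\<lambda>n. cdf (distr M borel (Y (r n))) x) \<longlonglongrightarrow> cdf (distr N borel Z) x"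
      by (rule Lim_transform_eventually[OF w]) (use qr in \<open>auto elim!: eventually_mono\<close>)
  qed
qed

lemma fgf_half_charfun:
  fixes h :: "'v \<Rightarrow> ('a::euclidean_space \<Rightarrow> real) \<Rightarrow> real" and \<phi> :: "'a \<Rightarrow> real"
  assumes h: "fgf_half N h" and \<phi>: "\<phi> \<in> schwartz_space"
  shows "(\<lambda>v. h v \<phi>) \<in> borel_measurable N"
    "(\<integral>v. iexp (t * h v \<phi>) \<partial>N) = of_real (exp (- t\<^sup>2 * (C_const DIM('a) *
       riesz_energy \<phi>) / 2))"
proof -
  have N: "prob_space N" and gp: "centered_gaussian_process N schwartz_space (\<lambda>\<phi> v. h v \<phi>)"
    and cov: "(\<integral>v. h v \<phi> * h v \<phi> \<partial>N) = C_const DIM('a) * (\<integral>x. (\<integral>y. \<phi> x * \<phi> y / norm (x - y) ^ (DIM('a) - 1) \<partial>lborel) \<partial>lborel)"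
    using h \<phi> unfolding fgf_half_def by auto
  have "gaussian_variable N (\<lambda>v. \<Sum>t\<in>{\<phi>}. 1 * h v t)"
    using gp[unfolded centered_gaussian_process_def, THEN conjunct1, rule_format, of "{\<phi>}" "\<lambda>_. 1"] \<phi> by simp
  then have g: "gaussian_variable N (\<lambda>v. h v \<phi>)" by simp
  then show "(\<lambda>v. h v \<phi>) \<in> borel_measurable N" unfolding gaussian_variable_def by simp
  have m0: "(\<integral>v. h v \<phi> \<partial>N) = 0" using gp \<phi> unfolding centered_gaussian_process_def by simp
  obtain C' where C': "\<And>x. \<bar>partials [] \<phi> x\<bar> \<le> C' / (1 + norm x) ^ 0" using schwartz_decay[OF \<phi>, of "[]" 0] by auto
  have "integrable lborel \<phi>" using schwartz_partials_integrable[OF \<phi>, of "[]"] by (simp add: partials_Nil)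
  from lborel_pair.integral_fst'[OF riesz_energy_integrable[OF this, of C']] C'
  have "(\<integral>x. (\<integral>y. \<phi> x * \<phi> y / norm (x - y) ^ (DIM('a) - 1) \<partial>lborel) \<partial>lborel) =
    riesz_energy \<phi>" by (simp add: partials_Nil)
  with cov gaussian_variable_moments(3)[OF N g m0, of t]
  show "(\<integral>v. iexp (t * h v \<phi>) \<partial>N) = of_real (exp (- t\<^sup>2 * (C_const DIM('a) *
       riesz_energy \<phi>) / 2))"
    by (simp add: power2_eq_square)
qed

section \<open>The universality theorem\<close>

lemma power_half_powr:
  fixes R :: real
  assumes "0 < R"
  shows "(R powr ((real d + 1) / 2))\<^sup>2 = R ^ (d + 1)"
proof -
  have "(R powr ((real d + 1) / 2))\<^sup>2 = R powr (real (d + 1))" by (simp add: power2_eq_square powr_add[symmetric] add.commute)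
  also have "\<dots> = R ^ (d + 1)" using assms by (rule powr_realpow)
  finally show ?thesis .
qed

lemma (in smooth_berry) dilated_energy_charfun:
  fixes c :: "nat \<Rightarrow> real" and k :: nat and \<phi> :: "'a \<Rightarrow> real" and \<beta> t :: real
  assumes d: "2 \<le> DIM('a)" and \<phi>: "\<phi> \<in> schwartz_space"
  shows "((\<lambda>R. \<integral>\<omega>. iexp (t * (energy c k (dilate R \<phi>) \<omega> / (\<beta> * R powr ((real DIM('a) + 1) / 2)))) \<partial>M) \<longlongrightarrow>
    of_real (exp (- t\<^sup>2 * ((K_const DIM('a))\<^sup>2 * (\<Sum>j\<le>k. c j)\<^sup>2 *
      riesz_energy \<phi> / \<beta>\<^sup>2) / 2))) at_top"
proof -
  define n where "n R = R powr ((real DIM('a) + 1) / 2)" for R :: real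
  have n0: "0 < n R" and n2: "(n R)\<^sup>2 = R ^ (DIM('a) + 1)" if "0 < R" for R
  unfolding n_def using that power_half_powr[OF that] by auto
  define V where "V R = 2 * (\<integral>s. (norm (wave_kernel (weight_poly c k) (fourier (dilate R \<phi>)) (fst s) (snd s)))\<^sup>2 \<partial>sph_pair)" for R
  define E where "E = (K_const DIM('a))\<^sup>2 * (\<Sum>j\<le>k. c j)\<^sup>2 * riesz_energy \<phi>"
  have V: "((\<lambda>R. V R / R ^ (DIM('a) + 1)) \<longlongrightarrow> E) at_top"
    unfolding V_def E_def by (rule dilated_variance_limit[OF d \<phi>])
  obtain D where D: "\<And>R. 0 < R \<Longrightarrow> 0 \<le> D R"
    "\<And>R \<theta>. 0 < R \<Longrightarrow> (\<integral>\<^sup>+\<eta>. ennreal (norm (wave_kernel (weight_poly c k) (fourier (dilate R \<phi>)) \<theta> \<eta>)) \<partial>sphere_uniform) \<le> ennreal (D R)"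
    "((\<lambda>R. D R / n R) \<longlongrightarrow> 0) at_top"
    by (rule dilated_schur_bound[OF d \<phi>, of c k, folded n_def]) (rule that)
  have \<phi>i: "integrable lborel (dilate R \<phi>)" if "0 < R" for R
    using schwartz_partials_integrable[OF dilate_schwartz[OF \<phi> that], of "[]"] by (simp add: partials_Nil)
  define G where "G R = complex_of_real (exp (- (t\<^sup>2 * (V R / R ^ (DIM('a) + 1) / \<beta>\<^sup>2) / 2)))" for R
  have "((\<lambda>R. (\<integral>\<omega>. iexp (t * (energy c k (dilate R \<phi>) \<omega> / (\<beta> * n R))) \<partial>M) - G R) \<longlongrightarrow> 0) at_top"
  proof (rule Lim_null_comparison)
    show "\<forall>\<^sub>F R in at_top. norm ((\<integral>\<omega>. iexp (t * (energy c k (dilate R \<phi>) \<omega> / (\<beta> * n R))) \<partial>M) - G R) \<le>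
        2 * (t / \<beta>)\<^sup>2 * ((D R / n R) * sqrt (V R / R ^ (DIM('a) + 1)))"
      using eventually_gt_at_top[of 0]
    proof eventually_elim
      fix R :: real assume R: "0 < R"
      note b = energy_charfun_near_gaussian(3)[OF \<phi>i[OF R] D(1)[OF R] D(2)[OF R], of "t / (\<beta> * n R)", folded V_def]
      have e1: "t / (\<beta> * n R) * x = t * (x / (\<beta> * n R))" for x by simp
      have e2: "- (t / (\<beta> * n R))\<^sup>2 * V R / 2 = - (t\<^sup>2 * (V R / R ^ (DIM('a) + 1) / \<beta>\<^sup>2) / 2)"
        unfolding n2[OF R, symmetric] power_divide power_mult_distrib by simp
      have e3: "2 * (t / (\<beta> * n R))\<^sup>2 * (D R * sqrt (V R)) = 2 * (t / \<beta>)\<^sup>2 * ((D R / n R) * sqrt (V R / R ^ (DIM('a) + 1)))"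
        unfolding n2[OF R, symmetric] real_sqrt_divide real_sqrt_abs using n0[OF R]
        by (simp add: power2_eq_square)
      show "norm ((\<integral>\<omega>. iexp (t * (energy c k (dilate R \<phi>) \<omega> / (\<beta> * n R))) \<partial>M) - G R) \<le>
        2 * (t / \<beta>)\<^sup>2 * ((D R / n R) * sqrt (V R / R ^ (DIM('a) + 1)))"
        using b unfolding e1 e2 e3 G_def .
    qed
    have "((\<lambda>R. 2 * (t / \<beta>)\<^sup>2 * ((D R / n R) * sqrt (V R / R ^ (DIM('a) + 1)))) \<longlongrightarrow> 2 * (t / \<beta>)\<^sup>2 * (0 * sqrt E)) at_top"
      by (intro tendsto_mult tendsto_const D(3) tendsto_real_sqrt V)
    then show "((\<lambda>R. 2 * (t / \<beta>)\<^sup>2 * ((D R / n R) * sqrt (V R / R ^ (DIM('a) + 1)))) \<longlongrightarrow> 0) at_top" by simp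
  qed
  moreover have "(G \<longlongrightarrow> of_real (exp (- (t\<^sup>2 * (E * inverse (\<beta>\<^sup>2)) / 2)))) at_top"
    unfolding G_def divide_inverse[of _ "\<beta>\<^sup>2"] by (intro tendsto_intros V) simp
  ultimately have "((\<lambda>R. ((\<integral>\<omega>. iexp (t * (energy c k (dilate R \<phi>) \<omega> / (\<beta> * n R))) \<partial>M) - G R) + G R) \<longlongrightarrow>
     0 + of_real (exp (- (t\<^sup>2 * (E * inverse (\<beta>\<^sup>2)) / 2)))) at_top" by (rule tendsto_add)
  then show ?thesis unfolding E_def n_def divide_inverse[of _ "\<beta>\<^sup>2"] by simp
qed

text \<open>The expansion writes the normalised observable as the normalised energy plus a remainder and a deterministic
  error. The energy is centred, hence so is the remainder, and its mean absolute value is at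
  most its standard deviation.\<close>

theorem theorem2p4p1:
  fixes M :: "'w measure"
    and B :: "'w \<Rightarrow> 'a::euclidean_space \<Rightarrow> real"
    and X :: "'w \<Rightarrow> ('a \<Rightarrow> real) \<Rightarrow> real"
    and T :: "('a \<Rightarrow> real) \<Rightarrow> real \<Rightarrow> 'w \<Rightarrow> real"
    and N :: "'v measure"
    and h :: "'v \<Rightarrow> ('a \<Rightarrow> real) \<Rightarrow> real"
    and c :: "nat \<Rightarrow> real" and k :: nat and \<alpha> :: real
  assumes dim: "DIM('a) \<ge> 2"
    and B: "berry_random_wave M B"
    and X: "observable M B X"
    and X_L2: "\<And>\<phi>. \<phi> \<in> schwartz_space \<Longrightarrow> square_integrable M (\<lambda>\<omega>. X \<omega> \<phi>)"
    and X_mean: "\<And>\<phi>. \<phi> \<in> schwartz_space \<Longrightarrow>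
      (\<lambda>R. (\<integral>\<omega>. X \<omega> (dilate R \<phi>) \<partial>M) - \<alpha> * R ^ DIM('a) * (\<integral>x. \<phi> x \<partial>lborel))
        \<in> o[at_top](\<lambda>R. R powr ((real DIM('a) + 1) / 2))"
    and c: "(\<Sum>j\<le>k. c j) \<noteq> 0"
    and T_L2: "\<And>\<phi> R. \<phi> \<in> schwartz_space \<Longrightarrow> R > 0 \<Longrightarrow> square_integrable M (T \<phi> R)"
    and X_expansion: "\<And>\<phi> R. \<phi> \<in> schwartz_space \<Longrightarrow> R > 0 \<Longrightarrow>
      AE \<omega> in M. X \<omega> (dilate R \<phi>) - (\<integral>\<omega>'. X \<omega>' (dilate R \<phi>) \<partial>M) =
        (\<Sum>j\<le>k. c j * (\<integral>x. dilate R \<phi> x * ((grad_norm j (B \<omega>) x)\<^sup>2 - 1) \<partial>lborel)) + T \<phi> R \<omega>"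
    and T_var: "\<And>\<phi>. \<phi> \<in> schwartz_space \<Longrightarrow>
      (\<lambda>R. prob_space.variance M (T \<phi> R)) \<in> o[at_top](\<lambda>R. R ^ (DIM('a) + 1))"
    and h: "fgf_half N h"
  shows "UC_fgf_half M X N h \<and>
    UC_fgf_half_with M X N h \<alpha>
      (C_const DIM('a) powr (- 1 / 2) * K_const DIM('a) * \<bar>\<Sum>j\<le>k. c j\<bar>)"
proof -
  define \<beta> where "\<beta> = C_const DIM('a) powr (- 1 / 2) * K_const DIM('a) * \<bar>\<Sum>j\<le>k. c j\<bar>"
  have C0: "0 < C_const DIM('a)" and K0: "0 < K_const DIM('a)"
    unfolding C_const_def K_const_def using dim by (auto intro!: mult_pos_pos divide_pos_pos Gamma_real_pos)
  have \<beta>0: "0 < \<beta>" unfolding \<beta>_def using C0 K0 c by simp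
  have \<beta>2: "\<beta>\<^sup>2 = (K_const DIM('a))\<^sup>2 * (\<Sum>j\<le>k. c j)\<^sup>2 / C_const DIM('a)"
  proof -
    have "(C_const DIM('a) powr (- 1 / 2))\<^sup>2 = C_const DIM('a) powr (- 1)"
      by (simp add: power2_eq_square powr_add[symmetric])
    also have "\<dots> = inverse (C_const DIM('a))" using C0 by (simp add: powr_minus)
    finally show ?thesis unfolding \<beta>_def power_mult_distrib by (simp only: power2_abs divide_inverse mult_ac)
  qed
  obtain B' where B': "smooth_berry M B'" and BB: "AE \<omega> in M. B' \<omega> = B \<omega>" using berry_smooth_modification[OF B] by blast
  interpret smooth_berry M B' by (rule B')
  have N: "prob_space N" using h unfolding fgf_half_def by simp
  have L1: "integrable M f" if "square_integrable M f" for f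
    using that unfolding square_integrable_def by (elim conjE) (rule square_integrable_imp_integrable)
  have Xi: "integrable M (\<lambda>\<omega>. X \<omega> \<phi>)" if "\<phi> \<in> schwartz_space" for \<phi>
    by (rule L1[OF X_L2[OF that]])
  have law: "converges_in_law M
     (\<lambda>R \<omega>. (X \<omega> (dilate R \<phi>) - \<alpha> * R ^ DIM('a) * (\<integral>x. \<phi> x \<partial>lborel)) / (\<beta> * R powr ((real DIM('a) + 1) / 2)))
     N (\<lambda>v. h v \<phi>)" if \<phi>: "\<phi> \<in> schwartz_space" for \<phi>
  proof (rule converges_in_law_charfun[OF prob_space_axioms N fgf_half_charfun(1)[OF h \<phi>]])
    define n where "n R = R powr ((real DIM('a) + 1) / 2)" for R :: real
    have n0: "0 < n R" and n2: "(n R)\<^sup>2 = R ^ (DIM('a) + 1)" if "0 < R" for R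
    unfolding n_def using that power_half_powr[OF that] by auto
    define Y where "Y R \<omega> = (X \<omega> (dilate R \<phi>) - \<alpha> * R ^ DIM('a) * (\<integral>x. \<phi> x \<partial>lborel)) / (\<beta> * n R)" for R \<omega>
    have Yi: "integrable M (Y R)" if "0 < R" for R
      unfolding Y_def using Xi[OF dilate_schwartz[OF \<phi> that]] by simp
    then show "(\<lambda>\<omega>. (X \<omega> (dilate R \<phi>) - \<alpha> * R ^ DIM('a) * (\<integral>x. \<phi> x \<partial>lborel)) / (\<beta> * R powr ((real DIM('a) + 1) / 2))) \<in> borel_measurable M" if "0 < R" for R
      using that unfolding Y_def n_def by blast
    fix t :: real
    define Q where "Q R \<omega> = energy c k (dilate R \<phi>) \<omega> / (\<beta> * n R)" for R \<omega>
    define m where "m R = (\<integral>\<omega>. X \<omega> (dilate R \<phi>) \<partial>M) - \<alpha> * R ^ DIM('a) * (\<integral>x. \<phi> x \<partial>lborel)" for R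
    have main: "((\<lambda>R. \<integral>\<omega>. iexp (t * Q R \<omega>) \<partial>M) \<longlongrightarrow> (\<integral>v. iexp (t * h v \<phi>) \<partial>N)) at_top"
    proof -
      have "(K_const DIM('a))\<^sup>2 * (\<Sum>j\<le>k. c j)\<^sup>2 * E / \<beta>\<^sup>2 = C_const DIM('a) * E" for E
        unfolding \<beta>2 using C0 K0 c by simp
      with dilated_energy_charfun[OF dim \<phi>, of t c k \<beta>] show ?thesis
        unfolding fgf_half_charfun(2)[OF h \<phi>] Q_def n_def by (simp only:)
    qed
    have diff: "norm ((\<integral>\<omega>. iexp (t * Y R \<omega>) \<partial>M) - (\<integral>\<omega>. iexp (t * Q R \<omega>) \<partial>M)) \<le>
       \<bar>t\<bar> / \<beta> * (sqrt (variance (T \<phi> R) / R ^ (DIM('a) + 1)) + \<bar>m R / n R\<bar>)" if R: "0 < R" for R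
    proof -
      have \<phi>R: "dilate R \<phi> \<in> schwartz_space" by (rule dilate_schwartz[OF \<phi> R])
      have \<phi>i: "integrable lborel (dilate R \<phi>)"
        using schwartz_partials_integrable[OF \<phi>R, of "[]"] by (simp add: partials_Nil)
      obtain D where D: "\<And>R. 0 < R \<Longrightarrow> 0 \<le> D R"
        "\<And>R \<theta>. 0 < R \<Longrightarrow> (\<integral>\<^sup>+\<eta>. ennreal (norm (wave_kernel (weight_poly c k) (fourier (dilate R \<phi>)) \<theta> \<eta>)) \<partial>sphere_uniform) \<le> ennreal (D R)"
        by (rule dilated_schur_bound[OF dim \<phi>, of c k]) (rule that)
      note en = energy_charfun_near_gaussian(1,2)[OF \<phi>i D(1)[OF R] D(2)[OF R]]
      have Ti: "integrable M (T \<phi> R)" by (rule L1[OF T_L2[OF \<phi> R]])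
      have T2: "integrable M (\<lambda>\<omega>. (T \<phi> R \<omega>)\<^sup>2)" using T_L2[OF \<phi> R] unfolding square_integrable_def by simp
      have ex: "AE \<omega> in M. X \<omega> (dilate R \<phi>) - (\<integral>\<omega>'. X \<omega>' (dilate R \<phi>) \<partial>M) = energy c k (dilate R \<phi>) \<omega> + T \<phi> R \<omega>"
        using X_expansion[OF \<phi> R] BB by eventually_elim (simp add: energy_def)
      have T0: "(\<integral>\<omega>. T \<phi> R \<omega> \<partial>M) = 0"
      proof -
        have "(\<integral>\<omega>. X \<omega> (dilate R \<phi>) - (\<integral>\<omega>'. X \<omega>' (dilate R \<phi>) \<partial>M) \<partial>M) = (\<integral>\<omega>. energy c k (dilate R \<phi>) \<omega> + T \<phi> R \<omega> \<partial>M)"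
          by (rule integral_cong_AE[OF _ _ ex]) (use Xi[OF \<phi>R] en(1) Ti in auto)
        then show ?thesis using Xi[OF \<phi>R] en Ti by (simp add: prob_space)
      qed
      have aT: "(\<integral>\<omega>. \<bar>T \<phi> R \<omega>\<bar> \<partial>M) \<le> sqrt (variance (T \<phi> R))"
      proof (rule real_le_rsqrt)
        have "0 \<le> variance (\<lambda>\<omega>. \<bar>T \<phi> R \<omega>\<bar>)" by (rule variance_positive)
        then show "(\<integral>\<omega>. \<bar>T \<phi> R \<omega>\<bar> \<partial>M)\<^sup>2 \<le> variance (T \<phi> R)"
          using variance_eq[of "\<lambda>\<omega>. \<bar>T \<phi> R \<omega>\<bar>"] Ti T2 T0 by simp
      qed
      have Qi: "integrable M (Q R)" unfolding Q_def using en(1) by simp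
      have ae: "AE \<omega> in M. \<bar>Y R \<omega> - Q R \<omega>\<bar> \<le> (\<bar>T \<phi> R \<omega>\<bar> + \<bar>m R\<bar>) / (\<beta> * n R)"
        using ex
      proof eventually_elim
        fix \<omega> assume e: "X \<omega> (dilate R \<phi>) - (\<integral>\<omega>'. X \<omega>' (dilate R \<phi>) \<partial>M) = energy c k (dilate R \<phi>) \<omega> + T \<phi> R \<omega>"
        have "Y R \<omega> - Q R \<omega> = (T \<phi> R \<omega> + m R) / (\<beta> * n R)"
          unfolding Y_def Q_def m_def diff_divide_distrib[symmetric] using e by (intro arg_cong2[where f=divide]) auto
        then have "\<bar>Y R \<omega> - Q R \<omega>\<bar> = \<bar>T \<phi> R \<omega> + m R\<bar> / (\<beta> * n R)" using \<beta>0 n0[OF R] by (simp add: abs_mult)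
        then show "\<bar>Y R \<omega> - Q R \<omega>\<bar> \<le> (\<bar>T \<phi> R \<omega>\<bar> + \<bar>m R\<bar>) / (\<beta> * n R)"
          using \<beta>0 n0[OF R] by (auto intro: divide_right_mono)
      qed
      have "norm ((\<integral>\<omega>. iexp (t * Y R \<omega>) \<partial>M) - (\<integral>\<omega>. iexp (t * Q R \<omega>) \<partial>M)) \<le> \<bar>t\<bar> * (\<integral>\<omega>. \<bar>Y R \<omega> - Q R \<omega>\<bar> \<partial>M)"
        by (rule charfun_lipschitz[OF prob_space_axioms Yi[OF R] Qi])
      also have "\<dots> \<le> \<bar>t\<bar> * (\<integral>\<omega>. (\<bar>T \<phi> R \<omega>\<bar> + \<bar>m R\<bar>) / (\<beta> * n R) \<partial>M)"
        by (intro mult_left_mono integral_mono_AE ae) (use Yi[OF R] Qi Ti in auto)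
      also have "(\<integral>\<omega>. (\<bar>T \<phi> R \<omega>\<bar> + \<bar>m R\<bar>) / (\<beta> * n R) \<partial>M) = ((\<integral>\<omega>. \<bar>T \<phi> R \<omega>\<bar> \<partial>M) + \<bar>m R\<bar>) / (\<beta> * n R)"
        using Ti by (simp add: prob_space)
      also have "\<bar>t\<bar> * (((\<integral>\<omega>. \<bar>T \<phi> R \<omega>\<bar> \<partial>M) + \<bar>m R\<bar>) / (\<beta> * n R)) \<le> \<bar>t\<bar> * ((sqrt (variance (T \<phi> R)) + \<bar>m R\<bar>) / (\<beta> * n R))"
        using aT \<beta>0 n0[OF R] by (intro mult_left_mono divide_right_mono) auto
      also have "\<dots> = \<bar>t\<bar> / \<beta> * (sqrt (variance (T \<phi> R) / R ^ (DIM('a) + 1)) + \<bar>m R / n R\<bar>)"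
        unfolding n2[OF R, symmetric] real_sqrt_divide real_sqrt_abs using n0[OF R]
        by (simp add: add_divide_distrib distrib_left)
      finally show ?thesis .
    qed
    have "((\<lambda>R. (\<integral>\<omega>. iexp (t * Y R \<omega>) \<partial>M) - (\<integral>\<omega>. iexp (t * Q R \<omega>) \<partial>M)) \<longlongrightarrow> 0) at_top"
    proof (rule Lim_null_comparison)
      show "\<forall>\<^sub>F R in at_top. norm ((\<integral>\<omega>. iexp (t * Y R \<omega>) \<partial>M) - (\<integral>\<omega>. iexp (t * Q R \<omega>) \<partial>M)) \<le>
         \<bar>t\<bar> / \<beta> * (sqrt (variance (T \<phi> R) / R ^ (DIM('a) + 1)) + \<bar>m R / n R\<bar>)"
        using eventually_gt_at_top[of 0] by eventually_elim (rule diff)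
      have "((\<lambda>R. \<bar>t\<bar> / \<beta> * (sqrt (variance (T \<phi> R) / R ^ (DIM('a) + 1)) + \<bar>m R / n R\<bar>)) \<longlongrightarrow> \<bar>t\<bar> / \<beta> * (sqrt 0 + \<bar>0\<bar>)) at_top"
        by (intro tendsto_mult tendsto_add tendsto_const tendsto_real_sqrt tendsto_rabs
              smalloD_tendsto[OF T_var[OF \<phi>]] smalloD_tendsto[OF X_mean[OF \<phi>], folded m_def n_def])
      then show "((\<lambda>R. \<bar>t\<bar> / \<beta> * (sqrt (variance (T \<phi> R) / R ^ (DIM('a) + 1)) + \<bar>m R / n R\<bar>)) \<longlongrightarrow> 0) at_top" by simp
    qed
    from tendsto_add[OF this main]
    show "((\<lambda>R. \<integral>\<omega>. iexp (t * ((X \<omega> (dilate R \<phi>) - \<alpha> * R ^ DIM('a) * (\<integral>x. \<phi> x \<partial>lborel)) / (\<beta> * R powr ((real DIM('a) + 1) / 2)))) \<partial>M) \<longlongrightarrow> (\<integral>v. iexp (t * h v \<phi>) \<partial>N)) at_top"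
      unfolding Y_def n_def by simp
  qed
  have "UC_fgf_half_with M X N h \<alpha> \<beta>"
    unfolding UC_fgf_half_with_def using X Xi h \<beta>0 X_mean law by (simp add: observable_def)
  then show ?thesis unfolding \<beta>_def UC_fgf_half_def by blast
qed

end
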